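(* Let $F$ be a global function field, let $E|F$ be a finite abelian extension, and let $\mathfrak{m}$ be an effective divisor of $F$ whose support contains all places of $F$ that ramify in $E$. Then the Artin map $A_{E|F}:\mathcal{D}_{\mathfrak{m}}(F)\to\mathrm{Gal}(E|F)$ is a surjective homomorphism.
   Context: A global function field is the function field of an irreducible smooth projective curve over a finite field; let $\mathbb{F}_q$ be the exact constant field of $F$. $\mathcal{D}_{\mathfrak{m}}(F)$ is the group of divisors of $F$ with support disjoint from the support of $\mathfrak{m}$. For a place $\mathfrak{p}$ of $F$ unramified in $E$, $\sigma_{\mathfrak{p}}\in\mathrm{Gal}(E|F)$ is the unique automorphism with $\sigma_{\mathfrak{p}}(x)\equiv x^{q^{\deg\mathfrak{p}}}\bmod\mathfrak{q}$ for all $x\in\mathcal{O}_{\mathfrak{q}}$ (the valuation ring of $\mathfrak{q}$) and all places $\mathfrak{q}$ of $E$ above $\mathfrak{p}$. The Artin map is $A_{E|F}(D)=\prod_{\mathfrak{p}}\sigma_{\mathfrak{p}}^{\mathrm{ord}_{\mathfrak{p}}(D)}$ for $D\in\mathcal{D}_{\mathfrak{m}}(F)$. *)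

theory Defs
  imports "HOL-Algebra.Algebra"
begin

text \<open>
  A global function field is rendered by its field-theoretic description: a finite extension of a
  rational function field \<open>k(x)\<close> over a finite field \<open>k\<close>. These are exactly the function fields of
  irreducible (smooth projective) curves over finite fields.
\<close>

definition global_function_field :: "('a, 'b) ring_scheme \<Rightarrow> bool" where
  "global_function_field K \<longleftrightarrow> field K \<and>
     (\<exists>k x. subfield k K \<and> finite k \<and> x \<in> carrier K \<and>
        (ring.transcendental K over k) x \<and>
        ring.finite_dimension K (generate_field K (insert x k)) (carrier K))"

text \<open>
  The exact constant field consists of the elements algebraic over the finite base field;
  equivalently, over the prime field \<open>generate_field K {}\<close>, so it does not depend on \<open>k\<close>.
\<close>

definition constant_field :: "('a, 'b) ring_scheme \<Rightarrow> 'a set" where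
  "constant_field K = {c \<in> carrier K. (ring.algebraic K over (generate_field K {})) c}"


section \<open>Places\<close>

text \<open>
  A place is represented by its normalized discrete valuation, a surjective map
  from the nonzero elements onto the integers. Extensionality makes the representation unique.
  Such a valuation is automatically trivial on a finite constant field, whose nonzero elements are
  roots of unity.
\<close>

definition places :: "('a, 'b) ring_scheme \<Rightarrow> ('a \<Rightarrow> int) set" where
  "places K = {v \<in> extensional (carrier K - {\<zero>\<^bsub>K\<^esub>}).
     v ` (carrier K - {\<zero>\<^bsub>K\<^esub>}) = UNIV \<and>
     (\<forall>x \<in> carrier K - {\<zero>\<^bsub>K\<^esub>}. \<forall>y \<in> carrier K - {\<zero>\<^bsub>K\<^esub>}.
        v (x \<otimes>\<^bsub>K\<^esub> y) = v x + v y \<and>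
        (x \<oplus>\<^bsub>K\<^esub> y \<noteq> \<zero>\<^bsub>K\<^esub> \<longrightarrow> min (v x) (v y) \<le> v (x \<oplus>\<^bsub>K\<^esub> y)))}"

definition valuation_ring :: "('a, 'b) ring_scheme \<Rightarrow> ('a \<Rightarrow> int) \<Rightarrow> 'a set" where
  "valuation_ring K v = {x \<in> carrier K. x = \<zero>\<^bsub>K\<^esub> \<or> 0 \<le> v x}"

definition valuation_ideal :: "('a, 'b) ring_scheme \<Rightarrow> ('a \<Rightarrow> int) \<Rightarrow> 'a set" where
  "valuation_ideal K v = {x \<in> carrier K. x = \<zero>\<^bsub>K\<^esub> \<or> 0 < v x}"

definition residue_field :: "('a, 'b) ring_scheme \<Rightarrow> ('a \<Rightarrow> int) \<Rightarrow> 'a set ring" where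
  "residue_field K v = (K\<lparr>carrier := valuation_ring K v\<rparr>) Quot (valuation_ideal K v)"

text \<open>
  The degree is the dimension of the residue field over the image of the exact constant field.
\<close>

definition place_degree :: "('a, 'b) ring_scheme \<Rightarrow> ('a \<Rightarrow> int) \<Rightarrow> nat" where
  "place_degree K v = ring.dim (residue_field K v)
     ((\<lambda>c. valuation_ideal K v +>\<^bsub>K\<^esub> c) ` constant_field K) (carrier (residue_field K v))"

text \<open>
  In a field extension the smaller field is a subset \<open>F\<close> of \<open>carrier E\<close>; as a field in its own
  right it is \<open>E\<lparr>carrier := F\<rparr>\<close>.
\<close>

definition places_above :: "('a, 'b) ring_scheme \<Rightarrow> 'a set \<Rightarrow> ('a \<Rightarrow> int) \<Rightarrow> ('a \<Rightarrow> int) set" where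
  "places_above E F \<pp> =
     {\<qq> \<in> places E. valuation_ideal (E\<lparr>carrier := F\<rparr>) \<pp> \<subseteq> valuation_ideal E \<qq>}"

definition ramification_index ::
    "('a, 'b) ring_scheme \<Rightarrow> 'a set \<Rightarrow> ('a \<Rightarrow> int) \<Rightarrow> ('a \<Rightarrow> int) \<Rightarrow> nat" where
  "ramification_index E F \<qq> \<pp> =
     (THE e. \<forall>x \<in> F - {\<zero>\<^bsub>E\<^esub>}. \<qq> x = int e * \<pp> x)"

text \<open>
  Residue fields are finite here, so residue extensions are separable and ramification is
  detected by the ramification index alone.
\<close>

definition ramifies :: "('a, 'b) ring_scheme \<Rightarrow> 'a set \<Rightarrow> ('a \<Rightarrow> int) \<Rightarrow> bool" where
  "ramifies E F \<pp> \<longleftrightarrow> (\<exists>\<qq> \<in> places_above E F \<pp>. 1 < ramification_index E F \<qq> \<pp>)"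


section \<open>Divisors\<close>

definition divisor_group :: "('a, 'b) ring_scheme \<Rightarrow> (('a \<Rightarrow> int) \<Rightarrow>\<^sub>0 int) monoid" where
  "divisor_group K = free_Abelian_group (places K)"

definition effective_divisor :: "('a, 'b) ring_scheme \<Rightarrow> (('a \<Rightarrow> int) \<Rightarrow>\<^sub>0 int) \<Rightarrow> bool" where
  "effective_divisor K D \<longleftrightarrow>
     D \<in> carrier (divisor_group K) \<and> (\<forall>\<pp>. 0 \<le> Poly_Mapping.lookup D \<pp>)"

definition divisor_group_away ::
    "('a, 'b) ring_scheme \<Rightarrow> (('a \<Rightarrow> int) \<Rightarrow>\<^sub>0 int) \<Rightarrow> (('a \<Rightarrow> int) \<Rightarrow>\<^sub>0 int) monoid" where
  "divisor_group_away K \<mm> = (divisor_group K)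
     \<lparr>carrier := {D \<in> carrier (divisor_group K).
                    Poly_Mapping.keys D \<inter> Poly_Mapping.keys \<mm> = {}}\<rparr>"


section \<open>Abelian extensions and the Artin map\<close>

definition galois_group :: "('a, 'b) ring_scheme \<Rightarrow> 'a set \<Rightarrow> ('a \<Rightarrow> 'a) monoid" where
  "galois_group E F = (BijGroup (carrier E))
     \<lparr>carrier := {\<sigma> \<in> ring_hom E E \<inter> Bij (carrier E). \<forall>x \<in> F. \<sigma> x = x}\<rparr>"

text \<open>Being Galois is Artin's condition that \<open>F\<close> is the fixed field of the Galois group.\<close>

definition finite_galois_extension :: "('a, 'b) ring_scheme \<Rightarrow> 'a set \<Rightarrow> bool" where
  "finite_galois_extension E F \<longleftrightarrow> field E \<and> subfield F E \<and>
     ring.finite_dimension E F (carrier E) \<and>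
     {x \<in> carrier E. \<forall>\<sigma> \<in> carrier (galois_group E F). \<sigma> x = x} = F"

definition finite_abelian_extension :: "('a, 'b) ring_scheme \<Rightarrow> 'a set \<Rightarrow> bool" where
  "finite_abelian_extension E F \<longleftrightarrow>
     finite_galois_extension E F \<and> comm_group (galois_group E F)"

definition frobenius :: "('a, 'b) ring_scheme \<Rightarrow> 'a set \<Rightarrow> ('a \<Rightarrow> int) \<Rightarrow> 'a \<Rightarrow> 'a" where
  "frobenius E F \<pp> = (THE \<sigma>. \<sigma> \<in> carrier (galois_group E F) \<and>
     (\<forall>\<qq> \<in> places_above E F \<pp>. \<forall>x \<in> valuation_ring E \<qq>.
        \<sigma> x \<ominus>\<^bsub>E\<^esub> x [^]\<^bsub>E\<^esub> (card (constant_field (E\<lparr>carrier := F\<rparr>)) ^ place_degree (E\<lparr>carrier := F\<rparr>) \<pp>)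
          \<in> valuation_ideal E \<qq>))"

definition artin_map ::
    "('a, 'b) ring_scheme \<Rightarrow> 'a set \<Rightarrow> (('a \<Rightarrow> int) \<Rightarrow>\<^sub>0 int) \<Rightarrow> 'a \<Rightarrow> 'a" where
  "artin_map E F D = (\<Otimes>\<^bsub>galois_group E F\<^esub>\<pp> \<in> Poly_Mapping.keys D.
     frobenius E F \<pp> [^]\<^bsub>galois_group E F\<^esub> Poly_Mapping.lookup D \<pp>)"

end

theory Submission
  imports Defs
begin

text \<open>
  Let \<open>H\<close> be the image of the Artin map, with fixed field \<open>L\<close>. Every place \<open>P\<close> of \<open>F\<close> outside the
  support of \<open>\<mm>\<close> has its Frobenius automorphism in \<open>H\<close>, so the places of \<open>L\<close> above \<open>P\<close> have the same
  norm as \<open>P\<close>. If \<open>H\<close> were proper, then \<open>L \<noteq> F\<close> and all but finitely many \<open>P\<close> would have two distinct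
  places of \<open>L\<close> above them. Hence \<open>\<Sum> 1 / N D\<close>, over the effective divisors \<open>D\<close> of \<open>F\<close> with
  \<open>N D \<le> b\<^sup>n\<close>, would have its square bounded, up to constants, by the same sum for \<open>L\<close>. But for every
  function field this sum grows linearly in \<open>n\<close>: this elementary substitute for the pole of the zeta
  function at \<open>1\<close> follows from the product formula and a weak form of Riemann's inequality.

  Both rest on counting. A function field is, up to denominators, the set of finite \<open>x\<close>-adic expansions
  with digits in a finite set, and comparing the numbers of expansions of bounded length bounds all
  residue rings.

  The Frobenius automorphism at an unramified place is obtained from the linear independence of the
  residue characters \<open>x \<mapsto> d x\<close> and \<open>x \<mapsto> (d x)\<^sup>N\<close> for \<open>d\<close> in the decomposition group.
\<close>

section \<open>Places of a field\<close>

text \<open>A bound \<open>a ^ Suc n \<le> C * b ^ n\<close> for all \<open>n\<close> loses its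
  constant on passing to n-th roots. This is why crude inclusions between sets of expansions give
  sharp inequalities between norms, and why cardinalities can do the work of dimensions: the bounds
  on residue rings, the discreteness of valuation rings and both halves of the product formula come
  from it. Counting has to work for F, for E and for the intermediate field L alike, so the notion
  of function field is axiomatic and is verified once for all fields between F and E. The two places
  of L come from one element \<open>y\<close> of L moved by some \<open>g\<close> in the Galois
  group: a place Q of E and its twist by \<open>g\<close> have different restrictions to L unless
  \<open>y - g y\<close> vanishes at Q or \<open>y\<close> has a pole there. Two places are enough
  because the square of a linearly growing sum grows quadratically. Leaving out the finitely many
  exceptional places costs a bounded factor, as in a finite Euler product. Such a \<open>y\<close>
  exists because otherwise the sums over H and over a coset \<open>g H\<close> would agree, against
  the linear independence of automorphisms.\<close>

definition vball :: "('a, 'b) ring_scheme \<Rightarrow> ('a \<Rightarrow> int) \<Rightarrow> int \<Rightarrow> 'a set" where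
  "vball K v n = {x \<in> carrier K. x = \<zero>\<^bsub>K\<^esub> \<or> n \<le> v x}"

lemma valuation_ring_eq_vball: "valuation_ring K v = vball K v 0"
  by (simp add: valuation_ring_def vball_def)

lemma valuation_ideal_eq_vball: "valuation_ideal K v = vball K v 1"
  by (auto simp: valuation_ideal_def vball_def)

lemma vball_subset_carrier: "vball K v n \<subseteq> carrier K"
  by (auto simp: vball_def)

lemma vball_mono: "m \<le> n \<Longrightarrow> vball K v n \<subseteq> vball K v m"
  by (auto simp: vball_def)

lemma vball_le: "x \<in> vball K v n \<Longrightarrow> m \<le> n \<Longrightarrow> x \<in> vball K v m"
  by (auto simp: vball_def)

context field
begin

lemma inv_nonzero [simp]:
  assumes "x \<in> carrier R" "x \<noteq> \<zero>" shows "inv x \<in> carrier R" "inv x \<noteq> \<zero>"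
    "x \<otimes> inv x = \<one>" "inv x \<otimes> x = \<one>"
proof -
  have u: "x \<in> Units R" using assms field_Units by auto
  show "inv x \<in> carrier R" "x \<otimes> inv x = \<one>" "inv x \<otimes> x = \<one>" using u by auto
  then show "inv x \<noteq> \<zero>" using assms by (metis r_null one_not_zero)
qed

lemma mult_nonzero [simp]:
  assumes "x \<in> carrier R" "x \<noteq> \<zero>" "y \<in> carrier R" "y \<noteq> \<zero>" shows "x \<otimes> y \<noteq> \<zero>"
  using assms integral by blast

lemma pow_nonzero [simp]:
  assumes "x \<in> carrier R" "x \<noteq> \<zero>" shows "x [^] (n::nat) \<noteq> \<zero>"
  using assms by (induction n) auto

lemma minus_eq_zero_iff:
  assumes "x \<in> carrier R" "y \<in> carrier R" shows "x \<ominus> y = \<zero> \<longleftrightarrow> x = y"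
  using assms by (metis a_minus_def minus_equality minus_minus r_neg a_inv_closed minus_closed)

lemma place_mult:
  assumes "v \<in> places R" "x \<in> carrier R" "x \<noteq> \<zero>" "y \<in> carrier R" "y \<noteq> \<zero>"
  shows "v (x \<otimes> y) = v x + v y"
  using assms by (auto simp: places_def)

lemma place_add:
  assumes "v \<in> places R" "x \<in> carrier R" "x \<noteq> \<zero>" "y \<in> carrier R" "y \<noteq> \<zero>" "x \<oplus> y \<noteq> \<zero>"
  shows "min (v x) (v y) \<le> v (x \<oplus> y)"
  using assms by (auto simp: places_def)

lemma place_surj:
  assumes "v \<in> places R" obtains x where "x \<in> carrier R" "x \<noteq> \<zero>" "v x = n"
proof -
  have "n \<in> v ` (carrier R - {\<zero>})" using assms by (auto simp: places_def)
  then show ?thesis using that by auto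
qed

lemma place_one: assumes "v \<in> places R" shows "v \<one> = 0"
  using place_mult[OF assms, of \<one> \<one>] by simp

lemma place_pow:
  assumes "v \<in> places R" "x \<in> carrier R" "x \<noteq> \<zero>" shows "v (x [^] (n::nat)) = int n * v x"
  using assms by (induction n) (auto simp: place_one place_mult algebra_simps)

lemma place_inv:
  assumes "v \<in> places R" "x \<in> carrier R" "x \<noteq> \<zero>" shows "v (inv x) = - v x"
  using place_mult[OF assms, of "inv x"] place_one[OF assms(1)] assms by simp

lemma place_of_root_of_unity:
  assumes "v \<in> places R" "x \<in> carrier R" "x [^] (n::nat) = \<one>" "n > 0" shows "v x = 0"
proof -
  have "x \<noteq> \<zero>" using assms by (metis nat_pow_zero neq0_conv one_not_zero)
  then show ?thesis using place_pow[of v x n] place_one[OF assms(1)] assms by simp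
qed

lemma place_neg:
  assumes "v \<in> places R" "x \<in> carrier R" "x \<noteq> \<zero>" shows "v (\<ominus> x) = v x"
proof -
  have "(\<ominus> \<one>) [^] (2::nat) = \<one>" by (simp add: numeral_2_eq_2 l_minus r_minus)
  then have "v (\<ominus> \<one>) = 0" using place_of_root_of_unity[OF assms(1), of "\<ominus> \<one>" 2] by simp
  moreover have "\<ominus> x = (\<ominus> \<one>) \<otimes> x" using assms by (simp add: l_minus)
  moreover have "\<ominus> \<one> \<noteq> \<zero>" by (metis minus_minus minus_zero one_closed one_not_zero)
  ultimately show ?thesis using place_mult[OF assms(1), of "\<ominus> \<one>" x] assms by simp
qed

lemma vball_zero [simp]: "\<zero> \<in> vball R v n" by (simp add: vball_def)

lemma vballI: "x \<in> carrier R \<Longrightarrow> n \<le> v x \<Longrightarrow> x \<in> vball R v n" by (simp add: vball_def)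

lemma vball_carrier: "x \<in> vball R v n \<Longrightarrow> x \<in> carrier R" by (simp add: vball_def)

lemma vball_add:
  assumes "v \<in> places R" "x \<in> vball R v n" "y \<in> vball R v n" shows "x \<oplus> y \<in> vball R v n"
  using assms place_add[of v x y] by (fastforce simp: vball_def)

lemma vball_neg:
  assumes "v \<in> places R" "x \<in> vball R v n" shows "\<ominus> x \<in> vball R v n"
  using assms place_neg[of v x] by (auto simp: vball_def)

lemma vball_minus:
  assumes "v \<in> places R" "x \<in> vball R v n" "y \<in> vball R v n" shows "x \<ominus> y \<in> vball R v n"
  using assms by (auto simp: a_minus_def intro: vball_add vball_neg)

lemma vball_mult:
  assumes "v \<in> places R" "x \<in> vball R v m" "y \<in> vball R v n" shows "x \<otimes> y \<in> vball R v (m + n)"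
  using assms place_mult[of v x y] integral[of x y]
  by (cases "x = \<zero>"; cases "y = \<zero>") (auto simp: vball_def)

lemma vball_one [simp]: "v \<in> places R \<Longrightarrow> \<one> \<in> vball R v 0"
  by (simp add: vball_def place_one)

lemma vball_pow:
  assumes "v \<in> places R" "x \<in> vball R v m" shows "x [^] (k::nat) \<in> vball R v (int k * m)"
proof (induction k)
  case (Suc k)
  show ?case using vball_mult[OF assms(1) Suc assms(2)] by (simp add: algebra_simps)
qed (use assms in simp)

lemma vball_minus_cancel:
  assumes "v \<in> places R" "x \<ominus> y \<in> vball R v n" "y \<in> vball R v n" "x \<in> carrier R"
  shows "x \<in> vball R v n"
proof -
  have "x = (x \<ominus> y) \<oplus> y" using assms vball_carrier[OF assms(3)] by algebra
  then show ?thesis using vball_add[OF assms(1-3)] by simp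
qed

lemma vball_minus_trans:
  assumes "v \<in> places R" "x \<ominus> y \<in> vball R v n" "y \<ominus> z \<in> vball R v n"
    "x \<in> carrier R" "y \<in> carrier R" "z \<in> carrier R"
  shows "x \<ominus> z \<in> vball R v n"
proof -
  have "x \<ominus> z = (x \<ominus> y) \<oplus> (y \<ominus> z)" using assms by algebra
  then show ?thesis using vball_add[OF assms(1-3)] by simp
qed

lemma vball_minus_sym:
  assumes "v \<in> places R" "x \<ominus> y \<in> vball R v n" "x \<in> carrier R" "y \<in> carrier R"
  shows "y \<ominus> x \<in> vball R v n"
proof -
  have "y \<ominus> x = \<ominus> (x \<ominus> y)" using assms by algebra
  then show ?thesis using vball_neg[OF assms(1-2)] by simp
qed

lemma vball_finsum:
  assumes "v \<in> places R" "\<And>i. i \<in> A \<Longrightarrow> f i \<in> vball R v n"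
  shows "(\<Oplus>i\<in>A. f i) \<in> vball R v n"
proof (cases "finite A")
  case True then show ?thesis using assms(2)
  proof (induction A)
    case (insert i A)
    have "f \<in> A \<rightarrow> carrier R" "f i \<in> carrier R" using insert vball_carrier by blast+
    then show ?case using insert vball_add[OF assms(1)] by (simp add: finsum_insert)
  qed simp
qed (simp add: finsum_infinite)

text \<open>If the sum were more divisible than \<open>x\<close>, subtracting \<open>y\<close> again
  would make \<open>x\<close> too divisible. The case \<open>y = \<zero>\<close> is separate because
  a place carries no information at zero.\<close>

lemma place_add_less:
  assumes v: "v \<in> places R" and x: "x \<in> carrier R" "x \<noteq> \<zero>" and y: "y \<in> carrier R" "y = \<zero> \<or> v x < v y"
  shows "x \<oplus> y \<noteq> \<zero>" "v (x \<oplus> y) = v x"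
proof -
  have nx: "x \<notin> vball R v (v x + 1)" using x by (simp add: vball_def)
  have yb: "y \<in> vball R v (v x + 1)" using y by (auto simp: vball_def)
  have e: "x = (x \<oplus> y) \<ominus> y" using x y by algebra
  have n: "x \<oplus> y \<notin> vball R v (v x + 1)" using vball_minus[OF v _ yb] e nx by metis
  then show nz: "x \<oplus> y \<noteq> \<zero>" by auto
  have "x \<oplus> y \<in> vball R v (v x)" using vball_add[OF v, of x "v x" y] x y by (auto simp: vball_def)
  then show "v (x \<oplus> y) = v x" using n nz x y by (auto simp: vball_def)
qed

text \<open>Containment of the valuation rings makes units for \<open>v\<close> units for
  \<open>w\<close>, so \<open>w\<close> is an integral multiple of \<open>v\<close>; normalization
  of both forces the factor 1.\<close>

lemma place_eqI:
  assumes v: "v \<in> places R" and w: "w \<in> places R"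
    and le: "\<And>x. x \<in> carrier R \<Longrightarrow> x \<noteq> \<zero> \<Longrightarrow> 0 \<le> v x \<Longrightarrow> 0 \<le> w x"
  shows "v = w"
proof -
  have u: "w x = 0" if "x \<in> carrier R" "x \<noteq> \<zero>" "v x = 0" for x
    using le[of x] le[of "inv x"] that place_inv[OF v, of x] place_inv[OF w, of x] by simp
  obtain p where p: "p \<in> carrier R" "p \<noteq> \<zero>" "v p = 1" using place_surj[OF v] by blast
  have pos: "w x = int n * w p" if "x \<in> carrier R" "x \<noteq> \<zero>" "v x = int n" for x n
  proof -
    let ?y = "x \<otimes> inv (p [^] n)"
    have "v ?y = 0" using that p by (simp add: place_mult[OF v] place_inv[OF v] place_pow[OF v])
    then have "w ?y = 0" using that p u by simp
    then show ?thesis using that p by (simp add: place_mult[OF w] place_inv[OF w] place_pow[OF w])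
  qed
  have all: "w x = v x * w p" if x: "x \<in> carrier R" "x \<noteq> \<zero>" for x
  proof (cases "0 \<le> v x")
    case True then show ?thesis using pos[OF x, of "nat (v x)"] by simp
  next
    case False then show ?thesis using pos[of "inv x" "nat (- v x)"] x
      by (simp add: place_inv[OF v] place_inv[OF w])
  qed
  obtain q where q: "q \<in> carrier R" "q \<noteq> \<zero>" "w q = 1" using place_surj[OF w] by blast
  have "1 = v q * w p" using all q by metis
  moreover have "0 \<le> w p" using le p by simp
  ultimately have "w p = 1" using zmult_eq_1_iff[of "v q" "w p"] by auto
  then have "w x = v x" if "x \<in> carrier R - {\<zero>}" for x using all that by simp
  moreover have "v \<in> extensional (carrier R - {\<zero>})" "w \<in> extensional (carrier R - {\<zero>})"
    using v w by (auto simp: places_def)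
  ultimately show ?thesis by (metis extensionalityI)
qed

section \<open>Separation of places and weak approximation\<close>

lemma places_separated:
  assumes v: "v \<in> places R" and w: "w \<in> places R" and ne: "v \<noteq> w"
  obtains z where "z \<in> carrier R" "z \<noteq> \<zero>" "v z > 0" "w z < 0"
proof -
  obtain x where x: "x \<in> carrier R" "x \<noteq> \<zero>" "v x \<ge> 0" "w x < 0"
    using place_eqI[OF v w] ne by force
  obtain y where y: "y \<in> carrier R" "y \<noteq> \<zero>" "w y \<ge> 0" "v y < 0"
    using place_eqI[OF w v] ne by force
  show ?thesis using that[of "x \<otimes> inv y"] x y
    by (simp add: place_mult[OF v] place_mult[OF w] place_inv[OF v] place_inv[OF w])
qed

lemma places_separated_finite:
  assumes v: "v \<in> places R" and T: "finite T" "T \<subseteq> places R" "v \<notin> T"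
  shows "\<exists>z \<in> carrier R. z \<noteq> \<zero> \<and> v z > 0 \<and> (\<forall>w\<in>T. w z < 0)"
  using T
proof (induction T)
  case empty
  then show ?case using place_surj[OF v, of 1] by (metis empty_iff zero_less_one)
next
  case (insert u T)
  have u: "u \<in> places R" "v \<noteq> u" using insert by auto
  obtain z where z: "z \<in> carrier R" "z \<noteq> \<zero>" "v z > 0" "\<And>w. w \<in> T \<Longrightarrow> w z < 0" using insert by auto
  obtain y where y: "y \<in> carrier R" "y \<noteq> \<zero>" "v y > 0" "u y < 0"
    using places_separated[OF v u] by blast
  show ?case
  proof (cases "u z < 0")
    case True then show ?thesis using z by auto
  next
    case False
    \<comment> \<open>Since \<open>w z \<le> -1\<close> on \<open>T\<close>, an exponent above every
      \<open>\<bar>w y\<bar>\<close> lets \<open>z [^] r\<close> dominate \<open>y\<close> there. At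
      \<open>u\<close> the roles are reversed, because \<open>u z \<ge> 0\<close> while
      \<open>u y < 0\<close>.\<close>
    obtain r :: nat where r: "r \<ge> 1" "\<And>w. w \<in> T \<Longrightarrow> \<bar>w y\<bar> < int r"
    proof
      show "\<bar>w y\<bar> < int (Suc (\<Sum>w\<in>T. nat \<bar>w y\<bar>))" if "w \<in> T" for w
        using member_le_sum[OF that, of "\<lambda>w. nat \<bar>w y\<bar>"] insert(1) by linarith
    qed simp
    let ?s = "z [^] r"
    have s: "?s \<in> carrier R" "?s \<noteq> \<zero>" using z by auto
    have vs: "v ?s > 0" using z(3) r(1) unfolding place_pow[OF v z(1,2)] by (intro mult_pos_pos) simp_all
    have us: "u ?s \<ge> 0" using z False by (simp add: place_pow[OF u(1)])
    have "u (y \<oplus> ?s) = u y" "y \<oplus> ?s \<noteq> \<zero>" using place_add_less[OF u(1), of y ?s] y s us by auto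
    moreover have "v (y \<oplus> ?s) > 0" using place_add[OF v, of y ?s] y s vs calculation by simp
    moreover have "w (y \<oplus> ?s) < 0" if w: "w \<in> T" for w
    proof -
      have wp: "w \<in> places R" using w insert by auto
      have "\<bar>w y\<bar> < int r" using r(2)[OF w] .
      moreover have "int r * w z \<le> int r * (-1)" using z(4)[OF w] by (intro mult_left_mono) simp_all
      then have "w ?s \<le> - int r" using place_pow[OF wp] z by simp
      ultimately have "w ?s < w y" "w ?s < 0" by linarith+
      moreover have "w (?s \<oplus> y) = w ?s" using place_add_less[OF wp, of ?s y] y s calculation by simp
      ultimately show ?thesis using y s by (simp add: a_comm)
    qed
    ultimately show ?thesis using y s by (intro bexI[of _ "y \<oplus> ?s"]) auto
  qed
qed

text \<open>The witness is \<open>1 / (1 + z^r)\<close>: it is close to 1 where \<open>z\<close> is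
  small and close to 0 where \<open>z\<close> has a pole.\<close>

lemma approximate_idempotent:
  assumes v: "v \<in> places R" and T: "finite T" "T \<subseteq> places R" "v \<notin> T"
  shows "\<exists>e \<in> carrier R. e \<ominus> \<one> \<in> vball R v n \<and> (\<forall>w\<in>T. e \<in> vball R w n)"
proof -
  obtain z where z: "z \<in> carrier R" "z \<noteq> \<zero>" "v z > 0" "\<And>w. w \<in> T \<Longrightarrow> w z < 0"
    using places_separated_finite[OF assms] by auto
  obtain r :: nat where r: "r \<ge> 1" "n \<le> int r" using that[of "Suc (nat n)"] by simp
  let ?s = "z [^] r" let ?d = "\<one> \<oplus> ?s"
  have s: "?s \<in> carrier R" "?s \<noteq> \<zero>" using z by auto
  have "int r * v z \<ge> int r" using z(3) mult_left_mono[of 1 "v z" "int r"] by simp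
  then have vs: "v ?s \<ge> int r" using z place_pow[OF v] by simp
  have d: "?d \<noteq> \<zero>" "v ?d = 0" "?d \<in> carrier R"
  proof -
    have "v \<one> < v ?s" using vs r by (simp only: place_one[OF v])
    then show "?d \<noteq> \<zero>" "v ?d = 0" "?d \<in> carrier R"
      using place_add_less[OF v, of \<one> ?s] s place_one[OF v] by auto
  qed
  have "inv ?d \<ominus> \<one> = \<ominus> (?s \<otimes> inv ?d)"
  proof -
    have "inv ?d \<ominus> (?d \<otimes> inv ?d) = \<ominus> (?s \<otimes> inv ?d)"
      using s inv_nonzero(1)[OF d(3,1)] by algebra
    then show ?thesis using d by simp
  qed
  moreover have "?s \<otimes> inv ?d \<in> vball R v n"
    using s d vs r by (auto simp: vball_def place_mult[OF v] place_inv[OF v])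
  ultimately have 1: "inv ?d \<ominus> \<one> \<in> vball R v n" using vball_neg[OF v] by metis
  have "inv ?d \<in> vball R w n" if w: "w \<in> T" for w
  proof -
    have wp: "w \<in> places R" using w T by auto
    have "int r * w z \<le> int r * (-1)" using z(4)[OF w] by (intro mult_left_mono) simp_all
    then have ws: "w ?s \<le> - int r" using place_pow[OF wp] z by simp
    then have "w (?s \<oplus> \<one>) = w ?s" using place_add_less[OF wp, of ?s \<one>] s r by (simp add: place_one[OF wp])
    then show ?thesis using ws d s r by (intro vballI) (auto simp: a_comm place_inv[OF wp])
  qed
  then show ?thesis using 1 d by auto
qed

theorem weak_approximation:
  assumes T: "finite T" "T \<subseteq> places R" and a: "\<And>v. v \<in> T \<Longrightarrow> a v \<in> carrier R"
  shows "\<exists>y \<in> carrier R. \<forall>v\<in>T. y \<ominus> a v \<in> vball R v n"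
proof -
  \<comment> \<open>Smallness of \<open>y\<close> at the places still to come belongs to the
    induction: it makes \<open>y + a u * e\<close> agree with \<open>a u\<close> at the new place
    \<open>u\<close>.\<close>
  have "\<exists>y \<in> carrier R. (\<forall>v\<in>S. y \<ominus> a v \<in> vball R v n) \<and> (\<forall>v\<in>T - S. y \<in> vball R v n)"
    if "finite S" "S \<subseteq> T" for S
    using that
  proof (induction S)
    case empty
    show ?case by (rule bexI[of _ \<zero>]) auto
  next
    case (insert u S)
    obtain y where y: "y \<in> carrier R" "\<And>v. v \<in> S \<Longrightarrow> y \<ominus> a v \<in> vball R v n"
      "\<And>v. v \<in> T - S \<Longrightarrow> y \<in> vball R v n" using insert by auto
    have u: "u \<in> places R" "u \<in> T" "a u \<in> carrier R" using insert T a by auto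
    \<comment> \<open>Multiplication by \<open>a u\<close> loses at most
      \<open>\<bar>w (a u)\<bar>\<close> of precision at \<open>w\<close>; this \<open>N\<close>
      pays for the loss at all places of \<open>T\<close> at once.\<close>
    define N where "N = (\<Sum>w\<in>T. \<bar>w (a u)\<bar>) + \<bar>n\<bar>"
    obtain e where e: "e \<in> carrier R" "e \<ominus> \<one> \<in> vball R u N" "\<And>w. w \<in> T - {u} \<Longrightarrow> e \<in> vball R w N"
      using approximate_idempotent[OF u(1), of "T - {u}" N] T by auto
    have small: "a u \<otimes> t \<in> vball R w n" if "t \<in> vball R w N" "w \<in> T" for t w
    proof -
      have wp: "w \<in> places R" using that T by auto
      have "\<bar>w (a u)\<bar> \<le> (\<Sum>w\<in>T. \<bar>w (a u)\<bar>)" using T that by (intro member_le_sum) auto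
      then have le: "n \<le> w (a u) + N" by (simp add: N_def)
      have "a u \<in> vball R w (w (a u))" using u by (auto simp: vball_def)
      then have "a u \<otimes> t \<in> vball R w (w (a u) + N)" using vball_mult[OF wp _ that(1)] by blast
      then show ?thesis using vball_mono[OF le] by (rule set_rev_mp)
    qed
    let ?y = "y \<oplus> a u \<otimes> e"
    have "?y \<ominus> a u = y \<oplus> a u \<otimes> (e \<ominus> \<one>)" using y e u by algebra
    then have 1: "?y \<ominus> a u \<in> vball R u n"
      using vball_add[OF u(1) y(3) small[OF e(2)]] u insert by simp
    have 2: "?y \<ominus> a v \<in> vball R v n" if v: "v \<in> S" for v
    proof -
      have vp: "v \<in> places R" "v \<in> T - {u}" "a v \<in> carrier R" using v insert T a by auto
      have "?y \<ominus> a v = (y \<ominus> a v) \<oplus> a u \<otimes> e" using y e u vp by algebra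
      then show ?thesis using vball_add[OF vp(1) y(2)[OF v] small[OF e(3)]] vp by simp
    qed
    have 3: "?y \<in> vball R v n" if v: "v \<in> T - insert u S" for v
    proof -
      have vp: "v \<in> places R" "v \<in> T - {u}" using v T by auto
      show ?thesis using vball_add[OF vp(1) y(3) small[OF e(3)]] vp v by simp
    qed
    show ?case using 1 2 3 y e u by (intro bexI[of _ ?y]) auto
  qed
  from this[of T] show ?thesis using T by auto
qed

end

section \<open>Finite expansions and incongruent elements\<close>

primrec expansions :: "('a, 'b) ring_scheme \<Rightarrow> 'a set \<Rightarrow> 'a \<Rightarrow> nat \<Rightarrow> 'a set" where
  "expansions K V x 0 = V"
| "expansions K V x (Suc n) = {w \<oplus>\<^bsub>K\<^esub> x \<otimes>\<^bsub>K\<^esub> m | w m. w \<in> V \<and> m \<in> expansions K V x n}"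

text \<open>Counting cosets instead of taking a power of the size of the constant field keeps the
  norm independent of dimensions; \<open>card_constant_field_power_degree\<close> compares the two.
  As infinite sets have cardinality 0, finiteness of the set of cosets always accompanies
  it.\<close>

definition place_norm :: "('a, 'b) ring_scheme \<Rightarrow> ('a \<Rightarrow> int) \<Rightarrow> nat" where
  "place_norm K v = card ((\<lambda>a. valuation_ideal K v +>\<^bsub>K\<^esub> a) ` valuation_ring K v)"

text \<open>If \<open>a > b\<close>, the ratio \<open>(a / b) ^ n\<close> outgrows \<open>C\<close>.
  This is the device that turns an estimate up to constants into an exact one.\<close>

lemma le_of_power_le:
  fixes a b C :: nat
  assumes "\<And>n. a ^ Suc n \<le> C * b ^ n"
  shows "a \<le> b"
proof (rule ccontr)
  assume "\<not> a \<le> b"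
  then have ab: "a > b" by simp
  show False
  proof (cases "b = 0")
    case True then show ?thesis using assms[of 1] ab by simp
  next
    case False
    then have "real a / real b > 1" using ab by simp
    then obtain n where n: "real C < (real a / real b) ^ n" using real_arch_pow by blast
    have "real C * real b ^ n < real a ^ n" using n False by (simp add: power_divide field_simps)
    then have "C * b ^ n < a ^ n" by (metis of_nat_less_iff of_nat_mult of_nat_power)
    also have "a ^ n \<le> a ^ Suc n" using ab by simp
    finally show False using assms[of n] by simp
  qed
qed

text \<open>A bound on \<open>card A\<close> alone says nothing for infinite \<open>A\<close>, whose
  \<open>card\<close> is 0; a bound on all finite subsets does.\<close>

lemma finite_if_card_subsets_bounded:
  assumes "\<And>B. B \<subseteq> A \<Longrightarrow> finite B \<Longrightarrow> card B \<le> n"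
  shows "finite A" "card A \<le> n"
proof -
  show f: "finite A"
  proof (rule ccontr)
    assume "infinite A"
    then obtain B where "B \<subseteq> A" "finite B" "card B = Suc n" using infinite_arbitrarily_large by blast
    then show False using assms[of B] by simp
  qed
  then show "card A \<le> n" using assms by blast
qed

lemma large_fibre:
  assumes "finite A" "f ` A \<subseteq> B" "finite B" "card B * r < card A"
  shows "\<exists>y\<in>B. r < card {x \<in> A. f x = y}"
proof (rule ccontr)
  assume "\<not> ?thesis"
  then have le: "card {x \<in> A. f x = y} \<le> r" if "y \<in> B" for y using that by force
  have "card A = (\<Sum>y\<in>f ` A. card {x \<in> A. f x = y})"
    using sum.image_gen[OF assms(1), of "\<lambda>_. 1::nat" f] by simp
  also have "\<dots> \<le> (\<Sum>y\<in>f ` A. r)" using le assms(2) by (intro sum_mono) auto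
  also have "\<dots> \<le> card B * r" using assms by (simp add: card_mono)
  finally show False using assms by simp
qed

context field
begin

text \<open>Additive subgroups are the right generality: the valuation ideal is an ideal of the
  valuation ring only, while the cosets are formed in the whole field.\<close>

lemma r_coset_eq_iff:
  assumes I: "I \<subseteq> carrier R" "\<zero> \<in> I" "\<And>a b. a \<in> I \<Longrightarrow> b \<in> I \<Longrightarrow> a \<ominus> b \<in> I"
    and ab: "a \<in> carrier R" "b \<in> carrier R"
  shows "I +> a = I +> b \<longleftrightarrow> a \<ominus> b \<in> I"
proof
  have el: "I +> c = {h \<oplus> c | h. h \<in> I}" for c by (auto simp: a_r_coset_def')
  assume "I +> a = I +> b"
  moreover have "a \<in> I +> a" using I ab unfolding el by (force intro: exI[of _ \<zero>])
  ultimately obtain h where h: "h \<in> I" "a = h \<oplus> b" unfolding el by auto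
  have "h \<in> carrier R" using h I by auto
  then have "a \<ominus> b = h" using ab unfolding h(2) by algebra
  then show "a \<ominus> b \<in> I" using h by simp
next
  have el: "I +> c = {h \<oplus> c | h. h \<in> I}" for c by (auto simp: a_r_coset_def')
  have plus: "c \<oplus> d \<in> I" if "c \<in> I" "d \<in> I" for c d
  proof -
    have cd: "c \<in> carrier R" "d \<in> carrier R" using that I by auto
    have "c \<ominus> (\<zero> \<ominus> d) = c \<oplus> d" using cd by algebra
    then show ?thesis using I(3)[OF that(1) I(3)[OF I(2) that(2)]] by simp
  qed
  assume d: "a \<ominus> b \<in> I"
  have "h \<oplus> a = (h \<oplus> (a \<ominus> b)) \<oplus> b \<and> h \<oplus> b = (h \<ominus> (a \<ominus> b)) \<oplus> a" if "h \<in> I" for h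
  proof -
    have h: "h \<in> carrier R" using that I(1) by auto
    have "h \<oplus> a = (h \<oplus> (a \<ominus> b)) \<oplus> b" using h ab by algebra
    moreover have "h \<oplus> b = (h \<ominus> (a \<ominus> b)) \<oplus> a" using h ab by algebra
    ultimately show ?thesis by simp
  qed
  then show "I +> a = I +> b" unfolding el using plus[OF _ d] I(3)[OF _ d] by blast
qed

lemma residue_class_eq_iff:
  assumes "v \<in> places R" "a \<in> carrier R" "b \<in> carrier R"
  shows "valuation_ideal R v +> a = valuation_ideal R v +> b \<longleftrightarrow> a \<ominus> b \<in> vball R v 1"
  unfolding valuation_ideal_eq_vball using assms
  by (intro r_coset_eq_iff) (auto intro: vball_minus vball_carrier)

text \<open>In the Horner form the lowest digit stands alone. Once it is determined, it cancels, and
  then so does the factor \<open>x\<close>, which leaves a shorter expansion. Length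
  \<open>n\<close> means \<open>Suc n\<close> digits, hence the exponent.\<close>

lemma card_expansions:
  assumes V: "finite V" "V \<subseteq> carrier R" and x: "x \<in> carrier R" "x \<noteq> \<zero>"
    and u: "\<And>w w' m m' n. \<lbrakk>w \<in> V; w' \<in> V; m \<in> expansions R V x n; m' \<in> expansions R V x n;
      w \<oplus> x \<otimes> m = w' \<oplus> x \<otimes> m'\<rbrakk> \<Longrightarrow> w = w'"
  shows "expansions R V x n \<subseteq> carrier R \<and> finite (expansions R V x n) \<and>
    card (expansions R V x n) = card V ^ Suc n"
proof (induction n)
  case (Suc n)
  let ?f = "\<lambda>(w, m). w \<oplus> x \<otimes> m" and ?S = "V \<times> expansions R V x n"
  have im: "expansions R V x (Suc n) = ?f ` ?S" by auto
  have "m = m'" if "w \<in> V" "m \<in> expansions R V x n" "m' \<in> expansions R V x n"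
    "w \<oplus> x \<otimes> m = w \<oplus> x \<otimes> m'" for w m m'
  proof -
    have "w \<in> carrier R" "m \<in> carrier R" "m' \<in> carrier R" using that V Suc by auto
    then have "x \<otimes> m = x \<otimes> m'" using that(4) x add.l_cancel[of w "x \<otimes> m" "x \<otimes> m'"] by simp
    then show ?thesis using m_lcancel[of x m m'] x \<open>m \<in> carrier R\<close> \<open>m' \<in> carrier R\<close> by simp
  qed
  moreover have "w = w'" if "w \<in> V" "w' \<in> V" "m \<in> expansions R V x n" "m' \<in> expansions R V x n"
    "w \<oplus> x \<otimes> m = w' \<oplus> x \<otimes> m'" for w w' m m'
    using u that by blast
  ultimately have *: "w = w' \<and> m = m'" if "w \<in> V" "w' \<in> V" "m \<in> expansions R V x n"
    "m' \<in> expansions R V x n" "w \<oplus> x \<otimes> m = w' \<oplus> x \<otimes> m'" for w w' m m'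
    using that by metis
  have "inj_on ?f ?S"
  proof (rule inj_onI, clarify)
    fix w m w' m'
    assume "w \<in> V" "w' \<in> V" "m \<in> expansions R V x n" "m' \<in> expansions R V x n"
      "w \<oplus> x \<otimes> m = w' \<oplus> x \<otimes> m'"
    then show "w = w' \<and> m = m'" by (rule *)
  qed
  then have "card (?f ` ?S) = card V ^ Suc (Suc n)" using Suc by (simp add: card_image card_cartesian_product)
  moreover have "?f ` ?S \<subseteq> carrier R" using V x Suc by auto
  ultimately show ?case using im V Suc by auto
qed (use V in auto)

end

text \<open>The digits \<open>V\<close> generalise the constants of a rational function field: every element of the
  field has a multiple with a finite \<open>x\<close>-adic expansion with digits in \<open>V\<close>.\<close>

locale expansion_field = field R for R (structure) +
  fixes V :: "'a set" and x :: 'a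
  assumes V_carrier: "V \<subseteq> carrier R" and V_finite: "finite V" and V_zero: "\<zero> \<in> V"
    and V_minus: "a \<in> V \<Longrightarrow> b \<in> V \<Longrightarrow> a \<ominus> b \<in> V"
    and V_nontrivial: "\<exists>w\<in>V. w \<noteq> \<zero>"
    and x_carrier: "x \<in> carrier R" and x_nonzero: "x \<noteq> \<zero>"
    and digit_unique: "w \<in> V \<Longrightarrow> m \<in> expansions R V x n \<Longrightarrow> w \<oplus> x \<otimes> m = \<zero> \<Longrightarrow> w = \<zero>"
    and prime_field_finite: "finite (generate_field R {})"
    and expansion_multiple: "f \<in> carrier R \<Longrightarrow> \<exists>h c. h \<in> carrier R \<and> h \<noteq> \<zero> \<and>
      (\<forall>w\<in>V. h \<otimes> w \<in> expansions R V x c \<and> f \<otimes> h \<otimes> w \<in> expansions R V x c)"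
begin

abbreviation "M \<equiv> expansions R V x"

lemma M_carrier: "M n \<subseteq> carrier R"
  using V_carrier x_carrier by (induction n) auto

lemma M_zero: "\<zero> \<in> M n"
proof (induction n)
  case (Suc n)
  have "\<zero> = \<zero> \<oplus> x \<otimes> \<zero>" using x_carrier by simp
  then show ?case using Suc V_zero by (simp) blast
qed (simp add: V_zero)

lemma M_minus: "a \<in> M n \<Longrightarrow> b \<in> M n \<Longrightarrow> a \<ominus> b \<in> M n"
proof (induction n arbitrary: a b)
  case (Suc n)
  obtain w m w' m' where *: "a = w \<oplus> x \<otimes> m" "b = w' \<oplus> x \<otimes> m'" "w \<in> V" "w' \<in> V" "m \<in> M n" "m' \<in> M n"
    using Suc.prems by auto
  have "w \<in> carrier R" "w' \<in> carrier R" "m \<in> carrier R" "m' \<in> carrier R"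
    using * V_carrier M_carrier by blast+
  then have "a \<ominus> b = (w \<ominus> w') \<oplus> x \<otimes> (m \<ominus> m')" using *(1,2) x_carrier by algebra
  then show ?case using V_minus[OF *(3,4)] Suc.IH[OF *(5,6)] by auto
qed (simp add: V_minus)

lemma M_add: "a \<in> M n \<Longrightarrow> b \<in> M n \<Longrightarrow> a \<oplus> b \<in> M n"
proof -
  assume ab: "a \<in> M n" "b \<in> M n"
  then have "a \<in> carrier R" "b \<in> carrier R" using M_carrier by auto
  then have "a \<oplus> b = a \<ominus> (\<zero> \<ominus> b)" by algebra
  then show ?thesis using M_minus[OF ab(1) M_minus[OF M_zero ab(2)]] by simp
qed

lemma M_mult_x: "m \<in> M n \<Longrightarrow> x \<otimes> m \<in> M (Suc n)"
proof -
  assume m: "m \<in> M n"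
  then have "x \<otimes> m = \<zero> \<oplus> x \<otimes> m" using M_carrier x_carrier by (simp add: subset_iff)
  then show ?thesis using m V_zero by auto
qed

lemma M_Suc: "M n \<subseteq> M (Suc n)"
proof (induction n)
  case 0
  have "w = w \<oplus> x \<otimes> \<zero>" if "w \<in> V" for w using that V_carrier x_carrier by (simp add: subset_iff)
  then show ?case using V_zero by auto
qed auto

lemma M_mono: "m \<le> n \<Longrightarrow> M m \<subseteq> M n"
  by (rule lift_Suc_mono_le[of M]) (use M_Suc in auto)

text \<open>The expansions form a filtration, and the degree of \<open>h\<close> as a multiplication
  operator on it can be read off from the digits alone.\<close>

lemma M_mult:
  assumes h: "h \<in> carrier R" and hV: "\<And>w. w \<in> V \<Longrightarrow> h \<otimes> w \<in> M c"
  shows "m \<in> M n \<Longrightarrow> h \<otimes> m \<in> M (n + c)"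
proof (induction n arbitrary: m)
  case (Suc n)
  then obtain w m' where *: "m = w \<oplus> x \<otimes> m'" "w \<in> V" "m' \<in> M n" by auto
  then have c: "w \<in> carrier R" "m' \<in> carrier R" using V_carrier M_carrier by auto
  have e: "h \<otimes> m = h \<otimes> w \<oplus> x \<otimes> (h \<otimes> m')" using * c h x_carrier by algebra
  have "h \<otimes> w \<in> M (Suc n + c)" using hV[OF *(2)] M_mono[of c "Suc n + c"] by auto
  moreover have "x \<otimes> (h \<otimes> m') \<in> M (Suc n + c)" using M_mult_x[OF Suc.IH[OF *(3)]] by simp
  ultimately show ?case unfolding e by (rule M_add)
qed (use hV in simp)

lemma M_card: "finite (M n)" "card (M n) = card V ^ Suc n"
proof -
  have "w = w'" if "w \<in> V" "w' \<in> V" "m \<in> M n" "m' \<in> M n" "w \<oplus> x \<otimes> m = w' \<oplus> x \<otimes> m'" for w w' m m' n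
  proof -
    have c: "w \<in> carrier R" "w' \<in> carrier R" "m \<in> carrier R" "m' \<in> carrier R"
      using that V_carrier M_carrier by blast+
    have "(w \<ominus> w') \<oplus> x \<otimes> (m \<ominus> m') = (w \<oplus> x \<otimes> m) \<ominus> (w' \<oplus> x \<otimes> m')"
      using c x_carrier by algebra
    also have "\<dots> = \<zero>" using that(5) c x_carrier by (simp add: minus_eq_zero_iff)
    finally have "w \<ominus> w' = \<zero>" using digit_unique V_minus M_minus that by blast
    then show ?thesis using c by (simp add: minus_eq_zero_iff)
  qed
  then show "finite (M n)" "card (M n) = card V ^ Suc n"
    using card_expansions[OF V_finite V_carrier x_carrier x_nonzero] by blast+
qed

lemma multiple_in_M:
  assumes "f \<in> carrier R" shows "\<exists>d n. d \<in> carrier R \<and> d \<noteq> \<zero> \<and> d \<otimes> f \<in> M n"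
proof -
  obtain w where w: "w \<in> V" "w \<noteq> \<zero>" using V_nontrivial by auto
  have wc: "w \<in> carrier R" using w V_carrier by auto
  obtain h c where h: "h \<in> carrier R" "h \<noteq> \<zero>" "f \<otimes> h \<otimes> w \<in> M c"
    using expansion_multiple[OF assms] w by blast
  have "f \<otimes> h \<otimes> w = (h \<otimes> w) \<otimes> f" using assms h wc by algebra
  then show ?thesis using h w wc by (intro exI[of _ "h \<otimes> w"] exI[of _ c]) auto
qed

lemma common_multiple_in_M:
  assumes "finite W" "W \<subseteq> carrier R"
  shows "\<exists>d n. d \<in> carrier R \<and> d \<noteq> \<zero> \<and> (\<forall>w\<in>W. d \<otimes> w \<in> M n)"
  using assms
proof (induction W)
  case (insert f W)
  then obtain d n where d: "d \<in> carrier R" "d \<noteq> \<zero>" "\<And>w. w \<in> W \<Longrightarrow> d \<otimes> w \<in> M n" by auto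
  obtain g k where g: "g \<in> carrier R" "g \<noteq> \<zero>" "g \<otimes> (d \<otimes> f) \<in> M k"
    using multiple_in_M[of "d \<otimes> f"] insert d by auto
  obtain h c where h: "h \<in> carrier R" "h \<noteq> \<zero>" "\<And>w. w \<in> V \<Longrightarrow> h \<otimes> w \<in> M c"
      "\<And>w. w \<in> V \<Longrightarrow> g \<otimes> h \<otimes> w \<in> M c"
    using expansion_multiple[OF g(1)] by blast
  \<comment> \<open>\<open>d\<close> clears denominators on \<open>W\<close> and \<open>g\<close>
    clears that of \<open>d \<otimes> f\<close>. Multiplying by \<open>g\<close> could spoil what
    \<open>d\<close> achieved, so \<open>h\<close> is chosen such that both \<open>h\<close> and
    \<open>g \<otimes> h\<close> respect expansions.\<close>
  let ?e = "h \<otimes> g \<otimes> d"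
  have 1: "?e \<otimes> f \<in> M (k + c + n)"
  proof -
    have fc: "f \<in> carrier R" using insert by auto
    have "?e \<otimes> f = h \<otimes> (g \<otimes> (d \<otimes> f))" using h g d fc by algebra
    then show ?thesis using M_mult[OF h(1,3) g(3)] M_mono[of "k + c" "k + c + n"] by auto
  qed
  have 2: "?e \<otimes> w \<in> M (k + c + n)" if w: "w \<in> W" for w
  proof -
    have fc: "w \<in> carrier R" using insert w by auto
    have "?e \<otimes> w = g \<otimes> h \<otimes> (d \<otimes> w)" using h g d fc by algebra
    moreover have "g \<otimes> h \<otimes> (d \<otimes> w) \<in> M (n + c)" using M_mult[OF _ h(4) d(3)[OF w]] g h by simp
    ultimately show ?thesis using M_mono[of "n + c" "k + c + n"] by auto
  qed
  show ?case using 1 2 h g d by (intro exI[of _ ?e] exI[of _ "k + c + n"]) auto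
qed (use one_closed one_not_zero in blast)

text \<open>The sums \<open>w\<^sub>0 + w\<^sub>1 t + \<dots> + w\<^sub>n t\<^sup>n\<close> with \<open>w\<^sub>i \<in> W\<close> are pairwise distinct, and up to a common
  factor they all lie in \<open>M (c n + c')\<close>.\<close>

theorem card_incongruent_le:
  assumes t: "t \<in> carrier R" "t \<noteq> \<zero>" and h: "h \<in> carrier R" "h \<noteq> \<zero>"
    and hV: "\<And>w. w \<in> V \<Longrightarrow> h \<otimes> w \<in> M c" "\<And>w. w \<in> V \<Longrightarrow> t \<otimes> h \<otimes> w \<in> M c"
    and B: "B \<subseteq> carrier R" "\<And>a b. a \<in> B \<Longrightarrow> b \<in> B \<Longrightarrow> a \<ominus> b \<in> B"
      "\<And>a. a \<in> B \<Longrightarrow> t \<otimes> a \<in> B"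
    and W: "finite W" "W \<subseteq> B"
      "\<And>w w' a. w \<in> W \<Longrightarrow> w' \<in> W \<Longrightarrow> a \<in> B \<Longrightarrow> w \<ominus> w' = t \<otimes> a \<Longrightarrow> w = w'"
  shows "card W \<le> card V ^ c"
proof -
  let ?P = "expansions R W t"
  have Wc: "W \<subseteq> carrier R" using W B by auto
  have PB: "?P n \<subseteq> B" for n
  proof (induction n)
    case (Suc n)
    have "w \<oplus> t \<otimes> m \<in> B" if "w \<in> W" "m \<in> ?P n" for w m
    proof -
      have "w \<in> B" "m \<in> B" "t \<otimes> m \<in> B" using that W B Suc by auto
      then have *: "w \<in> B" "t \<otimes> m \<in> B" "w \<in> carrier R" "t \<otimes> m \<in> carrier R" using B(1) by blast+
      then have "w \<oplus> t \<otimes> m = w \<ominus> ((w \<ominus> w) \<ominus> t \<otimes> m)" by algebra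
      then show ?thesis using * B(2) by simp
    qed
    then show ?case by auto
  qed (use W in simp)
  \<comment> \<open>Equality of two expansions in \<open>t\<close> is a congruence modulo
    \<open>t B\<close> between their lowest digits, which are incongruent unless equal.\<close>
  have inj: "w = w'" if "w \<in> W" "w' \<in> W" "m \<in> ?P n" "m' \<in> ?P n" "w \<oplus> t \<otimes> m = w' \<oplus> t \<otimes> m'" for w w' m m' n
  proof -
    have *: "w \<in> carrier R" "w' \<in> carrier R" "m \<in> B" "m' \<in> B" "m \<in> carrier R" "m' \<in> carrier R"
      using that Wc PB B(1) by blast+
    have "w \<ominus> w' = (w \<oplus> t \<otimes> m) \<ominus> w' \<ominus> t \<otimes> m" using * t by algebra
    also have "\<dots> = t \<otimes> (m' \<ominus> m)" unfolding that(5) using * t by algebra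
    finally show ?thesis using W(3)[OF that(1,2) B(2)[OF *(4,3)]] by simp
  qed
  have cP: "?P n \<subseteq> carrier R \<and> finite (?P n) \<and> card (?P n) = card W ^ Suc n" for n
    by (rule card_expansions[OF W(1) Wc t]) (rule inj)
  obtain d n0 where d: "d \<in> carrier R" "d \<noteq> \<zero>" "\<And>w. w \<in> W \<Longrightarrow> d \<otimes> w \<in> M n0"
    using common_multiple_in_M[OF W(1) Wc] by blast
  \<comment> \<open>Each power of \<open>t\<close> is paid for by one factor \<open>h\<close>, and
    each factor \<open>h\<close> lengthens an expansion by \<open>c\<close>; hence the length
    \<open>k + c * n\<close>.\<close>
  have hM: "h [^] n \<otimes> m \<in> M (k + c * n)" if "m \<in> M k" for m k and n :: nat
  proof (induction n)
    case 0 then show ?case using that M_carrier by (auto simp: subset_iff)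
  next
    case (Suc n)
    have "m \<in> carrier R" using that M_carrier by auto
    then have "h [^] Suc n \<otimes> m = h \<otimes> (h [^] n \<otimes> m)" using h by (simp add: m_ac)
    moreover have "h \<otimes> (h [^] n \<otimes> m) \<in> M (k + c * n + c)" using M_mult[OF h(1) hV(1) Suc] by blast
    ultimately show ?case by (simp add: algebra_simps)
  qed
  have dP: "d \<otimes> h [^] n \<otimes> p \<in> M (n0 + c * n)" if "p \<in> ?P n" for p n
    using that
  proof (induction n arbitrary: p)
    case (Suc n)
    then obtain w m where p: "p = w \<oplus> t \<otimes> m" "w \<in> W" "m \<in> ?P n" by auto
    have c: "w \<in> carrier R" "m \<in> carrier R" using p Wc PB B(1) by blast+
    have "d \<otimes> h [^] Suc n \<otimes> p = h [^] Suc n \<otimes> (d \<otimes> w) \<oplus> t \<otimes> h \<otimes> (d \<otimes> h [^] n \<otimes> m)"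
    proof -
      have "h [^] n \<in> carrier R" using h by simp
      then show ?thesis unfolding p(1) nat_pow_Suc using c d h t by algebra
    qed
    moreover have "t \<otimes> h \<otimes> (d \<otimes> h [^] n \<otimes> m) \<in> M (n0 + c * n + c)"
      using M_mult[OF _ hV(2) Suc.IH[OF p(3)]] t h by simp
    then have "t \<otimes> h \<otimes> (d \<otimes> h [^] n \<otimes> m) \<in> M (n0 + c * Suc n)" by (simp add: algebra_simps)
    moreover have "h [^] Suc n \<otimes> (d \<otimes> w) \<in> M (n0 + c * Suc n)" by (rule hM[OF d(3)[OF p(2)]])
    ultimately show ?case by (metis M_add)
  qed (use d Wc in auto)
  \<comment> \<open>Multiplication by \<open>d \<otimes> h [^] n\<close> embeds the
    \<open>W\<close>-expansions of length \<open>n\<close> into \<open>M (n0 + c * n)\<close>. Only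
    the slope \<open>c\<close> survives the passage to n-th roots.\<close>
  have "card W ^ Suc n \<le> card V ^ Suc n0 * (card V ^ c) ^ n" for n
  proof -
    let ?g = "d \<otimes> h [^] n"
    have g: "?g \<in> carrier R" "?g \<noteq> \<zero>" using d h by auto
    have "inj_on (\<lambda>p. ?g \<otimes> p) (?P n)"
      using g cP[of n] by (intro inj_onI) (metis m_lcancel subsetD)
    then have "card (?P n) \<le> card (M (n0 + c * n))"
      using dP M_card by (metis card_inj_on_le image_subsetI)
    then show ?thesis using cP[of n] M_card[of "n0 + c * n"] by (simp add: power_add power_mult)
  qed
  then show ?thesis by (rule le_of_power_le)
qed

text \<open>The order of the quantifiers matters: the bound depends on \<open>t\<close> only and
  serves all \<open>B\<close> and \<open>W\<close>. In the proof that \<open>f\<close> has finitely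
  many zeros, the ring \<open>B\<close> varies with the finite set of zeros under
  consideration.\<close>

lemma finite_incongruent_bound:
  assumes "t \<in> carrier R" "t \<noteq> \<zero>"
  shows "\<exists>N::nat. \<forall>B W. B \<subseteq> carrier R \<longrightarrow> (\<forall>a\<in>B. \<forall>b\<in>B. a \<ominus> b \<in> B) \<longrightarrow> (\<forall>a\<in>B. t \<otimes> a \<in> B) \<longrightarrow>
    finite W \<longrightarrow> W \<subseteq> B \<longrightarrow> (\<forall>w\<in>W. \<forall>w'\<in>W. \<forall>a\<in>B. w \<ominus> w' = t \<otimes> a \<longrightarrow> w = w') \<longrightarrow> card W \<le> N"
proof -
  obtain h c where h: "h \<in> carrier R" "h \<noteq> \<zero>" "\<And>w. w \<in> V \<Longrightarrow> h \<otimes> w \<in> M c"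
      "\<And>w. w \<in> V \<Longrightarrow> t \<otimes> h \<otimes> w \<in> M c"
    using expansion_multiple[OF assms(1)] by blast
  show ?thesis
  proof (intro exI[of _ "card V ^ c"] allI impI)
    fix B W
    assume B: "B \<subseteq> carrier R" "\<forall>a\<in>B. \<forall>b\<in>B. a \<ominus> b \<in> B" "\<forall>a\<in>B. t \<otimes> a \<in> B"
      and W: "finite W" "W \<subseteq> B" "\<forall>w\<in>W. \<forall>w'\<in>W. \<forall>a\<in>B. w \<ominus> w' = t \<otimes> a \<longrightarrow> w = w'"
    show "card W \<le> card V ^ c"
    proof (rule card_incongruent_le[OF assms h B(1) _ _ W(1,2)])
      show "w = w'" if "w \<in> W" "w' \<in> W" "a \<in> B" "w \<ominus> w' = t \<otimes> a" for w w' a using W(3) that by blast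
    qed (use B in auto)
  qed
qed

end

section \<open>Norms of divisors, Riemann-Roch spaces and the pigeonhole principle\<close>

definition divisor_norm :: "('a, 'b) ring_scheme \<Rightarrow> ('a \<Rightarrow> int) multiset \<Rightarrow> nat" where
  "divisor_norm K D = (\<Prod>v\<in>#D. place_norm K v)"

lemma divisor_norm_simps [simp]:
  "divisor_norm K {#} = 1"
  "divisor_norm K (add_mset v D) = place_norm K v * divisor_norm K D"
  "divisor_norm K (C + D) = divisor_norm K C * divisor_norm K D"
  by (simp_all add: divisor_norm_def)

lemma divisor_norm_repeat [simp]: "divisor_norm K (repeat_mset n D) = divisor_norm K D ^ n"
  by (induction n) (simp_all add: repeat_mset_Suc)

text \<open>The space L(A), zero included. \<open>A\<close> is an arbitrary integer-valued function,
  so differences of divisors are allowed; effective divisors are multisets and enter through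
  \<open>count\<close>.\<close>

definition riemann_roch_space :: "('a, 'b) ring_scheme \<Rightarrow> (('a \<Rightarrow> int) \<Rightarrow> int) \<Rightarrow> 'a set" where
  "riemann_roch_space K A = {f \<in> carrier K. \<forall>v\<in>places K. f \<in> vball K v (- A v)}"

context field
begin

text \<open>After scaling by an element of order \<open>-m\<close> the differences become integral,
  and a residue class containing more than \<open>r\<close> of the elements exists by
  pigeonhole.\<close>

lemma residue_classes_subset_large_fibre:
  assumes v: "v \<in> places R" and fin: "finite ((\<lambda>a. valuation_ideal R v +> a) ` valuation_ring R v)"
    and A: "finite A" "A \<subseteq> carrier R" "\<And>a b. a \<in> A \<Longrightarrow> b \<in> A \<Longrightarrow> a \<ominus> b \<in> vball R v m"
    and card: "place_norm R v * r < card A"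
  shows "\<exists>A'\<subseteq>A. r < card A' \<and> (\<forall>a\<in>A'. \<forall>b\<in>A'. a \<ominus> b \<in> vball R v (m + 1))"
proof -
  have "A \<noteq> {}" using card by auto
  then obtain a0 where a0: "a0 \<in> A" by auto
  obtain p where p: "p \<in> carrier R" "p \<noteq> \<zero>" "v p = - m" using place_surj[OF v] by blast
  define f where "f a = valuation_ideal R v +> (p \<otimes> (a \<ominus> a0))" for a
  have pO: "p \<otimes> (a \<ominus> b) \<in> vball R v 0" if "a \<in> A" "b \<in> A" for a b
    using vball_mult[OF v vballI[OF p(1)] A(3)[OF that], of "-m"] p by simp
  have "f ` A \<subseteq> (\<lambda>a. valuation_ideal R v +> a) ` valuation_ring R v"
    using pO[OF _ a0] by (auto simp: f_def valuation_ring_eq_vball)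
  then obtain y where y: "r < card {a \<in> A. f a = y}"
    using large_fibre[OF A(1) _ fin, of f r] card by (auto simp: place_norm_def)
  have "a \<ominus> b \<in> vball R v (m + 1)" if "a \<in> A" "b \<in> A" "f a = f b" for a b
  proof -
    have c: "a \<in> carrier R" "b \<in> carrier R" "a0 \<in> carrier R" using that a0 A by auto
    have "p \<otimes> (a \<ominus> a0) \<ominus> p \<otimes> (b \<ominus> a0) \<in> vball R v 1"
      using that(3) c p unfolding f_def by (subst (asm) residue_class_eq_iff[OF v]) auto
    moreover have "p \<otimes> (a \<ominus> a0) \<ominus> p \<otimes> (b \<ominus> a0) = p \<otimes> (a \<ominus> b)" using c p by algebra
    ultimately have "p \<otimes> (a \<ominus> b) \<in> vball R v 1" by simp
    then have "inv p \<otimes> (p \<otimes> (a \<ominus> b)) \<in> vball R v (m + 1)"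
      using vball_mult[OF v vballI[of "inv p" m]] p place_inv[OF v p(1,2)] by simp
    moreover have "inv p \<otimes> (p \<otimes> (a \<ominus> b)) = a \<ominus> b"
      using c p by (simp add: m_assoc[symmetric])
    ultimately show ?thesis by simp
  qed
  then show ?thesis using y by (intro exI[of _ "{a \<in> A. f a = y}"]) auto
qed

lemma riemann_roch_space_minus:
  "f \<in> riemann_roch_space R A \<Longrightarrow> g \<in> riemann_roch_space R A \<Longrightarrow> f \<ominus> g \<in> riemann_roch_space R A"
  by (auto simp: riemann_roch_space_def intro: vball_minus)

lemma riemann_roch_space_mult:
  assumes "f \<in> riemann_roch_space R A" "g \<in> riemann_roch_space R B"
  shows "f \<otimes> g \<in> riemann_roch_space R (\<lambda>v. A v + B v)"
proof -
  have "f \<otimes> g \<in> vball R v (- (A v + B v))" if "v \<in> places R" for v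
    using vball_mult[OF that, of f "- A v" g "- B v"] assms that
    by (simp add: riemann_roch_space_def)
  then show ?thesis using assms by (auto simp: riemann_roch_space_def)
qed

lemma riemann_roch_space_add:
  "f \<in> riemann_roch_space R A \<Longrightarrow> g \<in> riemann_roch_space R A \<Longrightarrow> f \<oplus> g \<in> riemann_roch_space R A"
  by (auto simp: riemann_roch_space_def intro: vball_add)

lemma riemann_roch_space_mono:
  assumes "\<And>v. v \<in> places R \<Longrightarrow> A v \<le> B v"
  shows "riemann_roch_space R A \<subseteq> riemann_roch_space R B"
proof -
  have "vball R v (- A v) \<subseteq> vball R v (- B v)" if "v \<in> places R" for v
    using assms[OF that] by (intro vball_mono) simp
  then show ?thesis by (auto simp: riemann_roch_space_def)
qed

text \<open>Counting counterpart of dim L(B) / L(B - D) \<le> deg D: tightening the condition at one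
  place loses at most the factor given by the norm of that place, and \<open>D\<close> is exhausted
  place by place.\<close>

lemma pigeonhole_divisor:
  assumes fin: "\<And>v. v \<in> places R \<Longrightarrow> finite ((\<lambda>a. valuation_ideal R v +> a) ` valuation_ring R v)"
    and "finite A" "A \<subseteq> carrier R"
      "\<And>a b. a \<in> A \<Longrightarrow> b \<in> A \<Longrightarrow> a \<ominus> b \<in> riemann_roch_space R B"
    and "set_mset D \<subseteq> places R" "divisor_norm R D * r < card A"
  shows "\<exists>A'\<subseteq>A. r < card A' \<and>
    (\<forall>a\<in>A'. \<forall>b\<in>A'. a \<ominus> b \<in> riemann_roch_space R (\<lambda>v. B v - int (count D v)))"
  using assms(2-)
proof (induction D arbitrary: A r)
  case empty
  then show ?case by (intro exI[of _ A]) auto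
next
  case (add v D)
  have v: "v \<in> places R" using add by auto
  obtain A1 where A1: "A1 \<subseteq> A" "place_norm R v * r < card A1"
    "\<And>a b. a \<in> A1 \<Longrightarrow> b \<in> A1 \<Longrightarrow> a \<ominus> b \<in> riemann_roch_space R (\<lambda>v. B v - int (count D v))"
  proof -
    have "divisor_norm R D * (place_norm R v * r) < card A" using add.prems(5) by (simp add: ac_simps)
    moreover have "set_mset D \<subseteq> places R" using add.prems(4) by simp
    ultimately have "\<exists>A'\<subseteq>A. place_norm R v * r < card A' \<and>
      (\<forall>a\<in>A'. \<forall>b\<in>A'. a \<ominus> b \<in> riemann_roch_space R (\<lambda>v. B v - int (count D v)))"
      by (intro add.IH add.prems(1-3))
    then show ?thesis using that by auto
  qed
  have "a \<ominus> b \<in> vball R v (int (count D v) - B v)" if "a \<in> A1" "b \<in> A1" for a b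
    using A1(3)[OF that] v by (simp add: riemann_roch_space_def)
  moreover have "finite A1" "A1 \<subseteq> carrier R" using A1(1) add.prems(1,2) finite_subset by auto
  ultimately have "\<exists>A'\<subseteq>A1. r < card A' \<and>
      (\<forall>a\<in>A'. \<forall>b\<in>A'. a \<ominus> b \<in> vball R v (int (count D v) - B v + 1))"
    using A1(2) by (intro residue_classes_subset_large_fibre[OF v fin[OF v]])
  then obtain A2 where A2: "A2 \<subseteq> A1" "r < card A2"
      "\<And>a b. a \<in> A2 \<Longrightarrow> b \<in> A2 \<Longrightarrow> a \<ominus> b \<in> vball R v (int (count D v) - B v + 1)"
    by auto
  have "a \<ominus> b \<in> riemann_roch_space R (\<lambda>w. B w - int (count (add_mset v D) w))"
    if ab: "a \<in> A2" "b \<in> A2" for a b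
  proof -
    have rr: "a \<ominus> b \<in> riemann_roch_space R (\<lambda>v. B v - int (count D v))" using A1(3) A2(1) ab by blast
    then have "a \<ominus> b \<in> vball R w (- (B w - int (count (add_mset v D) w)))" if "w \<in> places R" for w
      using that A2(3)[OF ab] by (cases "w = v") (auto simp: riemann_roch_space_def algebra_simps)
    then show ?thesis using rr by (simp add: riemann_roch_space_def)
  qed
  then show ?case using A2 A1(1) by (intro exI[of _ A2]) auto
qed

lemma residue_representatives:
  assumes v: "v \<in> places R" and fin: "finite ((\<lambda>a. valuation_ideal R v +> a) ` valuation_ring R v)"
  obtains Y where "finite Y" "card Y = place_norm R v" "Y \<subseteq> vball R v 0"
    "\<And>y y'. y \<in> Y \<Longrightarrow> y' \<in> Y \<Longrightarrow> y \<ominus> y' \<in> vball R v 1 \<Longrightarrow> y = y'"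
    "\<And>a. a \<in> vball R v 0 \<Longrightarrow> \<exists>y\<in>Y. a \<ominus> y \<in> vball R v 1"
proof -
  let ?c = "\<lambda>a. valuation_ideal R v +> a"
  obtain Y where Y: "Y \<subseteq> vball R v 0" "inj_on ?c Y" "?c ` vball R v 0 = ?c ` Y"
    using subset_image_inj[of "?c ` vball R v 0" ?c "vball R v 0"] by auto
  have eq: "?c a = ?c b \<longleftrightarrow> a \<ominus> b \<in> vball R v 1" if "a \<in> vball R v 0" "b \<in> vball R v 0" for a b
    using residue_class_eq_iff[OF v] that vball_carrier by blast
  show ?thesis
  proof
    show "finite Y" using fin Y finite_imageD by (metis valuation_ring_eq_vball)
    show "card Y = place_norm R v"
      using Y card_image[OF Y(2)] by (simp add: place_norm_def valuation_ring_eq_vball)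
    show "y = y'" if "y \<in> Y" "y' \<in> Y" "y \<ominus> y' \<in> vball R v 1" for y y'
      using that Y eq[of y y'] by (auto dest: inj_onD)
    show "\<exists>y\<in>Y. a \<ominus> y \<in> vball R v 1" if a: "a \<in> vball R v 0" for a
    proof -
      obtain y where "y \<in> Y" "?c a = ?c y" using Y(3) a by blast
      then show ?thesis using eq[OF a] Y(1) by blast
    qed
  qed (rule Y)
qed

lemma place_norm_ge_2:
  assumes v: "v \<in> places R" and fin: "finite ((\<lambda>a. valuation_ideal R v +> a) ` valuation_ring R v)"
  shows "place_norm R v \<ge> 2"
proof -
  let ?c = "\<lambda>a. valuation_ideal R v +> a"
  have "{?c \<zero>, ?c \<one>} \<subseteq> ?c ` valuation_ring R v" using v by (auto simp: valuation_ring_eq_vball)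
  moreover have "?c \<one> \<noteq> ?c \<zero>"
    using residue_class_eq_iff[OF v, of \<one> \<zero>] v by (simp add: vball_def place_one minus_eq_zero_iff a_minus_def)
  then have "card {?c \<zero>, ?c \<one>} = 2" by auto
  ultimately show ?thesis using card_mono[OF fin] unfolding place_norm_def by metis
qed

text \<open>The lower-bound half of the Chinese remainder theorem. Adding a place \<open>v\<close>
  to \<open>D\<close> refines each class: \<open>w\<close> is replaced by the sums
  \<open>w + z y\<close>, where \<open>z y\<close> is negligible modulo \<open>D\<close> and
  realizes the residue \<open>y\<close> in the next layer at \<open>v\<close>.\<close>

lemma divisor_representatives:
  assumes fin: "\<And>v. v \<in> places R \<Longrightarrow> finite ((\<lambda>a. valuation_ideal R v +> a) ` valuation_ring R v)"
    and T: "finite T" "T \<subseteq> places R" and D: "set_mset D \<subseteq> T"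
  shows "\<exists>W. finite W \<and> card W = divisor_norm R D \<and> W \<subseteq> carrier R \<and> (\<forall>w\<in>W. \<forall>v\<in>T. w \<in> vball R v 0) \<and>
    (\<forall>w\<in>W. \<forall>w'\<in>W. (\<forall>v\<in>T. w \<ominus> w' \<in> vball R v (int (count D v))) \<longrightarrow> w = w')"
  using D
proof (induction D)
  case empty
  show ?case by (rule exI[of _ "{\<zero>}"]) auto
next
  case (add v D)
  let ?e = "\<lambda>v. int (count D v)"
  obtain W where W: "finite W" "card W = divisor_norm R D" "W \<subseteq> carrier R"
    "\<And>w v. w \<in> W \<Longrightarrow> v \<in> T \<Longrightarrow> w \<in> vball R v 0"
    "\<And>w w'. w \<in> W \<Longrightarrow> w' \<in> W \<Longrightarrow> (\<And>v. v \<in> T \<Longrightarrow> w \<ominus> w' \<in> vball R v (?e v)) \<Longrightarrow> w = w'"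
    using add by auto
  have v: "v \<in> T" "v \<in> places R" using add T by auto
  obtain Y where Y: "finite Y" "card Y = place_norm R v" "Y \<subseteq> vball R v 0"
    "\<And>y y'. y \<in> Y \<Longrightarrow> y' \<in> Y \<Longrightarrow> y \<ominus> y' \<in> vball R v 1 \<Longrightarrow> y = y'"
    using residue_representatives[OF v(2) fin[OF v(2)]] by metis
  obtain p where p: "p \<in> carrier R" "p \<noteq> \<zero>" "v p = ?e v" using place_surj[OF v(2)] by blast
  \<comment> \<open>One precision for all of \<open>T\<close>: the size of \<open>D\<close> bounds
    every multiplicity, and one more digit is needed to see the new layer at
    \<open>v\<close>.\<close>
  define N where "N = int (size D) + 1"
  have N: "?e w + 1 \<le> N" for w by (simp add: N_def count_le_size)
  have "\<exists>z\<in>carrier R. \<forall>w\<in>T. z \<ominus> (if w = v then p \<otimes> y else \<zero>) \<in> vball R w N" if "y \<in> Y" for y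
    using that Y p by (intro weak_approximation[OF T]) (auto dest: vball_carrier)
  then obtain z where z: "\<And>y. y \<in> Y \<Longrightarrow> z y \<in> carrier R"
    "\<And>y w. y \<in> Y \<Longrightarrow> w \<in> T \<Longrightarrow> z y \<ominus> (if w = v then p \<otimes> y else \<zero>) \<in> vball R w N" by metis
  have z1: "z y \<in> vball R w (?e w + 1)" if "y \<in> Y" "w \<in> T" "w \<noteq> v" for y w
  proof -
    have "z y \<in> vball R w N" using z[OF that(1)] that by (force simp: a_minus_def)
    then show ?thesis using N by (rule vball_le)
  qed
  have z2: "z y \<ominus> p \<otimes> y \<in> vball R v (?e v + 1)" if "y \<in> Y" for y
    using z(2)[OF that v(1)] vball_le[OF _ N] by simp
  have z3: "z y \<in> vball R w (?e w)" if y: "y \<in> Y" and w: "w \<in> T" for y w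
  proof (cases "w = v")
    case True
    have "p \<otimes> y \<in> vball R v (?e v + 0)"
      using Y(3) y vballI[OF p(1)] p(3) by (intro vball_mult[OF v(2)]) auto
    moreover have "z y \<ominus> p \<otimes> y \<in> vball R v (?e v)"
      using z2[OF y] by (rule vball_le) simp
    ultimately show ?thesis using vball_minus_cancel[OF v(2)] z(1)[OF y] True by simp
  next
    case False
    show ?thesis using z1[OF y w False] by (rule vball_le) simp
  qed
  let ?f = "\<lambda>(w, y). w \<oplus> z y"
  \<comment> \<open>Modulo the old \<open>D\<close> the terms \<open>z y\<close> vanish, which gives
    \<open>w = w'\<close>. What remains at \<open>v\<close> is
    \<open>p \<otimes> (y \<ominus> y')\<close> with \<open>p\<close> of order exactly
    \<open>count D v\<close>, so one extra order of vanishing falls on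
    \<open>y \<ominus> y'\<close>.\<close>
  have key: "w = w' \<and> y = y'" if w: "w \<in> W" "w' \<in> W" and y: "y \<in> Y" "y' \<in> Y"
    and cong: "\<And>u. u \<in> T \<Longrightarrow> (w \<oplus> z y) \<ominus> (w' \<oplus> z y') \<in> vball R u (int (count (add_mset v D) u))" for w w' y y'
  proof -
    have c: "w \<in> carrier R" "w' \<in> carrier R" "z y \<in> carrier R" "z y' \<in> carrier R" "y \<in> carrier R" "y' \<in> carrier R"
      using w y W z Y vball_carrier by blast+
    have "w \<ominus> w' \<in> vball R u (?e u)" if u: "u \<in> T" for u
    proof -
      have up: "u \<in> places R" using u T by auto
      have "(w \<oplus> z y) \<ominus> (w' \<oplus> z y') \<in> vball R u (?e u)"
        using cong[OF u] by (rule vball_le) simp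
      moreover have "w \<ominus> w' = ((w \<oplus> z y) \<ominus> (w' \<oplus> z y')) \<ominus> (z y \<ominus> z y')" using c by algebra
      ultimately show ?thesis using vball_minus[OF up _ vball_minus[OF up z3[OF y(1) u] z3[OF y(2) u]]] by simp
    qed
    then have ww: "w = w'" using W(5) w by blast
    have "p \<otimes> (y \<ominus> y') = ((w \<oplus> z y) \<ominus> (w \<oplus> z y')) \<ominus> ((z y \<ominus> p \<otimes> y) \<ominus> (z y' \<ominus> p \<otimes> y'))"
      using c p by algebra
    moreover have "(w \<oplus> z y) \<ominus> (w \<oplus> z y') \<in> vball R v (?e v + 1)"
      using cong[OF v(1)] ww by (simp add: add.commute)
    ultimately have "p \<otimes> (y \<ominus> y') \<in> vball R v (?e v + 1)"
      using vball_minus[OF v(2) _ vball_minus[OF v(2) z2[OF y(1)] z2[OF y(2)]]] by simp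
    then have "y \<ominus> y' \<in> vball R v 1" using p c
      by (auto simp: vball_def place_mult[OF v(2)] integral_iff)
    then show ?thesis using ww Y(4) y by blast
  qed
  have "inj_on ?f (W \<times> Y)"
  proof (rule inj_onI, clarify)
    fix w y w' y' assume *: "w \<in> W" "y \<in> Y" "w' \<in> W" "y' \<in> Y" "w \<oplus> z y = w' \<oplus> z y'"
    have "w' \<oplus> z y' \<in> carrier R" using * W z by auto
    then have "(w \<oplus> z y) \<ominus> (w' \<oplus> z y') = \<zero>" using *(5) by (simp add: minus_eq_zero_iff)
    then show "w = w' \<and> y = y'" using key * by simp
  qed
  then have "card (?f ` (W \<times> Y)) = divisor_norm R (add_mset v D)"
    using W Y by (simp add: card_image card_cartesian_product mult.commute)
  moreover have "?f ` (W \<times> Y) \<subseteq> carrier R" using W z by auto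
  moreover have "w \<oplus> z y \<in> vball R u 0" if "w \<in> W" "y \<in> Y" "u \<in> T" for w y u
  proof -
    have "u \<in> places R" using T that by auto
    moreover have "z y \<in> vball R u 0" using z3[OF that(2,3)] by (rule vball_le) simp
    ultimately show ?thesis using vball_add W(4)[OF that(1,3)] by blast
  qed
  moreover have "a = b" if ab: "a \<in> ?f ` (W \<times> Y)" "b \<in> ?f ` (W \<times> Y)"
      "\<forall>u\<in>T. a \<ominus> b \<in> vball R u (int (count (add_mset v D) u))" for a b
  proof -
    obtain w y w' y' where "a = w \<oplus> z y" "b = w' \<oplus> z y'" "w \<in> W" "w' \<in> W" "y \<in> Y" "y' \<in> Y"
      using ab(1,2) by auto
    then show ?thesis using key[of w w' y y'] ab(3) by metis
  qed
  moreover have "finite (?f ` (W \<times> Y))" using W(1) Y(1) by simp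
  ultimately show ?case by (intro exI[of _ "?f ` (W \<times> Y)"] conjI ballI impI) auto
qed

end

section \<open>Existence of places\<close>

context field
begin

context
  fixes I z assumes I: "I \<subseteq> carrier R" "\<zero> \<in> I" "\<And>a b. a \<in> I \<Longrightarrow> b \<in> I \<Longrightarrow> a \<oplus> b \<in> I"
    and z: "z \<in> carrier R"
begin

lemma expansions_carrier: "expansions R I z n \<subseteq> carrier R"
  using I z by (induction n) auto

lemma expansions_zero: "\<zero> \<in> expansions R I z n"
proof (induction n)
  case (Suc n)
  have "\<zero> = \<zero> \<oplus> z \<otimes> \<zero>" using z by simp
  then show ?case using Suc I(2) by simp blast
qed (simp add: I)

lemma expansions_add: "a \<in> expansions R I z n \<Longrightarrow> b \<in> expansions R I z n \<Longrightarrow> a \<oplus> b \<in> expansions R I z n"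
proof (induction n arbitrary: a b)
  case (Suc n)
  obtain w m w' m' where *: "a = w \<oplus> z \<otimes> m" "b = w' \<oplus> z \<otimes> m'" "w \<in> I" "w' \<in> I"
      "m \<in> expansions R I z n" "m' \<in> expansions R I z n"
    using Suc.prems by auto
  have "w \<in> carrier R" "w' \<in> carrier R" "m \<in> carrier R" "m' \<in> carrier R"
    using * I expansions_carrier by blast+
  then have "a \<oplus> b = (w \<oplus> w') \<oplus> z \<otimes> (m \<oplus> m')" using *(1,2) z by algebra
  then show ?case using I(3)[OF *(3,4)] Suc.IH[OF *(5,6)] by auto
qed (simp add: I)

lemma expansions_mult_var: "m \<in> expansions R I z n \<Longrightarrow> z \<otimes> m \<in> expansions R I z (Suc n)"
proof -
  assume m: "m \<in> expansions R I z n"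
  then have "z \<otimes> m = \<zero> \<oplus> z \<otimes> m" using expansions_carrier z by (simp add: subset_iff)
  then show ?thesis using m I(2) by auto
qed

lemma expansions_mono: "m \<le> n \<Longrightarrow> expansions R I z m \<subseteq> expansions R I z n"
proof (rule lift_Suc_mono_le[of "expansions R I z"])
  show "expansions R I z n \<subseteq> expansions R I z (Suc n)" for n
  proof (induction n)
    case 0
    have "w = w \<oplus> z \<otimes> \<zero>" if "w \<in> I" for w using that I z by (simp add: subset_iff)
    then show ?case using I(2) by auto
  qed auto
qed

lemma expansions_digit: "I \<subseteq> expansions R I z n"
  using expansions_mono[of 0 n] by simp

lemma expansions_pow: "a \<in> I \<Longrightarrow> z [^] n \<otimes> a \<in> expansions R I z n"
proof (induction n)
  case (Suc n)
  have "a \<in> carrier R" using Suc I by auto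
  then have "z [^] Suc n \<otimes> a = z \<otimes> (z [^] n \<otimes> a)" using z by (simp add: m_ac)
  then show ?case using expansions_mult_var[OF Suc.IH[OF Suc.prems]] by simp
qed (use I in \<open>auto simp: subset_iff\<close>)

lemma expansions_smult:
  assumes "b \<in> carrier R" "\<And>a. a \<in> I \<Longrightarrow> b \<otimes> a \<in> I"
  shows "p \<in> expansions R I z n \<Longrightarrow> b \<otimes> p \<in> expansions R I z n"
proof (induction n arbitrary: p)
  case (Suc n)
  then obtain w m where *: "p = w \<oplus> z \<otimes> m" "w \<in> I" "m \<in> expansions R I z n" by auto
  have "w \<in> carrier R" "m \<in> carrier R" using * I expansions_carrier by blast+
  then have "b \<otimes> p = b \<otimes> w \<oplus> z \<otimes> (b \<otimes> m)" using *(1) z assms(1) by algebra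
  then show ?case using assms(2)[OF *(2)] Suc.IH[OF *(3)] by auto
qed (use assms in simp)

text \<open>The recursion exposes the lowest digit; reducing degrees needs the leading one.\<close>

lemma expansions_top:
  "p \<in> expansions R I z (Suc n) \<Longrightarrow> \<exists>q\<in>expansions R I z n. \<exists>a\<in>I. p = q \<oplus> z [^] Suc n \<otimes> a"
proof (induction n arbitrary: p)
  case 0
  then show ?case using z by auto
next
  case (Suc n)
  then obtain w m where *: "p = w \<oplus> z \<otimes> m" "w \<in> I" "m \<in> expansions R I z (Suc n)" by auto
  obtain q a where q: "q \<in> expansions R I z n" "a \<in> I" "m = q \<oplus> z [^] Suc n \<otimes> a"
    using Suc.IH[OF *(3)] by auto
  have c: "w \<in> carrier R" "q \<in> carrier R" "a \<in> carrier R" "z [^] Suc n \<in> carrier R"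
    using *(2) q(1,2) I(1) expansions_carrier[of n] z by blast+
  have "p = (w \<oplus> z \<otimes> q) \<oplus> z [^] Suc (Suc n) \<otimes> a"
    unfolding *(1) q(3) nat_pow_Suc[of _ "Suc n"] using c z by algebra
  moreover have "w \<oplus> z \<otimes> q \<in> expansions R I z (Suc n)" using *(2) q(1) by auto
  ultimately show ?case using q(2) by blast
qed

end

text \<open>The passage to the reciprocal polynomial: \<open>z^n\<close> times a polynomial of
  degree at most \<open>n\<close> in \<open>1/z\<close> is a polynomial of degree at most
  \<open>n\<close> in \<open>z\<close>.\<close>

lemma expansions_reverse:
  assumes I: "I \<subseteq> carrier R" "\<zero> \<in> I" "\<And>a b. a \<in> I \<Longrightarrow> b \<in> I \<Longrightarrow> a \<oplus> b \<in> I"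
    and z: "z \<in> carrier R" "z \<noteq> \<zero>"
  shows "p \<in> expansions R I (inv z) n \<Longrightarrow> z [^] n \<otimes> p \<in> expansions R I z n"
proof (induction n arbitrary: p)
  case 0
  then show ?case using I by (auto simp: subset_iff)
next
  case (Suc n)
  then obtain w m where *: "p = w \<oplus> inv z \<otimes> m" "w \<in> I" "m \<in> expansions R I (inv z) n" by auto
  have c: "w \<in> carrier R" "m \<in> carrier R"
    using *(2,3) I(1) expansions_carrier[OF I inv_nonzero(1)[OF z]] by blast+
  have "z [^] Suc n \<otimes> (inv z \<otimes> m) = z [^] n \<otimes> m"
  proof -
    have "z [^] Suc n \<otimes> (inv z \<otimes> m) = z [^] n \<otimes> ((z \<otimes> inv z) \<otimes> m)"
      using c z inv_nonzero(1)[OF z] by (simp add: m_ac del: inv_nonzero)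
    then show ?thesis using c z by simp
  qed
  then have "z [^] Suc n \<otimes> p = z [^] Suc n \<otimes> w \<oplus> z [^] n \<otimes> m"
    using *(1) c z by (simp add: r_distr del: nat_pow_Suc)
  moreover have "z [^] n \<otimes> m \<in> expansions R I z (Suc n)"
    using Suc.IH[OF *(3)] expansions_mono[OF I z(1), of n "Suc n"] by auto
  ultimately show ?case
    using expansions_add[OF I z(1) expansions_pow[OF I z(1) *(2)]] by metis
qed

lemma simple_extension_eq_expansions:
  assumes B: "subring B R" and z: "z \<in> carrier R"
  shows "simple_extension B z = (\<Union>n. expansions R B z n)"
proof
  note B' = subringE(1,2,7)[OF B]
  show "simple_extension B z \<subseteq> (\<Union>n. expansions R B z n)"
  proof
    fix a assume "a \<in> simple_extension B z"
    then show "a \<in> (\<Union>n. expansions R B z n)"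
    proof (induction rule: simple_extension.induct)
      case zero then show ?case using expansions_zero[OF B' z] by auto
    next
      case (lin k1 k2)
      then obtain n where n: "k1 \<in> expansions R B z n" by auto
      have "k1 \<in> carrier R" "k2 \<in> carrier R" using n expansions_carrier[OF B' z] lin B' by auto
      then have "k1 \<otimes> z \<oplus> k2 = k2 \<oplus> z \<otimes> k1" using z by algebra
      then have "k1 \<otimes> z \<oplus> k2 \<in> expansions R B z (Suc n)" using n lin by auto
      then show ?case by blast
    qed
  qed
  have "expansions R B z n \<subseteq> simple_extension B z" for n
  proof (induction n)
    case 0 then show ?case using simple_extension_incl[OF B'(1) z] by simp
  next
    case (Suc n)
    have "w \<oplus> z \<otimes> m \<in> simple_extension B z" if "w \<in> B" "m \<in> expansions R B z n" for w m
    proof -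
      have "w \<in> carrier R" "m \<in> carrier R" using that expansions_carrier[OF B' z] B' by auto
      then have "w \<oplus> z \<otimes> m = m \<otimes> z \<oplus> w" using z by algebra
      then show ?thesis using simple_extension.lin[of m B z w] that Suc by auto
    qed
    then show ?case by auto
  qed
  then show "(\<Union>n. expansions R B z n) \<subseteq> simple_extension B z" by blast
qed

text \<open>A subring maximal among those not containing \<open>t\<^sup>-\<^sup>1\<close> is a valuation ring.\<close>

theorem exists_valuation_ring:
  assumes B0: "subring B0 R" and t: "t \<in> B0" "t \<noteq> \<zero>" and not: "inv t \<notin> B0"
  shows "\<exists>B. subring B R \<and> B0 \<subseteq> B \<and> inv t \<notin> B \<and> (\<forall>z\<in>carrier R - {\<zero>}. z \<in> B \<or> inv z \<in> B)"
proof -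
  let ?A = "{B. subring B R \<and> B0 \<subseteq> B \<and> inv t \<notin> B}"
  have "\<exists>M\<in>?A. (\<forall>N\<in>?A. M \<subseteq> N \<longrightarrow> N = M)"
  proof (rule subset_Zorn_nonempty)
    show "?A \<noteq> {}" using B0 not by auto
  next
    fix C assume C: "C \<noteq> {}" "subset.chain ?A C"
    have CA: "C \<subseteq> ?A" using C(2) by (simp add: subset.chain_def)
    have lin: "S \<subseteq> Y \<or> Y \<subseteq> S" if "S \<in> C" "Y \<in> C" for S Y using C(2) that by (auto simp: subset.chain_def)
    have sr: "subring S R" if "S \<in> C" for S using CA that by auto
    have "subring (\<Union>C) R"
    proof (rule subringI)
      show "\<Union>C \<subseteq> carrier R" using subringE(1)[OF sr] by blast
      show "\<one> \<in> \<Union>C" using subringE(3)[OF sr] C(1) by blast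
      show "\<ominus> h \<in> \<Union>C" if "h \<in> \<Union>C" for h
        using that by (auto intro: subringE(5)[OF sr])
      fix h1 h2 assume h: "h1 \<in> \<Union>C" "h2 \<in> \<Union>C"
      then obtain S where "S \<in> C" "h1 \<in> S" "h2 \<in> S" using lin by blast
      then show "h1 \<otimes> h2 \<in> \<Union>C" "h1 \<oplus> h2 \<in> \<Union>C"
        by (auto intro: subringE(6,7)[OF sr])
    qed
    then show "\<Union>C \<in> ?A" using C(1) CA by auto
  qed
  then obtain B where B: "subring B R" "B0 \<subseteq> B" "inv t \<notin> B"
    and max: "\<And>S. subring S R \<Longrightarrow> B \<subseteq> S \<Longrightarrow> inv t \<notin> S \<Longrightarrow> S = B" by auto
  note B' = subringE(1,2,7)[OF B(1)]
  have tB: "t \<in> B" "t \<in> carrier R" using t B B' by auto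
  \<comment> \<open>By maximality of \<open>B\<close>, the proper overring \<open>B[z]\<close> must
    contain the forbidden inverse of \<open>t\<close>.\<close>
  have ext: "\<exists>n. inv t \<in> expansions R B z n" if z: "z \<in> carrier R" "z \<notin> B" for z
  proof (rule ccontr)
    assume "\<not> ?thesis"
    then have "inv t \<notin> simple_extension B z" using simple_extension_eq_expansions[OF B(1) z(1)] by auto
    then have "simple_extension B z = B"
      using max simple_extension_is_subring[OF B(1) z(1)] simple_extension_incl[OF B'(1) z(1)] by blast
    then show False using simple_extension_mem[OF B(1) z(1)] z by simp
  qed
  \<comment> \<open>\<open>t\<close> lies in the Jacobson radical of \<open>B\<close>. Otherwise the
    inverse of \<open>t\<close> is a polynomial in \<open>inv ?d\<close>, and clearing the
    denominator puts \<open>?d [^] n \<otimes> inv t\<close> into \<open>B\<close>.\<close>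
  have unit: "inv (\<one> \<ominus> t \<otimes> c) \<in> B \<and> \<one> \<ominus> t \<otimes> c \<noteq> \<zero>" if c: "c \<in> B" for c
  proof -
    let ?d = "\<one> \<ominus> t \<otimes> c"
    have cc: "c \<in> carrier R" using c B' by auto
    have dB: "?d \<in> B" using c tB subringE[OF B(1)] by (simp add: a_minus_def)
    have notin: False if "b \<in> B" "t \<otimes> b = \<one>" for b
    proof -
      have bc: "b \<in> carrier R" using that B' by auto
      have "inv t \<otimes> (t \<otimes> b) = b" using bc tB t by (simp add: m_assoc[symmetric])
      then show False using that B(3) tB t by simp
    qed
    have nz: "?d \<noteq> \<zero>" using notin[OF c] minus_eq_zero_iff[of \<one> "t \<otimes> c"] tB cc by auto
    have "inv ?d \<in> B"
    proof (rule ccontr)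
      assume "inv ?d \<notin> B"
      moreover have dc: "?d \<in> carrier R" using tB cc by simp
      ultimately obtain n where "inv t \<in> expansions R B (inv ?d) n" using ext[of "inv ?d"] nz by auto
      then have "?d [^] n \<otimes> inv t \<in> expansions R B ?d n" using expansions_reverse[OF B' dc nz] by blast
      moreover have "expansions R B ?d n \<subseteq> B"
        using subringE(6,7)[OF B(1)] dB by (induction n) auto
      ultimately have b: "?d [^] n \<otimes> inv t \<in> B" by blast
      \<comment> \<open>Powers of \<open>?d\<close> stay congruent to 1 modulo \<open>t B\<close>,
        so adding \<open>e\<close> to \<open>?d [^] n \<otimes> inv t\<close> yields the inverse of
        \<open>t\<close> itself inside \<open>B\<close>.\<close>
      have "\<exists>e\<in>B. ?d [^] n = \<one> \<ominus> t \<otimes> e"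
      proof (induction n)
        case 0
        show ?case using B'(2) tB by (intro bexI[of _ \<zero>]) (auto simp: a_minus_def)
      next
        case (Suc n)
        then obtain e where e: "e \<in> B" "?d [^] n = \<one> \<ominus> t \<otimes> e" by auto
        have ec: "e \<in> carrier R" using e B' by auto
        have "?d [^] Suc n = \<one> \<ominus> t \<otimes> (c \<oplus> e \<otimes> ?d)"
          unfolding nat_pow_Suc e(2) using tB ec cc by algebra
        moreover have "c \<oplus> e \<otimes> ?d \<in> B" using c e dB subringE[OF B(1)] by auto
        ultimately show ?case by blast
      qed
      then obtain e where e: "e \<in> B" "?d [^] n = \<one> \<ominus> t \<otimes> e" by auto
      have ec: "e \<in> carrier R" using e B' by auto
      have "t \<otimes> (?d [^] n \<otimes> inv t \<oplus> e) = ?d [^] n \<otimes> (t \<otimes> inv t) \<oplus> t \<otimes> e"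
      proof -
        have "?d [^] n \<in> carrier R" "inv t \<in> carrier R" using dc tB t by simp_all
        then show ?thesis using ec tB(2) by algebra
      qed
      also have "\<dots> = (\<one> \<ominus> t \<otimes> e) \<oplus> t \<otimes> e" using tB t ec e(2) by simp
      also have "\<dots> = \<one>" using tB ec by algebra
      finally show False using notin[of "?d [^] n \<otimes> inv t \<oplus> e"] b e subringE(7)[OF B(1)] by blast
    qed
    then show ?thesis using nz by simp
  qed
  define I where "I = (\<lambda>b. t \<otimes> b) ` B"
  have I: "I \<subseteq> carrier R" "\<zero> \<in> I" "\<And>a b. a \<in> I \<Longrightarrow> b \<in> I \<Longrightarrow> a \<oplus> b \<in> I"
  proof -
    show "I \<subseteq> carrier R" using tB B' by (auto simp: I_def)
    show "\<zero> \<in> I" using tB B'(2) by (force simp: I_def)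
    show "a \<oplus> b \<in> I" if "a \<in> I" "b \<in> I" for a b
    proof -
      obtain a' b' where "a = t \<otimes> a'" "b = t \<otimes> b'" "a' \<in> B" "b' \<in> B" using \<open>a \<in> I\<close> \<open>b \<in> I\<close> by (auto simp: I_def)
      moreover then have "a \<oplus> b = t \<otimes> (a' \<oplus> b')" using tB B'(1) by (simp add: r_distr subset_iff)
      ultimately show ?thesis using B'(3) by (auto simp: I_def)
    qed
  qed
  have Imult: "b \<otimes> a \<in> I" if "b \<in> B" "a \<in> I" for a b
  proof -
    obtain a' where a: "a = t \<otimes> a'" "a' \<in> B" using \<open>a \<in> I\<close> by (auto simp: I_def)
    have "b \<in> carrier R" "a' \<in> carrier R" using that a B' by auto
    then have "b \<otimes> a = t \<otimes> (b \<otimes> a')" using a tB by (simp add: m_ac)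
    then show ?thesis using a that subringE(6)[OF B(1)] by (auto simp: I_def)
  qed
  have "\<one> \<notin> I"
  proof
    assume "\<one> \<in> I"
    then obtain b where b: "b \<in> B" "t \<otimes> b = \<one>" by (auto simp: I_def)
    have bc: "b \<in> carrier R" using b B' by auto
    have "inv t \<otimes> (t \<otimes> b) = b" using bc tB t by (simp add: m_assoc[symmetric])
    then show False using b B(3) tB t by simp
  qed
  then have base: "\<one> \<notin> expansions R I z 0" for z by simp
  \<comment> \<open>The relation in \<open>inv z\<close> has constant digit \<open>a\<close> with
    \<open>\<one> \<ominus> a\<close> a unit of \<open>B\<close>, so it solves for \<open>z\<close>
    as an expansion in \<open>inv z\<close>; reversed, it expresses \<open>z [^] Suc m\<close> by
    lower powers with digits in \<open>I\<close>. Since \<open>m \<le> n\<close>, this replaces the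
    leading term of the relation in \<open>z\<close>.\<close>
  have reduce: "\<one> \<in> expansions R I z n"
    if z: "z \<in> carrier R" "z \<noteq> \<zero>" and n: "\<one> \<in> expansions R I z (Suc n)"
      and m: "\<one> \<in> expansions R I (inv z) (Suc m)" and mn: "m \<le> n" for z n m
  proof -
    obtain a p where p: "\<one> = a \<oplus> inv z \<otimes> p" "a \<in> I" "p \<in> expansions R I (inv z) m" using m by auto
    obtain c where c: "a = t \<otimes> c" "c \<in> B" using p by (auto simp: I_def)
    let ?u = "inv (\<one> \<ominus> a)"
    have u: "?u \<in> B" "\<one> \<ominus> a \<noteq> \<zero>" using unit[OF c(2)] c(1) by auto
    have cc: "a \<in> carrier R" "p \<in> carrier R" "?u \<in> carrier R"
      using p(2,3) I(1) expansions_carrier[OF I, of "inv z"] z u B' by auto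
    have pz: "inv z \<otimes> p = \<one> \<ominus> a"
    proof -
      have "(a \<oplus> inv z \<otimes> p) \<ominus> a = inv z \<otimes> p" using cc inv_nonzero(1)[OF z] by algebra
      then show ?thesis using p(1) by simp
    qed
    have zup: "z = ?u \<otimes> p"
    proof -
      have "p = (z \<otimes> inv z) \<otimes> p" using z cc by simp
      also have "\<dots> = z \<otimes> (inv z \<otimes> p)" using m_assoc[OF z(1) inv_nonzero(1)[OF z] cc(2)] .
      also have "\<dots> = z \<otimes> (\<one> \<ominus> a)" unfolding pz ..
      finally have "?u \<otimes> p = z \<otimes> (?u \<otimes> (\<one> \<ominus> a))" using z cc by (simp add: m_ac)
      then show ?thesis using u cc z by simp
    qed
    have "?u \<otimes> p \<in> expansions R I (inv z) m"
      using expansions_smult[OF I _ cc(3) _ p(3)] Imult[OF u(1)] z by simp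
    then have "z [^] m \<otimes> z \<in> expansions R I z m" using expansions_reverse[OF I z] zup by metis
    moreover have step: "z [^] k \<otimes> y \<in> expansions R I z (m + k)" if "y \<in> expansions R I z m" for y and k :: nat
    proof (induction k)
      case 0 then show ?case using that expansions_carrier[OF I z(1)] by (auto simp: subset_iff)
    next
      case (Suc k)
      have "y \<in> carrier R" using that expansions_carrier[OF I z(1)] by auto
      then have "z [^] Suc k \<otimes> y = z \<otimes> (z [^] k \<otimes> y)" using z by (simp add: m_ac)
      then show ?case using expansions_mult_var[OF I z(1) Suc] by simp
    qed
    ultimately have "z [^] (n - m) \<otimes> (z [^] m \<otimes> z) \<in> expansions R I z (m + (n - m))" by blast
    moreover have "z [^] (n - m) \<otimes> (z [^] m \<otimes> z) = z [^] Suc n"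
      using z mn by (simp add: m_assoc[symmetric] nat_pow_mult)
    ultimately have zn: "z [^] Suc n \<in> expansions R I z n" using mn by simp
    obtain q a' where q: "q \<in> expansions R I z n" "a' \<in> I" "\<one> = q \<oplus> z [^] Suc n \<otimes> a'"
      using expansions_top[OF I z(1) n] by auto
    have a'B: "a' \<in> B" "a' \<in> carrier R" using q(2) tB subringE(6)[OF B(1)] B' by (auto simp: I_def)
    have "a' \<otimes> z [^] Suc n \<in> expansions R I z n"
      using expansions_smult[OF I z(1) a'B(2) _ zn] Imult[OF a'B(1)] by simp
    moreover have "a' \<otimes> z [^] Suc n = z [^] Suc n \<otimes> a'" using a'B z m_comm nat_pow_closed by blast
    ultimately show ?thesis using expansions_add[OF I z(1) q(1)] q(3) by simp
  qed
  \<comment> \<open>Descent on the sum of the two degrees: the longer of the two relations can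
    always be shortened, while degree 0 would mean \<open>\<one> \<in> I\<close>.\<close>
  have none: "\<not> (\<one> \<in> expansions R I z n \<and> \<one> \<in> expansions R I (inv z) m)"
    if z: "z \<in> carrier R" "z \<noteq> \<zero>" for z n m
    using z
  proof (induction "n + m" arbitrary: n m z rule: less_induct)
    case less
    show ?case
    proof
      assume *: "\<one> \<in> expansions R I z n \<and> \<one> \<in> expansions R I (inv z) m"
      then obtain n' m' where nm: "n = Suc n'" "m = Suc m'" using base by (metis not0_implies_Suc)
      have ii: "inv (inv z) = z" using less.prems field_Units by auto
      show False
      proof (cases "m' \<le> n'")
        case True
        then have "\<one> \<in> expansions R I z n'" using reduce less.prems * nm by blast
        moreover have "n' + m < n + m" using nm by simp
        ultimately show False using less.hyps[of n' m z] * less.prems by blast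
      next
        case False
        then have "\<one> \<in> expansions R I (inv z) m'"
          using reduce[of "inv z" m' n'] less.prems * False unfolding nm ii by (metis inv_nonzero(1,2) nle_le)
        moreover have "n + m' < n + m" using nm by simp
        ultimately show False using less.hyps[of n m' z] * less.prems by blast
      qed
    qed
  qed
  \<comment> \<open>Multiplying the expansion of \<open>inv t\<close> by \<open>t\<close> turns
    digits in \<open>B\<close> into digits in \<open>I = t B\<close>.\<close>
  have one_in: "\<exists>n. \<one> \<in> expansions R I z n" if z: "z \<in> carrier R" "z \<notin> B" for z
  proof -
    obtain n where n: "inv t \<in> expansions R B z n" using ext z by auto
    have "t \<otimes> p \<in> expansions R I z n" if "p \<in> expansions R B z n" for p n
      using that
    proof (induction n arbitrary: p)
      case (Suc n)
      then obtain w m where *: "p = w \<oplus> z \<otimes> m" "w \<in> B" "m \<in> expansions R B z n" by auto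
      have "w \<in> carrier R" "m \<in> carrier R" using * B' expansions_carrier[OF B' z(1)] by blast+
      then have "t \<otimes> p = t \<otimes> w \<oplus> z \<otimes> (t \<otimes> m)" using *(1) z tB(2) by algebra
      then show ?case using Suc.IH[OF *(3)] *(2) by (auto simp: I_def)
    qed (auto simp: I_def)
    from this[OF n] show ?thesis using tB t by auto
  qed
  have "z \<in> B \<or> inv z \<in> B" if z: "z \<in> carrier R" "z \<noteq> \<zero>" for z
    using none[OF z] one_in[of z] one_in[of "inv z"] z by auto
  then show ?thesis using B by blast
qed

end

lemma (in field) inverse_mult:
  assumes "a \<in> carrier R" "a \<noteq> \<zero>" "b \<in> carrier R" "b \<noteq> \<zero>"
  shows "inv (a \<otimes> b) = inv a \<otimes> inv b"
proof (rule comm_inv_char)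
  have "a \<otimes> b \<otimes> (inv a \<otimes> inv b) = (a \<otimes> inv a) \<otimes> (b \<otimes> inv b)"
    using assms inv_nonzero(1)[OF assms(1,2)] inv_nonzero(1)[OF assms(3,4)] by (simp add: m_ac del: inv_nonzero)
  then show "a \<otimes> b \<otimes> (inv a \<otimes> inv b) = \<one>" using assms by simp
qed (use assms in auto)

section \<open>From valuation rings to discrete valuations\<close>

context expansion_field
begin

context
  fixes B assumes B: "subring B R" and val: "\<And>z. z \<in> carrier R \<Longrightarrow> z \<noteq> \<zero> \<Longrightarrow> z \<in> B \<or> inv z \<in> B"
    and proper: "\<exists>t\<in>B. t \<noteq> \<zero> \<and> inv t \<notin> B"
begin

private lemma Bc: "b \<in> B \<Longrightarrow> b \<in> carrier R" using subringE(1)[OF B] by auto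
private lemma B_minus: "a \<in> B \<Longrightarrow> b \<in> B \<Longrightarrow> a \<ominus> b \<in> B"
  using subringE(5,7)[OF B] by (simp add: a_minus_def)
private lemma B_mult: "a \<in> B \<Longrightarrow> b \<in> B \<Longrightarrow> a \<otimes> b \<in> B" using subringE(6)[OF B] by auto
private lemma B_pow: "a \<in> B \<Longrightarrow> a [^] (n::nat) \<in> B"
  using B_mult subringE(3)[OF B] by (induction n) auto

private definition "incongruent t W \<longleftrightarrow> finite W \<and> W \<subseteq> B \<and>
  (\<forall>w\<in>W. \<forall>w'\<in>W. \<forall>a\<in>B. w \<ominus> w' = t \<otimes> a \<longrightarrow> w = w')"

text \<open>The index of \<open>t B\<close> in \<open>B\<close>. It drops when a nonunit factor is split off, so a nonunit of least
  index is a uniformizer.\<close>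

private definition "index t = (GREATEST n. \<exists>W. incongruent t W \<and> card W = n)"

private lemma incongruent_bound:
  assumes "t \<in> B" "t \<noteq> \<zero>" shows "\<exists>N. \<forall>W. incongruent t W \<longrightarrow> card W \<le> N"
proof -
  obtain N where N: "\<forall>B W. B \<subseteq> carrier R \<longrightarrow> (\<forall>a\<in>B. \<forall>b\<in>B. a \<ominus> b \<in> B) \<longrightarrow> (\<forall>a\<in>B. t \<otimes> a \<in> B) \<longrightarrow>
    finite W \<longrightarrow> W \<subseteq> B \<longrightarrow> (\<forall>w\<in>W. \<forall>w'\<in>W. \<forall>a\<in>B. w \<ominus> w' = t \<otimes> a \<longrightarrow> w = w') \<longrightarrow> card W \<le> N"
    using finite_incongruent_bound[of t] assms Bc by auto
  have "card W \<le> N" if "incongruent t W" for W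
    using N[rule_format, of B W] that subringE(1)[OF B] B_minus B_mult assms(1)
    unfolding incongruent_def by blast
  then show ?thesis by blast
qed

private lemma index_attained:
  assumes "t \<in> B" "t \<noteq> \<zero>" shows "\<exists>W. incongruent t W \<and> card W = index t"
proof -
  obtain N where N: "\<And>W. incongruent t W \<Longrightarrow> card W \<le> N" using incongruent_bound[OF assms] by auto
  have "\<exists>W. incongruent t W \<and> card W = 0" by (intro exI[of _ "{}"]) (simp add: incongruent_def)
  then show ?thesis unfolding index_def by (rule GreatestI_nat) (use N in auto)
qed

private lemma index_ge:
  assumes "t \<in> B" "t \<noteq> \<zero>" "incongruent t W" shows "card W \<le> index t"
proof -
  obtain N where N: "\<And>W. incongruent t W \<Longrightarrow> card W \<le> N" using incongruent_bound[OF assms(1,2)] by auto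
  show ?thesis unfolding index_def by (rule Greatest_le_nat[of _ _ N]) (use N assms in auto)
qed

text \<open>A maximal system modulo \<open>s\<close> can be enlarged by \<open>w0 \<oplus> s\<close>
  when the modulus becomes \<open>s \<otimes> z\<close>. The new element is congruent to
  \<open>w0\<close> modulo \<open>s\<close>, but not modulo \<open>s \<otimes> z\<close>, since
  \<open>s = s \<otimes> z \<otimes> a\<close> would make \<open>z\<close> a unit.\<close>

private lemma index_less:
  assumes s: "s \<in> B" "s \<noteq> \<zero>" and z: "z \<in> B" "z \<noteq> \<zero>" "inv z \<notin> B"
  shows "index s < index (s \<otimes> z)"
proof -
  have sz: "s \<otimes> z \<in> B" "s \<otimes> z \<noteq> \<zero>" using B_mult s z Bc by auto
  obtain W where W: "incongruent s W" "card W = index s" using index_attained[OF s] by auto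
  have "incongruent s {\<zero>}" using subringE(2)[OF B] by (simp add: incongruent_def)
  then have "card W \<noteq> 0" using W index_ge[OF s] by fastforce
  then obtain w0 where w0: "w0 \<in> W" by (metis card.empty equals0I)
  have w0c: "w0 \<in> B" "w0 \<in> carrier R" using w0 W Bc by (auto simp: incongruent_def)
  have sc: "s \<in> carrier R" "z \<in> carrier R" using s z Bc by auto
  have lift: "\<exists>b\<in>B. s \<otimes> z \<otimes> a = s \<otimes> b" if "a \<in> B" for a
    using that B_mult[OF z(1) that] Bc sc by (intro bexI[of _ "z \<otimes> a"]) (auto simp: m_assoc)
  have notdvd: False if a: "a \<in> B" "s = s \<otimes> z \<otimes> a" for a
  proof -
    have ac: "a \<in> carrier R" using a Bc by auto
    have "s \<otimes> \<one> = s \<otimes> (z \<otimes> a)" using a(2) sc ac by (simp add: m_assoc)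
    then have "\<one> = z \<otimes> a" using m_lcancel[of s \<one> "z \<otimes> a"] s sc ac by auto
    then have "inv z = a" using sc ac z(2) inv_nonzero[OF sc(2) z(2)] by (metis m_assoc m_comm r_one)
    then show False using a z by simp
  qed
  have new: "w \<ominus> w' = s \<otimes> z \<otimes> a \<Longrightarrow> w = w'"
    if ww: "w \<in> insert (w0 \<oplus> s) W" "w' \<in> insert (w0 \<oplus> s) W" "a \<in> B" for w w' a
  proof -
    assume eq: "w \<ominus> w' = s \<otimes> z \<otimes> a"
    have inc: "\<And>u u' b. u \<in> W \<Longrightarrow> u' \<in> W \<Longrightarrow> b \<in> B \<Longrightarrow> u \<ominus> u' = s \<otimes> b \<Longrightarrow> u = u'"
      using W(1) by (auto simp: incongruent_def)
    have ac: "a \<in> carrier R" using ww Bc by auto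
    have Wc: "\<And>u. u \<in> W \<Longrightarrow> u \<in> carrier R" using W(1) Bc by (auto simp: incongruent_def)
    have ca: "a \<ominus> b \<in> B \<and> \<ominus> b \<in> B" if "a \<in> B" "b \<in> B" for a b
      using B_minus[OF that] subringE(5)[OF B that(2)] by simp
    consider "w \<in> W" "w' \<in> W" | "w = w0 \<oplus> s" "w' \<in> W" "w' \<noteq> w0 \<oplus> s" | "w \<in> W" "w' = w0 \<oplus> s" "w \<noteq> w0 \<oplus> s" | "w = w'"
      using ww by auto
    then show "w = w'"
    proof cases
      case 1 then show ?thesis using inc lift[OF ww(3)] eq by metis
    next
      case 2
      have "w0 \<ominus> w' = (w0 \<oplus> s \<ominus> w') \<ominus> s" using w0c sc Wc[OF 2(2)] by algebra
      also have "\<dots> = s \<otimes> (z \<otimes> a \<ominus> \<one>)" using eq unfolding 2(1) using sc ac by algebra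
      finally have "w0 \<ominus> w' = s \<otimes> (z \<otimes> a \<ominus> \<one>)" .
      moreover have "z \<otimes> a \<ominus> \<one> \<in> B" using B_minus B_mult z ww subringE(3)[OF B] by auto
      ultimately have e: "w0 = w'" using inc w0 2 by blast
      have "s = (w0 \<oplus> s) \<ominus> w0" using w0c sc by algebra
      then have "s = s \<otimes> z \<otimes> a" using eq unfolding 2(1) e[symmetric] by simp
      then show ?thesis using notdvd ww by blast
    next
      case 3
      have "w \<ominus> w0 = (w \<ominus> (w0 \<oplus> s)) \<oplus> s" using w0c sc Wc[OF 3(1)] by algebra
      also have "\<dots> = s \<otimes> (z \<otimes> a \<oplus> \<one>)" using eq unfolding 3(2) using sc ac by algebra
      finally have "w \<ominus> w0 = s \<otimes> (z \<otimes> a \<oplus> \<one>)" .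
      moreover have "z \<otimes> a \<oplus> \<one> \<in> B" using subringE(7)[OF B] B_mult z ww subringE(3)[OF B] by auto
      ultimately have e: "w = w0" using inc w0 3 by blast
      have "s = \<ominus> (w0 \<ominus> (w0 \<oplus> s))" using w0c sc by algebra
      then have "s = s \<otimes> z \<otimes> (\<ominus> a)" using eq unfolding 3(2) e using sc ac by algebra
      then show ?thesis using notdvd subringE(5)[OF B] ww by blast
    qed
  qed
  have "w0 \<oplus> s \<notin> W"
  proof
    assume "w0 \<oplus> s \<in> W"
    moreover have "w0 \<oplus> s \<ominus> w0 = s \<otimes> \<one>" using w0c sc by algebra
    ultimately have "w0 \<oplus> s = w0" using W(1) w0 subringE(3)[OF B] unfolding incongruent_def by blast
    moreover have "w0 \<oplus> s \<ominus> w0 = s" using w0c sc by algebra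
    ultimately have "s = \<zero>" using w0c minus_eq_zero_iff[of w0 w0] by simp
    then show False using s by simp
  qed
  then have "card (insert (w0 \<oplus> s) W) = Suc (index s)" using W by (simp add: incongruent_def)
  moreover have "w0 \<oplus> s \<in> B" using subringE(7)[OF B] w0c s by blast
  then have "incongruent (s \<otimes> z) (insert (w0 \<oplus> s) W)"
    using W(1) new unfolding incongruent_def by blast
  ultimately show ?thesis using index_ge[OF sz] by fastforce
qed

private definition "unit u \<longleftrightarrow> u \<in> B \<and> u \<noteq> \<zero> \<and> inv u \<in> B"

private lemma unit_mult: "unit a \<Longrightarrow> unit b \<Longrightarrow> unit (a \<otimes> b)"
proof -
  assume a: "unit a" and b: "unit b"
  then have c: "a \<in> carrier R" "b \<in> carrier R" using Bc by (auto simp: unit_def)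
  then have "inv (a \<otimes> b) = inv a \<otimes> inv b" using inverse_mult a b by (simp add: unit_def)
  then show ?thesis using a b B_mult c by (simp add: unit_def)
qed

private lemma unit_inv: "unit a \<Longrightarrow> unit (inv a)"
  using Bc by (auto simp: unit_def field_Units)

text \<open>A nonunit \<open>p\<close> of least index divides every nonunit \<open>y\<close>: if
  \<open>y / p\<close> were outside \<open>B\<close>, then \<open>p / y\<close> would be a nonunit
  of \<open>B\<close>, and \<open>p = y * (p / y)\<close> would have larger index than
  \<open>y\<close>.\<close>

private lemma uniformizer:
  "\<exists>p. p \<in> B \<and> p \<noteq> \<zero> \<and> inv p \<notin> B \<and> (\<forall>y\<in>B. y \<noteq> \<zero> \<longrightarrow> inv y \<notin> B \<longrightarrow> (\<exists>b\<in>B. b \<noteq> \<zero> \<and> y = p \<otimes> b))"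
proof -
  let ?P = "\<lambda>p. p \<in> B \<and> p \<noteq> \<zero> \<and> inv p \<notin> B"
  obtain p where p: "?P p" "\<And>y. ?P y \<Longrightarrow> index p \<le> index y"
    using proper ex_has_least_nat[of ?P _ index] by blast
  have "\<exists>b\<in>B. b \<noteq> \<zero> \<and> y = p \<otimes> b" if y: "?P y" for y
  proof -
    have c: "p \<in> carrier R" "y \<in> carrier R" using p y Bc by auto
    let ?q = "y \<otimes> inv p"
    have q: "?q \<in> carrier R" "?q \<noteq> \<zero>" "y = p \<otimes> ?q"
      using c p(1) y m_lcomm[of p y "inv p"] by auto
    have "?q \<in> B"
    proof (rule ccontr)
      assume n: "?q \<notin> B"
      then have "inv ?q \<in> B" using val q by auto
      moreover have "inv (inv ?q) \<notin> B" using n q by (simp add: field_Units)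
      moreover have "y \<otimes> inv ?q = p" using q c inv_nonzero[OF q(1,2)] by (metis m_assoc r_one)
      ultimately have "index y < index p" using index_less[of y "inv ?q"] y q by simp
      then show False using p(2)[OF y] by simp
    qed
    then show ?thesis using q by blast
  qed
  then show ?thesis using p by blast
qed

private definition "p = (SOME p. p \<in> B \<and> p \<noteq> \<zero> \<and> inv p \<notin> B \<and>
  (\<forall>y\<in>B. y \<noteq> \<zero> \<longrightarrow> inv y \<notin> B \<longrightarrow> (\<exists>b\<in>B. b \<noteq> \<zero> \<and> y = p \<otimes> b)))"

private lemma p: "p \<in> B" "p \<noteq> \<zero>" "inv p \<notin> B" "p \<in> carrier R"
  "\<And>y. y \<in> B \<Longrightarrow> y \<noteq> \<zero> \<Longrightarrow> inv y \<notin> B \<Longrightarrow> \<exists>b\<in>B. b \<noteq> \<zero> \<and> y = p \<otimes> b"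
  using someI_ex[OF uniformizer, folded p_def] Bc by auto

private lemma factor: "t \<in> B \<Longrightarrow> t \<noteq> \<zero> \<Longrightarrow> \<exists>(n::nat) u. unit u \<and> t = p [^] n \<otimes> u"
proof (induction "index t" arbitrary: t rule: less_induct)
  case less
  have tc: "t \<in> carrier R" using less Bc by auto
  show ?case
  proof (cases "inv t \<in> B")
    case True
    then show ?thesis using less tc by (intro exI[of _ 0] exI[of _ t]) (simp add: unit_def)
  next
    case False
    then obtain b where b: "b \<in> B" "b \<noteq> \<zero>" "t = p \<otimes> b" using p(5) less by blast
    have bc: "b \<in> carrier R" using b Bc by auto
    have "index b < index (b \<otimes> p)" using index_less b p by blast
    then have "index b < index t" using b bc p(4) m_comm by simp
    then obtain n u where nu: "unit u" "b = p [^] (n::nat) \<otimes> u" using less(1) b by blast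
    have uc: "u \<in> carrier R" using nu Bc by (simp add: unit_def)
    have "t = p [^] Suc n \<otimes> u" unfolding b(3) nu(2) using uc p(4) by (simp add: m_ac)
    then show ?thesis using nu(1) by blast
  qed
qed

text \<open>Clearing denominators, \<open>z * p^j = p^i * u\<close>, expresses the order
  \<open>i - j\<close> with natural exponents only; well-definedness is
  \<open>ord_unique\<close>.\<close>

private definition "has_ord z k \<longleftrightarrow> z \<in> carrier R \<and> z \<noteq> \<zero> \<and>
  (\<exists>(i::nat) (j::nat) u. unit u \<and> z \<otimes> p [^] j = p [^] i \<otimes> u \<and> k = int i - int j)"

private lemma ord_ex: "z \<in> carrier R \<Longrightarrow> z \<noteq> \<zero> \<Longrightarrow> \<exists>k. has_ord z k"
proof -
  assume z: "z \<in> carrier R" "z \<noteq> \<zero>"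
  then consider "z \<in> B" | "inv z \<in> B" using val by blast
  then show ?thesis
  proof cases
    case 1
    then obtain n u where "unit u" "z = p [^] (n::nat) \<otimes> u" using factor z by blast
    moreover have "z = z \<otimes> p [^] (0::nat)" using z by simp
    ultimately show ?thesis using z unfolding has_ord_def by metis
  next
    case 2
    then obtain n u where nu: "unit u" "inv z = p [^] (n::nat) \<otimes> u" using factor z by (metis inv_nonzero(2))
    have c: "u \<in> carrier R" "u \<noteq> \<zero>" using nu Bc by (auto simp: unit_def)
    have "z \<otimes> p [^] n = z \<otimes> (p [^] n \<otimes> u) \<otimes> inv u"
    proof -
      have "z \<otimes> (p [^] n \<otimes> u) \<otimes> inv u = z \<otimes> p [^] n \<otimes> (u \<otimes> inv u)"
        using z c p(4) inv_nonzero(1)[OF c] by (simp add: m_ac del: inv_nonzero)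
      then show ?thesis using z c p(4) by simp
    qed
    also have "\<dots> = p [^] (0::nat) \<otimes> inv u" using nu(2)[symmetric] z by simp
    finally show ?thesis using z unit_inv[OF nu(1)] unfolding has_ord_def by blast
  qed
qed

private lemma pow_unit_unique:
  assumes "p [^] (a::nat) \<otimes> u = p [^] (b::nat) \<otimes> u'" "unit u" "unit u'" shows "a = b"
proof -
  have *: False if "a < b" "p [^] a \<otimes> u = p [^] b \<otimes> u'" "unit u" "unit u'" for a b :: nat and u u'
  proof -
    have c: "u \<in> carrier R" "u' \<in> carrier R" "u \<noteq> \<zero>" "inv u \<in> carrier R" using that Bc by (auto simp: unit_def)
    obtain d where d: "b = a + Suc d" using \<open>a < b\<close> by (metis less_iff_Suc_add add_Suc_right)
    have "p [^] a \<otimes> u = p [^] a \<otimes> (p [^] Suc d \<otimes> u')"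
      using that(2) c p(4) unfolding d nat_pow_mult[OF p(4), symmetric] by (simp add: m_assoc)
    then have "u = p [^] Suc d \<otimes> u'"
      using m_lcancel[of "p [^] a" u "p [^] Suc d \<otimes> u'"] c p(2,4) by auto
    then have ue: "u = p \<otimes> (p [^] d \<otimes> u')" using c p(4) by (simp add: m_ac)
    have "p \<otimes> (p [^] d \<otimes> u') \<otimes> inv u = p \<otimes> (p [^] d \<otimes> u' \<otimes> inv u)" if "inv u \<in> carrier R"
      using c(2) that p(4) by (simp add: m_assoc)
    from this[OF c(4)] have e1: "u \<otimes> inv u = p \<otimes> (p [^] d \<otimes> u' \<otimes> inv u)"
      unfolding ue[symmetric] .
    have "\<one> = p \<otimes> (p [^] d \<otimes> u' \<otimes> inv u)"
      unfolding e1[symmetric] inv_nonzero(3)[OF c(1,3)] ..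
    moreover have e: "p [^] d \<otimes> u' \<otimes> inv u \<in> B" using that B_mult B_pow p(1) by (simp add: unit_def)
    ultimately have "inv p \<otimes> \<one> = inv p \<otimes> (p \<otimes> (p [^] d \<otimes> u' \<otimes> inv u))" by simp
    also have "\<dots> = p [^] d \<otimes> u' \<otimes> inv u" using p(2,4) Bc[OF e] by (simp add: m_assoc[symmetric])
    finally have "inv p = p [^] d \<otimes> u' \<otimes> inv u" using p(2,4) by simp
    then show False using e p(3) by simp
  qed
  show ?thesis using *[of a b u u'] *[of b a u' u] assms by (metis nat_neq_iff)
qed

private lemma ord_mult: "has_ord z k \<Longrightarrow> has_ord y l \<Longrightarrow> has_ord (z \<otimes> y) (k + l)"
proof -
  assume "has_ord z k" "has_ord y l"
  then obtain i j u i' j' u' where *: "unit u" "z \<otimes> p [^] (j::nat) = p [^] (i::nat) \<otimes> u" "k = int i - int j"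
    "unit u'" "y \<otimes> p [^] (j'::nat) = p [^] (i'::nat) \<otimes> u'" "l = int i' - int j'"
    and c: "z \<in> carrier R" "z \<noteq> \<zero>" "y \<in> carrier R" "y \<noteq> \<zero>"
    unfolding has_ord_def by blast
  have uc: "u \<in> carrier R" "u' \<in> carrier R" using * Bc by (auto simp: unit_def)
  have "z \<otimes> y \<otimes> p [^] (j + j') = (z \<otimes> p [^] j) \<otimes> (y \<otimes> p [^] j')"
    using c p(4) by (simp add: nat_pow_mult[symmetric] m_ac)
  also have "\<dots> = p [^] (i + i') \<otimes> (u \<otimes> u')"
    unfolding *(2,5) using uc p(4) by (simp add: nat_pow_mult[symmetric] m_ac)
  finally show ?thesis using unit_mult[OF *(1,4)] *(3,6) c unfolding has_ord_def
    by (intro conjI exI[of _ "i + i'"] exI[of _ "j + j'"] exI[of _ "u \<otimes> u'"]) auto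
qed

private lemma ord_unique: "has_ord z k \<Longrightarrow> has_ord z l \<Longrightarrow> k = l"
proof -
  assume "has_ord z k" "has_ord z l"
  then obtain i j u i' j' u' where *: "unit u" "z \<otimes> p [^] (j::nat) = p [^] (i::nat) \<otimes> u" "k = int i - int j"
    "unit u'" "z \<otimes> p [^] (j'::nat) = p [^] (i'::nat) \<otimes> u'" "l = int i' - int j'"
    and c: "z \<in> carrier R" "z \<noteq> \<zero>"
    unfolding has_ord_def by blast
  have uc: "u \<in> carrier R" "u' \<in> carrier R" using * Bc by (auto simp: unit_def)
  have "p [^] (i + j') \<otimes> u = z \<otimes> p [^] j \<otimes> p [^] j'"
    unfolding *(2) using uc p(4) by (simp add: nat_pow_mult[symmetric] m_ac)
  also have "\<dots> = z \<otimes> p [^] j' \<otimes> p [^] j" using c p(4) by (simp add: m_ac)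
  also have "\<dots> = p [^] (i' + j) \<otimes> u'"
    unfolding *(5) using uc p(4) by (simp add: nat_pow_mult[symmetric] m_ac)
  finally have "i + j' = i' + j" using pow_unit_unique * by blast
  then show ?thesis using * by linarith
qed

private lemma ord_nonneg_iff: "has_ord z k \<Longrightarrow> 0 \<le> k \<longleftrightarrow> z \<in> B"
proof
  assume o: "has_ord z k"
  then have zc: "z \<in> carrier R" "z \<noteq> \<zero>" unfolding has_ord_def by blast+
  { assume "z \<in> B"
    then obtain n u where nu: "unit u" "z = p [^] (n::nat) \<otimes> u" using factor zc by blast
    have "has_ord z (int n)" unfolding has_ord_def
      by (intro conjI zc exI[of _ n] exI[of _ 0] exI[of _ u]) (use zc nu in auto)
    then show "0 \<le> k" using ord_unique[OF o] by simp }
  { assume k: "0 \<le> k"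
    obtain i j u where *: "unit u" "z \<otimes> p [^] (j::nat) = p [^] (i::nat) \<otimes> u" "k = int i - int j"
      using o unfolding has_ord_def by blast
    then obtain d where d: "i = d + j" using k by (metis le_add_diff_inverse2 of_nat_le_iff diff_ge_0_iff_ge)
    have uc: "u \<in> carrier R" "u \<in> B" using * Bc by (auto simp: unit_def)
    have "p [^] j \<otimes> z = p [^] j \<otimes> (p [^] d \<otimes> u)"
      using *(2) zc p(4) uc unfolding d nat_pow_mult[OF p(4), symmetric] by (simp add: m_ac)
    then have "z = p [^] d \<otimes> u" using m_lcancel[of "p [^] j" z "p [^] d \<otimes> u"] zc p(2,4) uc by auto
    then show "z \<in> B" using B_mult B_pow p(1) uc by simp }
qed

text \<open>A valuation ring need not be discrete in general. Here it is, because the finite index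
  strictly decreases whenever a nonunit is split off, so every element of \<open>B\<close> is a
  finite power of the uniformizer times a unit.\<close>

theorem place_of_valuation_ring:
  "\<exists>v\<in>places R. \<forall>z\<in>carrier R - {\<zero>}. 0 \<le> v z \<longleftrightarrow> z \<in> B"
proof -
  define v where "v = restrict (\<lambda>z. THE k. has_ord z k) (carrier R - {\<zero>})"
  have v: "v z = k" if "has_ord z k" for z k
  proof -
    have "z \<in> carrier R - {\<zero>}" using that by (auto simp: has_ord_def)
    moreover have "(THE l. has_ord z l) = k"
      using that ord_unique[OF _ that] by (intro the_equality)
    ultimately show ?thesis by (simp add: v_def)
  qed
  have ov: "has_ord z (v z)" if "z \<in> carrier R" "z \<noteq> \<zero>" for z using ord_ex[OF that] v by auto
  have nonneg: "0 \<le> v z \<longleftrightarrow> z \<in> B" if "z \<in> carrier R" "z \<noteq> \<zero>" for z using ord_nonneg_iff[OF ov[OF that]] .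
  have mult: "v (z \<otimes> y) = v z + v y" if "z \<in> carrier R" "z \<noteq> \<zero>" "y \<in> carrier R" "y \<noteq> \<zero>" for z y
    using v[OF ord_mult[OF ov ov]] that by blast
  have add: "v z \<le> v (z \<oplus> y)"
    if z: "z \<in> carrier R" "z \<noteq> \<zero>" "y \<in> carrier R" "y \<noteq> \<zero>" "z \<oplus> y \<noteq> \<zero>" "v z \<le> v y" for z y
  proof -
    let ?q = "y \<otimes> inv z"
    have q: "?q \<in> carrier R" "?q \<noteq> \<zero>" "y = z \<otimes> ?q" using z by (auto simp: m_lcomm)
    have "v y = v z + v ?q" using mult[of z ?q] z q by metis
    then have "?q \<in> B" using nonneg[OF q(1,2)] z by simp
    then have 1: "\<one> \<oplus> ?q \<in> B" using subringE(3,7)[OF B] by blast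
    have e: "z \<oplus> y = z \<otimes> (\<one> \<oplus> ?q)" using q z(1) by (metis r_distr r_one one_closed)
    then have nz: "\<one> \<oplus> ?q \<noteq> \<zero>" using z by auto
    then have "v (z \<oplus> y) = v z + v (\<one> \<oplus> ?q)" using mult e z q(1) by simp
    moreover have "0 \<le> v (\<one> \<oplus> ?q)" using nonneg 1 nz q(1) by simp
    ultimately show ?thesis by simp
  qed
  have "unit \<one>" using subringE(3)[OF B] by (simp add: unit_def)
  then have pn: "has_ord (p [^] n) (int n)" for n :: nat
    unfolding has_ord_def using p(2,4) by (intro conjI exI[of _ n] exI[of _ 0] exI[of _ \<one>]) auto
  have vinv: "v (inv z) = - v z" if "z \<in> carrier R" "z \<noteq> \<zero>" for z
    using mult[of z "inv z"] that v[OF pn[of 0]] by simp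
  have "k \<in> v ` (carrier R - {\<zero>})" for k
  proof (cases "0 \<le> k")
    case True
    then have "k = v (p [^] nat k)" using v[OF pn[of "nat k"]] by simp
    then show ?thesis using p(2,4) by (intro image_eqI[of _ v "p [^] nat k"]) auto
  next
    case False
    then have "- k = int (nat (- k))" by simp
    then obtain n where "- k = int n" by blast
    then obtain q where "q \<in> carrier R" "q \<noteq> \<zero>" "v q = - k"
      using that[of "p [^] n"] v[OF pn[of n]] p(2,4) by simp
    then show ?thesis using vinv[of q] by (intro image_eqI[of _ v "inv q"]) auto
  qed
  then have surj: "v ` (carrier R - {\<zero>}) = UNIV" by auto
  have "min (v z) (v y) \<le> v (z \<oplus> y)"
    if z: "z \<in> carrier R" "z \<noteq> \<zero>" "y \<in> carrier R" "y \<noteq> \<zero>" "z \<oplus> y \<noteq> \<zero>" for z y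
    using add[of z y] add[of y z] z by (cases "v z \<le> v y") (auto simp: a_comm)
  then have "v \<in> places R" using surj mult by (auto simp: places_def v_def)
  then show ?thesis using nonneg by (intro bexI[of _ v]) auto
qed

end

text \<open>Used twice: with a ring generated over the prime field, to produce a pole of an element
  that is not algebraic, and with the valuation ring of a place of F, to extend that place to
  E.\<close>

theorem exists_place:
  assumes "subring B0 R" "t \<in> B0" "t \<noteq> \<zero>" "inv t \<notin> B0"
  shows "\<exists>v\<in>places R. B0 \<subseteq> vball R v 0 \<and> 0 < v t"
proof -
  obtain B where B: "subring B R" "B0 \<subseteq> B" "inv t \<notin> B" "\<And>z. z \<in> carrier R \<Longrightarrow> z \<noteq> \<zero> \<Longrightarrow> z \<in> B \<or> inv z \<in> B"
    using exists_valuation_ring[OF assms] by auto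
  have tB: "t \<in> B" "t \<in> carrier R" using assms B subringE(1)[OF B(1)] by auto
  obtain v where v: "v \<in> places R" "\<And>z. z \<in> carrier R \<Longrightarrow> z \<noteq> \<zero> \<Longrightarrow> 0 \<le> v z \<longleftrightarrow> z \<in> B"
    using place_of_valuation_ring[OF B(1,4)] assms(3) B(3) tB by blast
  have "\<not> 0 \<le> v (inv t)" using v(2)[of "inv t"] B tB assms by simp
  then have "0 < v t" using place_inv[OF v(1) tB(2) assms(3)] by simp
  moreover have "B0 \<subseteq> vball R v 0" using v(2) B(2) subringE(1)[OF B(1)] by (auto simp: vball_def)
  ultimately show ?thesis using v(1) by blast
qed

end

section \<open>Constants and the product formula\<close>

lemma (in field) root_of_unityI:
  assumes "finite S" "a \<in> carrier R" "a \<noteq> \<zero>" "\<And>n::nat. a [^] n \<in> S"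
  shows "\<exists>n::nat. n > 0 \<and> a [^] n = \<one>"
proof -
  have "\<not> inj (\<lambda>n::nat. a [^] n)"
    using assms(1,4) finite_subset[of "range (\<lambda>n::nat. a [^] n)" S] finite_imageD[of "\<lambda>n::nat. a [^] n" UNIV] by auto
  then obtain i j :: nat where ij: "i < j" "a [^] i = a [^] j"
    unfolding inj_def by (metis nat_neq_iff)
  have "i + (j - i) = j" using ij(1) by simp
  then have "a [^] i \<otimes> a [^] (j - i) = a [^] j" using nat_pow_mult[OF assms(2)] by metis
  then have "a [^] i \<otimes> \<one> = a [^] i \<otimes> a [^] (j - i)" using ij assms(2) by simp
  then have "\<one> = a [^] (j - i)" using m_lcancel[of "a [^] i" \<one> "a [^] (j - i)"] assms(2,3) by auto
  then show ?thesis using ij by (intro exI[of _ "j - i"]) simp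
qed

lemma set_repeat_mset_subset: "set_mset (repeat_mset n D) \<subseteq> set_mset D"
  by (induction n) (auto simp: repeat_mset_Suc)

lemma (in field) finite_subring_is_subfield:
  assumes "subring B R" "finite B" shows "subfield B R"
proof (rule subfieldI'[OF assms(1)])
  fix a assume a: "a \<in> B - {\<zero>}"
  then have ac: "a \<in> carrier R" "a \<noteq> \<zero>" using subringE(1)[OF assms(1)] by auto
  have pow: "a [^] (n::nat) \<in> B" for n
    using subringE(3,6)[OF assms(1)] a by (induction n) auto
  obtain n :: nat where n: "n > 0" "a [^] n = \<one>" using root_of_unityI[OF assms(2) ac pow] by auto
  then obtain m where "n = Suc m" by (cases n) auto
  then have "a \<otimes> a [^] m = \<one>" using n ac by (simp add: m_comm)
  then have "inv a = a [^] m" using comm_inv_char ac by auto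
  then show "inv a \<in> B" using pow by simp
qed

lemma (in field) place_of_finite_subring:
  assumes "v \<in> places R" "subring B R" "finite B" "a \<in> B" "a \<noteq> \<zero>" shows "v a = 0"
proof -
  have ac: "a \<in> carrier R" using subringE(1)[OF assms(2)] assms(4) by auto
  have "a [^] (n::nat) \<in> B" for n
    using subringE(3,6)[OF assms(2)] assms(4) by (induction n) auto
  then obtain n :: nat where "n > 0" "a [^] n = \<one>" using root_of_unityI[OF assms(3) ac assms(5)] by auto
  then show ?thesis using place_of_root_of_unity[OF assms(1) ac] by blast
qed

lemma (in field) riemann_roch_space_zero_iff:
  "u \<in> riemann_roch_space R (\<lambda>_. 0) \<longleftrightarrow> u \<in> carrier R \<and> (u = \<zero> \<or> (\<forall>v\<in>places R. 0 \<le> v u))"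
  by (auto simp: riemann_roch_space_def vball_def)

context expansion_field
begin

abbreviation "prime_subfield \<equiv> generate_field R {}"

abbreviation "constants \<equiv> riemann_roch_space R (\<lambda>_. 0)"

lemma prime_subfield: "subfield prime_subfield R" "subring prime_subfield R"
  using generate_field_is_subfield[of "{}"] subfieldE(1) by auto

lemma finite_expansions: "finite W \<Longrightarrow> finite (expansions R W z n)"
proof (induction n)
  case (Suc n)
  have "expansions R W z (Suc n) = (\<lambda>(w, m). w \<oplus> z \<otimes> m) ` (W \<times> expansions R W z n)" by auto
  then show ?case using Suc by simp
qed simp

text \<open>If \<open>u\<close> were not a polynomial in \<open>1/u\<close> over the prime field,
  some place would make \<open>1/u\<close> vanish and \<open>u\<close> would have a pole. Reversing
  this polynomial gives a monic equation for \<open>u\<close>, which bounds the degrees needed in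
  the ring generated by \<open>u\<close>.\<close>

lemma finite_extension_of_constant:
  assumes u: "u \<in> constants" "u \<noteq> \<zero>"
  shows "finite (simple_extension prime_subfield u)"
proof -
  let ?P = prime_subfield
  note P = subringE(1,2,7)[OF prime_subfield(2)]
  have uc: "u \<in> carrier R" "inv u \<in> carrier R" using u by (auto simp: riemann_roch_space_def)
  have ii: "inv (inv u) = u" using u uc by (simp add: field_Units)
  have "u \<in> simple_extension ?P (inv u)"
  proof (rule ccontr)
    assume n: "u \<notin> simple_extension ?P (inv u)"
    obtain v where "v \<in> places R" "0 < v (inv u)"
      using exists_place[OF simple_extension_is_subring[OF prime_subfield(2) uc(2)]
          simple_extension_mem[OF prime_subfield(2) uc(2)]] n ii u uc by auto
    then show False using u uc place_inv[of v u] by (fastforce simp: riemann_roch_space_zero_iff)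
  qed
  then obtain n where "u \<in> expansions R ?P (inv u) n"
    using simple_extension_eq_expansions[OF prime_subfield(2) uc(2)] by auto
  then have "u [^] n \<otimes> u \<in> expansions R ?P u n" using expansions_reverse[OF P uc(1) u(2)] by blast
  then have top: "u [^] Suc n \<in> expansions R ?P u n" by simp
  have "expansions R ?P u k \<subseteq> expansions R ?P u n" for k
  proof (induction k)
    case 0 then show ?case using expansions_mono[OF P uc(1), of 0 n] by simp
  next
    case (Suc k)
    have "w \<oplus> u \<otimes> m \<in> expansions R ?P u n" if w: "w \<in> ?P" "m \<in> expansions R ?P u k" for w m
    proof -
      have "u \<otimes> m \<in> expansions R ?P u (Suc n)" using w(2) Suc expansions_mult_var[OF P uc(1)] by blast
      then obtain q a where q: "q \<in> expansions R ?P u n" "a \<in> ?P" "u \<otimes> m = q \<oplus> u [^] Suc n \<otimes> a"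
        using expansions_top[OF P uc(1)] by meson
      have ac: "a \<in> carrier R" using q P by auto
      have "a \<otimes> u [^] Suc n \<in> expansions R ?P u n"
        using expansions_smult[OF P uc(1) ac _ top] subringE(6)[OF prime_subfield(2) q(2)] by blast
      moreover have "a \<otimes> u [^] Suc n = u [^] Suc n \<otimes> a" using ac uc m_comm nat_pow_closed by blast
      ultimately have "u \<otimes> m \<in> expansions R ?P u n" using q expansions_add[OF P uc(1)] by simp
      moreover have "w \<in> expansions R ?P u n" using w expansions_digit[OF P uc(1)] by blast
      ultimately show ?thesis using expansions_add[OF P uc(1)] by blast
    qed
    then show ?case by auto
  qed
  then have "simple_extension ?P u \<subseteq> expansions R ?P u n"
    using simple_extension_eq_expansions[OF prime_subfield(2) uc(1)] by blast
  then show ?thesis using finite_expansions[OF prime_field_finite] finite_subset by blast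
qed

lemma place_of_constant:
  assumes "u \<in> constants" "u \<noteq> \<zero>" "v \<in> places R" shows "v u = 0"
proof -
  have "u \<in> carrier R" using assms by (auto simp: riemann_roch_space_def)
  then show ?thesis
    using place_of_finite_subring[OF assms(3) simple_extension_is_subring[OF prime_subfield(2)]
      finite_extension_of_constant[OF assms(1,2)] simple_extension_mem[OF prime_subfield(2)]] assms by blast
qed

text \<open>Joins the algebraic definition to the absence of poles. For the second inclusion: if
  \<open>u\<close> is algebraic and has a pole at \<open>v\<close>, then \<open>u\<close>, being the
  inverse of \<open>inv u\<close>, is a polynomial in \<open>inv u\<close>, and so is integral at
  \<open>v\<close>.\<close>

theorem constant_field_eq: "constant_field R = constants"
proof
  note P = subringE(1,2,7)[OF prime_subfield(2)]
  show "constants \<subseteq> constant_field R"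
  proof
    fix u assume u: "u \<in> constants"
    then have uc: "u \<in> carrier R" by (auto simp: riemann_roch_space_def)
    show "u \<in> constant_field R"
    proof (cases "u = \<zero>")
      case True then show ?thesis using zero_is_algebraic[OF prime_subfield(2)] by (simp add: constant_field_def)
    next
      case False
      then have "subfield (simple_extension prime_subfield u) R"
        using finite_subring_is_subfield[OF simple_extension_is_subring[OF prime_subfield(2) uc]]
          finite_extension_of_constant[OF u] by blast
      then show ?thesis using simple_extension_is_subfield[OF prime_subfield(1) uc] uc
        by (simp add: constant_field_def)
    qed
  qed
  show "constant_field R \<subseteq> constants"
  proof
    fix u assume u: "u \<in> constant_field R"
    let ?A = "{x \<in> carrier R. (algebraic over prime_subfield) x}"
    have sub: "subfield ?A R" by (rule subfield_of_algebraics[OF prime_subfield(1)])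
    have uA: "u \<in> ?A" using u by (simp add: constant_field_def)
    then have uc: "u \<in> carrier R" by simp
    have "0 \<le> v u" if u0: "u \<noteq> \<zero>" and v: "v \<in> places R" for v
    proof (rule ccontr)
      assume "\<not> 0 \<le> v u"
      then have neg: "v u < 0" by simp
      have wc: "inv u \<in> carrier R" "inv u \<noteq> \<zero>" using uc u0 by auto
      have "inv u \<in> ?A" using subfield_m_inv(1)[OF sub, of u] uA u0 by blast
      then have "subfield (simple_extension prime_subfield (inv u)) R"
        using simple_extension_is_subfield[OF prime_subfield(1) wc(1)] by blast
      then have "inv (inv u) \<in> simple_extension prime_subfield (inv u)"
        using subfield_m_inv(1) simple_extension_mem[OF prime_subfield(2) wc(1)] wc by blast
      then obtain n where n: "u \<in> expansions R prime_subfield (inv u) n"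
        using simple_extension_eq_expansions[OF prime_subfield(2) wc(1)] u0 uc by (auto simp: field_Units)
      have "inv u \<in> vball R v 0" using wc neg place_inv[OF v uc u0] by (auto intro: vballI)
      moreover have "prime_subfield \<subseteq> vball R v 0"
        using place_of_finite_subring[OF v prime_subfield(2) prime_field_finite] P by (force simp: vball_def)
      moreover have "w \<oplus> inv u \<otimes> m \<in> vball R v 0"
        if "w \<in> vball R v 0" "inv u \<in> vball R v 0" "m \<in> vball R v 0" for w m
        using vball_add[OF v that(1)] vball_mult[OF v that(2,3)] by simp
      ultimately have "expansions R prime_subfield (inv u) n \<subseteq> vball R v 0"
        by (induction n) auto
      then have "u \<in> vball R v 0" using n by blast
      then show False using neg u0 by (simp add: vball_def)
    qed
    then show "u \<in> constants" using uc by (auto simp: riemann_roch_space_zero_iff)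
  qed
qed

lemma x_not_constant: "x \<notin> constants"
proof
  assume x: "x \<in> constants"
  have "x [^] (n::nat) \<in> simple_extension prime_subfield x" for n
  proof -
    have "subring (simple_extension prime_subfield x) R" "x \<in> simple_extension prime_subfield x"
      using simple_extension_is_subring simple_extension_mem prime_subfield x_carrier by blast+
    then show ?thesis using subringE(3,6)[of "simple_extension prime_subfield x" R] by (induction n) auto
  qed
  then obtain n :: nat where n: "n > 0" "x [^] n = \<one>"
    using root_of_unityI[OF finite_extension_of_constant[OF x x_nonzero] x_carrier x_nonzero] by auto
  then obtain k where k: "n = Suc k" by (cases n) auto
  obtain w where w: "w \<in> V" "w \<noteq> \<zero>" using V_nontrivial by auto
  have wc: "w \<in> carrier R" using w V_carrier by auto
  have "\<zero> \<ominus> w \<in> V" using V_minus V_zero w by blast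
  \<comment> \<open>Since \<open>x [^] Suc k = \<one>\<close>, the expansion with lowest digit
    \<open>w\<close> and top digit \<open>-w\<close> vanishes, contrary to uniqueness of the lowest
    digit.\<close>
  then have "x [^] k \<otimes> (\<zero> \<ominus> w) \<in> M k"
    using expansions_pow[OF V_carrier V_zero _ x_carrier] M_add[of _ 0] by simp
  moreover have "w \<oplus> x \<otimes> (x [^] k \<otimes> (\<zero> \<ominus> w)) = w \<ominus> (x [^] n) \<otimes> w"
  proof -
    have "x [^] k \<in> carrier R" using x_carrier by simp
    then show ?thesis unfolding k nat_pow_Suc using wc x_carrier by algebra
  qed
  moreover have "w \<ominus> (x [^] n) \<otimes> w = \<zero>" using n wc by (simp add: minus_eq_zero_iff)
  ultimately show False using digit_unique[OF w(1)] w(2) by metis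
qed

text \<open>For a uniformizer \<open>t\<close> of \<open>v\<close>, residue classes are classes
  modulo \<open>t\<close> in the valuation ring, so the uniform bound for \<open>t\<close>
  applies.\<close>

lemma finite_residue_classes:
  assumes v: "v \<in> places R" shows "finite ((\<lambda>a. valuation_ideal R v +> a) ` valuation_ring R v)"
proof -
  let ?c = "\<lambda>a. valuation_ideal R v +> a"
  obtain t where t: "t \<in> carrier R" "t \<noteq> \<zero>" "v t = 1" using place_surj[OF v] by blast
  have tb: "t \<in> vball R v 1" using t by (auto intro: vballI)
  obtain N where N: "\<forall>B W. B \<subseteq> carrier R \<longrightarrow> (\<forall>a\<in>B. \<forall>b\<in>B. a \<ominus> b \<in> B) \<longrightarrow> (\<forall>a\<in>B. t \<otimes> a \<in> B) \<longrightarrow>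
    finite W \<longrightarrow> W \<subseteq> B \<longrightarrow> (\<forall>w\<in>W. \<forall>w'\<in>W. \<forall>a\<in>B. w \<ominus> w' = t \<otimes> a \<longrightarrow> w = w') \<longrightarrow> card W \<le> N"
    using finite_incongruent_bound[OF t(1,2)] by blast
  show ?thesis
  proof (rule finite_if_card_subsets_bounded)
    fix C assume C: "C \<subseteq> ?c ` valuation_ring R v" "finite C"
    then obtain W where W: "W \<subseteq> vball R v 0" "inj_on ?c W" "C = ?c ` W"
      unfolding valuation_ring_eq_vball by (auto simp: subset_image_inj)
    have ta: "t \<otimes> a \<in> vball R v 1" if "a \<in> vball R v 0" for a
      using vball_mult[OF v tb that] by simp
    have "card W \<le> N"
    proof (rule N[rule_format])
      show "vball R v 0 \<subseteq> carrier R" by (rule vball_subset_carrier)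
      show "finite W" using W C finite_imageD by blast
      show "w = w'" if w: "w \<in> W" "w' \<in> W" "a \<in> vball R v 0" "w \<ominus> w' = t \<otimes> a" for w w' a
      proof -
        have "?c w = ?c w'" using residue_class_eq_iff[OF v] w W(1) ta vball_carrier by (metis subsetD)
        then show ?thesis using W(2) w by (auto dest: inj_onD)
      qed
      show "a \<ominus> b \<in> vball R v 0" if "a \<in> vball R v 0" "b \<in> vball R v 0" for a b using vball_minus[OF v that] .
      show "t \<otimes> a \<in> vball R v 0" if "a \<in> vball R v 0" for a using ta[OF that] by (rule vball_le) simp
      show "W \<subseteq> vball R v 0" by (rule W)
    qed
    then show "card C \<le> N" using W(2,3) by (simp add: card_image)
  qed
qed

lemmas place_norm_ge_2' = place_norm_ge_2[OF _ finite_residue_classes]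

lemma divisor_norm_ge_power: "set_mset D \<subseteq> places R \<Longrightarrow> 2 ^ size D \<le> divisor_norm R D"
proof (induction D)
  case (add v D)
  have "2 * 2 ^ size D \<le> place_norm R v * divisor_norm R D"
    using add place_norm_ge_2'[of v] by (intro mult_mono) auto
  then show ?case by simp
qed simp

lemma divisor_norm_pos: "set_mset D \<subseteq> places R \<Longrightarrow> divisor_norm R D > 0"
  using divisor_norm_ge_power[of D] by (metis less_le_trans zero_less_numeral zero_less_power)

text \<open>Constants inject into the residue field at any place, and a place exists because
  \<open>x\<close> is not a constant.\<close>

lemma finite_constants: "finite constants"
proof -
  obtain v where v: "v \<in> places R" using x_not_constant x_carrier by (auto simp: riemann_roch_space_zero_iff)
  have sub: "constants \<subseteq> vball R v 0" using v by (auto simp: riemann_roch_space_def)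
  have "inj_on (\<lambda>a. valuation_ideal R v +> a) constants"
  proof (rule inj_onI, rule ccontr)
    fix a b assume ab: "a \<in> constants" "b \<in> constants" "valuation_ideal R v +> a = valuation_ideal R v +> b" "a \<noteq> b"
    then have c: "a \<in> carrier R" "b \<in> carrier R" by (auto simp: riemann_roch_space_def)
    have "a \<ominus> b \<in> vball R v 1" "a \<ominus> b \<noteq> \<zero>"
      using residue_class_eq_iff[OF v c] ab c by (auto simp: minus_eq_zero_iff)
    then show False using place_of_constant[OF riemann_roch_space_minus[OF ab(1,2)] _ v] by (simp add: vball_def)
  qed
  then show ?thesis
    using finite_residue_classes[OF v] sub unfolding valuation_ring_eq_vball
    by (metis finite_imageD finite_subset image_mono)
qed

lemma card_constants_pos: "card constants > 0"
proof -
  have "\<zero> \<in> constants" by (simp add: riemann_roch_space_def)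
  then show ?thesis using finite_constants card_gt_0_iff by blast
qed

text \<open>Counting form of l(D) \<le> deg D + l(0): pigeonhole modulo \<open>D\<close> inside L(D)
  leads down to L(0), the constants.\<close>

lemma card_riemann_roch_space_le:
  assumes D: "set_mset D \<subseteq> places R"
  shows "finite (riemann_roch_space R (\<lambda>v. int (count D v)))"
    "card (riemann_roch_space R (\<lambda>v. int (count D v))) \<le> divisor_norm R D * card constants"
proof -
  have bound: "card A \<le> divisor_norm R D * card constants"
    if A: "A \<subseteq> riemann_roch_space R (\<lambda>v. int (count D v))" "finite A" for A
  proof (rule ccontr)
    assume "\<not> ?thesis"
    moreover have "A \<subseteq> carrier R" using A by (auto simp: riemann_roch_space_def)
    ultimately have "\<exists>A'\<subseteq>A. card constants < card A' \<and>
      (\<forall>a\<in>A'. \<forall>b\<in>A'. a \<ominus> b \<in> riemann_roch_space R (\<lambda>v. int (count D v) - int (count D v)))"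
      using A by (intro pigeonhole_divisor[OF finite_residue_classes _ _ _ D])
        (auto intro: riemann_roch_space_minus)
    then obtain A' where A': "A' \<subseteq> carrier R" "card constants < card A'"
        "\<And>a b. a \<in> A' \<Longrightarrow> b \<in> A' \<Longrightarrow> a \<ominus> b \<in> constants"
    proof (elim exE conjE)
      fix A' assume "A' \<subseteq> A" "card constants < card A'"
        and *: "\<forall>a\<in>A'. \<forall>b\<in>A'. a \<ominus> b \<in> riemann_roch_space R (\<lambda>v. int (count D v) - int (count D v))"
      moreover have "a \<ominus> b \<in> constants" if "a \<in> A'" "b \<in> A'" for a b using * that by simp
      ultimately show ?thesis using \<open>A \<subseteq> carrier R\<close> by (intro that) auto
    qed
    then have "A' \<noteq> {}" by auto
    then obtain a0 where a0: "a0 \<in> A'" by auto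
    have "inj_on (\<lambda>a. a \<ominus> a0) A'"
    proof (rule inj_onI)
      fix a b assume ab: "a \<in> A'" "b \<in> A'" "a \<ominus> a0 = b \<ominus> a0"
      have c: "a \<in> carrier R" "b \<in> carrier R" "a0 \<in> carrier R" using ab a0 A' by auto
      have "a = (a \<ominus> a0) \<oplus> a0" using c by algebra
      also have "\<dots> = b" unfolding ab(3) using c by algebra
      finally show "a = b" .
    qed
    then have "card A' \<le> card constants" using A'(3)[OF _ a0] finite_constants by (intro card_inj_on_le) auto
    then show False using A' by simp
  qed
  show "finite (riemann_roch_space R (\<lambda>v. int (count D v)))"
    "card (riemann_roch_space R (\<lambda>v. int (count D v))) \<le> divisor_norm R D * card constants"
    using finite_if_card_subsets_bounded[OF bound] by auto
qed

text \<open>A finite set \<open>T\<close> of zeros produces at least \<open>2 ^ card T\<close>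
  elements of a semilocal ring that are pairwise incongruent modulo \<open>f\<close>; their number
  is bounded in terms of \<open>f\<close> alone.\<close>

lemma finite_zeros:
  assumes f: "f \<in> carrier R" "f \<noteq> \<zero>" shows "finite {v \<in> places R. 0 < v f}"
proof -
  obtain N where N: "\<forall>B W. B \<subseteq> carrier R \<longrightarrow> (\<forall>a\<in>B. \<forall>b\<in>B. a \<ominus> b \<in> B) \<longrightarrow> (\<forall>a\<in>B. f \<otimes> a \<in> B) \<longrightarrow>
    finite W \<longrightarrow> W \<subseteq> B \<longrightarrow> (\<forall>w\<in>W. \<forall>w'\<in>W. \<forall>a\<in>B. w \<ominus> w' = f \<otimes> a \<longrightarrow> w = w') \<longrightarrow> card W \<le> N"
    using finite_incongruent_bound[OF f] by blast
  show ?thesis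
  proof (rule finite_if_card_subsets_bounded)
    fix T assume T: "T \<subseteq> {v \<in> places R. 0 < v f}" "finite T"
    then have Tp: "T \<subseteq> places R" by auto
    let ?D = "mset_set T"
    obtain W where W: "finite W" "card W = divisor_norm R ?D" "W \<subseteq> carrier R"
      "\<forall>w\<in>W. \<forall>v\<in>T. w \<in> vball R v 0"
      "\<And>w w'. w \<in> W \<Longrightarrow> w' \<in> W \<Longrightarrow> (\<And>v. v \<in> T \<Longrightarrow> w \<ominus> w' \<in> vball R v (int (count ?D v))) \<Longrightarrow> w = w'"
      using divisor_representatives[OF finite_residue_classes T(2) Tp, of ?D] T by auto
    let ?B = "{a \<in> carrier R. \<forall>v\<in>T. a \<in> vball R v 0}"
    have fa: "f \<otimes> a \<in> vball R v 1" if "a \<in> ?B" "v \<in> T" for a v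
    proof -
      have v: "v \<in> places R" "0 < v f" using that T by auto
      then have "f \<in> vball R v 1" using f by (auto intro: vballI)
      then show ?thesis using vball_mult[OF v(1), of f 1 a 0] that by auto
    qed
    have "card W \<le> N"
    proof (rule N[rule_format])
      show "a \<ominus> b \<in> ?B" if "a \<in> ?B" "b \<in> ?B" for a b using that vball_minus Tp by blast
      show "f \<otimes> a \<in> ?B" if "a \<in> ?B" for a
      proof -
        have "f \<otimes> a \<in> vball R v 0" if "v \<in> T" for v using fa[OF \<open>a \<in> ?B\<close> that] by (rule vball_le) simp
        moreover have "f \<otimes> a \<in> carrier R" using f that by simp
        ultimately show ?thesis by simp
      qed
      show "w = w'" if "w \<in> W" "w' \<in> W" "a \<in> ?B" "w \<ominus> w' = f \<otimes> a" for w w' a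
        using W(5)[OF that(1,2)] fa[OF that(3)] that(4) T by simp
    qed (use W in auto)
    moreover have "2 ^ card T \<le> card W" using divisor_norm_ge_power[of ?D] Tp T W by simp
    moreover have "card T < 2 ^ card T" by (rule less_exp)
    ultimately show "card T \<le> N" by linarith
  qed
qed

section \<open>Zero and pole divisors of a function\<close>

definition zeros :: "'a \<Rightarrow> ('a \<Rightarrow> int) multiset" where
  "zeros f = (\<Sum>v\<in>{v \<in> places R. 0 < v f}. replicate_mset (nat (v f)) v)"

lemma count_zeros:
  assumes "f \<in> carrier R" "f \<noteq> \<zero>" shows "count (zeros f) v = (if v \<in> places R then nat (v f) else 0)"
proof -
  let ?Z = "{v \<in> places R. 0 < v f}"
  have "count (zeros f) v = (\<Sum>w\<in>?Z. if w = v then nat (w f) else 0)"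
    unfolding zeros_def count_sum by (intro sum.cong) auto
  also have "\<dots> = (if v \<in> ?Z then nat (v f) else 0)" using finite_zeros[OF assms] by (simp add: sum.delta)
  finally show ?thesis by auto
qed

lemma set_zeros: "f \<in> carrier R \<Longrightarrow> f \<noteq> \<zero> \<Longrightarrow> set_mset (zeros f) = {v \<in> places R. 0 < v f}"
  by (auto simp: count_zeros set_mset_def)

abbreviation "poles f \<equiv> zeros (inv f)"

lemma count_poles:
  assumes "f \<in> carrier R" "f \<noteq> \<zero>" shows "count (poles f) v = (if v \<in> places R then nat (- v f) else 0)"
  using count_zeros[of "inv f" v] place_inv[of v f] assms by simp

lemma in_riemann_roch_space_poles:
  assumes "f \<in> carrier R" "f \<noteq> \<zero>" shows "f \<in> riemann_roch_space R (\<lambda>v. int (count (poles f) v))"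
  using assms by (auto simp: riemann_roch_space_def vball_def count_poles)

lemma finite_set_in_riemann_roch_space:
  assumes "finite W" "W \<subseteq> carrier R"
  shows "\<exists>C. set_mset C \<subseteq> places R \<and> W \<subseteq> riemann_roch_space R (\<lambda>v. int (count C v))"
proof -
  let ?C = "\<Sum>w\<in>W - {\<zero>}. poles w"
  have "count ?C v = 0" if "v \<notin> places R" for v
  proof -
    have "count (poles w) v = 0" if "w \<in> W - {\<zero>}" for w
      using count_poles[of w v] that \<open>v \<notin> places R\<close> assms(2) by auto
    then show ?thesis unfolding count_sum by (intro sum.neutral ballI)
  qed
  then have "v \<in># ?C \<Longrightarrow> v \<in> places R" for v by (metis count_eq_zero_iff)
  then have "set_mset ?C \<subseteq> places R" by (rule subsetI)
  moreover have "w \<in> riemann_roch_space R (\<lambda>v. int (count ?C v))" if w: "w \<in> W" for w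
  proof (cases "w = \<zero>")
    case False
    have "count (poles w) v \<le> count ?C v" for v
      unfolding count_sum using w False assms by (intro member_le_sum) auto
    then have "riemann_roch_space R (\<lambda>v. int (count (poles w) v)) \<subseteq> riemann_roch_space R (\<lambda>v. int (count ?C v))"
      by (intro riemann_roch_space_mono) simp
    then show ?thesis using in_riemann_roch_space_poles[of w] w assms False by blast
  qed (simp add: riemann_roch_space_def)
  ultimately show ?thesis by blast
qed

lemma expansions_in_riemann_roch_space:
  assumes W: "W \<subseteq> riemann_roch_space R (\<lambda>v. int (count C v))" and f: "f \<in> carrier R" "f \<noteq> \<zero>"
  shows "expansions R W f n \<subseteq> riemann_roch_space R (\<lambda>v. int (count (repeat_mset n (poles f) + C) v))"
proof (induction n)
  case (Suc n)
  let ?D = "\<lambda>n v. int (count (repeat_mset n (poles f) + C) v)"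
  have "w \<oplus> f \<otimes> m \<in> riemann_roch_space R (?D (Suc n))" if "w \<in> W" "m \<in> expansions R W f n" for w m
  proof -
    have "riemann_roch_space R (\<lambda>v. int (count C v)) \<subseteq> riemann_roch_space R (?D (Suc n))"
      by (rule riemann_roch_space_mono) simp
    then have 1: "w \<in> riemann_roch_space R (?D (Suc n))" using that W by blast
    have "f \<otimes> m \<in> riemann_roch_space R (\<lambda>v. int (count (poles f) v) + ?D n v)"
      using riemann_roch_space_mult in_riemann_roch_space_poles[OF f] that Suc by blast
    moreover have "(\<lambda>v. int (count (poles f) v) + ?D n v) = ?D (Suc n)" by (auto simp: algebra_simps)
    ultimately show ?thesis using riemann_roch_space_add[OF 1] by simp
  qed
  then show ?case by auto
qed (use W in simp)

text \<open>\<open>B\<close> is the semilocal ring of functions regular at all zeros of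
  \<open>f\<close>. A multiple of \<open>f\<close> in \<open>B\<close> vanishes to the order of
  \<open>f\<close> at each of them, so representatives modulo the zero divisor remain incongruent
  modulo \<open>f\<close>.\<close>

lemma zero_representatives:
  assumes f: "f \<in> carrier R" "f \<noteq> \<zero>"
  shows "\<exists>W B. finite W \<and> card W = divisor_norm R (zeros f) \<and> W \<subseteq> B \<and> B \<subseteq> carrier R \<and> subring B R \<and>
    (\<forall>a\<in>B. f \<otimes> a \<in> B) \<and> (\<forall>w\<in>W. \<forall>w'\<in>W. \<forall>a\<in>B. w \<ominus> w' = f \<otimes> a \<longrightarrow> w = w')"
proof -
  let ?T = "{v \<in> places R. 0 < v f}"
  have T: "finite ?T" "?T \<subseteq> places R" using finite_zeros[OF f] by auto
  obtain W where W: "finite W" "card W = divisor_norm R (zeros f)" "W \<subseteq> carrier R"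
    "\<forall>w\<in>W. \<forall>v\<in>?T. w \<in> vball R v 0"
    "\<forall>w\<in>W. \<forall>w'\<in>W. (\<forall>v\<in>?T. w \<ominus> w' \<in> vball R v (int (count (zeros f) v))) \<longrightarrow> w = w'"
  proof -
    have "\<exists>W. finite W \<and> card W = divisor_norm R (zeros f) \<and> W \<subseteq> carrier R \<and> (\<forall>w\<in>W. \<forall>v\<in>?T. w \<in> vball R v 0) \<and>
      (\<forall>w\<in>W. \<forall>w'\<in>W. (\<forall>v\<in>?T. w \<ominus> w' \<in> vball R v (int (count (zeros f) v))) \<longrightarrow> w = w')"
      by (rule divisor_representatives[OF finite_residue_classes T]) (simp_all add: set_zeros[OF f])
    then show ?thesis by (elim exE conjE) (rule that)
  qed
  let ?B = "{a \<in> carrier R. \<forall>v\<in>?T. a \<in> vball R v 0}"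
  have fa: "f \<otimes> a \<in> vball R v (v f)" if "a \<in> ?B" "v \<in> ?T" for a v
    using vball_mult[of v f "v f" a 0] that f by (auto intro: vballI)
  have inc: "w = w'" if "w \<in> W" "w' \<in> W" "a \<in> ?B" "w \<ominus> w' = f \<otimes> a" for w w' a
  proof (rule W(5)[rule_format, OF that(1,2)])
    fix v assume v: "v \<in> ?T"
    then have "int (count (zeros f) v) = v f" using count_zeros[OF f, of v] by simp
    then show "w \<ominus> w' \<in> vball R v (int (count (zeros f) v))" using fa[OF that(3) v] that(4) by simp
  qed
  have fB: "f \<otimes> a \<in> ?B" if "a \<in> ?B" for a
  proof -
    have "f \<otimes> a \<in> vball R v 0" if v: "v \<in> ?T" for v using fa[OF \<open>a \<in> ?B\<close> v] by (rule vball_le) (use v in simp)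
    moreover have "f \<otimes> a \<in> carrier R" using f that by simp
    ultimately show ?thesis by simp
  qed
  have sub: "subring ?B R"
  proof (rule subringI)
    fix a b assume "a \<in> ?B" "b \<in> ?B"
    moreover then have "a \<otimes> b \<in> vball R v 0" if "v \<in> ?T" for v using vball_mult[of v a 0 b 0] that by simp
    ultimately show "a \<otimes> b \<in> ?B" "a \<oplus> b \<in> ?B" "\<ominus> a \<in> ?B" by (simp_all add: vball_add vball_neg)
  qed auto
  have "\<forall>w\<in>W. \<forall>w'\<in>W. \<forall>a\<in>?B. w \<ominus> w' = f \<otimes> a \<longrightarrow> w = w'"
    by (intro ballI impI) (rule inc)
  moreover have "\<forall>a\<in>?B. f \<otimes> a \<in> ?B" by (intro ballI) (rule fB)
  moreover have "W \<subseteq> ?B" "?B \<subseteq> carrier R" using W(3,4) by auto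
  ultimately show ?thesis using W(1,2) sub by (intro exI[of _ W] exI[of _ ?B] conjI)
qed

text \<open>Expansions in powers of \<open>f\<close>, with representatives modulo \<open>f\<close>
  as digits, are pairwise distinct and have poles bounded by \<open>n\<close> times the pole divisor
  plus a fixed \<open>C\<close>. Comparing their number with the size of that Riemann-Roch space and
  taking n-th roots removes \<open>C\<close>.\<close>

lemma norm_zeros_le_norm_poles:
  assumes f: "f \<in> carrier R" "f \<noteq> \<zero>"
  shows "divisor_norm R (zeros f) \<le> divisor_norm R (poles f)"
proof -
  obtain W B where W: "finite W" "card W = divisor_norm R (zeros f)" "W \<subseteq> B" "B \<subseteq> carrier R" "subring B R"
      "\<And>a. a \<in> B \<Longrightarrow> f \<otimes> a \<in> B" "\<And>w w' a. w \<in> W \<Longrightarrow> w' \<in> W \<Longrightarrow> a \<in> B \<Longrightarrow> w \<ominus> w' = f \<otimes> a \<Longrightarrow> w = w'"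
    using zero_representatives[OF f] by metis
  have Wc: "W \<subseteq> carrier R" using W by auto
  have EB: "expansions R W f n \<subseteq> B" for n
  proof (induction n)
    case (Suc n)
    then show ?case using W(3,6) by (auto intro!: subringE(7)[OF W(5)])
  qed (use W(3) in simp)
  have inj: "w = w'" if "w \<in> W" "w' \<in> W" "m \<in> expansions R W f n" "m' \<in> expansions R W f n"
      "w \<oplus> f \<otimes> m = w' \<oplus> f \<otimes> m'" for w w' m m' n
  proof -
    have mB: "m \<in> B" "m' \<in> B" using that EB by auto
    have c: "w \<in> carrier R" "w' \<in> carrier R" "m \<in> carrier R" "m' \<in> carrier R" using that mB Wc W(4) by auto
    have "w \<ominus> w' = (w \<oplus> f \<otimes> m) \<ominus> w' \<ominus> f \<otimes> m" using c f by algebra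
    also have "\<dots> = f \<otimes> (m' \<ominus> m)" unfolding that(5) using c f by algebra
    finally have e: "w \<ominus> w' = f \<otimes> (m' \<ominus> m)" .
    have "m' \<ominus> m \<in> B" using subringE(5,7)[OF W(5)] mB by (simp add: a_minus_def)
    then show ?thesis using W(7)[OF that(1,2) _ e] by blast
  qed
  have card: "finite (expansions R W f n) \<and> card (expansions R W f n) = card W ^ Suc n" for n
  proof -
    have "expansions R W f n \<subseteq> carrier R \<and> finite (expansions R W f n) \<and> card (expansions R W f n) = card W ^ Suc n"
      by (rule card_expansions[OF W(1) Wc f]) (rule inj)
    then show ?thesis by simp
  qed
  obtain C where C: "set_mset C \<subseteq> places R" "W \<subseteq> riemann_roch_space R (\<lambda>v. int (count C v))"
    using finite_set_in_riemann_roch_space[OF W(1) Wc] by blast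
  have "card W ^ Suc n \<le> (divisor_norm R C * card constants) * divisor_norm R (poles f) ^ n" for n
  proof -
    let ?D = "repeat_mset n (poles f) + C"
    have D: "set_mset ?D \<subseteq> places R"
      using C(1) set_zeros[of "inv f"] f set_repeat_mset_subset[of n "poles f"] by auto
    have "card W ^ Suc n \<le> card (riemann_roch_space R (\<lambda>v. int (count ?D v)))"
      using card_mono[OF card_riemann_roch_space_le(1)[OF D] expansions_in_riemann_roch_space[OF C(2) f]] card by metis
    also have "\<dots> \<le> divisor_norm R ?D * card constants" by (rule card_riemann_roch_space_le(2)[OF D])
    finally show ?thesis by (simp add: ac_simps)
  qed
  then show ?thesis using W(2) le_of_power_le by metis
qed

theorem product_formula:
  assumes "f \<in> carrier R" "f \<noteq> \<zero>"
  shows "divisor_norm R (zeros f) = divisor_norm R (poles f)"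
proof (rule antisym)
  have "inv (inv f) = f" using assms by (simp add: field_Units)
  then show "divisor_norm R (poles f) \<le> divisor_norm R (zeros f)"
    using norm_zeros_le_norm_poles[of "inv f"] assms by simp
qed (rule norm_zeros_le_norm_poles[OF assms])

text \<open>The poles of \<open>x\<close> are the zeros of \<open>1/x\<close>, and for the modulus
  \<open>1/x\<close> the multiplier \<open>x\<close> works with \<open>c = 1\<close>: multiplied by
  \<open>x\<close> a digit has length 1, and multiplied by \<open>1/x * x\<close> it is unchanged.
  The lower bound 2 makes the norm usable as a base of exponential growth.\<close>

lemma norm_poles_x: "2 \<le> divisor_norm R (poles x)" "divisor_norm R (poles x) \<le> card V"
proof -
  have ix: "inv x \<in> carrier R" "inv x \<noteq> \<zero>" using x_carrier x_nonzero by auto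
  obtain W B where W: "finite W" "card W = divisor_norm R (poles x)" "W \<subseteq> B" "B \<subseteq> carrier R" "subring B R"
      "\<And>a. a \<in> B \<Longrightarrow> inv x \<otimes> a \<in> B" "\<And>w w' a. w \<in> W \<Longrightarrow> w' \<in> W \<Longrightarrow> a \<in> B \<Longrightarrow> w \<ominus> w' = inv x \<otimes> a \<Longrightarrow> w = w'"
    using zero_representatives[OF ix] by metis
  have "card W \<le> card V ^ 1"
  proof (rule card_incongruent_le[OF ix x_carrier x_nonzero])
    show "x \<otimes> w \<in> M 1" if "w \<in> V" for w using M_mult_x[of w 0] that by simp
    show "inv x \<otimes> x \<otimes> w \<in> M 1" if w: "w \<in> V" for w
    proof -
      have "w \<in> carrier R" using w V_carrier by auto
      then show ?thesis using M_mono[of 0 1] w x_carrier x_nonzero by auto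
    qed
    show "a \<ominus> b \<in> B" if "a \<in> B" "b \<in> B" for a b
      using subringE(5,7)[OF W(5)] that by (simp add: a_minus_def)
  qed (use W in blast)+
  then show "divisor_norm R (poles x) \<le> card V" using W(2) by simp
  obtain v where v: "v \<in> places R" "v x < 0"
    using x_not_constant x_carrier by (auto simp: riemann_roch_space_zero_iff)
  then have "v \<in># poles x" using set_zeros[OF ix] place_inv[OF v(1) x_carrier x_nonzero] by auto
  then have "size (poles x) \<ge> 1" by (metis One_nat_def Suc_leI nonempty_has_size empty_iff set_mset_empty)
  then have "(2::nat) ^ 1 \<le> 2 ^ size (poles x)" by (intro power_increasing) auto
  also have "\<dots> \<le> divisor_norm R (poles x)" using divisor_norm_ge_power[of "poles x"] set_zeros[OF ix] by auto
  finally show "2 \<le> divisor_norm R (poles x)" by simp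
qed

text \<open>The expansions of length \<open>n\<close> in \<open>x\<close> themselves fill the space:
  \<open>B\<close> is the pole divisor of \<open>x\<close> and \<open>C\<close> absorbs the poles of
  the digits, taking the place of the genus. The estimate concerns only the divisors
  \<open>n B + C\<close>.\<close>

theorem riemann_inequality:
  "\<exists>B C. set_mset B \<subseteq> places R \<and> set_mset C \<subseteq> places R \<and> 2 \<le> divisor_norm R B \<and>
    (\<forall>n. divisor_norm R B ^ Suc n \<le> card (riemann_roch_space R (\<lambda>v. int (count (repeat_mset n B + C) v))))"
proof -
  obtain C where C: "set_mset C \<subseteq> places R" "V \<subseteq> riemann_roch_space R (\<lambda>v. int (count C v))"
    using finite_set_in_riemann_roch_space[OF V_finite V_carrier] by blast
  have B: "set_mset (poles x) \<subseteq> places R" using set_zeros[of "inv x"] x_carrier x_nonzero by auto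
  have "divisor_norm R (poles x) ^ Suc n
      \<le> card (riemann_roch_space R (\<lambda>v. int (count (repeat_mset n (poles x) + C) v)))" for n
  proof -
    have D: "set_mset (repeat_mset n (poles x) + C) \<subseteq> places R"
      using B C(1) set_repeat_mset_subset[of n "poles x"] by auto
    have "divisor_norm R (poles x) ^ Suc n \<le> card V ^ Suc n" using norm_poles_x(2) by (rule power_mono) simp
    also have "\<dots> = card (M n)" by (simp only: M_card)
    also have "\<dots> \<le> card (riemann_roch_space R (\<lambda>v. int (count (repeat_mset n (poles x) + C) v)))"
      using expansions_in_riemann_roch_space[OF C(2) x_carrier x_nonzero]
      by (intro card_mono card_riemann_roch_space_le(1)[OF D])
    finally show ?thesis .
  qed
  then show ?thesis using B C(1) norm_poles_x(1) by blast
qed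

end

section \<open>Counting effective divisors\<close>

context expansion_field
begin

definition effective_divisors :: "('a \<Rightarrow> int) multiset set" where
  "effective_divisors = {D. set_mset D \<subseteq> places R}"

text \<open>This is A + div f. Subtraction of multisets truncates at 0, and membership of
  \<open>f\<close> in L(A) is what makes it the true difference; the norm is then unchanged by the
  product formula.\<close>

lemma divisor_of_function:
  assumes f: "f \<in> carrier R" "f \<noteq> \<zero>" and A: "set_mset A \<subseteq> places R"
    and fA: "f \<in> riemann_roch_space R (\<lambda>v. int (count A v))"
  shows "A + zeros f - poles f \<in> effective_divisors"
    "divisor_norm R (A + zeros f - poles f) = divisor_norm R A"
    "v \<in> places R \<Longrightarrow> int (count (A + zeros f - poles f) v) = int (count A v) + v f"
proof -
  have cnt: "int (count (A + zeros f - poles f) v) = int (count A v) + v f"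
    and le: "count (poles f) v \<le> count (A + zeros f) v" if v: "v \<in> places R" for v
  proof -
    have "- v f \<le> int (count A v)" using fA f v by (auto simp: riemann_roch_space_def vball_def)
    then show "int (count (A + zeros f - poles f) v) = int (count A v) + v f"
      "count (poles f) v \<le> count (A + zeros f) v"
      using v count_zeros[OF f, of v] count_poles[OF f, of v] by auto
  qed
  show "v \<in> places R \<Longrightarrow> int (count (A + zeros f - poles f) v) = int (count A v) + v f" by (rule cnt)
  show "A + zeros f - poles f \<in> effective_divisors"
    using A set_zeros[OF f] set_mset_mono[OF diff_subset_eq_self[of "A + zeros f" "poles f"]]
    by (auto simp: effective_divisors_def simp del: set_mset_mono)
  have "count (poles f) v \<le> count (A + zeros f) v" for v
  proof (cases "v \<in> places R")
    case False
    then have "count (poles f) v = 0" using count_poles[OF f, of v] by simp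
    then show ?thesis by simp
  qed (rule le)
  then have "poles f \<subseteq># A + zeros f" by (simp add: mset_subset_eqI)
  then have "(A + zeros f - poles f) + poles f = A + zeros f" by simp
  then have "divisor_norm R (A + zeros f - poles f) * divisor_norm R (poles f) = divisor_norm R A * divisor_norm R (zeros f)"
    by (metis divisor_norm_simps(3))
  moreover have "divisor_norm R (poles f) > 0" using set_zeros[of "inv f"] f by (intro divisor_norm_pos) auto
  ultimately show "divisor_norm R (A + zeros f - poles f) = divisor_norm R A"
    using product_formula[OF f] by simp
qed

context
  fixes B C
  assumes B: "set_mset B \<subseteq> places R" and C: "set_mset C \<subseteq> places R" and B2: "2 \<le> divisor_norm R B"
    and large: "\<And>n. divisor_norm R B ^ Suc n \<le> card (riemann_roch_space R (\<lambda>v. int (count (repeat_mset n B + C) v)))"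
begin

private abbreviation "b \<equiv> divisor_norm R B"
private abbreviation "A n \<equiv> repeat_mset n B + C"
private abbreviation "L n \<equiv> riemann_roch_space R (\<lambda>v. int (count (A n) v))"

private lemma A_places: "set_mset (A n) \<subseteq> places R"
  using B C set_repeat_mset_subset[of n B] by auto

private lemma L: "finite (L n)" "card (L n) \<le> b ^ n * divisor_norm R C * card constants"
  using card_riemann_roch_space_le[OF A_places[of n]] by auto

text \<open>L(A n) has more elements than there are classes modulo \<open>D\<close>, so two of its
  elements differ by a nonzero function vanishing along \<open>D\<close>.\<close>

private lemma multiple_of_divisor:
  assumes D: "D \<in> effective_divisors" "divisor_norm R D < b ^ Suc n"
  shows "\<exists>f\<in>L n. f \<noteq> \<zero> \<and> D \<subseteq># A n + zeros f - poles f"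
proof -
  have Lc: "L n \<subseteq> carrier R" by (auto simp: riemann_roch_space_def)
  have "divisor_norm R D * 1 < card (L n)" using D large[of n] by simp
  then have "\<exists>A'\<subseteq>L n. 1 < card A' \<and>
    (\<forall>f\<in>A'. \<forall>g\<in>A'. f \<ominus> g \<in> riemann_roch_space R (\<lambda>v. int (count (A n) v) - int (count D v)))"
    using D by (intro pigeonhole_divisor finite_residue_classes L(1) Lc riemann_roch_space_minus)
      (auto simp: effective_divisors_def)
  then obtain A' where A': "A' \<subseteq> L n" "1 < card A'"
      "\<forall>f\<in>A'. \<forall>g\<in>A'. f \<ominus> g \<in> riemann_roch_space R (\<lambda>v. int (count (A n) v) - int (count D v))"
    by (elim exE conjE) (rule that)
  obtain f g where fg: "f \<in> A'" "g \<in> A'" "f \<noteq> g"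
    using A'(2) by (metis card_le_Suc0_iff_eq card.infinite One_nat_def not_le not_one_less_zero)
  let ?h = "f \<ominus> g"
  have fgL: "f \<in> L n" "g \<in> L n" using fg A'(1) by auto
  then have c: "f \<in> carrier R" "g \<in> carrier R" using Lc by auto
  have h: "?h \<in> carrier R" "?h \<noteq> \<zero>" "?h \<in> L n"
    using c fg(3) riemann_roch_space_minus[OF fgL] by (auto simp: minus_eq_zero_iff)
  have "count D v \<le> count (A n + zeros ?h - poles ?h) v" for v
  proof (cases "v \<in> places R")
    case True
    have "int (count D v) - int (count (A n) v) \<le> v ?h"
      using A'(3)[rule_format, OF fg(1,2)] h True by (auto simp: riemann_roch_space_def vball_def)
    then show ?thesis using divisor_of_function(3)[OF h(1,2) A_places h(3) True] by linarith
  next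
    case False
    then have "v \<notin># D" using D(1) by (auto simp: effective_divisors_def)
    then show ?thesis by (simp add: not_in_iff)
  qed
  then have "D \<subseteq># A n + zeros ?h - poles ?h" by (rule mset_subset_eqI)
  then show ?thesis using h(2,3) by (intro bexI[of _ ?h] conjI)
qed

text \<open>As \<open>k < b ^ Suc k\<close>, every such place occurs in one of the divisors A k +
  div f, and there are only finitely many \<open>f\<close> in L(A k).\<close>

private lemma bounded_norm_places_finite: "finite {v \<in> places R. place_norm R v \<le> k}"
proof -
  have "k < 2 ^ k" by (rule less_exp)
  also have "(2::nat) ^ k \<le> b ^ k" using B2 by (rule power_mono) simp
  also have "b ^ k \<le> b ^ Suc k" using B2 by simp
  finally have "k < b ^ Suc k" .
  have "{v \<in> places R. place_norm R v \<le> k} \<subseteq> (\<Union>f\<in>L k - {\<zero>}. set_mset (A k + zeros f))"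
  proof
    fix v assume v: "v \<in> {v \<in> places R. place_norm R v \<le> k}"
    then have "{#v#} \<in> effective_divisors" "divisor_norm R {#v#} < b ^ Suc k"
      using \<open>k < b ^ Suc k\<close> by (auto simp: effective_divisors_def)
    then obtain f where f: "f \<in> L k" "f \<noteq> \<zero>" "{#v#} \<subseteq># A k + zeros f - poles f"
      using multiple_of_divisor by blast
    then have "v \<in># A k + zeros f - poles f" by (meson mset_subset_eqD union_single_eq_member multi_member_this)
    then have "v \<in># A k + zeros f" by (rule in_diffD)
    then show "v \<in> (\<Union>f\<in>L k - {\<zero>}. set_mset (A k + zeros f))" using f by blast
  qed
  then show ?thesis by (rule finite_subset) (use L(1)[of k] in simp)
qed

private lemma bounded_norm_finite: "finite {D \<in> effective_divisors. divisor_norm R D \<le> k}"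
proof -
  let ?S = "{v \<in> places R. place_norm R v \<le> k}"
  have "{D \<in> effective_divisors. divisor_norm R D \<le> k} \<subseteq> (\<Union>n\<in>{..k}. {D. set_mset D \<subseteq> ?S \<and> size D = n})"
  proof
    fix D assume D: "D \<in> {D \<in> effective_divisors. divisor_norm R D \<le> k}"
    then have Dp: "set_mset D \<subseteq> places R" by (simp add: effective_divisors_def)
    have "size D < 2 ^ size D" by (rule less_exp)
    then have "size D \<le> k" using divisor_norm_ge_power[OF Dp] D by (simp, linarith)
    moreover have "place_norm R v \<le> k" if v: "v \<in># D" for v
    proof -
      obtain D' where D': "D = add_mset v D'" using v by (metis insert_DiffM)
      have "place_norm R v * 1 \<le> place_norm R v * divisor_norm R D'"
        using divisor_norm_pos[of D'] Dp D' by (intro mult_le_mono2) auto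
      also have "\<dots> \<le> k" using D D' by simp
      finally show ?thesis by simp
    qed
    ultimately show "D \<in> (\<Union>n\<in>{..k}. {D. set_mset D \<subseteq> ?S \<and> size D = n})" using Dp by auto
  qed
  moreover have "finite {D. set_mset D \<subseteq> ?S \<and> size D = n}" for n
    using finite_multisets_of_size[OF bounded_norm_places_finite[of k], of n] by (simp add: multisets_of_size_def)
  ultimately show ?thesis by (meson finite_UN finite_atMost finite_subset)
qed

text \<open>\<open>D\<close> is recovered from \<open>f\<close> and the complement of
  \<open>D\<close> in A n + div f. The whole divisor has norm \<open>b ^ n\<close> times the norm of
  \<open>C\<close>, so the complement has norm at most that of \<open>C\<close>: finitely many
  complements, independently of \<open>n\<close>, and O(\<open>b ^ n\<close>) functions.\<close>

private lemma card_norm_range: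
  "card {D \<in> effective_divisors. b ^ n \<le> divisor_norm R D \<and> divisor_norm R D < b ^ Suc n}
    \<le> b ^ n * (divisor_norm R C * card constants * card {D \<in> effective_divisors. divisor_norm R D \<le> divisor_norm R C})"
proof -
  let ?R = "{D \<in> effective_divisors. b ^ n \<le> divisor_norm R D \<and> divisor_norm R D < b ^ Suc n}"
  let ?K = "{D \<in> effective_divisors. divisor_norm R D \<le> divisor_norm R C}"
  have "?R \<subseteq> (\<lambda>(f, D'). (A n + zeros f - poles f) - D') ` (L n \<times> ?K)"
  proof
    fix D assume D: "D \<in> ?R"
    then obtain f where f: "f \<in> L n" "f \<noteq> \<zero>" "D \<subseteq># A n + zeros f - poles f"
      using multiple_of_divisor by auto
    have fc: "f \<in> carrier R" using f by (simp add: riemann_roch_space_def)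
    let ?E = "A n + zeros f - poles f"
    have E: "?E \<in> effective_divisors" "divisor_norm R ?E = b ^ n * divisor_norm R C"
      using divisor_of_function(1,2)[OF fc f(2) A_places f(1)] by auto
    have "divisor_norm R D * divisor_norm R (?E - D) = divisor_norm R ?E"
      using f(3) by (metis divisor_norm_simps(3) subset_mset.add_diff_inverse)
    then have "b ^ n * divisor_norm R (?E - D) \<le> b ^ n * divisor_norm R C"
      using D E(2) by (metis (mono_tags, lifting) mem_Collect_eq mult_le_mono1)
    then have "divisor_norm R (?E - D) \<le> divisor_norm R C" using B2 by simp
    moreover have "?E - D \<in> effective_divisors"
      using E(1) set_mset_mono[OF diff_subset_eq_self[of ?E D]] unfolding effective_divisors_def by blast
    moreover have "D = ?E - (?E - D)"
    proof -
      have "?E = D + (?E - D)" using f(3) by (metis subset_mset.add_diff_inverse)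
      then show ?thesis by (metis add_diff_cancel_right')
    qed
    ultimately show "D \<in> (\<lambda>(f, D'). (A n + zeros f - poles f) - D') ` (L n \<times> ?K)"
      using f(1) by (intro image_eqI[of _ _ "(f, ?E - D)"]) auto
  qed
  then have "card ?R \<le> card (L n \<times> ?K)"
    using L(1)[of n] bounded_norm_finite[of "divisor_norm R C"] by (intro surj_card_le) auto
  also have "\<dots> \<le> (b ^ n * divisor_norm R C * card constants) * card ?K"
    unfolding card_cartesian_product using L(2)[of n] by (rule mult_le_mono1)
  finally show ?thesis by (simp add: ac_simps)
qed

text \<open>Nonzero functions in L(A n) with the same divisor have a constant quotient, so at most
  \<open>card constants\<close> of them share a divisor.\<close>

private lemma card_norm_eq:
  "b ^ n \<le> card constants * card {D \<in> effective_divisors. divisor_norm R D = b ^ n * divisor_norm R C}"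
proof -
  let ?E = "{D \<in> effective_divisors. divisor_norm R D = b ^ n * divisor_norm R C}"
  let ?g = "\<lambda>f. A n + zeros f - poles f"
  have fin: "finite ?E"
    by (rule finite_subset[OF _ bounded_norm_finite[of "b ^ n * divisor_norm R C"]]) auto
  have Lc: "L n \<subseteq> carrier R" by (auto simp: riemann_roch_space_def)
  have im: "?g ` (L n - {\<zero>}) \<subseteq> ?E"
    using divisor_of_function(1,2)[OF _ _ A_places] Lc by auto
  have fibre: "card {f \<in> L n - {\<zero>}. ?g f = D} \<le> card constants" for D
  proof (cases "{f \<in> L n - {\<zero>}. ?g f = D} = {}")
    case False
    then obtain f0 where f0: "f0 \<in> L n" "f0 \<noteq> \<zero>" "?g f0 = D" by auto
    have f0c: "f0 \<in> carrier R" using f0 Lc by auto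
    have "f \<otimes> inv f0 \<in> constants" if f: "f \<in> L n" "f \<noteq> \<zero>" "?g f = D" for f
    proof -
      have fc: "f \<in> carrier R" using f Lc by auto
      have eq: "v f = v f0" if v: "v \<in> places R" for v
        using divisor_of_function(3)[OF fc f(2) A_places f(1) v]
          divisor_of_function(3)[OF f0c f0(2) A_places f0(1) v] f(3) f0(3) by simp
      have "0 \<le> v (f \<otimes> inv f0)" if v: "v \<in> places R" for v
        using eq[OF v] place_mult[OF v fc f(2), of "inv f0"] place_inv[OF v f0c f0(2)] f0c f0(2) by simp
      then show ?thesis using fc f0c f0 by (simp add: riemann_roch_space_zero_iff)
    qed
    moreover have "inj_on (\<lambda>f. f \<otimes> inv f0) {f \<in> L n - {\<zero>}. ?g f = D}"
    proof (rule inj_onI)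
      fix f g assume "f \<in> {f \<in> L n - {\<zero>}. ?g f = D}" "g \<in> {f \<in> L n - {\<zero>}. ?g f = D}" "f \<otimes> inv f0 = g \<otimes> inv f0"
      moreover then have "f \<in> carrier R" "g \<in> carrier R" using Lc by auto
      ultimately show "f = g" using f0c f0(2) m_rcancel[of "inv f0" f g] by simp
    qed
    ultimately show ?thesis using finite_constants by (intro card_inj_on_le) auto
  qed (simp only: card.empty le0)
  have card: "card (L n - {\<zero>}) \<le> card ?E * card constants"
  proof (rule ccontr)
    assume "\<not> ?thesis"
    then obtain D where "card constants < card {f \<in> L n - {\<zero>}. ?g f = D}"
      using large_fibre[of "L n - {\<zero>}" ?g ?E "card constants"] L(1)[of n] im fin by auto
    then show False using fibre[of D] by simp
  qed
  \<comment> \<open>Since \<open>b \<ge> 2\<close>, the bound \<open>b ^ Suc n\<close> leaves room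
    for dropping the zero function and still having \<open>b ^ n\<close> elements.\<close>
  have "b ^ n + 1 \<le> b ^ n + b ^ n" using B2 by simp
  also have "\<dots> = 2 * b ^ n" by simp
  also have "\<dots> \<le> b * b ^ n" using B2 by (rule mult_le_mono1)
  also have "\<dots> = b ^ Suc n" by simp
  also have "\<dots> \<le> card (L n)" by (rule large)
  finally have "b ^ n + 1 \<le> card (L n)" .
  moreover have "card (L n) - card {\<zero>} \<le> card (L n - {\<zero>})" by (rule diff_card_le_card_Diff) simp
  ultimately have "b ^ n \<le> card (L n - {\<zero>})" by simp
  then show ?thesis using card by (simp add: mult.commute)
qed

text \<open>Norms are grouped into ranges from \<open>b ^ i\<close> to \<open>b ^ Suc i\<close>; a
  range contains at most \<open>K * b ^ i\<close> divisors, each contributing at most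
  \<open>1 / b ^ i\<close>.\<close>

private lemma sum_inverse_norm_le:
  "\<exists>K::real. \<forall>n \<D>. \<D> \<subseteq> {D \<in> effective_divisors. divisor_norm R D < b ^ n} \<longrightarrow>
    finite \<D> \<and> (\<Sum>D\<in>\<D>. 1 / real (divisor_norm R D)) \<le> K * real n"
proof -
  define K where "K = real (divisor_norm R C * card constants * card {D \<in> effective_divisors. divisor_norm R D \<le> divisor_norm R C})"
  let ?S = "\<lambda>n. {D \<in> effective_divisors. divisor_norm R D < b ^ n}"
  have fin: "finite (?S n)" for n
    by (rule finite_subset[OF _ bounded_norm_finite[of "b ^ n"]]) auto
  have main: "(\<Sum>D\<in>?S n. 1 / real (divisor_norm R D)) \<le> K * real n" for n
  proof (induction n)
    case 0
    have "?S 0 = {}" using divisor_norm_pos by (auto simp: effective_divisors_def)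
    then show ?case by (simp only: sum.empty of_nat_0 mult_zero_right order_refl)
  next
    case (Suc n)
    let ?R = "{D \<in> effective_divisors. b ^ n \<le> divisor_norm R D \<and> divisor_norm R D < b ^ Suc n}"
    have "b ^ n \<le> b ^ Suc n" using B2 by simp
    then have split: "?S (Suc n) = ?S n \<union> ?R" by (auto simp del: power_Suc)
    have finR: "finite ?R" using fin[of "Suc n"] by (rule finite_subset[rotated]) auto
    have bn: "real (b ^ n) > 0" using B2 by simp
    have "(\<Sum>D\<in>?R. 1 / real (divisor_norm R D)) \<le> (\<Sum>D\<in>?R. 1 / real (b ^ n))"
    proof (intro sum_mono divide_left_mono)
      fix D assume D: "D \<in> ?R"
      then show "real (b ^ n) \<le> real (divisor_norm R D)" by (simp only: mem_Collect_eq of_nat_le_iff)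
      have "divisor_norm R D > 0" using D divisor_norm_pos[of D] by (simp add: effective_divisors_def)
      then show "0 < real (divisor_norm R D) * real (b ^ n)" using bn by simp
    qed simp
    also have "\<dots> = real (card ?R) / real (b ^ n)" by simp
    also have "\<dots> \<le> K"
    proof -
      have "real (card ?R) \<le> real (b ^ n) * K"
        unfolding K_def using card_norm_range[of n] by (simp only: of_nat_mult[symmetric] of_nat_le_iff)
      then show ?thesis using bn by (simp add: divide_le_eq mult.commute)
    qed
    finally have "(\<Sum>D\<in>?R. 1 / real (divisor_norm R D)) \<le> K" .
    moreover have "(\<Sum>D\<in>?S (Suc n). 1 / real (divisor_norm R D)) =
        (\<Sum>D\<in>?S n. 1 / real (divisor_norm R D)) + (\<Sum>D\<in>?R. 1 / real (divisor_norm R D))"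
    proof -
      have "?S n \<inter> ?R = {}" by (auto simp only: Int_iff mem_Collect_eq not_le[symmetric])
      then show ?thesis unfolding split by (rule sum.union_disjoint[OF fin finR])
    qed
    ultimately show ?case using Suc by (simp only: of_nat_Suc distrib_left mult_1_right)
  qed
  have "finite \<D> \<and> (\<Sum>D\<in>\<D>. 1 / real (divisor_norm R D)) \<le> K * real n" if "\<D> \<subseteq> ?S n" for n \<D>
  proof
    show "finite \<D>" using that fin by (rule finite_subset)
    have "(\<Sum>D\<in>\<D>. 1 / real (divisor_norm R D)) \<le> (\<Sum>D\<in>?S n. 1 / real (divisor_norm R D))"
      by (rule sum_mono2[OF fin that]) simp
    then show "(\<Sum>D\<in>\<D>. 1 / real (divisor_norm R D)) \<le> K * real n" using main[of n] by (rule order_trans)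
  qed
  then show ?thesis by blast
qed

text \<open>Raising \<open>n\<close> by one adds at least the divisors of the single norm
  \<open>b ^ Suc n\<close> times the norm of \<open>C\<close>. There are enough of them to
  contribute the fixed amount \<open>c\<close>.\<close>

private lemma sum_inverse_norm_ge:
  "\<exists>c>0. \<forall>n. c * real n \<le> (\<Sum>D\<in>{D \<in> effective_divisors. divisor_norm R D \<le> b ^ n * divisor_norm R C}. 1 / real (divisor_norm R D))"
proof -
  define c where "c = 1 / (real (card constants) * real (divisor_norm R C))"
  have Cpos: "divisor_norm R C > 0" using C by (rule divisor_norm_pos)
  have c: "c > 0" using card_constants_pos Cpos by (simp add: c_def)
  let ?S = "\<lambda>n. {D \<in> effective_divisors. divisor_norm R D \<le> b ^ n * divisor_norm R C}"
  have fin: "finite (?S n)" for n by (rule bounded_norm_finite)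
  have "c * real n \<le> (\<Sum>D\<in>?S n. 1 / real (divisor_norm R D))" for n
  proof (induction n)
    case 0
    show ?case by (simp add: sum_nonneg)
  next
    case (Suc n)
    let ?k = "b ^ Suc n * divisor_norm R C"
    let ?E = "{D \<in> effective_divisors. divisor_norm R D = ?k}"
    have kpos: "real ?k > 0" using B2 Cpos by simp
    have finE: "finite ?E" using fin[of "Suc n"] by (rule finite_subset[rotated]) auto
    have "b ^ n < b ^ Suc n" using B2 by simp
    then have lt: "b ^ n * divisor_norm R C < ?k" using Cpos by simp
    have "c = real (b ^ Suc n) / (real (card constants) * real ?k)"
      using B2 by (simp add: c_def)
    also have "\<dots> \<le> (real (card constants) * real (card ?E)) / (real (card constants) * real ?k)"
      using card_norm_eq[of "Suc n"] kpos card_constants_pos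
      by (intro divide_right_mono) (simp_all only: of_nat_mult[symmetric] of_nat_le_iff of_nat_0_le_iff)
    also have "\<dots> = real (card ?E) / real ?k" using card_constants_pos by simp
    also have "\<dots> = (\<Sum>D\<in>?E. 1 / real (divisor_norm R D))" by simp
    finally have "c \<le> (\<Sum>D\<in>?E. 1 / real (divisor_norm R D))" .
    moreover have "(\<Sum>D\<in>?S n \<union> ?E. 1 / real (divisor_norm R D)) =
        (\<Sum>D\<in>?S n. 1 / real (divisor_norm R D)) + (\<Sum>D\<in>?E. 1 / real (divisor_norm R D))"
    proof (rule sum.union_disjoint[OF fin finE])
      show "?S n \<inter> ?E = {}" using lt by (auto simp del: power_Suc mult_less_cancel2)
    qed
    moreover have "(\<Sum>D\<in>?S n \<union> ?E. 1 / real (divisor_norm R D)) \<le> (\<Sum>D\<in>?S (Suc n). 1 / real (divisor_norm R D))"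
    proof (rule sum_mono2[OF fin])
      show "?S n \<union> ?E \<subseteq> ?S (Suc n)"
        using lt by (auto simp only: Un_iff mem_Collect_eq order_refl intro: order_trans[OF _ less_imp_le])
    qed simp
    ultimately show ?case using Suc by (simp only: of_nat_Suc distrib_left mult_1_right)
  qed
  then show ?thesis using c by blast
qed

lemmas counting_aux = B2 bounded_norm_finite sum_inverse_norm_le sum_inverse_norm_ge

end

theorem sum_inverse_norm_upper:
  "\<exists>b\<ge>2. \<exists>K::real. \<forall>n \<D>. \<D> \<subseteq> {D \<in> effective_divisors. divisor_norm R D < b ^ n} \<longrightarrow>
    finite \<D> \<and> (\<Sum>D\<in>\<D>. 1 / real (divisor_norm R D)) \<le> K * real n"
proof -
  obtain B C where *: "set_mset B \<subseteq> places R" "set_mset C \<subseteq> places R" "2 \<le> divisor_norm R B"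
    "\<forall>n. divisor_norm R B ^ Suc n \<le> card (riemann_roch_space R (\<lambda>v. int (count (repeat_mset n B + C) v)))"
    using riemann_inequality by (elim exE conjE) (rule that)
  show ?thesis using *(3) by (intro exI[of _ "divisor_norm R B"] conjI counting_aux(3)[OF *(1-3) *(4)[rule_format]])
qed
theorem finite_bounded_norm: "finite {D \<in> effective_divisors. divisor_norm R D \<le> k}"
proof -
  obtain B C where *: "set_mset B \<subseteq> places R" "set_mset C \<subseteq> places R" "2 \<le> divisor_norm R B"
    "\<forall>n. divisor_norm R B ^ Suc n \<le> card (riemann_roch_space R (\<lambda>v. int (count (repeat_mset n B + C) v)))"
    using riemann_inequality by (elim exE conjE) (rule that)
  show ?thesis by (rule counting_aux(2)[OF *(1-3) *(4)[rule_format]])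
qed

theorem sum_inverse_norm_lower:
  "\<exists>b\<ge>2. \<exists>N::nat. \<exists>c::real. c > 0 \<and> (\<forall>n. c * real n \<le>
    (\<Sum>D\<in>{D \<in> effective_divisors. divisor_norm R D \<le> b ^ n * N}. 1 / real (divisor_norm R D)))"
proof -
  obtain B C where *: "set_mset B \<subseteq> places R" "set_mset C \<subseteq> places R" "2 \<le> divisor_norm R B"
    "\<forall>n. divisor_norm R B ^ Suc n \<le> card (riemann_roch_space R (\<lambda>v. int (count (repeat_mset n B + C) v)))"
    using riemann_inequality by (elim exE conjE) (rule that)
  show ?thesis using *(3)
    by (intro exI[of _ "divisor_norm R B"] exI[of _ "divisor_norm R C"] conjI counting_aux(4)[OF *(1-3) *(4)[rule_format]])
qed

end

section \<open>Finite extensions of a rational function field\<close>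

lemma (in ring) dimension_of_subring:
  assumes "subring H R"
  shows "ring.dimension (R\<lparr>carrier := H\<rparr>) n K W \<Longrightarrow> dimension n K W"
proof -
  interpret H: ring "R\<lparr>carrier := H\<rparr>" by (rule subring_is_ring[OF assms])
  show "H.dimension n K W \<Longrightarrow> dimension n K W"
  proof (induction n K W rule: H.dimension.induct)
    case (Suc_dim v W n K)
    have "v \<in> carrier R" using Suc_dim(1) subringE(1)[OF assms] by auto
    then show ?case using Suc_dim dimension.Suc_dim line_extension_consistent[OF assms] by metis
  qed simp
qed

lemma (in field) a_inv_subring:
  assumes "subring H R" "b \<in> H" shows "\<ominus>\<^bsub>R\<lparr>carrier := H\<rparr>\<^esub> b = \<ominus> b"
proof -
  interpret H: ring "R\<lparr>carrier := H\<rparr>" by (rule subring_is_ring[OF assms(1)])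
  have "b \<in> carrier R" "\<ominus> b \<in> H" using assms subringE(1,5)[OF assms(1)] by auto
  then show ?thesis using H.minus_equality[of "\<ominus> b" b] assms(2) by (simp add: l_neg)
qed

lemma (in field) minus_subring:
  assumes "subring H R" "b \<in> H" shows "a \<ominus>\<^bsub>R\<lparr>carrier := H\<rparr>\<^esub> b = a \<ominus> b"
  using a_inv_subring[OF assms] by (simp add: a_minus_def)

lemma expansions_subring [simp]: "expansions (R\<lparr>carrier := H\<rparr>) V x n = expansions R V x n"
  by (induction n) auto

context field
begin

lemma normalize_eq_Nil: "normalize p = [] \<Longrightarrow> set p \<subseteq> {\<zero>}"
  by (induction p) (auto split: if_splits)

text \<open>This supplies digit uniqueness in the rational function field: a vanishing expansion in
  a transcendental element has vanishing coefficients.\<close>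

lemma transcendental_expansion_unique:
  assumes k: "subring k R" and x: "x \<in> carrier R" "(transcendental over k) x"
    and c: "c \<in> k" and a: "a \<in> expansions R k x n" and eq: "c \<oplus> x \<otimes> a = \<zero>"
  shows "c = \<zero>"
proof -
  have "a \<in> simple_extension k x" using simple_extension_eq_expansions[OF k x(1)] a by auto
  then obtain p where p: "p \<in> carrier (k[X])" "a = eval p x"
    using simple_extension_as_eval_img[OF subringE(1)[OF k] x(1)] by auto
  have ps: "set p \<subseteq> k" using p(1) by (simp add: univ_poly_carrier[symmetric] polynomial_incl)
  then have pc: "set p \<subseteq> carrier R" "c \<in> carrier R" using subringE(1)[OF k] c by auto
  have ac: "a \<in> carrier R" using p(2) eval_in_carrier[OF pc(1) x(1)] by simp
  \<comment> \<open>Coefficient lists begin with the leading coefficient, so appending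
    \<open>c\<close> forms X p + c. An empty normal form then means that all entries are zero,
    \<open>c\<close> included.\<close>
  have "eval (normalize (p @ [c])) x = eval p x \<otimes> x \<oplus> c"
    using eval_append_aux[of p c x] eval_normalize[of "p @ [c]" x] x(1) pc by auto
  also have "\<dots> = c \<oplus> x \<otimes> a" using p(2) ac pc x(1) by (simp add: m_comm a_comm)
  finally have "eval (normalize (p @ [c])) x = \<zero>" using eq by simp
  moreover have "normalize (p @ [c]) \<in> carrier (k[X])"
    using normalize_gives_polynomial[of "p @ [c]" k] ps c univ_poly_carrier by auto
  ultimately have "normalize (p @ [c]) = []" using eval_transcendental[OF x(2)] by blast
  then show ?thesis using normalize_eq_Nil[of "p @ [c]"] by simp
qed

context
  fixes k x assumes k: "subfield k R" and fk: "finite k" and x: "x \<in> carrier R" "(transcendental over k) x"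
begin

private lemma ksub: "subring k R" using subfieldE(1)[OF k] .
private lemmas kc = subringE(1,2,7)[OF ksub]

private abbreviation "P \<equiv> simple_extension k x"
private lemma P: "subring P R" by (rule simple_extension_is_subring[OF ksub x(1)])
private lemmas Pc = subringE(1)[OF P]
private lemma P_exp: "P = (\<Union>n. expansions R k x n)" by (rule simple_extension_eq_expansions[OF ksub x(1)])
private abbreviation "kx \<equiv> generate_field R (insert x k)"

text \<open>k(x) is the fraction field of k[x]; the equation \<open>y \<otimes> b = a\<close> avoids
  division, and the structural induction collects denominators.\<close>

private lemma fraction: "y \<in> kx \<Longrightarrow> \<exists>a\<in>P. \<exists>b\<in>P. b \<noteq> \<zero> \<and> y \<in> carrier R \<and> y \<otimes> b = a"
proof (induction rule: generate_field.induct)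
  case one
  then show ?case using subringE(3)[OF P] by (intro bexI[of _ \<one>]) auto
next
  case (incl h)
  then have "h \<in> P" using simple_extension_mem[OF ksub x(1)] simple_extension_incl[OF kc(1) x(1)] by auto
  then show ?case using subringE(3)[OF P] Pc by (intro bexI[of _ h] bexI[of _ \<one>]) auto
next
  case (a_inv h)
  then obtain a b where *: "a \<in> P" "b \<in> P" "b \<noteq> \<zero>" "h \<in> carrier R" "h \<otimes> b = a" by blast
  have "b \<in> carrier R" using *(2) Pc by auto
  then have "(\<ominus> h) \<otimes> b = \<ominus> a" using l_minus[OF *(4)] unfolding *(5)[symmetric] by blast
  then show ?case using *(1-4) subringE(5)[OF P *(1)] by (intro bexI[of _ "\<ominus> a"] bexI[of _ b]) auto
next
  case (m_inv h)
  then obtain a b where *: "a \<in> P" "b \<in> P" "b \<noteq> \<zero>" "h \<in> carrier R" "h \<otimes> b = a" by blast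
  have c: "b \<in> carrier R" "a \<in> carrier R" using *(1,2) Pc by auto
  have "inv h \<otimes> a = (inv h \<otimes> h) \<otimes> b"
    unfolding *(5)[symmetric] using m_assoc[OF _ *(4) c(1), of "inv h"] *(4) m_inv(2) by simp
  then have "inv h \<otimes> a = b" using *(4) m_inv(2) c by simp
  moreover have "a \<noteq> \<zero>" unfolding *(5)[symmetric] using *(3,4) c m_inv(2) by simp
  ultimately show ?case using *(1,2,4) m_inv(2) by (intro bexI[of _ b] bexI[of _ a]) auto
next
  case (eng_add h g)
  obtain a b where "a \<in> P" "b \<in> P" "b \<noteq> \<zero>" "h \<in> carrier R" "h \<otimes> b = a" using eng_add.IH(1) by blast
  moreover obtain a' b' where "a' \<in> P" "b' \<in> P" "b' \<noteq> \<zero>" "g \<in> carrier R" "g \<otimes> b' = a'"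
    using eng_add.IH(2) by blast
  ultimately have *: "a \<in> P" "b \<in> P" "b \<noteq> \<zero>" "h \<in> carrier R" "h \<otimes> b = a"
    "a' \<in> P" "b' \<in> P" "b' \<noteq> \<zero>" "g \<in> carrier R" "g \<otimes> b' = a'" by this+
  have c: "b \<in> carrier R" "b' \<in> carrier R" using *(2,7) Pc by auto
  have nz: "b \<otimes> b' \<noteq> \<zero>" "b \<otimes> b' \<in> P" using *(2,3,7,8) c subringE(6)[OF P] by simp_all
  have "(h \<oplus> g) \<otimes> (b \<otimes> b') = a \<otimes> b' \<oplus> a' \<otimes> b"
    unfolding *(5)[symmetric] *(10)[symmetric] using *(4,9) c by algebra
  moreover have "a \<otimes> b' \<oplus> a' \<otimes> b \<in> P" using subringE(6,7)[OF P] *(1,2,6,7) by simp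
  ultimately show ?case using nz *(4,9)
    by (intro bexI[of _ "a \<otimes> b' \<oplus> a' \<otimes> b"] bexI[of _ "b \<otimes> b'"] conjI) auto
next
  case (eng_mult h g)
  obtain a b where "a \<in> P" "b \<in> P" "b \<noteq> \<zero>" "h \<in> carrier R" "h \<otimes> b = a" using eng_mult.IH(1) by blast
  moreover obtain a' b' where "a' \<in> P" "b' \<in> P" "b' \<noteq> \<zero>" "g \<in> carrier R" "g \<otimes> b' = a'"
    using eng_mult.IH(2) by blast
  ultimately have *: "a \<in> P" "b \<in> P" "b \<noteq> \<zero>" "h \<in> carrier R" "h \<otimes> b = a"
    "a' \<in> P" "b' \<in> P" "b' \<noteq> \<zero>" "g \<in> carrier R" "g \<otimes> b' = a'" by this+
  have c: "b \<in> carrier R" "b' \<in> carrier R" using *(2,7) Pc by auto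
  have nz: "b \<otimes> b' \<noteq> \<zero>" "b \<otimes> b' \<in> P" using *(2,3,7,8) c subringE(6)[OF P] by simp_all
  have "(h \<otimes> g) \<otimes> (b \<otimes> b') = a \<otimes> a'"
    unfolding *(5)[symmetric] *(10)[symmetric] using *(4,9) c by algebra
  moreover have "a \<otimes> a' \<in> P" using subringE(6)[OF P] *(1,6) by simp
  ultimately show ?case using nz *(4,9)
    by (intro bexI[of _ "a \<otimes> a'"] bexI[of _ "b \<otimes> b'"] conjI) auto
qed

text \<open>For a k(x)-space \<open>W\<close> with a given basis, the intended \<open>V\<close> is
  the k-span of that basis: then the expansions in \<open>x\<close> form the k[x]-lattice it spans.
  The last clauses say that this lattice is free on \<open>V\<close> and that denominators from k[x]
  move every element of \<open>W\<close> into it.\<close>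

private definition "digits W V \<longleftrightarrow> finite V \<and> V \<subseteq> W \<and> \<zero> \<in> V \<and> (\<forall>a\<in>V. \<forall>b\<in>V. a \<oplus> b \<in> V) \<and>
  (\<forall>c\<in>k. \<forall>a\<in>V. c \<otimes> a \<in> V) \<and>
  (\<forall>w\<in>V. \<forall>n. \<forall>m\<in>expansions R V x n. w \<oplus> x \<otimes> m = \<zero> \<longrightarrow> w = \<zero>) \<and>
  (\<forall>y\<in>W. \<exists>b\<in>P. b \<noteq> \<zero> \<and> (\<exists>n. b \<otimes> y \<in> expansions R V x n))"

private lemma expansions_P_mult:
  assumes V: "V \<subseteq> carrier R" "\<zero> \<in> V" "\<And>a b. a \<in> V \<Longrightarrow> b \<in> V \<Longrightarrow> a \<oplus> b \<in> V"
    "\<And>c a. c \<in> k \<Longrightarrow> a \<in> V \<Longrightarrow> c \<otimes> a \<in> V"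
  shows "a \<in> expansions R k x i \<Longrightarrow> m \<in> expansions R V x j \<Longrightarrow> a \<otimes> m \<in> expansions R V x (i + j)"
proof (induction i arbitrary: a)
  case 0
  then show ?case using expansions_smult[OF V(1-3) x(1), of a m j] V(4) kc(1) by auto
next
  case (Suc i)
  then obtain c a' where *: "a = c \<oplus> x \<otimes> a'" "c \<in> k" "a' \<in> expansions R k x i" by auto
  have cc: "c \<in> carrier R" "a' \<in> carrier R" "m \<in> carrier R"
    using * kc(1) expansions_carrier[OF kc x(1)] expansions_carrier[OF V(1-3) x(1)] Suc(3) by blast+
  have "a \<otimes> m = c \<otimes> m \<oplus> x \<otimes> (a' \<otimes> m)" unfolding *(1) using cc x(1) by algebra
  moreover have "x \<otimes> (a' \<otimes> m) \<in> expansions R V x (Suc i + j)"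
    using expansions_mult_var[OF V(1-3) x(1) Suc.IH[OF *(3) Suc(3)]] by simp
  moreover have "c \<otimes> m \<in> expansions R V x (Suc i + j)"
    using expansions_smult[OF V(1-3) x(1) cc(1) V(4)[OF *(2)] Suc(3)]
      expansions_mono[OF V(1-3) x(1), of j "Suc i + j"] by auto
  ultimately show ?case using expansions_add[OF V(1-3) x(1)] by metis
qed

text \<open>Induction along the construction of the space by line extensions: a new basis vector
  \<open>v\<close> enlarges the digits to k v + V', and an expansion splits into a polynomial
  multiple of \<open>v\<close> and an expansion with the old digits.\<close>

private lemma digits_exist:
  assumes "dimension n kx W" shows "\<exists>V. digits W V \<and> (0 < n \<longrightarrow> (\<exists>w\<in>V. w \<noteq> \<zero>))"
  using assms
proof (induction n arbitrary: W)
  case 0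
  have kxf: "subfield kx R" using generate_field_is_subfield[of "insert x k"] x(1) kc(1) by auto
  have W: "W = {\<zero>}" using dimension_zero[OF kxf 0] .
  have e: "expansions R {\<zero>} x n = {\<zero>}" for n using x(1) by (induction n) auto
  have "digits W {\<zero>}" unfolding digits_def W e
    using kc(1) subringE(3)[OF P] x(1) by (auto intro!: bexI[of _ \<one>])
  then show ?case by blast
next
  case (Suc n)
  have kxf: "subfield kx R" using generate_field_is_subfield[of "insert x k"] x(1) kc(1) by auto
  obtain v W' where v: "v \<in> carrier R" "v \<notin> W'" "dimension n kx W'" "W = line_extension kx v W'"
    using Suc.prems by (cases rule: dimension.cases) auto
  obtain V' where V': "digits W' V'" using Suc.IH[OF v(3)] by auto
  note W'sp = space_subgroup_props[OF kxf v(3)]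
  have V'f: "finite V'" "V' \<subseteq> W'" "\<zero> \<in> V'" and V'add: "\<And>a b. a \<in> V' \<Longrightarrow> b \<in> V' \<Longrightarrow> a \<oplus> b \<in> V'"
    and V'sm: "\<And>c a. c \<in> k \<Longrightarrow> a \<in> V' \<Longrightarrow> c \<otimes> a \<in> V'"
    and V'u: "\<And>w n m. w \<in> V' \<Longrightarrow> m \<in> expansions R V' x n \<Longrightarrow> w \<oplus> x \<otimes> m = \<zero> \<Longrightarrow> w = \<zero>"
    and V'd: "\<And>y. y \<in> W' \<Longrightarrow> \<exists>b\<in>P. b \<noteq> \<zero> \<and> (\<exists>n. b \<otimes> y \<in> expansions R V' x n)"
    using V' unfolding digits_def by blast+
  have V'c: "V' \<subseteq> carrier R" using V'f(2) W'sp(1) by auto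
  have kkx: "k \<subseteq> kx" "x \<in> kx" by (auto intro: generate_field.incl)
  define V where "V = (\<lambda>(c, w). c \<otimes> v \<oplus> w) ` (k \<times> V')"
  have Vmem: "c \<otimes> v \<oplus> w \<in> V" if "c \<in> k" "w \<in> V'" for c w using that by (auto simp: V_def)
  have Vel: "\<exists>c\<in>k. \<exists>w\<in>V'. u = c \<otimes> v \<oplus> w" if "u \<in> V" for u using that by (auto simp: V_def)
  have kxc: "kx \<subseteq> carrier R" using subringE(1)[OF subfieldE(1)[OF kxf]] .
  have exp1: "\<exists>a\<in>expansions R k x i. \<exists>m\<in>expansions R V' x i. u = a \<otimes> v \<oplus> m" if "u \<in> expansions R V x i" for u i
    using that
  proof (induction i arbitrary: u)
    case 0 then show ?case using Vel by simp
  next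
    case (Suc i)
    then obtain z u' where u: "u = z \<oplus> x \<otimes> u'" "z \<in> V" "u' \<in> expansions R V x i" by auto
    obtain a m where am: "a \<in> expansions R k x i" "m \<in> expansions R V' x i" "u' = a \<otimes> v \<oplus> m"
      using Suc.IH[OF u(3)] by blast
    obtain c w where cw: "c \<in> k" "w \<in> V'" "z = c \<otimes> v \<oplus> w" using Vel[OF u(2)] by blast
    have cc: "a \<in> carrier R" "m \<in> carrier R" "c \<in> carrier R" "w \<in> carrier R"
      using am cw kc(1) V'c expansions_carrier[OF kc x(1)] expansions_carrier[OF V'c V'f(3) V'add x(1)] by blast+
    have "u = (c \<oplus> x \<otimes> a) \<otimes> v \<oplus> (w \<oplus> x \<otimes> m)" unfolding u(1) am(3) cw(3) using cc v(1) x(1) by algebra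
    moreover have "c \<oplus> x \<otimes> a \<in> expansions R k x (Suc i)" using cw(1) am(1) by auto
    moreover have "w \<oplus> x \<otimes> m \<in> expansions R V' x (Suc i)" using cw(2) am(2) by auto
    ultimately show ?case by blast
  qed
  have exp2: "a \<otimes> v \<oplus> m \<in> expansions R V x i" if "a \<in> expansions R k x i" "m \<in> expansions R V' x i" for a m i
    using that
  proof (induction i arbitrary: a m)
    case 0 then show ?case using Vmem by simp
  next
    case (Suc i)
    then obtain c a' w m' where *: "a = c \<oplus> x \<otimes> a'" "m = w \<oplus> x \<otimes> m'" "c \<in> k" "w \<in> V'"
      "a' \<in> expansions R k x i" "m' \<in> expansions R V' x i" by auto
    have cc: "a' \<in> carrier R" "m' \<in> carrier R" "c \<in> carrier R" "w \<in> carrier R"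
      using * kc(1) V'c expansions_carrier[OF kc x(1)] expansions_carrier[OF V'c V'f(3) V'add x(1)] by blast+
    have "a \<otimes> v \<oplus> m = (c \<otimes> v \<oplus> w) \<oplus> x \<otimes> (a' \<otimes> v \<oplus> m')" unfolding *(1,2) using cc v(1) x(1) by algebra
    then show ?case using Vmem[OF *(3,4)] Suc.IH[OF *(5,6)] by auto
  qed
  have "digits W V" unfolding digits_def
  proof (intro conjI ballI allI impI)
    show "finite V" using fk V'f by (simp add: V_def)
    show "V \<subseteq> W"
    proof
      fix u assume "u \<in> V"
      then show "u \<in> W" using Vel[of u] kkx V'f(2) unfolding v(4) line_extension_mem_iff by blast
    qed
    show "\<zero> \<in> V" using Vmem[OF kc(2) V'f(3)] v(1) by simp
    show "a \<oplus> b \<in> V" if ab: "a \<in> V" "b \<in> V" for a b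
    proof -
      obtain c w c' w' where *: "c \<in> k" "w \<in> V'" "a = c \<otimes> v \<oplus> w" "c' \<in> k" "w' \<in> V'" "b = c' \<otimes> v \<oplus> w'"
        using Vel ab by metis
      have cc: "c \<in> carrier R" "w \<in> carrier R" "c' \<in> carrier R" "w' \<in> carrier R" using * kc(1) V'c by auto
      have "a \<oplus> b = (c \<oplus> c') \<otimes> v \<oplus> (w \<oplus> w')" unfolding *(3,6) using cc v(1) by algebra
      then show ?thesis using Vmem[OF kc(3)[OF *(1,4)] V'add[OF *(2,5)]] by simp
    qed
    show "d \<otimes> a \<in> V" if d: "d \<in> k" "a \<in> V" for d a
    proof -
      obtain c w where *: "c \<in> k" "w \<in> V'" "a = c \<otimes> v \<oplus> w" using Vel[OF d(2)] by blast
      have cc: "c \<in> carrier R" "w \<in> carrier R" "d \<in> carrier R" using * d kc(1) V'c by auto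
      have "d \<otimes> a = (d \<otimes> c) \<otimes> v \<oplus> d \<otimes> w" unfolding *(3) using cc v(1) by algebra
      then show ?thesis using Vmem[OF subringE(6)[OF ksub d(1) *(1)] V'sm[OF d(1) *(2)]] by simp
    qed
    show "u = \<zero>" if u: "u \<in> V" "m \<in> expansions R V x i" "u \<oplus> x \<otimes> m = \<zero>" for u i m
    proof -
      obtain c w where cw: "c \<in> k" "w \<in> V'" "u = c \<otimes> v \<oplus> w" using Vel[OF u(1)] by blast
      obtain a m' where am: "a \<in> expansions R k x i" "m' \<in> expansions R V' x i" "m = a \<otimes> v \<oplus> m'"
        using exp1[OF u(2)] by blast
      have aP: "a \<in> P" using am(1) P_exp by auto
      have cc: "a \<in> carrier R" "m' \<in> carrier R" "c \<in> carrier R" "w \<in> carrier R"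
        using am cw kc(1) V'c expansions_carrier[OF kc x(1)] expansions_carrier[OF V'c V'f(3) V'add x(1)] by blast+
      have e: "(c \<oplus> x \<otimes> a) \<otimes> v \<oplus> (w \<oplus> x \<otimes> m') = \<zero>"
        using u(3) unfolding cw(3) am(3) using cc v(1) x(1) by algebra
      have akx: "a \<in> kx"
        using am(1)
      proof (induction i arbitrary: a)
        case 0 then show ?case using kkx by auto
      next
        case (Suc i) then show ?case using kkx by (auto intro!: generate_field.eng_add generate_field.eng_mult)
      qed
      have m'W: "m' \<in> W'"
        using am(2)
      proof (induction i arbitrary: m')
        case 0 then show ?case using V'f by auto
      next
        case (Suc i) then show ?case using V'f kkx by (auto intro!: W'sp(3) W'sp(5))
      qed
      have cx: "c \<oplus> x \<otimes> a \<in> kx" using cw(1) kkx akx by (auto intro!: generate_field.eng_add generate_field.eng_mult)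
      have wW: "w \<oplus> x \<otimes> m' \<in> W'" using W'sp(3) W'sp(5)[OF kkx(2) m'W] cw(2) V'f(2) by blast
      \<comment> \<open>Otherwise a nonzero k(x)-multiple of \<open>v\<close> would lie in
        \<open>W'\<close>, and hence \<open>v\<close> itself.\<close>
      have "c \<oplus> x \<otimes> a = \<zero>"
      proof (rule ccontr)
        assume nz: "c \<oplus> x \<otimes> a \<noteq> \<zero>"
        have "(c \<oplus> x \<otimes> a) \<otimes> v = ((c \<oplus> x \<otimes> a) \<otimes> v \<oplus> (w \<oplus> x \<otimes> m')) \<oplus> (\<ominus> (w \<oplus> x \<otimes> m'))"
          using cc v(1) x(1) by algebra
        then have "(c \<oplus> x \<otimes> a) \<otimes> v = \<ominus> (w \<oplus> x \<otimes> m')" unfolding e using cc x(1) by simp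
        then have "(c \<oplus> x \<otimes> a) \<otimes> v \<in> W'" using W'sp(4)[OF wW] by simp
        then show False using W'sp(6)[of "c \<oplus> x \<otimes> a" v] cx nz v(1,2) by blast
      qed
      then have "c = \<zero>" "w \<oplus> x \<otimes> m' = \<zero>"
        using transcendental_expansion_unique[OF ksub x cw(1) am(1)] e cc x(1) v(1) by auto
      then have "w = \<zero>" using V'u[OF cw(2) am(2)] by blast
      then show ?thesis using cw(3) \<open>c = \<zero>\<close> v(1) by simp
    qed
    show "\<exists>b\<in>P. b \<noteq> \<zero> \<and> (\<exists>i. b \<otimes> y \<in> expansions R V x i)" if y: "y \<in> W" for y
    proof -
      obtain c w where cw: "c \<in> kx" "w \<in> W'" "y = c \<otimes> v \<oplus> w"
        using y unfolding v(4) line_extension_mem_iff by blast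
      obtain a b where ab: "a \<in> P" "b \<in> P" "b \<noteq> \<zero>" "c \<otimes> b = a" using fraction[OF cw(1)] by blast
      obtain d j where d: "d \<in> P" "d \<noteq> \<zero>" "d \<otimes> w \<in> expansions R V' x j" using V'd[OF cw(2)] by blast
      have cc: "a \<in> carrier R" "b \<in> carrier R" "d \<in> carrier R" "c \<in> carrier R" "w \<in> carrier R"
        using ab d cw Pc kxc W'sp(1) by auto
      obtain i where i: "d \<otimes> a \<in> expansions R k x i"
        using subringE(6)[OF P d(1) ab(1)] P_exp by blast
      obtain l where l: "b \<in> expansions R k x l" using ab(2) P_exp by blast
      have "b \<otimes> (d \<otimes> w) \<in> expansions R V' x (l + j)"
        by (rule expansions_P_mult[OF V'c V'f(3) V'add V'sm l d(3)])
      then have 1: "b \<otimes> (d \<otimes> w) \<in> expansions R V' x (i + (l + j))"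
        using expansions_mono[OF V'c V'f(3) V'add x(1), of "l + j" "i + (l + j)"] by auto
      have 2: "d \<otimes> a \<in> expansions R k x (i + (l + j))"
        using i expansions_mono[OF kc x(1), of i "i + (l + j)"] by auto
      have "(b \<otimes> d) \<otimes> y = (d \<otimes> a) \<otimes> v \<oplus> b \<otimes> (d \<otimes> w)"
        unfolding ab(4)[symmetric] cw(3) using cc v(1) by algebra
      then have "(b \<otimes> d) \<otimes> y \<in> expansions R V x (i + (l + j))" using exp2[OF 2 1] by simp
      then show ?thesis using subringE(6)[OF P ab(2) d(1)] cc ab(3) d(2)
        by (intro bexI[of _ "b \<otimes> d"]) auto
    qed
  qed
  moreover have "v \<in> V" "v \<noteq> \<zero>"
    using Vmem[of \<one> \<zero>] subringE(3)[OF ksub] V'f(3) v(1,2) W'sp(2) by auto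
  ultimately show ?case by blast
qed

lemma expansion_field_of_finite_dimension:
  assumes L: "subfield L R" and xkL: "insert x k \<subseteq> L" and dim: "finite_dimension kx L"
  shows "\<exists>V. expansion_field (R\<lparr>carrier := L\<rparr>) V x"
proof -
  have Lr: "subring L R" by (rule subfieldE(1)[OF L])
  note Lc = subringE(1)[OF Lr]
  have kxf: "subfield kx R" using generate_field_is_subfield[of "insert x k"] x(1) kc(1) by auto
  obtain n where n: "dimension n kx L" using dim by (auto simp: finite_dimension_def)
  have "n > 0"
  proof (rule ccontr)
    assume "\<not> n > 0"
    then have "L = {\<zero>}" using dimension_zero[OF kxf] n by simp
    then show False using subringE(3)[OF Lr] by simp
  qed
  then obtain V w0 where V: "digits L V" and w0: "w0 \<in> V" "w0 \<noteq> \<zero>" using digits_exist[OF n] by auto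
  have Vf: "finite V" "V \<subseteq> L" "\<zero> \<in> V" and Vadd: "\<And>a b. a \<in> V \<Longrightarrow> b \<in> V \<Longrightarrow> a \<oplus> b \<in> V"
    and Vsm: "\<And>c a. c \<in> k \<Longrightarrow> a \<in> V \<Longrightarrow> c \<otimes> a \<in> V"
    and Vu: "\<And>w n m. w \<in> V \<Longrightarrow> m \<in> expansions R V x n \<Longrightarrow> w \<oplus> x \<otimes> m = \<zero> \<Longrightarrow> w = \<zero>"
    and Vd: "\<And>y. y \<in> L \<Longrightarrow> \<exists>b\<in>P. b \<noteq> \<zero> \<and> (\<exists>n. b \<otimes> y \<in> expansions R V x n)"
    using V unfolding digits_def by blast+
  have Vc: "V \<subseteq> carrier R" using Vf(2) Lc by auto
  have PL: "P \<subseteq> L" by (rule simple_extension_subring_incl[OF Lr]) (use xkL in auto)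
  have Vminus: "a \<ominus> b \<in> V" if "a \<in> V" "b \<in> V" for a b
  proof -
    have c: "a \<in> carrier R" "b \<in> carrier R" using that Vc by auto
    have "a \<ominus> b = a \<oplus> (\<ominus> \<one>) \<otimes> b" using c by algebra
    then show ?thesis using Vadd Vsm subringE(3,5)[OF ksub] that by simp
  qed
  have prime: "finite (generate_field (R\<lparr>carrier := L\<rparr>) {})"
  proof -
    have "generate_field R {} \<subseteq> k" using generate_field_min_subfield1[of "{}" k] k by auto
    then show ?thesis using fk finite_subset subfield_gen_equality[OF L, of "{}"] by auto
  qed
  have mult: "\<exists>h c. h \<in> L \<and> h \<noteq> \<zero> \<and> (\<forall>w\<in>V. h \<otimes> w \<in> expansions R V x c \<and> f \<otimes> h \<otimes> w \<in> expansions R V x c)"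
    if f: "f \<in> L" for f
  proof -
    have fc: "f \<in> carrier R" using f Lc by auto
    \<comment> \<open>A common denominator in k[x] for the finitely many products
      \<open>f \<otimes> w\<close>, built one digit at a time. Being a polynomial, it also keeps
      \<open>h \<otimes> w\<close> among the expansions.\<close>
    have "\<exists>h\<in>P. h \<noteq> \<zero> \<and> (\<exists>c. \<forall>w\<in>S. h \<otimes> (f \<otimes> w) \<in> expansions R V x c)" if "finite S" "S \<subseteq> V" for S
      using that
    proof (induction S)
      case empty
      then show ?case using subringE(3)[OF P] by (intro bexI[of _ \<one>]) auto
    next
      case (insert w S)
      then obtain h c where h: "h \<in> P" "h \<noteq> \<zero>" "\<And>w. w \<in> S \<Longrightarrow> h \<otimes> (f \<otimes> w) \<in> expansions R V x c" by auto
      have "f \<otimes> w \<in> L" using subringE(6)[OF Lr f] insert Vf(2) by auto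
      then obtain b n where b: "b \<in> P" "b \<noteq> \<zero>" "b \<otimes> (f \<otimes> w) \<in> expansions R V x n" using Vd by blast
      obtain i where i: "h \<in> expansions R k x i" using h(1) P_exp by auto
      obtain j where j: "b \<in> expansions R k x j" using b(1) P_exp by auto
      have hc: "h \<in> carrier R" "b \<in> carrier R" using h b Pc by auto
      let ?N = "(i + n) + (j + c)"
      have 1: "(h \<otimes> b) \<otimes> (f \<otimes> w) \<in> expansions R V x ?N"
      proof -
        have wc: "w \<in> carrier R" using insert Vc by auto
        have "h \<otimes> (b \<otimes> (f \<otimes> w)) \<in> expansions R V x (i + n)"
          by (rule expansions_P_mult[OF Vc Vf(3) Vadd Vsm i b(3)])
        moreover have "h \<otimes> (b \<otimes> (f \<otimes> w)) = (h \<otimes> b) \<otimes> (f \<otimes> w)" using hc fc wc by (simp add: m_assoc)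
        ultimately show ?thesis using expansions_mono[OF Vc Vf(3) Vadd x(1), of "i + n" ?N] by auto
      qed
      have 2: "(h \<otimes> b) \<otimes> (f \<otimes> u) \<in> expansions R V x ?N" if u: "u \<in> S" for u
      proof -
        have uc: "u \<in> carrier R" using insert u Vc by auto
        have "b \<otimes> (h \<otimes> (f \<otimes> u)) \<in> expansions R V x (j + c)"
          by (rule expansions_P_mult[OF Vc Vf(3) Vadd Vsm j h(3)[OF u]])
        moreover have "b \<otimes> (h \<otimes> (f \<otimes> u)) = (h \<otimes> b) \<otimes> (f \<otimes> u)" using hc fc uc by (simp add: m_ac)
        ultimately show ?thesis using expansions_mono[OF Vc Vf(3) Vadd x(1), of "j + c" ?N] by auto
      qed
      have "\<forall>u\<in>insert w S. (h \<otimes> b) \<otimes> (f \<otimes> u) \<in> expansions R V x ?N" using 1 2 by simp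
      then show ?case using subringE(6)[OF P h(1) b(1)] hc h(2) b(2) mult_nonzero by blast
    qed
    from this[OF Vf(1) subset_refl] obtain h c where
      h: "h \<in> P" "h \<noteq> \<zero>" "\<And>w. w \<in> V \<Longrightarrow> h \<otimes> (f \<otimes> w) \<in> expansions R V x c" by auto
    obtain i where i: "h \<in> expansions R k x i" using h(1) P_exp by auto
    have hc: "h \<in> carrier R" using h Pc by auto
    have "h \<otimes> w \<in> expansions R V x (i + c) \<and> f \<otimes> h \<otimes> w \<in> expansions R V x (i + c)" if w: "w \<in> V" for w
    proof
      have wc: "w \<in> carrier R" using w Vc by auto
      have "w \<in> expansions R V x 0" using w by simp
      from expansions_P_mult[OF Vc Vf(3) Vadd Vsm i this]
      show "h \<otimes> w \<in> expansions R V x (i + c)"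
        using expansions_mono[OF Vc Vf(3) Vadd x(1), of "i + 0" "i + c"] by auto
      have "f \<otimes> h \<otimes> w = h \<otimes> (f \<otimes> w)" using fc hc wc by (simp add: m_ac)
      then show "f \<otimes> h \<otimes> w \<in> expansions R V x (i + c)"
        using h(3)[OF w] expansions_mono[OF Vc Vf(3) Vadd x(1), of c "i + c"] by auto
    qed
    then show ?thesis using h PL by blast
  qed
  have xnz: "x \<noteq> \<zero>"
  proof
    assume "x = \<zero>"
    then show False using x(2) zero_is_algebraic[OF ksub] by (simp add: over_def)
  qed
  have Lf: "field (R\<lparr>carrier := L\<rparr>)" by (rule subfield_iff(2)[OF L])
  have "expansion_field (R\<lparr>carrier := L\<rparr>) V x"
  proof (intro expansion_field.intro[OF Lf] expansion_field_axioms.intro)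
    show "a \<ominus>\<^bsub>R\<lparr>carrier := L\<rparr>\<^esub> b \<in> V" if "a \<in> V" "b \<in> V" for a b
      using Vminus[OF that] minus_subring[OF Lr, of b a] that Vf(2) by auto
    show "\<exists>w\<in>V. w \<noteq> \<zero>\<^bsub>R\<lparr>carrier := L\<rparr>\<^esub>" using w0 by auto
    show "w = \<zero>\<^bsub>R\<lparr>carrier := L\<rparr>\<^esub>"
      if "w \<in> V" "m \<in> expansions (R\<lparr>carrier := L\<rparr>) V x n"
        "w \<oplus>\<^bsub>R\<lparr>carrier := L\<rparr>\<^esub> x \<otimes>\<^bsub>R\<lparr>carrier := L\<rparr>\<^esub> m = \<zero>\<^bsub>R\<lparr>carrier := L\<rparr>\<^esub>" for w m n
      using Vu[of w m n] that by simp
    show "\<exists>h c. h \<in> carrier (R\<lparr>carrier := L\<rparr>) \<and> h \<noteq> \<zero>\<^bsub>R\<lparr>carrier := L\<rparr>\<^esub> \<and>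
        (\<forall>w\<in>V. h \<otimes>\<^bsub>R\<lparr>carrier := L\<rparr>\<^esub> w \<in> expansions (R\<lparr>carrier := L\<rparr>) V x c \<and>
          f \<otimes>\<^bsub>R\<lparr>carrier := L\<rparr>\<^esub> h \<otimes>\<^bsub>R\<lparr>carrier := L\<rparr>\<^esub> w \<in> expansions (R\<lparr>carrier := L\<rparr>) V x c)"
      if "f \<in> carrier (R\<lparr>carrier := L\<rparr>)" for f
      using mult[of f] that by simp
  qed (use Vf xkL xnz prime in auto)
  then show ?thesis by blast
qed

end

text \<open>Finiteness over k(x) passes from F up to E in the tower and from E down to the subspace
  L. It is applied to F, to E and to a fixed field.\<close>

theorem expansion_field_of_intermediate_field:
  assumes F: "subfield F R" and gff: "global_function_field (R\<lparr>carrier := F\<rparr>)"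
    and fin: "finite_dimension F (carrier R)" and L: "subfield L R" "F \<subseteq> L"
  shows "\<exists>V x. expansion_field (R\<lparr>carrier := L\<rparr>) V x"
proof -
  have Fr: "subring F R" by (rule subfieldE(1)[OF F])
  interpret F: field "R\<lparr>carrier := F\<rparr>" by (rule subfield_iff(2)[OF F])
  obtain k x where k: "subfield k (R\<lparr>carrier := F\<rparr>)" "finite k" and x: "x \<in> F"
      "(F.transcendental over k) x" "F.finite_dimension (generate_field (R\<lparr>carrier := F\<rparr>) (insert x k)) F"
    using gff by (auto simp: global_function_field_def)
  have kF: "k \<subseteq> F" using subringE(1)[OF subfieldE(1)[OF k(1)]] by simp
  have kR: "subfield k R"
  proof (rule subfield_iff(1))
    have "(R\<lparr>carrier := F\<rparr>)\<lparr>carrier := k\<rparr> = R\<lparr>carrier := k\<rparr>" by simp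
    then show "field (R\<lparr>carrier := k\<rparr>)" using F.subfield_iff(2)[OF k(1)] by simp
    show "k \<subseteq> carrier R" using kF subringE(1)[OF Fr] by auto
  qed
  have xR: "x \<in> carrier R" "(transcendental over k) x"
    using x(1,2) subringE(1)[OF Fr] transcendental_consistent[OF Fr] by auto
  let ?kx = "generate_field R (insert x k)"
  have kx: "?kx = generate_field (R\<lparr>carrier := F\<rparr>) (insert x k)"
    using subfield_gen_equality[OF F, of "insert x k"] x(1) kF by auto
  have kxf: "subfield ?kx R"
    using generate_field_is_subfield[of "insert x k"] xR(1) kF subringE(1)[OF Fr] by auto
  obtain n where "dimension n ?kx F"
    using x(3) dimension_of_subring[OF Fr] unfolding kx by (auto simp: F.finite_dimension_def)
  moreover obtain m where "dimension m F (carrier R)" using fin by (auto simp: finite_dimension_def)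
  ultimately have "finite_dimension ?kx (carrier R)"
    using telescopic_base[OF kxf F] by (auto intro: finite_dimensionI)
  moreover have kxL: "?kx \<subseteq> L"
    using generate_field_min_subfield1[of "insert x k" L] x(1) kF L xR(1) subringE(1)[OF Fr] by auto
  have "subalgebra ?kx L R"
  proof (intro subalgebra.intro subalgebra_axioms.intro)
    show "subgroup L (add_monoid R)" by (rule subring.axioms(1)[OF subfieldE(1)[OF L(1)]])
    show "c \<otimes> y \<in> L" if "c \<in> ?kx" "y \<in> L" for c y
      using subringE(6)[OF subfieldE(1)[OF L(1)] subsetD[OF kxL that(1)] that(2)] .
  qed
  ultimately have "finite_dimension ?kx L"
    using subalbegra_incl_imp_finite_dimension[OF kxf] subringE(1)[OF subfieldE(1)[OF L(1)]] by blast
  then show ?thesis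
    using expansion_field_of_finite_dimension[OF kR k(2) xR L(1)] x(1) kF L(2) by blast
qed

end

section \<open>Residue fields\<close>

lemma (in field) finite_field_power_card:
  assumes "finite (carrier R)" "z \<in> carrier R" shows "z [^] card (carrier R) = z"
proof (cases "z = \<zero>")
  case True
  have "card (carrier R) > 0" using assms card_gt_0_iff by blast
  then obtain n where "card (carrier R) = Suc n" by (cases "card (carrier R)") auto
  then show ?thesis using True by simp
next
  case False
  interpret M: group "Multiplicative_Group.mult_of R" by (rule field_mult_group)
  have "z [^]\<^bsub>Multiplicative_Group.mult_of R\<^esub> order (Multiplicative_Group.mult_of R) = \<one>"
    using M.pow_order_eq_1[of z] assms False by simp
  then have 1: "z [^] (card (carrier R) - 1) = \<one>"
    using order_mult_of[OF assms(1)]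
    by (simp add: Multiplicative_Group.nat_pow_mult_of order_def)
  have "card (carrier R) > 0" using assms card_gt_0_iff by blast
  then have "card (carrier R) = Suc (card (carrier R) - 1)" by simp
  then have "z [^] card (carrier R) = z [^] (card (carrier R) - 1) \<otimes> z" by (metis nat_pow_Suc)
  then show ?thesis using 1 assms by simp
qed

lemma (in field) finite_subfield_power_card:
  assumes "subfield k R" "finite k" "c \<in> k" shows "c [^] card k = c"
proof -
  interpret k: field "R\<lparr>carrier := k\<rparr>" by (rule subfield_iff(2)[OF assms(1)])
  have "c [^]\<^bsub>R\<lparr>carrier := k\<rparr>\<^esub> card k = c" using k.finite_field_power_card[of c] assms by simp
  then show ?thesis by (simp add: nat_pow_def)
qed

text \<open>Polynomial functions in Horner form, determined only by their values on the carrier. The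
  index bounds the degree without being equal to it, so sums and padding stay inside the same
  class.\<close>

inductive (in field) polynomial_fun :: "nat \<Rightarrow> ('a \<Rightarrow> 'a) \<Rightarrow> bool" where
  const: "c \<in> carrier R \<Longrightarrow> (\<And>z. z \<in> carrier R \<Longrightarrow> f z = c) \<Longrightarrow> polynomial_fun 0 f"
| step: "c \<in> carrier R \<Longrightarrow> polynomial_fun n g \<Longrightarrow> (\<And>z. z \<in> carrier R \<Longrightarrow> f z = c \<oplus> z \<otimes> g z) \<Longrightarrow>
    polynomial_fun (Suc n) f"

context field
begin

lemma polynomial_fun_closed: "polynomial_fun n f \<Longrightarrow> z \<in> carrier R \<Longrightarrow> f z \<in> carrier R"
  by (induction rule: polynomial_fun.induct) auto

lemma polynomial_fun_cong:
  "polynomial_fun n f \<Longrightarrow> (\<And>z. z \<in> carrier R \<Longrightarrow> g z = f z) \<Longrightarrow> polynomial_fun n g"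
proof (induction arbitrary: g rule: polynomial_fun.induct)
  case (const c f)
  then show ?case by (intro polynomial_fun.const[of c]) auto
next
  case (step c n g f h)
  then show ?case by (intro polynomial_fun.step[of c n g]) auto
qed

lemma polynomial_fun_Suc: "polynomial_fun n f \<Longrightarrow> polynomial_fun (Suc n) f"
proof (induction rule: polynomial_fun.induct)
  case (const c f)
  have "polynomial_fun 0 (\<lambda>_. \<zero>)" by (rule polynomial_fun.const[of \<zero>]) auto
  then show ?case using const by (intro polynomial_fun.step[of c 0 "\<lambda>_. \<zero>"]) auto
next
  case (step c n g f)
  then show ?case by (intro polynomial_fun.step[of c "Suc n" g])
qed

lemma polynomial_fun_add:
  "polynomial_fun n f \<Longrightarrow> polynomial_fun n g \<Longrightarrow> polynomial_fun n (\<lambda>z. f z \<oplus> g z)"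
proof (induction n arbitrary: f g)
  case 0
  obtain c where "c \<in> carrier R" "\<And>z. z \<in> carrier R \<Longrightarrow> f z = c" using 0(1) by (cases) auto
  moreover obtain d where "d \<in> carrier R" "\<And>z. z \<in> carrier R \<Longrightarrow> g z = d" using 0(2) by (cases) auto
  ultimately show ?case by (intro polynomial_fun.const[of "c \<oplus> d"]) auto
next
  case (Suc n)
  obtain c f' where f: "c \<in> carrier R" "polynomial_fun n f'" "\<And>z. z \<in> carrier R \<Longrightarrow> f z = c \<oplus> z \<otimes> f' z"
    using Suc.prems(1) by (cases) auto
  obtain d g' where g: "d \<in> carrier R" "polynomial_fun n g'" "\<And>z. z \<in> carrier R \<Longrightarrow> g z = d \<oplus> z \<otimes> g' z"
    using Suc.prems(2) by (cases) auto
  show ?case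
  proof (rule polynomial_fun.step[of "c \<oplus> d" n "\<lambda>z. f' z \<oplus> g' z"])
    fix z assume z: "z \<in> carrier R"
    have c: "f' z \<in> carrier R" "g' z \<in> carrier R" using polynomial_fun_closed f g z by auto
    show "f z \<oplus> g z = c \<oplus> d \<oplus> z \<otimes> (f' z \<oplus> g' z)" unfolding f(3)[OF z] g(3)[OF z] using c f(1) g(1) z by algebra
  qed (use f g Suc.IH in auto)
qed

lemma polynomial_fun_mult_var: "polynomial_fun n f \<Longrightarrow> polynomial_fun (Suc n) (\<lambda>z. z \<otimes> f z)"
  by (rule polynomial_fun.step[of \<zero> n f]) (auto simp: polynomial_fun_closed)

lemma polynomial_fun_smult:
  "polynomial_fun n f \<Longrightarrow> a \<in> carrier R \<Longrightarrow> polynomial_fun n (\<lambda>z. a \<otimes> f z)"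
proof (induction rule: polynomial_fun.induct)
  case (const c f)
  then show ?case by (intro polynomial_fun.const[of "a \<otimes> c"]) auto
next
  case (step c n g f)
  show ?case
  proof (rule polynomial_fun.step[of "a \<otimes> c" n "\<lambda>z. a \<otimes> g z"])
    fix z assume z: "z \<in> carrier R"
    have c: "g z \<in> carrier R" using polynomial_fun_closed step z by auto
    show "a \<otimes> f z = a \<otimes> c \<oplus> z \<otimes> (a \<otimes> g z)" unfolding step(3)[OF z] using c step(1,5) z by algebra
  qed (use step in auto)
qed

lemma polynomial_fun_divide:
  assumes "polynomial_fun (Suc n) f" "a \<in> carrier R"
  shows "\<exists>h. polynomial_fun n h \<and> (\<forall>z\<in>carrier R. f z \<ominus> f a = (z \<ominus> a) \<otimes> h z)"
  using assms
proof (induction n arbitrary: f)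
  case 0
  then obtain c g where f: "c \<in> carrier R" "polynomial_fun 0 g" "\<And>z. z \<in> carrier R \<Longrightarrow> f z = c \<oplus> z \<otimes> g z"
    by (auto elim: polynomial_fun.cases)
  obtain d where g: "d \<in> carrier R" "\<And>z. z \<in> carrier R \<Longrightarrow> g z = d" using f(2) by (cases) auto
  have "f z \<ominus> f a = (z \<ominus> a) \<otimes> g z" if z: "z \<in> carrier R" for z
    unfolding f(3)[OF z] f(3)[OF 0(2)] g(2)[OF z] g(2)[OF 0(2)] using f(1) g(1) z 0(2) by algebra
  then show ?case using f(2) by blast
next
  case (Suc n)
  then obtain c g where f: "c \<in> carrier R" "polynomial_fun (Suc n) g" "\<And>z. z \<in> carrier R \<Longrightarrow> f z = c \<oplus> z \<otimes> g z"
    by (auto elim: polynomial_fun.cases)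
  obtain h where h: "polynomial_fun n h" "\<And>z. z \<in> carrier R \<Longrightarrow> g z \<ominus> g a = (z \<ominus> a) \<otimes> h z"
    using Suc.IH[OF f(2) Suc.prems(2)] by auto
  have "f z \<ominus> f a = (z \<ominus> a) \<otimes> (g z \<oplus> a \<otimes> h z)" if z: "z \<in> carrier R" for z
  proof -
    have c: "g z \<in> carrier R" "g a \<in> carrier R" "h z \<in> carrier R"
      using polynomial_fun_closed f(2) h(1) z Suc.prems(2) by auto
    have "f z \<ominus> f a = (z \<ominus> a) \<otimes> g z \<oplus> a \<otimes> (g z \<ominus> g a)"
      unfolding f(3)[OF z] f(3)[OF Suc.prems(2)] using f(1) c z Suc.prems(2) by algebra
    also have "\<dots> = (z \<ominus> a) \<otimes> (g z \<oplus> a \<otimes> h z)" unfolding h(2)[OF z] using c z Suc.prems(2) by algebra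
    finally show ?thesis .
  qed
  moreover have "polynomial_fun (Suc n) (\<lambda>z. g z \<oplus> a \<otimes> h z)"
    using polynomial_fun_add f(2) polynomial_fun_Suc polynomial_fun_smult h(1) Suc.prems(2) by blast
  ultimately show ?case by blast
qed

text \<open>A function of degree at most \<open>n\<close> with more than \<open>n\<close> roots
  vanishes everywhere: each root splits off a linear factor and lowers the bound. The roots may lie
  in a small subfield while the conclusion holds in the whole field.\<close>

lemma polynomial_fun_roots:
  assumes "polynomial_fun n f" "finite S" "S \<subseteq> carrier R" "n < card S" "\<And>z. z \<in> S \<Longrightarrow> f z = \<zero>" "z \<in> carrier R"
  shows "f z = \<zero>"
  using assms
proof (induction n arbitrary: f S)
  case 0
  then obtain s where s: "s \<in> S" by fastforce
  obtain c where c: "\<And>z. z \<in> carrier R \<Longrightarrow> f z = c" using 0(1) by (cases) auto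
  have "s \<in> carrier R" using s 0 by auto
  then have "c = \<zero>" using c[of s] 0(5)[OF s] by simp
  then show ?case using c[OF 0(6)] by simp
next
  case (Suc n)
  then obtain a where a: "a \<in> S" by fastforce
  have ac: "a \<in> carrier R" using a Suc by auto
  obtain h where h: "polynomial_fun n h" "\<And>z. z \<in> carrier R \<Longrightarrow> f z \<ominus> f a = (z \<ominus> a) \<otimes> h z"
    using polynomial_fun_divide[OF Suc.prems(1) ac] by auto
  have fz: "f z = (z \<ominus> a) \<otimes> h z" if "z \<in> carrier R" for z
    using h(2)[OF that] Suc.prems(5)[OF a] polynomial_fun_closed[OF Suc.prems(1) that] by (simp add: a_minus_def)
  have "h s = \<zero>" if s: "s \<in> S - {a}" for s
  proof -
    have sc: "s \<in> carrier R" "s \<noteq> a" using s Suc.prems by auto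
    have "(s \<ominus> a) \<otimes> h s = \<zero>" using fz[OF sc(1)] Suc.prems(5) s by auto
    moreover have "s \<ominus> a \<noteq> \<zero>" using minus_eq_zero_iff[of s a] sc ac by simp
    ultimately show ?thesis using integral_iff[of "s \<ominus> a" "h s"] sc ac polynomial_fun_closed[OF h(1)] by auto
  qed
  moreover have "n < card (S - {a})" using a Suc.prems by simp
  ultimately have "h z = \<zero>" using Suc.IH[OF h(1), of "S - {a}"] Suc.prems by auto
  then show ?case using fz[OF Suc.prems(6)] ac Suc.prems(6) by simp
qed

text \<open>The function \<open>(z + 1)\<^sup>N - z\<^sup>N - 1\<close> has degree less than \<open>N\<close>, and it vanishes on a field
  with \<open>N\<close> elements; hence it vanishes everywhere.\<close>

lemma polynomial_fun_power_difference:
  "polynomial_fun n (\<lambda>z. (z \<oplus> \<one>) [^] Suc n \<ominus> z [^] Suc n)"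
proof (induction n)
  case 0
  have "(z \<oplus> \<one>) \<ominus> z = \<one>" if "z \<in> carrier R" for z using that by algebra
  then show ?case by (intro polynomial_fun.const[of \<one>]) auto
next
  case (Suc n)
  let ?d = "\<lambda>z. (z \<oplus> \<one>) [^] Suc n \<ominus> z [^] Suc n"
  have pow: "polynomial_fun m (\<lambda>z. z [^] m)" for m
  proof (induction m)
    case 0 then show ?case by (intro polynomial_fun.const[of \<one>]) auto
  next
    case (Suc m)
    show ?case by (rule polynomial_fun_cong[OF polynomial_fun_mult_var[OF Suc]]) (simp add: m_comm)
  qed
  have "polynomial_fun (Suc n) (\<lambda>z. (z \<otimes> ?d z \<oplus> ?d z) \<oplus> z [^] Suc n)"
    by (intro polynomial_fun_add polynomial_fun_mult_var Suc polynomial_fun_Suc pow)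
  then show ?case
  proof (rule polynomial_fun_cong)
    fix z assume z: "z \<in> carrier R"
    have c: "(z \<oplus> \<one>) [^] Suc n \<in> carrier R" "z [^] Suc n \<in> carrier R" using z by auto
    show "(z \<oplus> \<one>) [^] Suc (Suc n) \<ominus> z [^] Suc (Suc n) = (z \<otimes> ?d z \<oplus> ?d z) \<oplus> z [^] Suc n"
      unfolding nat_pow_Suc[of _ "Suc n"] using c z by algebra
  qed
qed

lemma power_card_subfield_add:
  assumes k: "subfield k R" "finite k" and a: "a \<in> carrier R" "b \<in> carrier R"
  shows "(a \<oplus> b) [^] card k = a [^] card k \<oplus> b [^] card k"
proof -
  have ksub: "subring k R" by (rule subfieldE(1)[OF k(1)])
  have one: "\<one> \<in> k" by (rule subringE(3)[OF ksub])
  have "card k > 0" using one k(2) card_gt_0_iff by blast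
  then obtain n where n: "card k = Suc n" by (cases "card k") auto
  let ?f = "\<lambda>z. ((z \<oplus> \<one>) [^] Suc n \<ominus> z [^] Suc n) \<oplus> \<ominus> \<one>"
  have pf: "polynomial_fun n ?f"
  proof (rule polynomial_fun_add[OF polynomial_fun_power_difference])
    have "polynomial_fun m (\<lambda>z. \<ominus> \<one>)" for m
      by (induction m) (auto intro: polynomial_fun.const[of "\<ominus> \<one>"] polynomial_fun_Suc)
    then show "polynomial_fun n (\<lambda>z. \<ominus> \<one>)" .
  qed
  have root: "?f c = \<zero>" if c: "c \<in> k" for c
  proof -
    have cc: "c \<in> carrier R" using c subringE(1)[OF ksub] by auto
    have "c \<oplus> \<one> \<in> k" using subringE(7)[OF ksub c one] .
    then have "?f c = ((c \<oplus> \<one>) \<ominus> c) \<oplus> \<ominus> \<one>"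
      using finite_subfield_power_card[OF k c] finite_subfield_power_card[OF k, of "c \<oplus> \<one>"] unfolding n by simp
    then show ?thesis using cc by algebra
  qed
  have key: "(z \<oplus> \<one>) [^] card k = z [^] card k \<oplus> \<one>" if z: "z \<in> carrier R" for z
  proof -
    have "?f z = \<zero>"
      by (rule polynomial_fun_roots[OF pf k(2) subringE(1)[OF ksub]]) (use n root z in auto)
    moreover have c: "(z \<oplus> \<one>) [^] Suc n \<in> carrier R" "z [^] Suc n \<in> carrier R" using z by auto
    then have "(z \<oplus> \<one>) [^] Suc n = ?f z \<oplus> (z [^] Suc n \<oplus> \<one>)" by algebra
    ultimately show ?thesis unfolding n using c by simp
  qed
  show ?thesis
  proof (cases "b = \<zero>")
    case True
    then show ?thesis using a n by simp
  next
    case False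
    \<comment> \<open>Both sides are homogeneous, so dividing by \<open>b\<close> reduces to the
      case in which the second summand is 1.\<close>
    have c: "a \<otimes> inv b \<in> carrier R" using a False by simp
    have "a \<oplus> b = (a \<otimes> inv b \<oplus> \<one>) \<otimes> b" "a = (a \<otimes> inv b) \<otimes> b"
      using a False by (simp_all add: l_distr m_assoc)
    then have "(a \<oplus> b) [^] card k = (a \<otimes> inv b \<oplus> \<one>) [^] card k \<otimes> b [^] card k"
        "a [^] card k = (a \<otimes> inv b) [^] card k \<otimes> b [^] card k"
      using c a nat_pow_distrib[of "a \<otimes> inv b \<oplus> \<one>" b] nat_pow_distrib[of "a \<otimes> inv b" b] by auto
    then show ?thesis using key[OF c] c a by (simp add: l_distr)
  qed
qed

lemma power_card_subfield_power_add:
  assumes k: "subfield k R" "finite k" and a: "a \<in> carrier R" "b \<in> carrier R"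
  shows "(a \<oplus> b) [^] (card k ^ j) = a [^] (card k ^ j) \<oplus> b [^] (card k ^ j)"
proof (induction j)
  case (Suc j)
  have e: "z [^] (card k ^ Suc j) = (z [^] (card k ^ j)) [^] card k" if "z \<in> carrier R" for z
    using that by (simp add: nat_pow_pow mult.commute)
  show ?case using Suc power_card_subfield_add[OF k] a by (simp add: e del: power_Suc)
qed (use a in simp)

section \<open>The residue field of a place\<close>

context
  fixes v assumes v: "v \<in> places R"
begin

abbreviation "rc \<equiv> \<lambda>a. valuation_ideal R v +> a"

lemma valuation_ring_subring: "subring (vball R v 0) R"
  using v vball_mult[OF v, of _ 0 _ 0]
  by (intro subringI) (auto intro: vball_carrier vball_neg vball_add)

lemma valuation_ideal_ideal: "ideal (valuation_ideal R v) (R\<lparr>carrier := valuation_ring R v\<rparr>)"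
proof -
  interpret VR: ring "R\<lparr>carrier := vball R v 0\<rparr>" by (rule subring_is_ring[OF valuation_ring_subring])
  have sub: "vball R v 1 \<subseteq> vball R v 0" by (rule vball_mono) simp
  show ?thesis unfolding valuation_ring_eq_vball valuation_ideal_eq_vball
  proof (rule idealI)
    show "ring (R\<lparr>carrier := vball R v 0\<rparr>)" by (rule VR.ring_axioms)
    show "subgroup (vball R v 1) (add_monoid (R\<lparr>carrier := vball R v 0\<rparr>))"
    proof (rule VR.add.subgroupI)
      show "vball R v 1 \<noteq> {}" using vball_zero by blast
      show "\<ominus>\<^bsub>R\<lparr>carrier := vball R v 0\<rparr>\<^esub> a \<in> vball R v 1" if a: "a \<in> vball R v 1" for a
      proof -
        have "a \<in> vball R v 0" using a sub by auto
        then show ?thesis using a_inv_subring[OF valuation_ring_subring] vball_neg[OF v a] by simp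
      qed
    qed (use sub vball_add[OF v] in auto)
    show "x \<otimes>\<^bsub>R\<lparr>carrier := vball R v 0\<rparr>\<^esub> a \<in> vball R v 1" "a \<otimes>\<^bsub>R\<lparr>carrier := vball R v 0\<rparr>\<^esub> x \<in> vball R v 1"
      if "a \<in> vball R v 1" "x \<in> carrier (R\<lparr>carrier := vball R v 0\<rparr>)" for a x
      using that vball_mult[OF v, of x 0 a 1] vball_mult[OF v, of a 1 x 0] by auto
  qed
qed

lemma rc_subring: "valuation_ideal R v +>\<^bsub>R\<lparr>carrier := valuation_ring R v\<rparr>\<^esub> a = rc a"
  by (simp add: a_r_coset_def')

lemma rc_hom: "rc \<in> ring_hom (R\<lparr>carrier := valuation_ring R v\<rparr>) (residue_field R v)"
proof -
  have "a_r_coset (R\<lparr>carrier := valuation_ring R v\<rparr>) (valuation_ideal R v) = rc"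
    by (rule ext) (rule rc_subring)
  then show ?thesis using ideal.rcos_ring_hom[OF valuation_ideal_ideal] by (simp add: residue_field_def)
qed

lemma residue_field_carrier: "carrier (residue_field R v) = rc ` vball R v 0"
  by (auto simp: residue_field_def FactRing_def A_RCOSETS_def' valuation_ring_eq_vball a_r_coset_def')

lemma residue_field_zero: "\<zero>\<^bsub>residue_field R v\<^esub> = valuation_ideal R v"
  by (simp add: residue_field_def FactRing_def)

lemma rc_eq_zero_iff: "a \<in> carrier R \<Longrightarrow> rc a = \<zero>\<^bsub>residue_field R v\<^esub> \<longleftrightarrow> a \<in> vball R v 1"
proof -
  assume a: "a \<in> carrier R"
  have "rc \<zero> = valuation_ideal R v"
    using vball_subset_carrier[of R v 1] by (auto simp: a_r_coset_def' valuation_ideal_eq_vball subset_iff)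
  then show ?thesis using residue_class_eq_iff[OF v a, of \<zero>] a by (simp add: residue_field_zero a_minus_def)
qed

lemma rc_eq_iff: "a \<in> carrier R \<Longrightarrow> b \<in> carrier R \<Longrightarrow> rc a = rc b \<longleftrightarrow> a \<ominus> b \<in> vball R v 1"
  by (rule residue_class_eq_iff[OF v])

lemma rc_simps:
  "a \<in> vball R v 0 \<Longrightarrow> rc a \<in> carrier (residue_field R v)"
  "\<lbrakk>a \<in> vball R v 0; b \<in> vball R v 0\<rbrakk> \<Longrightarrow> rc (a \<otimes> b) = rc a \<otimes>\<^bsub>residue_field R v\<^esub> rc b"
  "\<lbrakk>a \<in> vball R v 0; b \<in> vball R v 0\<rbrakk> \<Longrightarrow> rc (a \<oplus> b) = rc a \<oplus>\<^bsub>residue_field R v\<^esub> rc b"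
  "rc \<one> = \<one>\<^bsub>residue_field R v\<^esub>"
  using ring_hom_mult[OF rc_hom] ring_hom_add[OF rc_hom] ring_hom_one[OF rc_hom] residue_field_carrier
  by (auto simp: valuation_ring_eq_vball)

theorem residue_field_is_field: "field (residue_field R v)"
proof -
  have "subcring (vball R v 0) R" by (rule subcringI'[OF valuation_ring_subring])
  then have "cring (R\<lparr>carrier := valuation_ring R v\<rparr>)"
    using subcring_iff[OF vball_subset_carrier] by (simp add: valuation_ring_eq_vball)
  then have "cring (residue_field R v)"
    unfolding residue_field_def by (rule ideal.quotient_is_cring[OF valuation_ideal_ideal])
  then show ?thesis
  proof (rule cring.cring_fieldI2)
    show "\<zero>\<^bsub>residue_field R v\<^esub> \<noteq> \<one>\<^bsub>residue_field R v\<^esub>"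
      using rc_eq_zero_iff[of \<one>] rc_simps(4) place_one[OF v] by (auto simp: vball_def)
    fix A assume A: "A \<in> carrier (residue_field R v)" "A \<noteq> \<zero>\<^bsub>residue_field R v\<^esub>"
    then obtain a where a: "a \<in> vball R v 0" "A = rc a" using residue_field_carrier by auto
    have "a \<notin> vball R v 1" using A a rc_eq_zero_iff[OF vball_carrier[OF a(1)]] by simp
    then have u: "a \<in> carrier R" "a \<noteq> \<zero>" "v a = 0" using a(1) by (auto simp: vball_def)
    then have i: "inv a \<in> vball R v 0" using place_inv[OF v u(1,2)] by (auto intro: vballI)
    have "A \<otimes>\<^bsub>residue_field R v\<^esub> rc (inv a) = \<one>\<^bsub>residue_field R v\<^esub>"
      using rc_simps(2)[OF a(1) i] rc_simps(4) u a(2) by simp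
    then show "\<exists>B\<in>carrier (residue_field R v). A \<otimes>\<^bsub>residue_field R v\<^esub> B = \<one>\<^bsub>residue_field R v\<^esub>"
      using rc_simps(1)[OF i] by blast
  qed
qed

lemma rc_pow:
  "a \<in> vball R v 0 \<Longrightarrow> rc (a [^] (n::nat)) = rc a [^]\<^bsub>residue_field R v\<^esub> n"
proof (induction n)
  interpret k: field "residue_field R v" by (rule residue_field_is_field)
  case 0 then show ?case using rc_simps(4) by simp
next
  interpret k: field "residue_field R v" by (rule residue_field_is_field)
  case (Suc n)
  have "a [^] n \<in> vball R v 0" using vball_pow[OF v Suc(2), of n] by simp
  then show ?case using Suc rc_simps(2) by simp
qed

lemma rc_finsum:
  assumes "finite S" "\<And>i. i \<in> S \<Longrightarrow> f i \<in> vball R v 0"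
  shows "rc (\<Oplus>i\<in>S. f i) = (\<Oplus>\<^bsub>residue_field R v\<^esub>i\<in>S. rc (f i))"
  using assms
proof (induction S)
  interpret k: field "residue_field R v" by (rule residue_field_is_field)
  case empty
  then show ?case using rc_eq_zero_iff[of \<zero>] by simp
next
  interpret k: field "residue_field R v" by (rule residue_field_is_field)
  case (insert i S)
  have f: "f \<in> S \<rightarrow> carrier R" "f i \<in> carrier R" using insert vball_carrier by blast+
  have g: "(\<lambda>i. rc (f i)) \<in> S \<rightarrow> carrier (residue_field R v)" "rc (f i) \<in> carrier (residue_field R v)"
    using insert rc_simps(1) by auto
  have "finsum R f S \<in> vball R v 0" using insert by (intro vball_finsum[OF v]) auto
  then have "rc (f i \<oplus> finsum R f S) = rc (f i) \<oplus>\<^bsub>residue_field R v\<^esub> rc (finsum R f S)"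
    using rc_simps(3) insert.prems by simp
  then show ?case using insert f g by (simp add: finsum_insert k.finsum_insert)
qed

lemma card_residue_field: "card (carrier (residue_field R v)) = place_norm R v"
  by (simp add: residue_field_carrier place_norm_def valuation_ring_eq_vball)

text \<open>The finite-field identity z^q = z, read in the residue field.\<close>

lemma power_place_norm_cong:
  assumes "finite ((\<lambda>a. valuation_ideal R v +> a) ` valuation_ring R v)" "a \<in> vball R v 0"
  shows "a [^] place_norm R v \<ominus> a \<in> vball R v 1"
proof -
  interpret k: field "residue_field R v" by (rule residue_field_is_field)
  have "finite (carrier (residue_field R v))"
    using assms(1) by (simp add: residue_field_carrier valuation_ring_eq_vball)
  from k.finite_field_power_card[OF this rc_simps(1)[OF assms(2)]]
  have "rc a [^]\<^bsub>residue_field R v\<^esub> place_norm R v = rc a" unfolding card_residue_field .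
  then have "rc (a [^] place_norm R v) = rc a" using rc_pow[OF assms(2)] by simp
  then show ?thesis using rc_eq_iff vball_carrier[OF assms(2)] by simp
qed

end

section \<open>Cardinalities of spaces over a finite subfield\<close>

lemma card_of_dimension:
  assumes k: "subfield k R" "finite k" shows "dimension n k W \<Longrightarrow> finite W \<and> card W = card k ^ n"
proof (induction n arbitrary: W)
  case 0
  then show ?case using dimension_zero[OF k(1) 0] by simp
next
  case (Suc n)
  obtain v W' where v: "v \<in> carrier R" "v \<notin> W'" "dimension n k W'" "W = line_extension k v W'"
    using Suc.prems by (cases rule: dimension.cases) auto
  note W' = space_subgroup_props[OF k(1) v(3)]
  have kc: "k \<subseteq> carrier R" by (rule subfieldE(3)[OF k(1)])
  let ?f = "\<lambda>(c, w). c \<otimes> v \<oplus> w"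
  have im: "W = ?f ` (k \<times> W')"
  proof (rule Set.set_eqI)
    show "u \<in> W \<longleftrightarrow> u \<in> ?f ` (k \<times> W')" for u unfolding v(4) line_extension_mem_iff by force
  qed
  have "inj_on ?f (k \<times> W')"
  proof (rule inj_onI, clarify)
    fix c w c' w' assume *: "c \<in> k" "w \<in> W'" "c' \<in> k" "w' \<in> W'" "c \<otimes> v \<oplus> w = c' \<otimes> v \<oplus> w'"
    have cc: "c \<in> carrier R" "c' \<in> carrier R" "w \<in> carrier R" "w' \<in> carrier R" using * kc W'(1) by auto
    have "(c \<ominus> c') \<otimes> v = ((c \<otimes> v \<oplus> w) \<ominus> c' \<otimes> v) \<ominus> w" using cc v(1) by algebra
    also have "\<dots> = w' \<oplus> \<ominus> w" unfolding *(5) using cc v(1) by algebra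
    finally have e: "(c \<ominus> c') \<otimes> v = w' \<oplus> \<ominus> w" .
    have "w' \<oplus> \<ominus> w \<in> W'" using W'(3,4) * by blast
    moreover have "c \<ominus> c' \<in> k" using subringE(5,7)[OF subfieldE(1)[OF k(1)]] * by (simp add: a_minus_def)
    ultimately have "c \<ominus> c' = \<zero>" using W'(6)[of "c \<ominus> c'" v] e v(1,2) by auto
    then have "c = c'" using cc by (simp add: minus_eq_zero_iff)
    then show "c = c' \<and> w = w'" using *(5) cc v(1) add.l_cancel[of "c \<otimes> v" w w'] by simp
  qed
  then show ?case using Suc.IH[OF v(3)] k(2) im by (simp add: card_image card_cartesian_product)
qed

lemma card_eq_power_dim:
  assumes "subfield k R" "finite (carrier R)" shows "card (carrier R) = card k ^ dim k (carrier R)"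
proof -
  obtain Us where Us: "set Us = carrier R" using finite_list[OF assms(2)] by auto
  have "Span k Us = carrier R"
    using Span_base_incl[OF assms(1), of Us] Span_in_carrier[OF subfieldE(3)[OF assms(1)], of Us] Us by auto
  then have "finite_dimension k (carrier R)" using Span_finite_dimension[OF assms(1), of Us] Us by simp
  then have "dimension (dim k (carrier R)) k (carrier R)"
    using finite_dimensionE[OF assms(1)] by (simp add: over_def)
  moreover have "finite k" using finite_subset[OF subfieldE(3)[OF assms(1)] assms(2)] .
  ultimately show ?thesis using card_of_dimension[OF assms(1)] by blast
qed

end

context expansion_field
begin

lemma constants_subfield: "subfield constants R"
proof (rule finite_subring_is_subfield[OF _ finite_constants], rule subringI)
  show "constants \<subseteq> carrier R" by (auto simp: riemann_roch_space_def)
  show "\<one> \<in> constants" by (simp add: riemann_roch_space_def)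
  show "\<ominus> a \<in> constants" if "a \<in> constants" for a using that by (auto simp: riemann_roch_space_def intro: vball_neg)
  show "a \<otimes> b \<in> constants" if "a \<in> constants" "b \<in> constants" for a b
    using riemann_roch_space_mult[OF that] by simp
  show "a \<oplus> b \<in> constants" if "a \<in> constants" "b \<in> constants" for a b
    using riemann_roch_space_add[OF that] .
qed

text \<open>This identifies the Frobenius exponent of the definition with the norm of the place. A
  nonzero constant is a unit at every place, so the constants keep their number in the residue
  field, which is a vector space over their image.\<close>

theorem card_constant_field_power_degree:
  assumes v: "v \<in> places R" shows "card (constant_field R) ^ place_degree R v = place_norm R v"
proof -
  interpret k: field "residue_field R v" by (rule residue_field_is_field[OF v])
  let ?rc = "\<lambda>a. valuation_ideal R v +> a"
  have sub: "constants \<subseteq> vball R v 0" using v by (auto simp: riemann_roch_space_def)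
  have cc: "constants \<subseteq> carrier R" by (auto simp: riemann_roch_space_def)
  have "inj_on ?rc constants"
  proof (rule inj_onI, rule ccontr)
    fix a b assume ab: "a \<in> constants" "b \<in> constants" "?rc a = ?rc b" "a \<noteq> b"
    then have c: "a \<in> carrier R" "b \<in> carrier R" using cc by auto
    have "a \<ominus> b \<in> vball R v 1" "a \<ominus> b \<noteq> \<zero>"
      using residue_class_eq_iff[OF v c] ab c by (auto simp: minus_eq_zero_iff)
    then show False using place_of_constant[OF riemann_roch_space_minus[OF ab(1,2)] _ v] by (simp add: vball_def)
  qed
  then have card: "card (?rc ` constants) = card constants" by (rule card_image)
  have "subfield (?rc ` constants) (residue_field R v)"
  proof (rule k.finite_subring_is_subfield[OF k.subringI])
    note C = subringE[OF subfieldE(1)[OF constants_subfield]]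
    show "?rc ` constants \<subseteq> carrier (residue_field R v)" using sub rc_simps(1)[OF v] by auto
    show "\<one>\<^bsub>residue_field R v\<^esub> \<in> ?rc ` constants" using C(3) rc_simps(4)[OF v] by (metis imageI)
    show "\<ominus>\<^bsub>residue_field R v\<^esub> h \<in> ?rc ` constants" if h: "h \<in> ?rc ` constants" for h
    proof -
      obtain a where a: "a \<in> constants" "h = ?rc a" using h by auto
      have ab: "a \<in> vball R v 0" "\<ominus> a \<in> vball R v 0" "\<ominus> a \<in> constants" using a sub C(5) by auto
      have "?rc (\<ominus> a) \<oplus>\<^bsub>residue_field R v\<^esub> ?rc a = \<zero>\<^bsub>residue_field R v\<^esub>"
        using rc_simps(3)[OF v ab(2,1)] rc_eq_zero_iff[OF v, of \<zero>] vball_carrier[OF ab(1)] by (simp add: l_neg)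
      then have "\<ominus>\<^bsub>residue_field R v\<^esub> h = ?rc (\<ominus> a)"
        using k.minus_equality rc_simps(1)[OF v] ab a(2) by blast
      then show ?thesis using ab(3) by simp
    qed
    show "h1 \<otimes>\<^bsub>residue_field R v\<^esub> h2 \<in> ?rc ` constants" "h1 \<oplus>\<^bsub>residue_field R v\<^esub> h2 \<in> ?rc ` constants"
      if h: "h1 \<in> ?rc ` constants" "h2 \<in> ?rc ` constants" for h1 h2
    proof -
      obtain a b where ab: "a \<in> constants" "h1 = ?rc a" "b \<in> constants" "h2 = ?rc b" using h by auto
      then have "a \<in> vball R v 0" "b \<in> vball R v 0" using sub by auto
      then show "h1 \<otimes>\<^bsub>residue_field R v\<^esub> h2 \<in> ?rc ` constants" "h1 \<oplus>\<^bsub>residue_field R v\<^esub> h2 \<in> ?rc ` constants"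
        using ab rc_simps(2,3)[OF v, of a b] C(6,7)[OF ab(1,3)] by (metis imageI)+
    qed
  qed (simp add: finite_constants)
  moreover have "finite (carrier (residue_field R v))"
    using finite_residue_classes[OF v] residue_field_carrier[OF v] by (simp add: valuation_ring_eq_vball)
  ultimately have "card (carrier (residue_field R v)) = card (?rc ` constants) ^ place_degree R v"
    unfolding place_degree_def constant_field_eq by (rule k.card_eq_power_dim)
  then show ?thesis unfolding card constant_field_eq card_residue_field[OF v] by simp
qed

end

section \<open>Galois action on places\<close>

text \<open>Dedekind independence for characters with arbitrary index type, domain and operation. It
  is used once with residue characters of a decomposition group and once with automorphisms of
  E.\<close>

lemma (in field) independent_characters:
  fixes \<chi> :: "'i \<Rightarrow> 'c \<Rightarrow> 'a"
  assumes "finite S"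
    and mult: "\<And>i a b. i \<in> S \<Longrightarrow> a \<in> A \<Longrightarrow> b \<in> A \<Longrightarrow> \<chi> i (m b a) = \<chi> i b \<otimes> \<chi> i a"
    and closed: "\<And>a b. a \<in> A \<Longrightarrow> b \<in> A \<Longrightarrow> m b a \<in> A"
    and A: "A \<noteq> {}" "\<And>i a. i \<in> S \<Longrightarrow> a \<in> A \<Longrightarrow> \<chi> i a \<in> carrier R \<and> \<chi> i a \<noteq> \<zero>"
    and distinct: "\<And>i j. i \<in> S \<Longrightarrow> j \<in> S \<Longrightarrow> i \<noteq> j \<Longrightarrow> \<exists>a\<in>A. \<chi> i a \<noteq> \<chi> j a"
    and c: "\<And>i. i \<in> S \<Longrightarrow> c i \<in> carrier R"
    and relation: "\<And>a. a \<in> A \<Longrightarrow> (\<Oplus>i\<in>S. c i \<otimes> \<chi> i a) = \<zero>"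
    and i: "i \<in> S"
  shows "c i = \<zero>"
  using assms
proof (induction S arbitrary: c i)
  case empty
  then show ?case by simp
next
  case (insert k S)
  note mult = insert.prems(1) and closed = insert.prems(2) and ne = insert.prems(3)
    and val = insert.prems(4) and dist = insert.prems(5) and cc = insert.prems(6) and rel = insert.prems(7)
  have sum: "c k \<otimes> \<chi> k a \<oplus> (\<Oplus>j\<in>S. c j \<otimes> \<chi> j a) = \<zero>" if a: "a \<in> A" for a
  proof -
    have "(\<lambda>j. c j \<otimes> \<chi> j a) \<in> S \<rightarrow> carrier R" "c k \<otimes> \<chi> k a \<in> carrier R" using cc val a by auto
    then show ?thesis using rel[OF a] insert.hyps by (simp add: finsum_insert)
  qed
  have zero: "c j = \<zero>" if j: "j \<in> S" for j
  proof -
    have "j \<noteq> k" using j insert.hyps by auto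
    then obtain b where b: "b \<in> A" "\<chi> j b \<noteq> \<chi> k b" using dist[of j k] j by auto
    have kb: "\<chi> k b \<in> carrier R" using val b by auto
    \<comment> \<open>Subtracting \<open>\<chi> k b\<close> times the relation at \<open>a\<close>
      from the relation at \<open>m b a\<close> eliminates the character \<open>k\<close>; the
      shorter relation has these coefficients.\<close>
    have "c j \<otimes> (\<chi> j b \<ominus> \<chi> k b) = \<zero>"
    proof (rule insert.IH[of "\<lambda>j. c j \<otimes> (\<chi> j b \<ominus> \<chi> k b)"])
      fix a assume a: "a \<in> A"
      let ?f = "\<lambda>j. c j \<otimes> \<chi> j (m b a)" and ?g = "\<lambda>j. c j \<otimes> \<chi> j a"
      have f: "?f \<in> S \<rightarrow> carrier R" and g: "?g \<in> S \<rightarrow> carrier R" using cc val a b closed by auto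
      have t: "\<chi> k b \<otimes> (\<Oplus>j\<in>S. ?g j) = (\<Oplus>j\<in>S. \<chi> k b \<otimes> ?g j)"
        using finsum_rdistr[OF insert.hyps(1) kb g] by simp
      have eq: "(\<Oplus>j\<in>S. c j \<otimes> (\<chi> j b \<ominus> \<chi> k b) \<otimes> \<chi> j a) = (\<Oplus>j\<in>S. ?f j \<oplus> (\<ominus> \<chi> k b) \<otimes> ?g j)"
      proof (rule finsum_cong')
        fix j assume j: "j \<in> S"
        have cv: "c j \<in> carrier R" "\<chi> j b \<in> carrier R" "\<chi> j a \<in> carrier R" using cc val a b j by auto
        show "c j \<otimes> (\<chi> j b \<ominus> \<chi> k b) \<otimes> \<chi> j a = ?f j \<oplus> (\<ominus> \<chi> k b) \<otimes> ?g j"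
          unfolding mult[OF insertI2[OF j] a b(1)] using cv kb by algebra
      qed (use f g kb in auto)
      also have "\<dots> = (\<Oplus>j\<in>S. ?f j) \<oplus> (\<Oplus>j\<in>S. (\<ominus> \<chi> k b) \<otimes> ?g j)"
        using f g kb by (intro finsum_addf) auto
      also have "(\<Oplus>j\<in>S. (\<ominus> \<chi> k b) \<otimes> ?g j) = (\<ominus> \<chi> k b) \<otimes> (\<Oplus>j\<in>S. ?g j)"
        using finsum_rdistr[OF insert.hyps(1) _ g, of "\<ominus> \<chi> k b"] kb by simp
      finally have e: "(\<Oplus>j\<in>S. c j \<otimes> (\<chi> j b \<ominus> \<chi> k b) \<otimes> \<chi> j a) =
        (\<Oplus>j\<in>S. ?f j) \<oplus> (\<ominus> \<chi> k b) \<otimes> (\<Oplus>j\<in>S. ?g j)" .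
      have F: "(\<Oplus>j\<in>S. ?f j) \<in> carrier R" "(\<Oplus>j\<in>S. ?g j) \<in> carrier R" using f g by auto
      have kc: "c k \<in> carrier R" "\<chi> k a \<in> carrier R" using cc val a by auto
      have ba: "m b a \<in> A" using closed a b by auto
      have mk: "\<chi> k (m b a) = \<chi> k b \<otimes> \<chi> k a" by (rule mult) (use a b in auto)
      have s1: "c k \<otimes> (\<chi> k b \<otimes> \<chi> k a) \<oplus> (\<Oplus>j\<in>S. ?f j) = \<zero>" using sum[OF ba] mk by simp
      have s2: "c k \<otimes> \<chi> k a \<oplus> (\<Oplus>j\<in>S. ?g j) = \<zero>" by (rule sum[OF a])
      have "(\<Oplus>j\<in>S. ?f j) \<oplus> (\<ominus> \<chi> k b) \<otimes> (\<Oplus>j\<in>S. ?g j) =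
         (c k \<otimes> (\<chi> k b \<otimes> \<chi> k a) \<oplus> (\<Oplus>j\<in>S. ?f j)) \<ominus> \<chi> k b \<otimes> (c k \<otimes> \<chi> k a \<oplus> (\<Oplus>j\<in>S. ?g j))"
      proof -
        have "f \<oplus> (\<ominus> k) \<otimes> g = (c \<otimes> (k \<otimes> x) \<oplus> f) \<ominus> k \<otimes> (c \<otimes> x \<oplus> g)"
          if "f \<in> carrier R" "g \<in> carrier R" "c \<in> carrier R" "k \<in> carrier R" "x \<in> carrier R" for f g c k x
          using that by algebra
        from this[OF F(1,2) kc(1) kb kc(2)] show ?thesis .
      qed
      also have "\<dots> = \<zero>" unfolding s1 s2 using kb by simp
      finally show "(\<Oplus>j\<in>S. c j \<otimes> (\<chi> j b \<ominus> \<chi> k b) \<otimes> \<chi> j a) = \<zero>" using e by simp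
    next
      show "\<chi> i (m b a) = \<chi> i b \<otimes> \<chi> i a" if "i \<in> S" "a \<in> A" "b \<in> A" for i a b using mult that by simp
      show "\<exists>a\<in>A. \<chi> i a \<noteq> \<chi> j a" if "i \<in> S" "j \<in> S" "i \<noteq> j" for i j using dist that by simp
      show "c i \<otimes> (\<chi> i b \<ominus> \<chi> k b) \<in> carrier R" if "i \<in> S" for i
        using cc[of i] val[of i b] that b(1) kb by simp
    qed (use closed ne val j in auto)
    moreover have "\<chi> j b \<ominus> \<chi> k b \<noteq> \<zero>" "\<chi> j b \<in> carrier R" "c j \<in> carrier R"
      using b val[of j b] j kb cc minus_eq_zero_iff[of "\<chi> j b" "\<chi> k b"] by auto
    ultimately show ?thesis using integral_iff[of "c j" "\<chi> j b \<ominus> \<chi> k b"] kb by simp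
  qed
  moreover have "c k = \<zero>"
  proof -
    obtain a where a: "a \<in> A" using ne by auto
    have "(\<Oplus>j\<in>S. c j \<otimes> \<chi> j a) = (\<Oplus>j\<in>S. \<zero>)"
      using zero val a by (intro finsum_cong') auto
    then have "c k \<otimes> \<chi> k a = \<zero>" using sum[OF a] cc[of k] val[of k a] a by simp
    then show ?thesis using integral_iff[of "c k" "\<chi> k a"] cc[of k] val[of k a] a by simp
  qed
  ultimately show ?case using insert.prems(8) by auto
qed

lemma (in field) place_finprod:
  assumes "v \<in> places R" "finite S" "\<And>i. i \<in> S \<Longrightarrow> f i \<in> carrier R \<and> f i \<noteq> \<zero>"
  shows "(\<Otimes>i\<in>S. f i) \<in> carrier R \<and> (\<Otimes>i\<in>S. f i) \<noteq> \<zero> \<and> v (\<Otimes>i\<in>S. f i) = (\<Sum>i\<in>S. v (f i))"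
  using assms(2,3)
proof (induction S)
  case empty then show ?case using place_one[OF assms(1)] by simp
next
  case (insert i S)
  have "f \<in> S \<rightarrow> carrier R" "f i \<in> carrier R" using insert by auto
  then show ?case using insert place_mult[OF assms(1)] by (simp add: finprod_insert)
qed

text \<open>Composition of a place with an automorphism. The restriction restores extensionality, so
  that equal valuations are equal as functions.\<close>

definition twist :: "('a, 'b) ring_scheme \<Rightarrow> ('a \<Rightarrow> int) \<Rightarrow> ('a \<Rightarrow> 'a) \<Rightarrow> 'a \<Rightarrow> int" where
  "twist K v \<gamma> = restrict (\<lambda>x. v (\<gamma> x)) (carrier K - {\<zero>\<^bsub>K\<^esub>})"

locale abelian_function_field_extension = field E for E (structure) +
  fixes F :: "'a set"
  assumes F_function_field: "global_function_field (E\<lparr>carrier := F\<rparr>)"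
    and abelian: "finite_abelian_extension E F"
begin

abbreviation "G \<equiv> galois_group E F"
abbreviation "FF \<equiv> E\<lparr>carrier := F\<rparr>"

lemma F_subfield: "subfield F E" and E_finite: "finite_dimension F (carrier E)"
  and G_comm: "comm_group G"
  and in_F: "\<And>x. x \<in> carrier E \<Longrightarrow> (\<And>\<gamma>. \<gamma> \<in> carrier G \<Longrightarrow> \<gamma> x = x) \<Longrightarrow> x \<in> F"
  using abelian by (auto simp: finite_abelian_extension_def finite_galois_extension_def)

lemma F_carrier: "F \<subseteq> carrier E" by (rule subfieldE(3)[OF F_subfield])

sublocale G: comm_group G by (rule G_comm)
sublocale FF: field FF by (rule subfield_iff(2)[OF F_subfield])

lemma expansion_field_exists:
  assumes "subfield L E" "F \<subseteq> L" shows "\<exists>V x. expansion_field (E\<lparr>carrier := L\<rparr>) V x"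
  by (rule expansion_field_of_intermediate_field[OF F_subfield F_function_field E_finite assms])

lemma expansion_field_F: "\<exists>V x. expansion_field FF V x"
  by (rule expansion_field_exists[OF F_subfield subset_refl])

lemma expansion_field_E: "\<exists>V x. expansion_field E V x"
  using expansion_field_exists[OF carrier_is_subfield F_carrier] by simp

lemma gal_hom: "\<gamma> \<in> carrier G \<Longrightarrow> \<gamma> \<in> ring_hom E E"
  and gal_bij: "\<gamma> \<in> carrier G \<Longrightarrow> bij_betw \<gamma> (carrier E) (carrier E)"
  and gal_extensional: "\<gamma> \<in> carrier G \<Longrightarrow> \<gamma> \<in> extensional (carrier E)"
  and gal_fix: "\<gamma> \<in> carrier G \<Longrightarrow> x \<in> F \<Longrightarrow> \<gamma> x = x"
  by (auto simp: galois_group_def Bij_def)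

lemma gal_Bij: "\<gamma> \<in> carrier G \<Longrightarrow> \<gamma> \<in> Bij (carrier E)" by (simp add: galois_group_def)

lemma gal_closed [simp]: "\<gamma> \<in> carrier G \<Longrightarrow> x \<in> carrier E \<Longrightarrow> \<gamma> x \<in> carrier E"
  using ring_hom_closed[OF gal_hom] .

lemma gal_mult: "\<gamma> \<in> carrier G \<Longrightarrow> x \<in> carrier E \<Longrightarrow> y \<in> carrier E \<Longrightarrow> \<gamma> (x \<otimes> y) = \<gamma> x \<otimes> \<gamma> y"
  using ring_hom_mult[OF gal_hom] .

lemma gal_add: "\<gamma> \<in> carrier G \<Longrightarrow> x \<in> carrier E \<Longrightarrow> y \<in> carrier E \<Longrightarrow> \<gamma> (x \<oplus> y) = \<gamma> x \<oplus> \<gamma> y"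
  using ring_hom_add[OF gal_hom] .

lemma gal_one: "\<gamma> \<in> carrier G \<Longrightarrow> \<gamma> \<one> = \<one>"
  using ring_hom_one[OF gal_hom] .

lemma gal_zero: "\<gamma> \<in> carrier G \<Longrightarrow> \<gamma> \<zero> = \<zero>"
  using gal_fix subringE(2)[OF subfieldE(1)[OF F_subfield]] by auto

lemma gal_inj: "\<gamma> \<in> carrier G \<Longrightarrow> x \<in> carrier E \<Longrightarrow> y \<in> carrier E \<Longrightarrow> \<gamma> x = \<gamma> y \<longleftrightarrow> x = y"
  using inj_on_eq_iff[OF bij_betw_imp_inj_on[OF gal_bij]] .

lemma gal_eq_zero_iff [simp]: "\<gamma> \<in> carrier G \<Longrightarrow> x \<in> carrier E \<Longrightarrow> \<gamma> x = \<zero> \<longleftrightarrow> x = \<zero>"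
  using gal_inj[of \<gamma> x \<zero>] gal_zero[of \<gamma>] by auto

lemma gal_minus: "\<gamma> \<in> carrier G \<Longrightarrow> x \<in> carrier E \<Longrightarrow> y \<in> carrier E \<Longrightarrow> \<gamma> (x \<ominus> y) = \<gamma> x \<ominus> \<gamma> y"
proof -
  assume *: "\<gamma> \<in> carrier G" "x \<in> carrier E" "y \<in> carrier E"
  have "\<gamma> (x \<ominus> y) \<oplus> \<gamma> y = \<gamma> ((x \<ominus> y) \<oplus> y)" using * gal_add by simp
  also have "(x \<ominus> y) \<oplus> y = x" using * by algebra
  finally have e: "\<gamma> (x \<ominus> y) \<oplus> \<gamma> y = \<gamma> x" .
  have c: "\<gamma> (x \<ominus> y) \<in> carrier E" "\<gamma> y \<in> carrier E" using * by auto
  have "\<gamma> (x \<ominus> y) = (\<gamma> (x \<ominus> y) \<oplus> \<gamma> y) \<ominus> \<gamma> y" using c by algebra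
  then show ?thesis using e by simp
qed

lemma gal_pow: "\<gamma> \<in> carrier G \<Longrightarrow> x \<in> carrier E \<Longrightarrow> \<gamma> (x [^] (n::nat)) = \<gamma> x [^] n"
  by (induction n) (auto simp: gal_one gal_mult)

lemma gal_compose: "\<gamma> \<in> carrier G \<Longrightarrow> \<tau> \<in> carrier G \<Longrightarrow> x \<in> carrier E \<Longrightarrow> (\<gamma> \<otimes>\<^bsub>G\<^esub> \<tau>) x = \<gamma> (\<tau> x)"
proof -
  assume *: "\<gamma> \<in> carrier G" "\<tau> \<in> carrier G" "x \<in> carrier E"
  have "\<gamma> \<otimes>\<^bsub>G\<^esub> \<tau> = compose (carrier E) \<gamma> \<tau>"
    using gal_Bij[OF *(1)] gal_Bij[OF *(2)] by (simp add: galois_group_def BijGroup_def)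
  then show ?thesis using *(3) by (simp add: compose_def)
qed

lemma gal_id: "x \<in> carrier E \<Longrightarrow> \<one>\<^bsub>G\<^esub> x = x"
  by (simp add: galois_group_def BijGroup_def)

lemma gal_inv: "\<gamma> \<in> carrier G \<Longrightarrow> x \<in> carrier E \<Longrightarrow> (inv\<^bsub>G\<^esub> \<gamma>) (\<gamma> x) = x"
  "\<gamma> \<in> carrier G \<Longrightarrow> x \<in> carrier E \<Longrightarrow> \<gamma> ((inv\<^bsub>G\<^esub> \<gamma>) x) = x"
  using gal_compose[of "inv\<^bsub>G\<^esub> \<gamma>" \<gamma> x] gal_compose[of \<gamma> "inv\<^bsub>G\<^esub> \<gamma>" x] gal_id by auto

lemma gal_eqI:
  assumes "\<gamma> \<in> carrier G" "\<tau> \<in> carrier G" "\<And>x. x \<in> carrier E \<Longrightarrow> \<gamma> x = \<tau> x" shows "\<gamma> = \<tau>"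
  using gal_extensional[OF assms(1)] gal_extensional[OF assms(2)] assms(3) by (rule extensionalityI)

lemma gal_finsum:
  assumes "\<gamma> \<in> carrier G" "f \<in> S \<rightarrow> carrier E" shows "\<gamma> (\<Oplus>i\<in>S. f i) = (\<Oplus>i\<in>S. \<gamma> (f i))"
  using assms(2)
proof (induction S rule: infinite_finite_induct)
  case (insert i S)
  then have f: "f \<in> S \<rightarrow> carrier E" "f i \<in> carrier E" by (simp_all add: Pi_def)
  then have "\<gamma> (f j) \<in> carrier E" if "j \<in> S" for j using gal_closed[OF assms(1)] that by (simp add: Pi_def)
  then have "(\<lambda>i. \<gamma> (f i)) \<in> S \<rightarrow> carrier E" by (rule Pi_I)
  then show ?case using insert assms(1) f gal_add[OF assms(1) f(2) finsum_closed[OF f(1)]] by (simp add: finsum_insert)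
qed (use assms in \<open>auto simp: gal_zero finsum_infinite\<close>)

lemma gal_finprod:
  assumes "\<gamma> \<in> carrier G" "f \<in> S \<rightarrow> carrier E" shows "\<gamma> (\<Otimes>i\<in>S. f i) = (\<Otimes>i\<in>S. \<gamma> (f i))"
  using assms(2)
proof (induction S rule: infinite_finite_induct)
  case (insert i S)
  then have f: "f \<in> S \<rightarrow> carrier E" "f i \<in> carrier E" by (simp_all add: Pi_def)
  then have "\<gamma> (f j) \<in> carrier E" if "j \<in> S" for j using gal_closed[OF assms(1)] that by (simp add: Pi_def)
  then have "(\<lambda>i. \<gamma> (f i)) \<in> S \<rightarrow> carrier E" by (rule Pi_I)
  then show ?case using insert assms(1) f gal_mult[OF assms(1) f(2) finprod_closed[OF f(1)]] by (simp add: finprod_insert)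
qed (use assms in \<open>auto simp: gal_one\<close>)

lemma gal_combine:
  assumes s: "\<gamma> \<in> carrier G"
  shows "set Ks \<subseteq> F \<Longrightarrow> set Us \<subseteq> carrier E \<Longrightarrow> \<gamma> (combine Ks Us) = combine Ks (map \<gamma> Us)"
proof (induction Ks Us rule: combine.induct)
  case (1 k Ks u Us)
  have k: "k \<in> carrier E" "set Ks \<subseteq> carrier E" using 1 F_carrier by auto
  then have "combine Ks Us \<in> carrier E" using 1 by auto
  then show ?case using 1 k s by (simp add: gal_add gal_mult gal_fix)
qed (use s in \<open>auto simp: gal_zero\<close>)

text \<open>An automorphism over F is determined by the images of a finite spanning list, and each
  image is a root of a fixed polynomial over F.\<close>

lemma G_finite: "finite (carrier G)"
proof -
  obtain n where "dimension n F (carrier E)" using E_finite by (auto simp: finite_dimension_def)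
  then obtain Us where Us: "set Us \<subseteq> carrier E" "Span F Us = carrier E"
    using exists_base[OF F_subfield] by blast
  \<comment> \<open>The choice operator fixes one annihilating polynomial per \<open>u\<close>, so
    all automorphisms send \<open>u\<close> into the same finite set of roots.\<close>
  define R where "R u = {z. \<exists>p\<in>carrier (F[X]). p \<noteq> [] \<and> p = (SOME p. p \<in> carrier (F[X]) \<and> p \<noteq> [] \<and> eval p u = \<zero>) \<and> is_root p z}" for u
  have alg: "\<exists>p. p \<in> carrier (F[X]) \<and> p \<noteq> [] \<and> eval p u = \<zero>" if "u \<in> carrier E" for u
    using finite_dimension_imp_algebraic[OF F_subfield carrier_is_subring E_finite that]
      algebraicE[OF subfieldE(1)[OF F_subfield] that] by metis
  have Rfin: "finite (R u)" for u
  proof -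
    let ?p = "SOME p. p \<in> carrier (F[X]) \<and> p \<noteq> [] \<and> eval p u = \<zero>"
    have "finite {z. is_root ?p z}" if "?p \<in> carrier (F[X])"
    proof -
      have "?p \<in> carrier (poly_ring E)" using that F_carrier unfolding univ_poly_def polynomial_def by auto
      then show ?thesis by (rule finite_number_of_roots)
    qed
    then show ?thesis unfolding R_def by (cases "?p \<in> carrier (F[X])") auto
  qed
  have root: "\<gamma> u \<in> R u" if s: "\<gamma> \<in> carrier G" and u: "u \<in> carrier E" for \<gamma> u
  proof -
    let ?p = "SOME p. p \<in> carrier (F[X]) \<and> p \<noteq> [] \<and> eval p u = \<zero>"
    have p: "?p \<in> carrier (F[X])" "?p \<noteq> []" "eval ?p u = \<zero>" using someI_ex[OF alg[OF u]] by auto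
    interpret s: ring_hom_ring E E \<gamma> by (rule ring_hom_ringI2[OF ring_axioms ring_axioms gal_hom[OF s]])
    have ps: "set ?p \<subseteq> F" using p(1) by (simp add: univ_poly_carrier[symmetric] polynomial_incl)
    then have "map \<gamma> ?p = ?p" using gal_fix[OF s] by (intro map_idI) auto
    moreover have "eval (map \<gamma> ?p) (\<gamma> u) = \<gamma> (eval ?p u)" using s.eval_hom'[OF u] ps F_carrier by auto
    ultimately have "eval ?p (\<gamma> u) = \<zero>" using p(3) gal_zero[OF s] by simp
    then show ?thesis using p s u unfolding R_def is_root_def by auto
  qed
  have "inj_on (\<lambda>\<gamma>. map \<gamma> Us) (carrier G)"
  proof (rule inj_onI)
    fix \<gamma> \<tau> assume *: "\<gamma> \<in> carrier G" "\<tau> \<in> carrier G" "map \<gamma> Us = map \<tau> Us"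
    show "\<gamma> = \<tau>"
    proof (rule gal_eqI[OF *(1,2)])
      fix x assume "x \<in> carrier E"
      then have "x \<in> {combine Ks Us |Ks. set Ks \<subseteq> F}"
        using equalityD1[OF trans[OF Us(2)[symmetric] Span_eq_combine_set[OF F_subfield Us(1)]]] by (rule subsetD[rotated])
      then obtain Ks where "set Ks \<subseteq> F" "x = combine Ks Us" by blast
      then show "\<gamma> x = \<tau> x" using gal_combine[OF *(1) _ Us(1)] gal_combine[OF *(2) _ Us(1)] *(3) by simp
    qed
  qed
  moreover have "(\<lambda>\<gamma>. map \<gamma> Us) ` carrier G \<subseteq> {xs. set xs \<subseteq> (\<Union>u\<in>set Us. R u) \<and> length xs = length Us}"
  proof (rule image_subsetI)
    fix \<gamma> assume g: "\<gamma> \<in> carrier G"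
    have "\<gamma> u \<in> R u" if "u \<in> set Us" for u using root[OF g] Us(1) that by blast
    then show "map \<gamma> Us \<in> {xs. set xs \<subseteq> (\<Union>u\<in>set Us. R u) \<and> length xs = length Us}" by auto
  qed
  moreover have "finite {xs. set xs \<subseteq> (\<Union>u\<in>set Us. R u) \<and> length xs = length Us}"
    using Rfin by (intro finite_lists_length_eq) auto
  ultimately show ?thesis by (rule inj_on_finite)
qed

lemma G_reindex:
  assumes "\<gamma> \<in> carrier G" shows "(\<lambda>\<tau>. \<gamma> \<otimes>\<^bsub>G\<^esub> \<tau>) ` carrier G = carrier G" "inj_on (\<lambda>\<tau>. \<gamma> \<otimes>\<^bsub>G\<^esub> \<tau>) (carrier G)"
proof -
  show inj: "inj_on (\<lambda>\<tau>. \<gamma> \<otimes>\<^bsub>G\<^esub> \<tau>) (carrier G)" using assms by (auto intro!: inj_onI)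
  have "(\<lambda>\<tau>. \<gamma> \<otimes>\<^bsub>G\<^esub> \<tau>) ` carrier G \<subseteq> carrier G" using assms by auto
  then show "(\<lambda>\<tau>. \<gamma> \<otimes>\<^bsub>G\<^esub> \<tau>) ` carrier G = carrier G" using endo_inj_surj[OF G_finite _ inj] by blast
qed

lemma trace_in_F:
  assumes y: "y \<in> carrier E" shows "(\<Oplus>\<tau>\<in>carrier G. \<tau> y) \<in> F"
proof (rule in_F)
  show c: "(\<Oplus>\<tau>\<in>carrier G. \<tau> y) \<in> carrier E" using y by (intro finsum_closed) auto
  fix \<gamma> assume s: "\<gamma> \<in> carrier G"
  have "\<gamma> (\<Oplus>\<tau>\<in>carrier G. \<tau> y) = (\<Oplus>\<tau>\<in>carrier G. \<gamma> (\<tau> y))" using s y by (intro gal_finsum) auto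
  also have "\<dots> = (\<Oplus>\<tau>\<in>carrier G. (\<gamma> \<otimes>\<^bsub>G\<^esub> \<tau>) y)" using s y gal_compose by (intro finsum_cong') auto
  also have "\<dots> = (\<Oplus>\<tau>\<in>(\<lambda>\<tau>. \<gamma> \<otimes>\<^bsub>G\<^esub> \<tau>) ` carrier G. \<tau> y)"
    using G_reindex[OF s] y by (intro add.finprod_reindex[symmetric]) auto
  finally show "\<gamma> (\<Oplus>\<tau>\<in>carrier G. \<tau> y) = (\<Oplus>\<tau>\<in>carrier G. \<tau> y)" using G_reindex[OF s] by simp
qed

lemma norm_in_F:
  assumes y: "y \<in> carrier E" shows "(\<Otimes>\<tau>\<in>carrier G. \<tau> y) \<in> F"
proof (rule in_F)
  show c: "(\<Otimes>\<tau>\<in>carrier G. \<tau> y) \<in> carrier E" using y by (intro finprod_closed) auto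
  fix \<gamma> assume s: "\<gamma> \<in> carrier G"
  have "\<gamma> (\<Otimes>\<tau>\<in>carrier G. \<tau> y) = (\<Otimes>\<tau>\<in>carrier G. \<gamma> (\<tau> y))" using s y by (intro gal_finprod) auto
  also have "\<dots> = (\<Otimes>\<tau>\<in>carrier G. (\<gamma> \<otimes>\<^bsub>G\<^esub> \<tau>) y)" using s y gal_compose by (intro finprod_cong') auto
  also have "\<dots> = (\<Otimes>\<tau>\<in>(\<lambda>\<tau>. \<gamma> \<otimes>\<^bsub>G\<^esub> \<tau>) ` carrier G. \<tau> y)"
    using G_reindex[OF s] y by (intro finprod_reindex[symmetric]) auto
  finally show "\<gamma> (\<Otimes>\<tau>\<in>carrier G. \<tau> y) = (\<Otimes>\<tau>\<in>carrier G. \<tau> y)" using G_reindex[OF s] by simp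
qed

lemma twist_apply: "x \<in> carrier E \<Longrightarrow> x \<noteq> \<zero> \<Longrightarrow> twist E v \<gamma> x = v (\<gamma> x)"
  by (simp add: twist_def)

lemma twist_place:
  assumes v: "v \<in> places E" and s: "\<gamma> \<in> carrier G" shows "twist E v \<gamma> \<in> places E"
proof -
  have "n \<in> twist E v \<gamma> ` (carrier E - {\<zero>})" for n
  proof -
    obtain x where x: "x \<in> carrier E" "x \<noteq> \<zero>" "v x = n" using place_surj[OF v] by blast
    let ?y = "(inv\<^bsub>G\<^esub> \<gamma>) x"
    have "?y \<in> carrier E" "?y \<noteq> \<zero>" "\<gamma> ?y = x" using x s gal_inv(2) by auto
    then show ?thesis using twist_apply[of ?y v \<gamma>] x by (intro image_eqI[of _ _ ?y]) auto
  qed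
  then have "twist E v \<gamma> ` (carrier E - {\<zero>}) = UNIV" by auto
  moreover have "min (v (\<gamma> x)) (v (\<gamma> y)) \<le> v (\<gamma> x \<oplus> \<gamma> y)"
    if "x \<in> carrier E" "x \<noteq> \<zero>" "y \<in> carrier E" "y \<noteq> \<zero>" "x \<oplus> y \<noteq> \<zero>" for x y
  proof (rule place_add[OF v])
    show "\<gamma> x \<oplus> \<gamma> y \<noteq> \<zero>" using that s gal_add[OF s, symmetric] by simp
  qed (use that s in auto)
  ultimately show ?thesis
    using s by (auto simp: places_def twist_def gal_mult gal_add place_mult[OF v])
qed

lemma vball_twist: "x \<in> carrier E \<Longrightarrow> \<gamma> \<in> carrier G \<Longrightarrow> x \<in> vball E (twist E v \<gamma>) n \<longleftrightarrow> \<gamma> x \<in> vball E v n"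
  by (cases "x = \<zero>") (auto simp: vball_def twist_apply gal_zero)

lemma twist_twist:
  "\<gamma> \<in> carrier G \<Longrightarrow> \<tau> \<in> carrier G \<Longrightarrow> twist E (twist E v \<gamma>) \<tau> = twist E v (\<gamma> \<otimes>\<^bsub>G\<^esub> \<tau>)"
  by (rule extensionalityI[of _ "carrier E - {\<zero>}"]) (auto simp: twist_def gal_compose)

lemma twist_id: "v \<in> places E \<Longrightarrow> twist E v \<one>\<^bsub>G\<^esub> = v"
  by (rule extensionalityI[of _ "carrier E - {\<zero>}"]) (auto simp: twist_def gal_id places_def)

lemma places_above_twist:
  assumes "Q \<in> places_above E F P" "\<gamma> \<in> carrier G" shows "twist E Q \<gamma> \<in> places_above E F P"
proof -
  have Q: "Q \<in> places E" "valuation_ideal FF P \<subseteq> valuation_ideal E Q" using assms by (auto simp: places_above_def)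
  have "x \<in> valuation_ideal E (twist E Q \<gamma>)" if x: "x \<in> valuation_ideal FF P" for x
  proof -
    have "x \<in> F" using x by (auto simp: valuation_ideal_def)
    moreover have "x \<in> vball E Q 1" using x Q(2) unfolding valuation_ideal_eq_vball by blast
    ultimately show ?thesis using vball_twist[of x \<gamma> Q 1] assms(2) gal_fix[of \<gamma> x] F_carrier
      unfolding valuation_ideal_eq_vball by auto
  qed
  then show ?thesis using twist_place[OF Q(1) assms(2)] by (auto simp: places_above_def)
qed

text \<open>The valuation ring of P, taken as a subring of E, contains \<open>t\<close> but not its
  inverse; the place obtained from \<open>exists_place\<close> is integral on it and positive at
  \<open>t\<close>. Writing \<open>y = t * (y / t)\<close> shows that all of the maximal ideal of P
  becomes positive.\<close>

lemma places_above_nonempty: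
  assumes P: "P \<in> places FF" shows "\<exists>Q. Q \<in> places_above E F P"
proof -
  obtain V x where "expansion_field E V x" using expansion_field_E by blast
  then interpret X: expansion_field E V x .
  obtain t where t: "t \<in> F" "t \<noteq> \<zero>" "P t = 1" using FF.place_surj[OF P, of 1] by auto
  let ?B = "vball FF P 0"
  have Br: "subring ?B FF" by (rule FF.valuation_ring_subring[OF P])
  have BE: "subring ?B E"
  proof (rule subringI)
    show "?B \<subseteq> carrier E" using vball_subset_carrier[of FF P 0] F_carrier by auto
    show "\<one> \<in> ?B" using subringE(3)[OF Br] by simp
    show "\<ominus> h \<in> ?B" if h: "h \<in> ?B" for h
      using subringE(5)[OF Br h] a_inv_subring[OF subfieldE(1)[OF F_subfield], of h] FF.vball_carrier[OF h] by simp
    show "a \<otimes> b \<in> ?B" "a \<oplus> b \<in> ?B" if "a \<in> ?B" "b \<in> ?B" for a b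
      using subringE(6,7)[OF Br that] by simp_all
  qed
  have tinv: "inv t = inv\<^bsub>FF\<^esub> t"
  proof -
    have "t \<otimes> inv\<^bsub>FF\<^esub> t = \<one>" "inv\<^bsub>FF\<^esub> t \<in> F" using FF.inv_nonzero[of t] t by auto
    then show ?thesis using comm_inv_char[of t "inv\<^bsub>FF\<^esub> t"] t F_carrier by auto
  qed
  have "inv\<^bsub>FF\<^esub> t \<notin> ?B" using FF.place_inv[OF P, of t] FF.inv_nonzero[of t] t by (auto simp: vball_def)
  moreover have tB: "t \<in> ?B" using t by (auto simp: vball_def)
  ultimately obtain Q where Q: "Q \<in> places E" "?B \<subseteq> vball E Q 0" "0 < Q t"
    using X.exists_place[OF BE tB t(2)] tinv by auto
  have "y \<in> vball E Q 1" if y: "y \<in> vball FF P 1" for y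
  proof -
    have yF: "y \<in> F" "y \<in> carrier E" using FF.vball_carrier[OF y] F_carrier by auto
    have i: "inv\<^bsub>FF\<^esub> t \<in> vball FF P (- 1)"
      using FF.place_inv[OF P, of t] FF.inv_nonzero[of t] t by (intro FF.vballI) auto
    have "y \<otimes>\<^bsub>FF\<^esub> inv\<^bsub>FF\<^esub> t \<in> vball FF P (1 + - 1)" by (rule FF.vball_mult[OF P y i])
    then have 1: "y \<otimes> inv t \<in> vball E Q 0" using Q(2) tinv by auto
    have tc: "t \<in> carrier E" using t F_carrier by auto
    have "y = t \<otimes> (y \<otimes> inv t)" using yF tc t(2) m_lcomm[of t y "inv t"] by simp
    moreover have "t \<otimes> (y \<otimes> inv t) \<in> vball E Q (1 + 0)"
      using Q(3) tc by (intro vball_mult[OF Q(1) _ 1] vballI) auto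
    ultimately show ?thesis by simp
  qed
  then show ?thesis using Q(1) by (auto simp: places_above_def valuation_ideal_eq_vball)
qed

lemma F_inv:
  assumes "u \<in> F" "u \<noteq> \<zero>" shows "inv u = inv\<^bsub>FF\<^esub> u \<and> inv u \<in> F"
proof -
  have *: "u \<otimes> inv\<^bsub>FF\<^esub> u = \<one>" "inv\<^bsub>FF\<^esub> u \<in> F" using FF.inv_nonzero[of u] assms by auto
  have "u \<in> carrier E" "inv\<^bsub>FF\<^esub> u \<in> carrier E" using assms(1) *(2) F_carrier by blast+
  then have "inv u = inv\<^bsub>FF\<^esub> u" using comm_inv_char *(1) by blast
  then show ?thesis using *(2) by simp
qed

text \<open>Units for P turn out to be units for Q, so Q restricted to F is a multiple of P, with
  multiplier the value of Q at a uniformizer of P.\<close>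

lemma place_above_index:
  assumes P: "P \<in> places FF" and Q: "Q \<in> places_above E F P"
  shows "\<exists>e::nat. 0 < e \<and> (\<forall>x\<in>F - {\<zero>}. Q x = int e * P x)"
proof -
  have Qp: "Q \<in> places E" and sub: "vball FF P 1 \<subseteq> vball E Q 1"
    using Q by (auto simp: places_above_def valuation_ideal_eq_vball)
  have pos: "0 < Q x" if "x \<in> F" "x \<noteq> \<zero>" "0 < P x" for x
  proof -
    have "x \<in> vball FF P 1" using that by (intro FF.vballI) auto
    then show ?thesis using sub that by (auto simp: vball_def)
  qed
  obtain t where t: "t \<in> F" "t \<noteq> \<zero>" "P t = 1" using FF.place_surj[OF P, of 1] by auto
  have tc: "t \<in> carrier E" using t F_carrier by auto
  \<comment> \<open>If the unit \<open>u\<close> had a pole at Q, the element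
    \<open>u [^] n \<otimes> t\<close> would still be positive at P but no longer at Q;
    \<open>n = Q t\<close> is already large enough.\<close>
  have nn: "0 \<le> Q u" if u: "u \<in> F" "u \<noteq> \<zero>" "P u = 0" for u
  proof (rule ccontr)
    assume "\<not> 0 \<le> Q u"
    then have neg: "Q u \<le> -1" by simp
    define n where "n = nat (Q t)"
    have uc: "u \<in> carrier E" using u F_carrier by auto
    have un: "u [^] n = u [^]\<^bsub>FF\<^esub> n" by (simp add: nat_pow_def)
    have "u [^] n \<in> F" "u [^] n \<noteq> \<zero>" "P (u [^] n) = 0"
      using FF.nat_pow_closed[of u n] FF.pow_nonzero[of u n] FF.place_pow[OF P, of u n] u unfolding un by auto
    then have "0 < Q (u [^] n \<otimes> t)"
      using pos[of "u [^] n \<otimes> t"] FF.place_mult[OF P, of "u [^] n" t] FF.m_closed[of "u [^] n" t] t tc uc u by auto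
    then have "0 < int n * Q u + Q t"
      using place_mult[OF Qp, of "u [^] n" t] place_pow[OF Qp uc u(2)] uc u tc t by simp
    moreover have "int n * Q u \<le> int n * (-1)" using neg by (intro mult_left_mono) auto
    moreover have "int n = Q t" using pos[OF t(1,2)] t by (simp add: n_def)
    ultimately show False by simp
  qed
  have finv: "inv u = inv\<^bsub>FF\<^esub> u \<and> inv u \<in> F" if "u \<in> F" "u \<noteq> \<zero>" for u
    using F_inv[OF that] .
  have unit: "Q u = 0" if u: "u \<in> F" "u \<noteq> \<zero>" "P u = 0" for u
  proof -
    have uc: "u \<in> carrier E" using u F_carrier by auto
    have "0 \<le> Q (inv u)"
      using nn[of "inv u"] finv[OF u(1,2)] FF.place_inv[OF P, of u] u inv_nonzero(2)[OF uc u(2)] by auto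
    then show ?thesis using nn[OF u] place_inv[OF Qp uc u(2)] by simp
  qed
  have main: "Q x = int n * Q t" if x: "x \<in> F" "x \<noteq> \<zero>" "P x = int n" for x n
  proof -
    have xc: "x \<in> carrier E" using x F_carrier by auto
    have tn: "t [^] n = t [^]\<^bsub>FF\<^esub> n" by (simp add: nat_pow_def)
    have t1: "t [^] n \<in> F" "t [^] n \<noteq> \<zero>" "P (t [^] n) = int n"
      using FF.nat_pow_closed[of t n] FF.pow_nonzero[of t n] FF.place_pow[OF P, of t n] t unfolding tn by auto
    let ?u = "x \<otimes> inv (t [^] n)"
    have "?u \<in> F" "?u \<noteq> \<zero>" "P ?u = 0"
      using finv[OF t1(1,2)] FF.place_mult[OF P, of x "inv (t [^] n)"] FF.place_inv[OF P, of "t [^] n"] t1 x xc tc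
        FF.m_closed[of x "inv (t [^] n)"] inv_nonzero[of "t [^] n"] by auto
    then have "Q ?u = 0" by (rule unit)
    then show ?thesis
      using place_mult[OF Qp xc x(2), of "inv (t [^] n)"] place_inv[OF Qp, of "t [^] n"] place_pow[OF Qp tc t(2)] tc t1 by simp
  qed
  have "Q x = int (nat (Q t)) * P x" if x: "x \<in> F" "x \<noteq> \<zero>" for x
  proof (cases "0 \<le> P x")
    case True
    then show ?thesis using main[OF x, of "nat (P x)"] pos[OF t(1,2)] t by simp
  next
    case False
    have xc: "x \<in> carrier E" using x F_carrier by auto
    have "Q (inv x) = int (nat (- P x)) * Q t"
      using main[of "inv x" "nat (- P x)"] finv[OF x] FF.place_inv[OF P, of x] x False inv_nonzero(2)[OF xc x(2)] by auto
    then show ?thesis using place_inv[OF Qp xc x(2)] False pos[OF t(1,2)] t by simp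
  qed
  moreover have "0 < nat (Q t)" using pos[OF t(1,2)] t by simp
  ultimately show ?thesis by blast
qed

text \<open>An element with \<open>P t = 1\<close> pins down the multiplier, so the description
  operator in \<open>ramification_index\<close> returns it; positive and not above 1, it is
  1.\<close>

lemma place_above_unramified:
  assumes P: "P \<in> places FF" and Q: "Q \<in> places_above E F P" and un: "\<not> ramifies E F P" and x: "x \<in> F" "x \<noteq> \<zero>"
  shows "Q x = P x"
proof -
  obtain e :: nat where e: "0 < e" "\<And>x. x \<in> F - {\<zero>} \<Longrightarrow> Q x = int e * P x"
    using place_above_index[OF P Q] by blast
  obtain t where t: "t \<in> F" "t \<noteq> \<zero>" "P t = 1" using FF.place_surj[OF P, of 1] by auto
  have "ramification_index E F Q P = e"
    unfolding ramification_index_def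
  proof (rule the_equality)
    show "\<forall>x\<in>F - {\<zero>}. Q x = int e * P x" using e(2) by blast
    fix e' assume "\<forall>x\<in>F - {\<zero>}. Q x = int e' * P x"
    then have "Q t = int e'" using t by simp
    then show "e' = e" using e(2)[of t] t by simp
  qed
  then have "\<not> 1 < e" using un Q by (auto simp: ramifies_def)
  then have "e = 1" using e(1) by simp
  then show ?thesis using e(2)[of x] x by simp
qed

lemma place_below_unique:
  assumes P: "P \<in> places FF" "P' \<in> places FF" and Q: "Q \<in> places_above E F P" "Q \<in> places_above E F P'"
  shows "P = P'"
proof (rule FF.place_eqI[OF P])
  obtain e :: nat where e: "0 < e" "\<And>x. x \<in> F - {\<zero>} \<Longrightarrow> Q x = int e * P x"
    using place_above_index[OF P(1) Q(1)] by blast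
  obtain e' :: nat where e': "0 < e'" "\<And>x. x \<in> F - {\<zero>} \<Longrightarrow> Q x = int e' * P' x"
    using place_above_index[OF P(2) Q(2)] by blast
  fix x assume x: "x \<in> carrier FF" "x \<noteq> \<zero>\<^bsub>FF\<^esub>" "0 \<le> P x"
  then have "0 \<le> int e' * P' x" using e(1) e(2)[of x] e'(2)[of x] by simp
  then show "0 \<le> P' x" using e'(1) by (simp add: zero_le_mult_iff)
qed

text \<open>If Q' were no conjugate of Q, choose \<open>y\<close> vanishing at Q' and congruent to 1
  at all other conjugates of Q and Q'. Its norm lies in F and is a unit at Q but not at Q', although
  both places are positive multiples of P on F.\<close>

lemma places_above_transitive:
  assumes P: "P \<in> places FF" and Q: "Q \<in> places_above E F P" "Q' \<in> places_above E F P"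
  shows "\<exists>\<gamma>\<in>carrier G. Q' = twist E Q \<gamma>"
proof (rule ccontr)
  assume no: "\<not> ?thesis"
  have Qp: "Q \<in> places E" "Q' \<in> places E" using Q by (auto simp: places_above_def)
  let ?T = "twist E Q ` carrier G \<union> twist E Q' ` carrier G"
  have T: "finite ?T" "?T \<subseteq> places E" using G_finite twist_place Qp by auto
  have QT: "Q' \<in> ?T" using twist_id[OF Qp(2)] G.one_closed by (metis UnI2 imageI)
  obtain y where y: "y \<in> carrier E" "\<forall>v\<in>?T. y \<ominus> (if v = Q' then \<zero> else \<one>) \<in> vball E v 1"
  proof -
    have "\<exists>y\<in>carrier E. \<forall>v\<in>?T. y \<ominus> (if v = Q' then \<zero> else \<one>) \<in> vball E v 1"
      by (rule weak_approximation[OF T]) simp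
    then show ?thesis using that by blast
  qed
  have unit: "y \<noteq> \<zero> \<and> v y = 0" if v: "v \<in> ?T" "v \<noteq> Q'" for v
  proof -
    have vp: "v \<in> places E" using v T by auto
    have b: "y \<ominus> \<one> \<in> vball E v 1" using y(2)[rule_format, OF v(1)] v(2) by simp
    have e: "y = \<one> \<oplus> (y \<ominus> \<one>)" using y(1) by algebra
    have "\<one> \<oplus> (y \<ominus> \<one>) \<noteq> \<zero> \<and> v (\<one> \<oplus> (y \<ominus> \<one>)) = v \<one>"
      using place_add_less[OF vp, of \<one> "y \<ominus> \<one>"] b y(1) place_one[OF vp] by (auto simp: vball_def)
    then show ?thesis using e place_one[OF vp] by simp
  qed
  have QQ: "Q \<in> ?T" "Q \<noteq> Q'"
  proof -
    show "Q \<in> ?T" using twist_id[OF Qp(1)] G.one_closed by (metis UnI1 imageI)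
    show "Q \<noteq> Q'" using no twist_id[OF Qp(1)] G.one_closed by metis
  qed
  then have nz: "y \<noteq> \<zero>" using unit by blast
  let ?N = "\<Otimes>\<tau>\<in>carrier G. \<tau> y"
  have NF: "?N \<in> F" by (rule norm_in_F[OF y(1)])
  have fin: "\<And>\<tau>. \<tau> \<in> carrier G \<Longrightarrow> \<tau> y \<in> carrier E \<and> \<tau> y \<noteq> \<zero>" using y(1) nz by auto
  have N: "?N \<noteq> \<zero>" "Q ?N = (\<Sum>\<tau>\<in>carrier G. Q (\<tau> y))" "Q' ?N = (\<Sum>\<tau>\<in>carrier G. Q' (\<tau> y))"
    using place_finprod[OF Qp(1) G_finite, of "\<lambda>\<tau>. \<tau> y"] place_finprod[OF Qp(2) G_finite, of "\<lambda>\<tau>. \<tau> y"] fin by auto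
  have "Q (\<tau> y) = 0" if t: "\<tau> \<in> carrier G" for \<tau>
  proof -
    have "twist E Q \<tau> \<noteq> Q'" using no t by auto
    then show ?thesis using unit[of "twist E Q \<tau>"] t twist_apply[OF y(1) nz, of Q \<tau>] by auto
  qed
  then have QN: "Q ?N = 0" using N(2) by simp
  have Q'y: "0 < Q' y"
  proof -
    have "y \<ominus> \<zero> \<in> vball E Q' 1" using y(2)[rule_format, OF QT] by simp
    then have "y \<in> vball E Q' 1" using y(1) by (simp add: a_minus_def)
    then show ?thesis using nz by (auto simp: vball_def)
  qed
  have nn: "0 \<le> Q' (\<tau> y)" if t: "\<tau> \<in> carrier G" for \<tau>
  proof (cases "twist E Q' \<tau> = Q'")
    case True
    then show ?thesis using twist_apply[OF y(1) nz, of Q' \<tau>] Q'y by simp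
  next
    case False
    then show ?thesis using unit[of "twist E Q' \<tau>"] t twist_apply[OF y(1) nz, of Q' \<tau>] by auto
  qed
  have "0 < (\<Sum>\<tau>\<in>carrier G. Q' (\<tau> y))"
    using Q'y gal_id[OF y(1)] by (intro sum_pos2[OF G_finite G.one_closed _ nn]) simp_all
  then have Q'N: "0 < Q' ?N" using N(3) by simp
  obtain e :: nat where "0 < e" "\<And>x. x \<in> F - {\<zero>} \<Longrightarrow> Q x = int e * P x"
    using place_above_index[OF P Q(1)] by blast
  moreover obtain e' :: nat where "0 < e'" "\<And>x. x \<in> F - {\<zero>} \<Longrightarrow> Q' x = int e' * P x"
    using place_above_index[OF P Q(2)] by blast
  ultimately show False using NF N(1) QN Q'N by auto
qed

end

section \<open>Frobenius automorphisms\<close>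

context abelian_function_field_extension
begin

lemma E_residue_finite: "Q \<in> places E \<Longrightarrow> finite ((\<lambda>a. valuation_ideal E Q +> a) ` valuation_ring E Q)"
proof -
  assume Q: "Q \<in> places E"
  obtain V x where "expansion_field E V x" using expansion_field_E by blast
  then show ?thesis using Q by (rule expansion_field.finite_residue_classes)
qed

lemma F_residue_finite: "P \<in> places FF \<Longrightarrow> finite ((\<lambda>a. valuation_ideal FF P +>\<^bsub>FF\<^esub> a) ` valuation_ring FF P)"
proof -
  assume P: "P \<in> places FF"
  obtain V x where "expansion_field FF V x" using expansion_field_F by blast
  then show ?thesis using P by (rule expansion_field.finite_residue_classes)
qed

lemma above_vball:
  assumes P: "P \<in> places FF" and Q: "Q \<in> places_above E F P" and un: "\<not> ramifies E F P" and x: "x \<in> F"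
  shows "x \<in> vball E Q n \<longleftrightarrow> x \<in> vball FF P n"
  using place_above_unramified[OF P Q un x] x F_carrier by (cases "x = \<zero>") (auto simp: vball_def)

text \<open>Powers \<open>x\<^sup>q\<close> with \<open>q\<close> divisible by the characteristic contract congruences modulo \<open>Q\<close>,
  so elements of the inertia group fix lifts of all residue classes to any prescribed precision.\<close>

lemma inertia_fixed_lifts:
  assumes Q: "Q \<in> places E" and t: "\<tau> \<in> carrier G"
    and inertia: "\<And>x. x \<in> vball E Q 0 \<Longrightarrow> \<tau> x \<ominus> x \<in> vball E Q 1" and x: "x \<in> vball E Q 0"
  shows "\<exists>c \<in> vball E Q 0. x \<ominus> c \<in> vball E Q 1 \<and> \<tau> c \<ominus> c \<in> vball E Q (int n)"
proof -
  obtain V y where "expansion_field E V y" using expansion_field_E by blast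
  then interpret X: expansion_field E V y .
  let ?k = "X.constants"
  define N where "N = place_norm E Q"
  have N: "N = card ?k ^ place_degree E Q"
    using X.card_constant_field_power_degree[OF Q] by (simp add: N_def X.constant_field_eq)
  have N2: "N \<ge> 2" using X.place_norm_ge_2'[OF Q Q] by (simp add: N_def)
  have xc: "x \<in> carrier E" using vball_carrier[OF x] .
  have xp: "x [^] j \<in> vball E Q 0" for j :: nat using vball_pow[OF Q x, of j] by simp
  \<comment> \<open>N-th powers preserve residue classes, so \<open>c\<close> lifts the class of
    \<open>x\<close>. By additivity of the power map, \<open>\<tau> c \<ominus> c\<close> is the
    \<open>N ^ n\<close>-th power of \<open>\<tau> x \<ominus> x\<close>, of order at least
    \<open>N ^ n \<ge> n\<close>.\<close>
  define c where "c = x [^] (N ^ n)"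
  have c0: "c \<in> vball E Q 0" unfolding c_def by (rule xp)
  have cc: "c \<in> carrier E" using vball_carrier[OF c0] .
  have "x [^] (N ^ j) \<ominus> x \<in> vball E Q 1" for j
  proof (induction j)
    case 0
    have "x [^] (N ^ 0) \<ominus> x = \<zero>" using xc by (simp add: minus_eq_zero_iff)
    then show ?case using vball_zero by (simp del: power_0)
  next
    case (Suc j)
    have "(x [^] (N ^ j)) [^] N \<ominus> x [^] (N ^ j) \<in> vball E Q 1"
      using power_place_norm_cong[OF Q E_residue_finite[OF Q] xp] by (simp add: N_def)
    moreover have "(x [^] (N ^ j)) [^] N = x [^] (N ^ Suc j)" using xc by (simp add: nat_pow_pow mult.commute)
    ultimately show ?case using vball_minus_trans[OF Q _ Suc] xc by simp
  qed
  then have 1: "x \<ominus> c \<in> vball E Q 1" using vball_minus_sym[OF Q _ cc xc] by (simp add: c_def)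
  let ?d = "\<tau> x \<ominus> x"
  have tx: "\<tau> x \<in> carrier E" using gal_closed[OF t xc] .
  have dc: "?d \<in> carrier E" using tx xc by simp
  have "N ^ n = card ?k ^ (place_degree E Q * n)" by (simp add: N power_mult)
  then have "(?d \<oplus> x) [^] (N ^ n) = ?d [^] (N ^ n) \<oplus> x [^] (N ^ n)"
    using power_card_subfield_power_add[OF X.constants_subfield X.finite_constants dc xc] by simp
  moreover have "?d \<oplus> x = \<tau> x" using tx xc by algebra
  ultimately have e: "\<tau> c = ?d [^] (N ^ n) \<oplus> c" using gal_pow[OF t xc] by (simp add: c_def)
  have "\<tau> c \<ominus> c = ?d [^] (N ^ n)"
  proof -
    have "?d [^] (N ^ n) \<in> carrier E" using dc by simp
    then show ?thesis unfolding e using cc by algebra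
  qed
  moreover have "?d [^] (N ^ n) \<in> vball E Q (int (N ^ n) * 1)" by (rule vball_pow[OF Q inertia[OF x]])
  moreover have "n \<le> N ^ n" using less_exp[of n] power_mono[OF N2, of n] by linarith
  then have "int n \<le> int (N ^ n) * 1" by (simp only: mult_1_right of_nat_le_iff)
  ultimately have "\<tau> c \<ominus> c \<in> vball E Q (int n)" using vball_le by metis
  then show ?thesis using c0 1 by blast
qed

text \<open>At an unramified place a uniformizer \<open>p\<close> of P is also one at Q, and it is
  fixed by \<open>\<tau>\<close>. Writing \<open>x = c + p * y\<close> with \<open>c\<close> almost
  fixed transfers a congruence for \<open>y\<close> to one of higher order for \<open>x\<close>;
  hence \<open>\<tau> x\<close> and \<open>x\<close> agree to every order.\<close>

lemma inertia_trivial: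
  assumes P: "P \<in> places FF" and Q: "Q \<in> places_above E F P" and un: "\<not> ramifies E F P" and t: "\<tau> \<in> carrier G"
    and inertia: "\<And>x. x \<in> vball E Q 0 \<Longrightarrow> \<tau> x \<ominus> x \<in> vball E Q 1"
  shows "\<tau> = \<one>\<^bsub>G\<^esub>"
proof -
  have Qp: "Q \<in> places E" using Q by (simp add: places_above_def)
  obtain p where p: "p \<in> F" "p \<noteq> \<zero>" "P p = 1" using FF.place_surj[OF P, of 1] by auto
  have pc: "p \<in> carrier E" using p F_carrier by auto
  have Qpp: "Q p = 1" using place_above_unramified[OF P Q un p(1,2)] p(3) by simp
  \<comment> \<open>The precision \<open>n\<close> of the almost fixed lifts stays constant during
    the induction on \<open>j\<close>, which runs only up to it.\<close>
  have main: "\<tau> x \<ominus> x \<in> vball E Q (int j)" if "j \<le> n" "x \<in> vball E Q 0" for j n x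
    using that
  proof (induction j arbitrary: x)
    case 0
    then show ?case using vball_le[OF inertia[OF 0(2)], of 0] by simp
  next
    case (Suc j)
    obtain c where c: "c \<in> vball E Q 0" "x \<ominus> c \<in> vball E Q 1" "\<tau> c \<ominus> c \<in> vball E Q (int n)"
      using inertia_fixed_lifts[OF Qp t inertia Suc.prems(2)] by blast
    have cc: "x \<in> carrier E" "c \<in> carrier E" using Suc.prems c vball_carrier by blast+
    let ?y = "inv p \<otimes> (x \<ominus> c)"
    have ip: "inv p \<in> vball E Q (- 1)" using place_inv[OF Qp pc p(2)] Qpp pc p(2) by (intro vballI) auto
    have y: "?y \<in> vball E Q 0" using vball_mult[OF Qp ip c(2)] by simp
    have yc: "?y \<in> carrier E" by (rule vball_carrier[OF y])
    have "p \<otimes> ?y = (p \<otimes> inv p) \<otimes> (x \<ominus> c)" using pc p(2) cc m_assoc[of p "inv p" "x \<ominus> c"] by simp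
    also have "\<dots> = x \<ominus> c" using pc p(2) cc by simp
    finally have py: "p \<otimes> ?y = x \<ominus> c" .
    have "c \<oplus> (x \<ominus> c) = x" using cc by algebra
    then have xe: "x = c \<oplus> p \<otimes> ?y" unfolding py by simp
    have ty: "\<tau> ?y \<in> carrier E" "\<tau> c \<in> carrier E" using gal_closed[OF t] yc cc by auto
    have "\<tau> (c \<oplus> p \<otimes> ?y) = \<tau> c \<oplus> p \<otimes> \<tau> ?y"
      using gal_add[OF t cc(2)] gal_mult[OF t pc yc] gal_fix[OF t p(1)] pc yc by simp
    then have "\<tau> x = \<tau> c \<oplus> p \<otimes> \<tau> ?y" using xe by simp
    then have "\<tau> x \<ominus> x = (\<tau> c \<oplus> p \<otimes> \<tau> ?y) \<ominus> (c \<oplus> p \<otimes> ?y)" using xe by simp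
    also have "\<dots> = (\<tau> c \<ominus> c) \<oplus> p \<otimes> (\<tau> ?y \<ominus> ?y)"
    proof -
      have "(a \<oplus> p \<otimes> b) \<ominus> (a' \<oplus> p \<otimes> b') = (a \<ominus> a') \<oplus> p \<otimes> (b \<ominus> b')"
        if "a \<in> carrier E" "a' \<in> carrier E" "b \<in> carrier E" "b' \<in> carrier E" for a a' b b'
        using that pc by algebra
      from this[OF ty(2) cc(2) ty(1) yc] show ?thesis .
    qed
    finally have e: "\<tau> x \<ominus> x = (\<tau> c \<ominus> c) \<oplus> p \<otimes> (\<tau> ?y \<ominus> ?y)" .
    have "\<tau> ?y \<ominus> ?y \<in> vball E Q (int j)" using Suc.IH[OF _ y] Suc.prems(1) by simp
    moreover have "p \<in> vball E Q 1" using pc Qpp by (intro vballI) auto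
    ultimately have "p \<otimes> (\<tau> ?y \<ominus> ?y) \<in> vball E Q (int (Suc j))" using vball_mult[OF Qp, of p 1 _ "int j"] by simp
    moreover have "\<tau> c \<ominus> c \<in> vball E Q (int (Suc j))" using vball_le[OF c(3)] Suc.prems(1) by simp
    ultimately show ?case unfolding e using vball_add[OF Qp] by blast
  qed
  have fix0: "\<tau> x = x" if x: "x \<in> vball E Q 0" for x
  proof (rule ccontr)
    assume ne: "\<tau> x \<noteq> x"
    have xc: "x \<in> carrier E" "\<tau> x \<in> carrier E" using vball_carrier[OF x] gal_closed[OF t] by auto
    have nz: "\<tau> x \<ominus> x \<noteq> \<zero>" using ne xc by (simp add: minus_eq_zero_iff)
    let ?n = "nat (Q (\<tau> x \<ominus> x)) + 1"
    have "\<tau> x \<ominus> x \<in> vball E Q (int ?n)" using main[OF order_refl x] .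
    then have "int ?n \<le> Q (\<tau> x \<ominus> x)" using nz by (simp add: vball_def)
    then show False by linarith
  qed
  show ?thesis
  proof (rule gal_eqI[OF t G.one_closed])
    fix x assume x: "x \<in> carrier E"
    show "\<tau> x = \<one>\<^bsub>G\<^esub> x"
    proof (cases "x \<in> vball E Q 0")
      case True then show ?thesis using fix0 gal_id[OF x] by simp
    next
      case False
      then have nz: "x \<noteq> \<zero>" and neg: "Q x < 0" using x by (auto simp: vball_def)
      then have "inv x \<in> vball E Q 0" using place_inv[OF Qp x nz] x by (intro vballI) auto
      then have i: "\<tau> (inv x) = inv x" by (rule fix0)
      have "\<tau> x \<otimes> inv x = \<tau> (x \<otimes> inv x)" using gal_mult[OF t x, of "inv x"] i x nz by simp
      also have "\<dots> = \<one>" using x nz gal_one[OF t] by simp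
      finally have e1: "\<tau> x \<otimes> inv x = \<one>" .
      have tc: "\<tau> x \<in> carrier E" using gal_closed[OF t x] .
      have "\<tau> x = \<tau> x \<otimes> (inv x \<otimes> x)" using tc x nz by simp
      also have "\<dots> = \<tau> x \<otimes> inv x \<otimes> x" using tc x nz m_assoc[of "\<tau> x" "inv x" x] by simp
      also have "\<dots> = x" unfolding e1 using x by simp
      finally show ?thesis using gal_id[OF x] by simp
    qed
  qed
qed

definition frobenius_at :: "('a \<Rightarrow> int) \<Rightarrow> nat \<Rightarrow> ('a \<Rightarrow> 'a) \<Rightarrow> bool" where
  "frobenius_at Q N s \<longleftrightarrow> (\<forall>x\<in>vball E Q 0. s x \<ominus> x [^] N \<in> vball E Q 1)"

text \<open>\<open>t\<close> preserves Q, so its inverse may be applied to the congruence; then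
  \<open>t^-1 s\<close> acts trivially on the residue field and inertia is trivial.\<close>

lemma congruent_mod_place_imp_eq:
  assumes P: "P \<in> places FF" and Q: "Q \<in> places_above E F P" and un: "\<not> ramifies E F P"
    and s: "s \<in> carrier G" and t: "t \<in> carrier G" "twist E Q t = Q"
    and cong: "\<And>x. x \<in> vball E Q 0 \<Longrightarrow> s x \<ominus> t x \<in> vball E Q 1"
  shows "s = t"
proof -
  let ?r = "inv\<^bsub>G\<^esub> t \<otimes>\<^bsub>G\<^esub> s"
  have r: "?r \<in> carrier G" "inv\<^bsub>G\<^esub> t \<in> carrier G" using s t by auto
  have Qp: "Q \<in> places E" using Q by (simp add: places_above_def)
  have "twist E Q (inv\<^bsub>G\<^esub> t) = twist E (twist E Q t) (inv\<^bsub>G\<^esub> t)" using t by simp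
  also have "\<dots> = Q" using twist_twist[OF t(1) r(2)] t(1) twist_id[OF Qp] by simp
  finally have tw: "twist E Q (inv\<^bsub>G\<^esub> t) = Q" .
  have "?r = \<one>\<^bsub>G\<^esub>"
  proof (rule inertia_trivial[OF P Q un r(1)])
    fix x assume x: "x \<in> vball E Q 0"
    have xc: "x \<in> carrier E" "s x \<in> carrier E" "t x \<in> carrier E"
      using vball_carrier[OF x] gal_closed[OF s] gal_closed[OF t(1)] by auto
    have "(inv\<^bsub>G\<^esub> t) (s x \<ominus> t x) \<in> vball E Q 1"
      using vball_twist[of "s x \<ominus> t x" "inv\<^bsub>G\<^esub> t" Q 1] tw cong[OF x] xc r(2) by simp
    moreover have "(inv\<^bsub>G\<^esub> t) (s x \<ominus> t x) = ?r x \<ominus> x"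
      using gal_minus[OF r(2) xc(2,3)] gal_compose[OF r(2) s xc(1)] gal_inv(1)[OF t(1) xc(1)] by simp
    ultimately show "?r x \<ominus> x \<in> vball E Q 1" by simp
  qed
  then have "t \<otimes>\<^bsub>G\<^esub> ?r = t" using t by simp
  moreover have "t \<otimes>\<^bsub>G\<^esub> ?r = s" using s t r by (simp add: G.m_assoc[symmetric])
  ultimately show ?thesis by simp
qed

text \<open>The power map preserves integrality, so \<open>s\<close> sends elements integral at Q to
  elements integral at Q. One containment of valuation rings already gives equality of
  places.\<close>

lemma frobenius_at_decomposition:
  assumes Q: "Q \<in> places E" and s: "s \<in> carrier G" and N: "N > 0" and f: "frobenius_at Q N s"
  shows "twist E Q s = Q"
proof -
  have "Q = twist E Q s"
  proof (rule place_eqI[OF Q twist_place[OF Q s]])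
    fix x assume x: "x \<in> carrier E" "x \<noteq> \<zero>" "0 \<le> Q x"
    then have xb: "x \<in> vball E Q 0" by (intro vballI)
    have "s x \<ominus> x [^] N \<in> vball E Q 0" using f xb vball_le[of _ E Q 1 0] by (simp add: frobenius_at_def)
    moreover have "x [^] N \<in> vball E Q 0" using vball_pow[OF Q xb, of N] by simp
    ultimately have "s x \<in> vball E Q 0" using vball_minus_cancel[OF Q] gal_closed[OF s x(1)] by blast
    then show "0 \<le> twist E Q s x" using x s twist_apply[OF x(1,2)] by (simp add: vball_def)
  qed
  then show ?thesis by simp
qed

lemma frobenius_at_unique:
  assumes P: "P \<in> places FF" and Q: "Q \<in> places_above E F P" and un: "\<not> ramifies E F P" and N: "N > 0"
    and s: "s \<in> carrier G" "frobenius_at Q N s" and t: "t \<in> carrier G" "frobenius_at Q N t"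
  shows "s = t"
proof (rule congruent_mod_place_imp_eq[OF P Q un s(1) t(1)])
  have Qp: "Q \<in> places E" using Q by (simp add: places_above_def)
  show "twist E Q t = Q" by (rule frobenius_at_decomposition[OF Qp t(1) N t(2)])
  fix x assume x: "x \<in> vball E Q 0"
  have c: "x [^] N \<in> carrier E" "s x \<in> carrier E" "t x \<in> carrier E"
    using vball_carrier[OF x] gal_closed[OF s(1)] gal_closed[OF t(1)] by auto
  have "s x \<ominus> x [^] N \<in> vball E Q 1" "t x \<ominus> x [^] N \<in> vball E Q 1"
    using s(2) t(2) x by (simp_all add: frobenius_at_def)
  then show "s x \<ominus> t x \<in> vball E Q 1"
    using vball_minus_trans[OF Qp _ vball_minus_sym[OF Qp _ c(3,1)]] c by blast
qed

text \<open>Conjugation would carry a Frobenius at Q to one at the twisted place; since the group is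
  commutative, the same \<open>s\<close> serves all places above P.\<close>

lemma frobenius_at_twist:
  assumes Q: "Q \<in> places E" and s: "s \<in> carrier G" "frobenius_at Q N s" and g: "g \<in> carrier G"
  shows "frobenius_at (twist E Q g) N s"
  unfolding frobenius_at_def
proof
  fix x assume x: "x \<in> vball E (twist E Q g) 0"
  have xc: "x \<in> carrier E" by (rule vball_carrier[OF x])
  have c: "g x \<in> carrier E" "s x \<in> carrier E" "x [^] N \<in> carrier E"
    using gal_closed[OF g xc] gal_closed[OF s(1) xc] xc by auto
  have "g x \<in> vball E Q 0" using vball_twist[OF xc g] x by simp
  then have "s (g x) \<ominus> g x [^] N \<in> vball E Q 1" using s(2) by (simp add: frobenius_at_def)
  moreover have "s (g x) = g (s x)"
    using gal_compose[OF s(1) g xc] gal_compose[OF g s(1) xc] G.m_comm[OF s(1) g] by simp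
  moreover have "g x [^] N = g (x [^] N)" using gal_pow[OF g xc] by simp
  ultimately have "g (s x \<ominus> x [^] N) \<in> vball E Q 1" using gal_minus[OF g c(2,3)] by simp
  then show "s x \<ominus> x [^] N \<in> vball E (twist E Q g) 1" using vball_twist[of "s x \<ominus> x [^] N" g Q 1] c g by simp
qed

text \<open>If no decomposition automorphism induced the \<open>N\<close>-th power map on the residue field, then the
  residue characters \<open>x \<mapsto> d x\<close> and \<open>x \<mapsto> (d x)\<^sup>N\<close> would be distinct; but the sum of the former
  is a trace from \<open>F\<close>, hence invariant under the \<open>N\<close>-th power map.\<close>

lemma frobenius_at_exists:
  assumes P: "P \<in> places FF" and Q: "Q \<in> places_above E F P" and un: "\<not> ramifies E F P"
  shows "\<exists>s\<in>carrier G. frobenius_at Q (place_norm FF P) s"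
proof (rule ccontr)
  assume none: "\<not> ?thesis"
  obtain V0 y0 where "expansion_field FF V0 y0" using expansion_field_F by blast
  then interpret Y: expansion_field FF V0 y0 .
  have Qp: "Q \<in> places E" using Q by (simp add: places_above_def)
  interpret \<kappa>: field "residue_field E Q" by (rule residue_field_is_field[OF Qp])
  define N where "N = place_norm FF P"
  have N0: "N > 0" using Y.place_norm_ge_2'[OF P P] by (simp add: N_def)
  let ?rc = "\<lambda>a. valuation_ideal E Q +> a"
  define D where "D = {d \<in> carrier G. twist E Q d = Q}"
  have DG: "d \<in> carrier G" if "d \<in> D" for d using that by (simp add: D_def)
  have D1: "\<one>\<^bsub>G\<^esub> \<in> D" using twist_id[OF Qp] by (simp add: D_def)
  have Dfin: "finite D" using G_finite by (simp add: D_def)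
  have Dinv: "inv\<^bsub>G\<^esub> d \<in> D" if d: "d \<in> D" for d
  proof -
    have "twist E Q (inv\<^bsub>G\<^esub> d) = twist E (twist E Q d) (inv\<^bsub>G\<^esub> d)" using d by (simp add: D_def)
    also have "\<dots> = Q" using twist_twist[OF DG[OF d] G.inv_closed[OF DG[OF d]]] DG[OF d] twist_id[OF Qp] by simp
    finally show ?thesis using DG[OF d] by (simp add: D_def)
  qed
  have Dball: "d x \<in> vball E Q n \<longleftrightarrow> x \<in> vball E Q n" if "d \<in> D" "x \<in> carrier E" for d x n
    using vball_twist[of x d Q n] that by (simp add: D_def)
  have Npow: "(a \<oplus> b) [^] N = a [^] N \<oplus> b [^] N" if "a \<in> carrier E" "b \<in> carrier E" for a b
  proof -
    have "subfield Y.constants E"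
    proof (rule subfield_iff(1))
      show "field (E\<lparr>carrier := Y.constants\<rparr>)" using FF.subfield_iff(2)[OF Y.constants_subfield] by simp
      show "Y.constants \<subseteq> carrier E" using F_carrier by (auto simp: riemann_roch_space_def)
    qed
    moreover have "N = card Y.constants ^ place_degree FF P"
      using Y.card_constant_field_power_degree[OF P] by (simp add: N_def Y.constant_field_eq)
    ultimately show ?thesis using power_card_subfield_power_add[OF _ Y.finite_constants that] by simp
  qed
  \<comment> \<open>Characters need a multiplicative domain with nonzero values: the units at Q, on
    which residues do not vanish.\<close>
  define A where "A = {x \<in> carrier E. x \<noteq> \<zero> \<and> Q x = 0}"
  have Ab: "x \<in> vball E Q 0" "x \<notin> vball E Q 1" "x \<in> carrier E" if "x \<in> A" for x
    using that by (auto simp: A_def vball_def)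
  have A1: "x \<in> A" if "x \<in> vball E Q 0" "x \<notin> vball E Q 1" for x
    using that by (auto simp: A_def vball_def)
  \<comment> \<open>The Boolean component distinguishes the residue of \<open>d x\<close> from that
    of its N-th power.\<close>
  define \<chi> where "\<chi> i x = (case i of (d, b) \<Rightarrow> if b then ?rc (d x [^] N) else ?rc (d x))" for i :: "('a \<Rightarrow> 'a) \<times> bool" and x
  have dA: "d x \<in> A" if "d \<in> D" "x \<in> A" for d x
    using that Ab[OF that(2)] Dball[OF that(1)] by (intro A1) auto
  have powA: "x [^] N \<in> A" if "x \<in> A" for x
    using that place_pow[OF Qp, of x N] by (auto simp: A_def)
  have rcA: "?rc x \<in> carrier (residue_field E Q)" "?rc x \<noteq> \<zero>\<^bsub>residue_field E Q\<^esub>" if "x \<in> A" for x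
    using rc_simps(1)[OF Qp Ab(1)[OF that]] rc_eq_zero_iff[OF Qp Ab(3)[OF that]] Ab(2)[OF that] by auto
  have rcm: "?rc (x \<otimes> y) = ?rc x \<otimes>\<^bsub>residue_field E Q\<^esub> ?rc y" if "x \<in> A" "y \<in> A" for x y
    using rc_simps(2)[OF Qp] Ab that by blast
  let ?S = "D \<times> (UNIV :: bool set)"
  \<comment> \<open>With these signs the relation reads: residue of the trace minus the N-th power
    of that residue equals 0.\<close>
  define c where "c i = (if snd i then \<ominus>\<^bsub>residue_field E Q\<^esub> \<one>\<^bsub>residue_field E Q\<^esub> else \<one>\<^bsub>residue_field E Q\<^esub>)"
    for i :: "('a \<Rightarrow> 'a) \<times> bool"
  \<comment> \<open>A coincidence between \<open>d\<close> and the N-th power of \<open>d'\<close>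
    makes \<open>d\<close> composed with the inverse of \<open>d'\<close> a Frobenius at Q, which
    was excluded.\<close>
  have agree_pow: False
    if d: "d \<in> D" "d' \<in> D" and eq: "\<And>x. x \<in> A \<Longrightarrow> ?rc (d x) = ?rc (d' x [^] N)" for d d'
  proof -
    let ?s = "d \<otimes>\<^bsub>G\<^esub> inv\<^bsub>G\<^esub> d'"
    have i: "inv\<^bsub>G\<^esub> d' \<in> D" "inv\<^bsub>G\<^esub> d' \<in> carrier G" using Dinv[OF d(2)] DG by auto
    have s: "?s \<in> carrier G" using DG[OF d(1)] i(2) by simp
    have "frobenius_at Q N ?s" unfolding frobenius_at_def
    proof
      fix x assume x: "x \<in> vball E Q 0"
      have xc: "x \<in> carrier E" by (rule vball_carrier[OF x])
      let ?z = "(inv\<^bsub>G\<^esub> d') x"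
      have zc: "?z \<in> carrier E" using gal_closed[OF i(2) xc] .
      have sz: "?s x = d ?z" using gal_compose[OF DG[OF d(1)] i(2) xc] .
      have dz: "d' ?z = x" using gal_inv(2)[OF DG[OF d(2)] xc] .
      have dc: "d ?z \<in> carrier E" "x [^] N \<in> carrier E" using gal_closed[OF DG[OF d(1)] zc] xc by auto
      show "?s x \<ominus> x [^] N \<in> vball E Q 1"
      proof (cases "x \<in> vball E Q 1")
        case True
        have "d ?z \<in> vball E Q 1" using Dball[OF d(1) zc] Dball[OF i(1) xc] True by simp
        moreover have "x [^] N \<in> vball E Q 1"
        proof -
          have "x [^] N \<in> vball E Q (int N * 1)" by (rule vball_pow[OF Qp True])
          then show ?thesis by (rule vball_le) (use N0 in simp)
        qed
        ultimately show ?thesis unfolding sz by (rule vball_minus[OF Qp])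
      next
        case False
        have "?z \<in> A" using A1[of ?z] Dball[OF i(1) xc] x False by simp
        then have "?rc (d ?z) = ?rc (x [^] N)" using eq[of ?z] dz by simp
        then show ?thesis unfolding sz using rc_eq_iff[OF Qp dc] by simp
      qed
    qed
    then show False using none s by (auto simp: N_def)
  qed
  have agree: "d = d'" if d: "d \<in> D" "d' \<in> D" and eq: "\<And>x. x \<in> A \<Longrightarrow> ?rc (d x) = ?rc (d' x)" for d d'
  proof (rule congruent_mod_place_imp_eq[OF P Q un DG[OF d(1)] DG[OF d(2)]])
    show "twist E Q d' = Q" using d by (simp add: D_def)
    fix x assume x: "x \<in> vball E Q 0"
    have xc: "x \<in> carrier E" by (rule vball_carrier[OF x])
    have dc: "d x \<in> carrier E" "d' x \<in> carrier E" using gal_closed[OF DG xc] d by auto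
    show "d x \<ominus> d' x \<in> vball E Q 1"
    proof (cases "x \<in> vball E Q 1")
      case True
      then show ?thesis using Dball[OF d(1) xc] Dball[OF d(2) xc] vball_minus[OF Qp] by blast
    next
      case False
      then show ?thesis using eq[OF A1[OF x False]] rc_eq_iff[OF Qp dc] by simp
    qed
  qed
  \<comment> \<open>By additivity, equal N-th powers make the N-th power of
    \<open>a \<ominus> b\<close> vanish at Q, and a unit has only unit powers.\<close>
  have pow_inj: "?rc a = ?rc b" if a: "a \<in> A" "b \<in> A" and eq: "?rc (a [^] N) = ?rc (b [^] N)" for a b
  proof -
    have cc: "a \<in> carrier E" "b \<in> carrier E" using Ab a by auto
    have "a [^] N = ((a \<ominus> b) \<oplus> b) [^] N"
    proof -
      have "(a \<ominus> b) \<oplus> b = a" using cc by algebra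
      then show ?thesis by simp
    qed
    then have e: "a [^] N = (a \<ominus> b) [^] N \<oplus> b [^] N" using Npow[of "a \<ominus> b" b] cc by simp
    have "(u \<oplus> w) \<ominus> w = u" if "u \<in> carrier E" "w \<in> carrier E" for u w using that by algebra
    from this[of "(a \<ominus> b) [^] N" "b [^] N"] have "a [^] N \<ominus> b [^] N = (a \<ominus> b) [^] N" unfolding e using cc by simp
    then have m: "(a \<ominus> b) [^] N \<in> vball E Q 1" using eq rc_eq_iff[OF Qp] cc by simp
    have "a \<ominus> b \<in> vball E Q 1"
    proof (rule ccontr)
      assume n: "a \<ominus> b \<notin> vball E Q 1"
      have "a \<ominus> b \<in> vball E Q 0" using vball_minus[OF Qp] Ab a by blast
      then have "(a \<ominus> b) [^] N \<in> A" using powA[OF A1[OF _ n]] by blast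
      then show False using Ab(2) m by blast
    qed
    then show ?thesis using rc_eq_iff[OF Qp cc] by simp
  qed
  have relation: "(\<Oplus>\<^bsub>residue_field E Q\<^esub>i\<in>?S. c i \<otimes>\<^bsub>residue_field E Q\<^esub> \<chi> i x) = \<zero>\<^bsub>residue_field E Q\<^esub>" if x: "x \<in> A" for x
  proof -
    let ?K = "residue_field E Q"
    have xc: "x \<in> carrier E" "x \<in> vball E Q 0" using Ab[OF x] by auto
    let ?T = "twist E Q ` carrier G"
    have T: "finite ?T" "?T \<subseteq> places E" using G_finite twist_place[OF Qp] by auto
    \<comment> \<open>\<open>y\<close> imitates \<open>x\<close> at Q and vanishes at all other
      conjugates, so modulo Q its full trace reduces to the sum of \<open>d x\<close> over the
      decomposition group alone.\<close>
    obtain y where y: "y \<in> carrier E" "\<forall>v\<in>?T. y \<ominus> (if v = Q then x else \<zero>) \<in> vball E v 1"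
    proof -
      have "\<exists>y\<in>carrier E. \<forall>v\<in>?T. y \<ominus> (if v = Q then x else \<zero>) \<in> vball E v 1"
        by (rule weak_approximation[OF T]) (simp add: xc)
      then show ?thesis using that by blast
    qed
    have yQ: "y \<ominus> x \<in> vball E Q 1"
    proof -
      have "Q \<in> ?T" using twist_id[OF Qp] G.one_closed by (metis imageI)
      then show ?thesis using y(2) by auto
    qed
    have y_D: "d y \<ominus> d x \<in> vball E Q 1" if d: "d \<in> D" for d
      using Dball[OF d, of "y \<ominus> x" 1] yQ gal_minus[OF DG[OF d] y(1) xc(1)] y(1) xc(1) by simp
    have y_notD: "s y \<in> vball E Q 1" if s: "s \<in> carrier G - D" for s
    proof -
      have sG: "s \<in> carrier G" "twist E Q s \<noteq> Q" using s by (auto simp: D_def)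
      then have "y \<ominus> \<zero> \<in> vball E (twist E Q s) 1" using y(2)[rule_format, of "twist E Q s"] by simp
      then show ?thesis using vball_twist[OF y(1) sG(1)] y(1) by (simp add: a_minus_def)
    qed
    have gy: "s y \<in> vball E Q 0" if s: "s \<in> carrier G" for s
    proof (cases "s \<in> D")
      case True
      have "d y \<ominus> d x \<in> vball E Q 0" if "d = s" for d using y_D[of d] True that vball_le[of _ E Q 1 0] by simp
      moreover have "s x \<in> vball E Q 0" using Dball[OF True xc(1)] xc(2) by simp
      ultimately show ?thesis using vball_minus_cancel[OF Qp] gal_closed[OF s y(1)] by blast
    next
      case False
      then show ?thesis using y_notD[of s] s vball_le[of _ E Q 1 0] by simp
    qed
    let ?t = "\<Oplus>s\<in>carrier G. s y"
    have tF: "?t \<in> F" by (rule trace_in_F[OF y(1)])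
    have tb: "?t \<in> vball E Q 0" by (rule vball_finsum[OF Qp gy])
    have tc: "?t \<in> carrier E" by (rule vball_carrier[OF tb])
    have rc_gy: "?rc (s y) = (if s \<in> D then ?rc (s x) else \<zero>\<^bsub>?K\<^esub>)" if s: "s \<in> carrier G" for s
      using y_D[of s] y_notD[of s] rc_eq_iff[OF Qp] rc_eq_zero_iff[OF Qp] gal_closed[OF s] y(1) xc(1) s by auto
    have rcx: "?rc (d x) \<in> carrier ?K" if "d \<in> D" for d using rcA(1) dA[OF that x] by simp
    have "?rc ?t = (\<Oplus>\<^bsub>?K\<^esub>s\<in>carrier G. ?rc (s y))" by (rule rc_finsum[OF Qp G_finite gy])
    also have "\<dots> = (\<Oplus>\<^bsub>?K\<^esub>d\<in>D. ?rc (d x))"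
      by (rule \<kappa>.add.finprod_mono_neutral_cong_right[OF G_finite])
        (use rc_gy DG rc_simps(1)[OF Qp gy] in auto)
    finally have trace: "?rc ?t = (\<Oplus>\<^bsub>?K\<^esub>d\<in>D. ?rc (d x))" .
    have sumc: "(\<Oplus>d\<in>D. d x) \<in> carrier E" using DG gal_closed xc(1) by (intro finsum_closed) auto
    have dxb: "d x \<in> vball E Q 0" if "d \<in> D" for d using Ab(1)[OF dA[OF that x]] .
    have trace': "?rc ?t = ?rc (\<Oplus>d\<in>D. d x)"
      unfolding trace by (rule rc_finsum[OF Qp Dfin, symmetric]) (rule dxb)
    \<comment> \<open>The trace lies in F, where N is the size of the residue field at P, so its
      N-th power has the same residue.\<close>
    have "?t [^] N \<ominus> ?t \<in> vball E Q 1"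
    proof -
      have "?t \<in> vball FF P 0" using above_vball[OF P Q un tF] tb by simp
      then have "?t [^]\<^bsub>FF\<^esub> place_norm FF P \<ominus>\<^bsub>FF\<^esub> ?t \<in> vball FF P 1"
        by (rule FF.power_place_norm_cong[OF P F_residue_finite[OF P]])
      moreover have "?t [^]\<^bsub>FF\<^esub> place_norm FF P \<ominus>\<^bsub>FF\<^esub> ?t = ?t [^] N \<ominus> ?t"
        using minus_subring[OF subfieldE(1)[OF F_subfield] tF] by (simp add: nat_pow_def N_def)
      ultimately have "?t [^] N \<ominus> ?t \<in> vball FF P 1" by simp
      moreover from this have "?t [^] N \<ominus> ?t \<in> F" using FF.vball_carrier by fastforce
      ultimately show ?thesis using above_vball[OF P Q un] by blast
    qed
    then have tN: "?rc (?t [^] N) = ?rc ?t" using rc_eq_iff[OF Qp] tc by simp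
    have sumN: "(\<Oplus>d\<in>S. d x) [^] N = (\<Oplus>d\<in>S. d x [^] N)" if "finite S" "S \<subseteq> D" for S
      using that
    proof (induction S)
      case empty
      have "\<zero> [^] N = \<zero>" using N0 by (cases N) auto
      then show ?case by simp
    next
      case (insert d S)
      have f: "(\<lambda>d. d x) \<in> S \<rightarrow> carrier E" "d x \<in> carrier E"
        using insert.prems DG gal_closed[OF _ xc(1)] by auto
      have g: "(\<lambda>d. d x [^] N) \<in> S \<rightarrow> carrier E" "d x [^] N \<in> carrier E" using f by (auto simp: Pi_def)
      show ?case using insert f g Npow[OF f(2) finsum_closed[OF f(1)]] by (simp add: finsum_insert)
    qed
    have dxNb: "d x [^] N \<in> vball E Q 0" if "d \<in> D" for d using Ab(1)[OF powA[OF dA[OF that x]]] .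
    have sumb: "(\<Oplus>d\<in>D. d x) \<in> vball E Q 0" by (rule vball_finsum[OF Qp dxb])
    have "?rc (?t [^] N) = ?rc ((\<Oplus>d\<in>D. d x) [^] N)"
      using rc_pow[OF Qp tb, of N] rc_pow[OF Qp sumb, of N] trace' by simp
    also have "\<dots> = (\<Oplus>\<^bsub>?K\<^esub>d\<in>D. ?rc (d x [^] N))"
      unfolding sumN[OF Dfin subset_refl] by (rule rc_finsum[OF Qp Dfin dxNb])
    finally have power: "(\<Oplus>\<^bsub>?K\<^esub>d\<in>D. ?rc (d x [^] N)) = ?rc ?t" using tN by simp
    have rcxN: "?rc (d x [^] N) \<in> carrier ?K" if "d \<in> D" for d using rc_simps(1)[OF Qp dxNb[OF that]] .
    have S: "?S = (\<lambda>d. (d, False)) ` D \<union> (\<lambda>d. (d, True)) ` D" by auto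
    have val: "(\<lambda>i. c i \<otimes>\<^bsub>?K\<^esub> \<chi> i x) \<in> ?S \<rightarrow> carrier ?K"
      using rcx rcxN by (auto simp: c_def \<chi>_def)
    have "(\<Oplus>\<^bsub>?K\<^esub>i\<in>?S. c i \<otimes>\<^bsub>?K\<^esub> \<chi> i x) =
        (\<Oplus>\<^bsub>?K\<^esub>i\<in>(\<lambda>d. (d, False)) ` D. c i \<otimes>\<^bsub>?K\<^esub> \<chi> i x) \<oplus>\<^bsub>?K\<^esub> (\<Oplus>\<^bsub>?K\<^esub>i\<in>(\<lambda>d. (d, True)) ` D. c i \<otimes>\<^bsub>?K\<^esub> \<chi> i x)"
      unfolding S by (rule \<kappa>.add.finprod_Un_disjoint) (use Dfin val in \<open>auto simp: S\<close>)
    also have "(\<Oplus>\<^bsub>?K\<^esub>i\<in>(\<lambda>d. (d, False)) ` D. c i \<otimes>\<^bsub>?K\<^esub> \<chi> i x) = (\<Oplus>\<^bsub>?K\<^esub>d\<in>D. ?rc (d x))"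
    proof -
      have "(\<Oplus>\<^bsub>?K\<^esub>i\<in>(\<lambda>d. (d, False)) ` D. c i \<otimes>\<^bsub>?K\<^esub> \<chi> i x) = (\<Oplus>\<^bsub>?K\<^esub>d\<in>D. c (d, False) \<otimes>\<^bsub>?K\<^esub> \<chi> (d, False) x)"
        using val by (intro \<kappa>.add.finprod_reindex) (auto simp: S inj_on_def)
      also have "\<dots> = (\<Oplus>\<^bsub>?K\<^esub>d\<in>D. ?rc (d x))"
        using rcx by (intro \<kappa>.finsum_cong') (auto simp: c_def \<chi>_def)
      finally show ?thesis .
    qed
    also have "(\<Oplus>\<^bsub>?K\<^esub>i\<in>(\<lambda>d. (d, True)) ` D. c i \<otimes>\<^bsub>?K\<^esub> \<chi> i x) = \<ominus>\<^bsub>?K\<^esub> (\<Oplus>\<^bsub>?K\<^esub>d\<in>D. ?rc (d x [^] N))"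
    proof -
      have m1: "\<ominus>\<^bsub>?K\<^esub> \<one>\<^bsub>?K\<^esub> \<in> carrier ?K" by simp
      have "(\<Oplus>\<^bsub>?K\<^esub>i\<in>(\<lambda>d. (d, True)) ` D. c i \<otimes>\<^bsub>?K\<^esub> \<chi> i x) = (\<Oplus>\<^bsub>?K\<^esub>d\<in>D. c (d, True) \<otimes>\<^bsub>?K\<^esub> \<chi> (d, True) x)"
        using val by (intro \<kappa>.add.finprod_reindex) (auto simp: S inj_on_def)
      also have "\<dots> = (\<Oplus>\<^bsub>?K\<^esub>d\<in>D. (\<ominus>\<^bsub>?K\<^esub> \<one>\<^bsub>?K\<^esub>) \<otimes>\<^bsub>?K\<^esub> ?rc (d x [^] N))"
        using rcxN by (intro \<kappa>.finsum_cong') (auto simp: c_def \<chi>_def)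
      also have "\<dots> = (\<ominus>\<^bsub>?K\<^esub> \<one>\<^bsub>?K\<^esub>) \<otimes>\<^bsub>?K\<^esub> (\<Oplus>\<^bsub>?K\<^esub>d\<in>D. ?rc (d x [^] N))"
        using \<kappa>.finsum_rdistr[OF Dfin m1, of "\<lambda>d. ?rc (d x [^] N)"] rcxN by (simp add: Pi_def)
      also have "\<dots> = \<ominus>\<^bsub>?K\<^esub> (\<Oplus>\<^bsub>?K\<^esub>d\<in>D. ?rc (d x [^] N))"
        using rcxN by (subst \<kappa>.l_minus) (auto intro!: \<kappa>.finsum_closed)
      finally show ?thesis .
    qed
    finally show ?thesis unfolding power trace[symmetric]
      using rc_simps(1)[OF Qp tb] by (simp add: \<kappa>.r_neg)
  qed
  have "c (\<one>\<^bsub>G\<^esub>, False) = \<zero>\<^bsub>residue_field E Q\<^esub>"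
  proof (rule \<kappa>.independent_characters[of ?S A \<chi> "(\<otimes>)" c])
    show "finite ?S" using Dfin by simp
    show "A \<noteq> {}" using place_one[OF Qp] by (auto simp: A_def)
    show "b \<otimes> a \<in> A" if "a \<in> A" "b \<in> A" for a b
      using that place_mult[OF Qp] by (auto simp: A_def)
    show "\<chi> i (b \<otimes> a) = \<chi> i b \<otimes>\<^bsub>residue_field E Q\<^esub> \<chi> i a" if i: "i \<in> ?S" and ab: "a \<in> A" "b \<in> A" for i a b
    proof -
      obtain d e where de: "i = (d, e)" "d \<in> D" using i by auto
      have cc: "d a \<in> carrier E" "d b \<in> carrier E" using Ab(3)[OF dA[OF de(2)]] ab by auto
      have "d (b \<otimes> a) = d b \<otimes> d a" using gal_mult[OF DG[OF de(2)]] Ab(3) ab by simp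
      moreover have "(d b \<otimes> d a) [^] N = d b [^] N \<otimes> d a [^] N" using nat_pow_distrib cc by simp
      ultimately show ?thesis
        using rcm[OF dA[OF de(2) ab(2)] dA[OF de(2) ab(1)]]
          rcm[OF powA[OF dA[OF de(2) ab(2)]] powA[OF dA[OF de(2) ab(1)]]]
        by (simp add: \<chi>_def de(1))
    qed
    show "\<chi> i a \<in> carrier (residue_field E Q) \<and> \<chi> i a \<noteq> \<zero>\<^bsub>residue_field E Q\<^esub>" if i: "i \<in> ?S" and a: "a \<in> A" for i a
    proof -
      obtain d e where de: "i = (d, e)" "d \<in> D" using i by auto
      show ?thesis using rcA[OF dA[OF de(2) a]] rcA[OF powA[OF dA[OF de(2) a]]] by (simp add: \<chi>_def de(1))
    qed
    show "\<exists>a\<in>A. \<chi> i a \<noteq> \<chi> j a" if i: "i \<in> ?S" and j: "j \<in> ?S" and ij: "i \<noteq> j" for i j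
    proof (rule ccontr)
      assume "\<not> ?thesis"
      then have eq: "\<And>a. a \<in> A \<Longrightarrow> \<chi> i a = \<chi> j a" by blast
      obtain d e d' e' where de: "i = (d, e)" "d \<in> D" "j = (d', e')" "d' \<in> D" using i j by auto
      consider "e" "e'" | "e" "\<not> e'" | "\<not> e" "e'" | "\<not> e" "\<not> e'" by blast
      then show False
      proof cases
        case 1
        have "?rc (d x) = ?rc (d' x)" if x: "x \<in> A" for x
          using pow_inj[OF dA[OF de(2) x] dA[OF de(4) x]] eq[OF x] 1 by (simp add: \<chi>_def de(1,3))
        then show False using agree[OF de(2,4)] ij de(1,3) 1 by blast
      next
        case 2
        have "?rc (d' x) = ?rc (d x [^] N)" if x: "x \<in> A" for x
          using eq[OF x] 2 by (simp add: \<chi>_def de(1,3))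
        then show False using agree_pow[OF de(4,2)] by blast
      next
        case 3
        have "?rc (d x) = ?rc (d' x [^] N)" if x: "x \<in> A" for x
          using eq[OF x] 3 by (simp add: \<chi>_def de(1,3))
        then show False using agree_pow[OF de(2,4)] by blast
      next
        case 4
        have "?rc (d x) = ?rc (d' x)" if x: "x \<in> A" for x
          using eq[OF x] 4 by (simp add: \<chi>_def de(1,3))
        then show False using agree[OF de(2,4)] ij de(1,3) 4 by blast
      qed
    qed
    show "c i \<in> carrier (residue_field E Q)" if "i \<in> ?S" for i by (simp add: c_def)
    show "(\<one>\<^bsub>G\<^esub>, False) \<in> ?S" using D1 by simp
  qed (rule relation)
  then show False by (simp add: c_def)
qed

text \<open>The definition asks for the congruence at all places above P. Existence at one place
  spreads to the others by transitivity and commutativity, while uniqueness at one place already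
  determines the automorphism.\<close>

theorem frobenius_properties:
  assumes P: "P \<in> places FF" and un: "\<not> ramifies E F P"
  shows "frobenius E F P \<in> carrier G"
    "Q \<in> places_above E F P \<Longrightarrow> frobenius_at Q (place_norm FF P) (frobenius E F P)"
proof -
  obtain V0 y0 where "expansion_field FF V0 y0" using expansion_field_F by blast
  then interpret Y: expansion_field FF V0 y0 .
  let ?N = "place_norm FF P"
  have N: "card (constant_field FF) ^ place_degree FF P = ?N" by (rule Y.card_constant_field_power_degree[OF P])
  have N0: "?N > 0" using Y.place_norm_ge_2'[OF P P] by simp
  obtain Q0 where Q0: "Q0 \<in> places_above E F P" using places_above_nonempty[OF P] by blast
  have Q0p: "Q0 \<in> places E" using Q0 by (simp add: places_above_def)
  obtain s where s: "s \<in> carrier G" "frobenius_at Q0 ?N s" using frobenius_at_exists[OF P Q0 un] by blast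
  have all: "frobenius_at Q ?N s" if "Q \<in> places_above E F P" for Q
    using places_above_transitive[OF P Q0 that] frobenius_at_twist[OF Q0p s] by auto
  have "frobenius E F P = (THE s. s \<in> carrier G \<and> (\<forall>Q\<in>places_above E F P. frobenius_at Q ?N s))"
    unfolding frobenius_def frobenius_at_def N valuation_ring_eq_vball valuation_ideal_eq_vball ..
  also have "\<dots> = s"
  proof (rule the_equality)
    show "s \<in> carrier G \<and> (\<forall>Q\<in>places_above E F P. frobenius_at Q ?N s)" using s all by blast
    show "t = s" if "t \<in> carrier G \<and> (\<forall>Q\<in>places_above E F P. frobenius_at Q ?N t)" for t
      using frobenius_at_unique[OF P Q0 un N0] that s Q0 by blast
  qed
  finally show "frobenius E F P \<in> carrier G"
    "Q \<in> places_above E F P \<Longrightarrow> frobenius_at Q ?N (frobenius E F P)" using s all by auto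
qed

end

section \<open>Splitting and the growth of effective divisors\<close>

text \<open>A partial Euler product: each of the finitely many places contributes at most the
  geometric series with ratio 1/2, that is, a factor 2.\<close>

lemma sum_inverse_norm_finite_support:
  fixes w :: "'v \<Rightarrow> nat"
  assumes "finite S" "\<And>v. v \<in> S \<Longrightarrow> 2 \<le> w v"
    and "finite \<D>" "\<And>D. D \<in> \<D> \<Longrightarrow> set_mset D \<subseteq> S"
  shows "(\<Sum>D\<in>\<D>. 1 / real (\<Prod>v\<in>#D. w v)) \<le> 2 ^ card S"
  using assms
proof (induction S arbitrary: \<D>)
  case empty
  then have "\<D> \<subseteq> {{#}}" by auto
  then have "(\<Sum>D\<in>\<D>. 1 / real (\<Prod>v\<in>#D. w v)) \<le> (\<Sum>D\<in>{{#}}. 1 / real (\<Prod>v\<in>#D. w v))"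
    by (intro sum_mono2) auto
  then show ?case by simp
next
  case (insert s S)
  let ?N = "\<lambda>D. real (\<Prod>v\<in>#D. w v)"
  let ?f = "\<lambda>D. (count D s, filter_mset (\<lambda>v. v \<noteq> s) D)"
  \<comment> \<open>The largest multiplicity of \<open>s\<close> in the finite family; it bounds the
    exponents in the geometric sum.\<close>
  define m where "m = Max (insert 0 ((\<lambda>D. count D s) ` \<D>))"
  let ?\<D>' = "(\<lambda>D. filter_mset (\<lambda>v. v \<noteq> s) D) ` \<D>"
  have split: "D = replicate_mset (count D s) s + filter_mset (\<lambda>v. v \<noteq> s) D" for D
    by (rule multiset_eqI) auto
  have inj: "inj_on ?f \<D>" by (rule inj_onI) (metis split prod.inject)
  have im: "?f ` \<D> \<subseteq> {..m} \<times> ?\<D>'" using insert.prems(2) by (auto simp: m_def)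
  have ws: "real (w s) \<ge> 2" using insert.prems(1)[of s] by simp
  have Npos: "0 < ?N D" if "set_mset D \<subseteq> insert s S" for D
  proof -
    have "(\<Prod>v\<in>#D. w v) \<noteq> 0"
    proof
      assume "(\<Prod>v\<in>#D. w v) = 0"
      then obtain v where "v \<in># D" "w v = 0" by (auto simp: prod_mset_zero_iff)
      then show False using that insert.prems(1)[of v] by auto
    qed
    then show ?thesis by linarith
  qed
  have bound: "1 / ?N D \<le> (1/2) ^ count D s * (1 / ?N (filter_mset (\<lambda>v. v \<noteq> s) D))" if D: "D \<in> \<D>" for D
  proof -
    let ?D' = "filter_mset (\<lambda>v. v \<noteq> s) D"
    have "?N D = ?N (replicate_mset (count D s) s + ?D')" using split[of D] by simp
    also have "\<dots> = real (w s) ^ count D s * ?N ?D'" by simp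
    finally have e: "?N D = real (w s) ^ count D s * ?N ?D'" .
    have p: "0 < ?N ?D'" using insert.prems(3)[OF D] by (intro Npos) auto
    have "2 ^ count D s \<le> real (w s) ^ count D s" using ws by (intro power_mono) auto
    then have "2 ^ count D s * ?N ?D' \<le> ?N D" unfolding e using p by (intro mult_right_mono) auto
    then have "1 / ?N D \<le> 1 / (2 ^ count D s * ?N ?D')" using p by (intro divide_left_mono) (auto simp: e intro!: mult_pos_pos zero_less_power less_le_trans[OF _ ws])
    then show ?thesis by (simp add: power_one_over)
  qed
  have "(\<Sum>D\<in>\<D>. 1 / ?N D) \<le> (\<Sum>D\<in>\<D>. (\<lambda>(i, D'). (1/2) ^ i * (1 / ?N D')) (?f D))"
    using bound by (intro sum_mono) auto
  also have "\<dots> = (\<Sum>x\<in>?f ` \<D>. (\<lambda>(i, D'). (1/2) ^ i * (1 / ?N D')) x)"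
    by (rule sum.reindex_cong[OF inj, symmetric]) auto
  also have "\<dots> \<le> (\<Sum>x\<in>{..m} \<times> ?\<D>'. (\<lambda>(i, D'). (1/2) ^ i * (1 / ?N D')) x)"
    using im insert.prems(2) by (intro sum_mono2) auto
  also have "\<dots> = (\<Sum>i\<le>m. \<Sum>D'\<in>?\<D>'. (1/2) ^ i * (1 / ?N D'))"
    by (rule sum.cartesian_product[symmetric])
  also have "\<dots> = (\<Sum>i\<le>m. (1/2) ^ i) * (\<Sum>D'\<in>?\<D>'. 1 / ?N D')"
    by (simp only: sum_product)
  also have "\<dots> \<le> 2 * 2 ^ card S"
  proof (rule mult_mono)
    have "(\<Sum>i\<le>m. (1/2::real) ^ i) = 2 - (1/2) ^ m"
      by (induction m) (auto simp: field_simps)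
    then show "(\<Sum>i\<le>m. (1/2::real) ^ i) \<le> 2" by simp
    have "set_mset D' \<subseteq> S" if D': "D' \<in> ?\<D>'" for D'
    proof -
      obtain D where D: "D \<in> \<D>" "D' = filter_mset (\<lambda>v. v \<noteq> s) D" using D' by auto
      show ?thesis using insert.prems(3)[OF D(1)] unfolding D(2) by auto
    qed
    then show "(\<Sum>D'\<in>?\<D>'. 1 / ?N D') \<le> 2 ^ card S"
      using insert.IH[of ?\<D>'] insert.prems(1,2) by simp
  qed (auto intro!: sum_nonneg)
  finally show ?case using insert.hyps by simp
qed

text \<open>Two disjoint norm preserving lifts would make the square of the divergent sum of the inverse
  norms of the effective divisors below at most linear.\<close>

lemma no_two_norm_preserving_lifts:
  fixes w :: "'v \<Rightarrow> nat" and u :: "'z \<Rightarrow> nat"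
  assumes S: "finite S" "S \<subseteq> A" and w2: "\<And>v. v \<in> A \<Longrightarrow> 2 \<le> w v"
    and f: "inj_on f (A - S)" "inj_on g (A - S)" "f ` (A - S) \<inter> g ` (A - S) = {}"
    and fB: "\<And>v. v \<in> A - S \<Longrightarrow> f v \<in> B \<and> g v \<in> B" and fw: "\<And>v. v \<in> A - S \<Longrightarrow> u (f v) = w v \<and> u (g v) = w v"
    and upper: "\<exists>b\<ge>2. \<exists>K::real. \<forall>n \<D>. \<D> \<subseteq> {D. set_mset D \<subseteq> B \<and> (\<Prod>v\<in>#D. u v) < b ^ n} \<longrightarrow>
      finite \<D> \<and> (\<Sum>D\<in>\<D>. 1 / real (\<Prod>v\<in>#D. u v)) \<le> K * real n"
    and fin: "\<And>k. finite {D. set_mset D \<subseteq> A \<and> (\<Prod>v\<in>#D. w v) \<le> k}"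
    and lower: "\<exists>b\<ge>2. \<exists>N::nat. \<exists>c::real. c > 0 \<and> (\<forall>n. c * real n \<le>
      (\<Sum>D\<in>{D. set_mset D \<subseteq> A \<and> (\<Prod>v\<in>#D. w v) \<le> b ^ n * N}. 1 / real (\<Prod>v\<in>#D. w v)))"
  shows False
proof -
  let ?N = "\<lambda>D. \<Prod>v\<in>#D. w v" and ?M = "\<lambda>D. \<Prod>v\<in>#D. u v"
  obtain b K where b: "2 \<le> b" and K: "\<And>n \<D>. \<D> \<subseteq> {D. set_mset D \<subseteq> B \<and> ?M D < b ^ n} \<Longrightarrow>
      finite \<D> \<and> (\<Sum>D\<in>\<D>. 1 / real (?M D)) \<le> K * real n"
    using upper by blast
  obtain a N and c :: real where a: "2 \<le> a" and c: "c > 0" "\<And>n. c * real n \<le>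
      (\<Sum>D\<in>{D. set_mset D \<subseteq> A \<and> ?N D \<le> a ^ n * N}. 1 / real (?N D))"
    using lower by blast
  have Npos: "0 < ?N D" if "set_mset D \<subseteq> A" for D
  proof (rule ccontr)
    assume "\<not> 0 < ?N D"
    then obtain v where "v \<in># D" "w v = 0" by (auto simp: prod_mset_zero_iff)
    then show False using that w2[of v] by auto
  qed
  have key: "(c * real n / 2 ^ card S)\<^sup>2 \<le> K * real (2 * (a * n + N))" for n
  proof -
    let ?A = "{D. set_mset D \<subseteq> A \<and> ?N D \<le> a ^ n * N}"
    \<comment> \<open>Every divisor splits into a part supported on \<open>S\<close> and a part away
      from \<open>S\<close>. The first parts contribute a factor of at most
      \<open>2 ^ card S\<close>, so the divisors away from \<open>S\<close> still have a linearly
      growing sum.\<close>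
    let ?A' = "{D \<in> ?A. set_mset D \<subseteq> A - S}" and ?B = "{D \<in> ?A. set_mset D \<subseteq> S}"
    have finA: "finite ?A" by (rule fin)
    have finA': "finite ?A'" and finB: "finite ?B" by (rule finite_subset[OF _ finA]; blast)+
    let ?h = "\<lambda>D. (filter_mset (\<lambda>v. v \<in> S) D, filter_mset (\<lambda>v. v \<notin> S) D)"
    have part: "D = filter_mset (\<lambda>v. v \<in> S) D + filter_mset (\<lambda>v. v \<notin> S) D" for D :: "'v multiset"
      by (rule multiset_partition)
    have Nsplit: "?N D = ?N (filter_mset (\<lambda>v. v \<in> S) D) * ?N (filter_mset (\<lambda>v. v \<notin> S) D)" for D
    proof -
      have "?N (A1 + B1) = ?N A1 * ?N B1" for A1 B1 by simp
      then show ?thesis using part[of D] by metis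
    qed
    have inj: "inj_on ?h ?A" by (rule inj_onI) (metis part prod.inject)
    have im: "?h ` ?A \<subseteq> ?B \<times> ?A'"
    proof (rule image_subsetI)
      fix D assume D: "D \<in> ?A"
      let ?D1 = "filter_mset (\<lambda>v. v \<in> S) D" and ?D2 = "filter_mset (\<lambda>v. v \<notin> S) D"
      have sub: "set_mset ?D1 \<subseteq> A" "set_mset ?D2 \<subseteq> A" using D by auto
      have "?N ?D1 \<le> ?N D" "?N ?D2 \<le> ?N D" using Nsplit[of D] Npos[OF sub(1)] Npos[OF sub(2)] by simp_all
      then have "?N ?D1 \<le> a ^ n * N" "?N ?D2 \<le> a ^ n * N" using D by (simp_all only: mem_Collect_eq) linarith+
      then show "?h D \<in> ?B \<times> ?A'" using sub by auto
    qed
    have nonneg: "0 \<le> (\<Sum>D\<in>?A'. 1 / real (?N D))" by (intro sum_nonneg) simp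
    have "c * real n \<le> (\<Sum>D\<in>?A. 1 / real (?N D))" by (rule c(2))
    also have "\<dots> = (\<Sum>D\<in>?A. (\<lambda>(D1, D2). 1 / real (?N D1) * (1 / real (?N D2))) (?h D))"
    proof (rule sum.cong[OF refl])
      fix D
      show "1 / real (?N D) = (\<lambda>(D1, D2). 1 / real (?N D1) * (1 / real (?N D2))) (?h D)"
        by (subst Nsplit) simp
    qed
    also have "\<dots> = (\<Sum>x\<in>?h ` ?A. (\<lambda>(D1, D2). 1 / real (?N D1) * (1 / real (?N D2))) x)"
      by (rule sum.reindex_cong[OF inj, symmetric]) auto
    also have "\<dots> \<le> (\<Sum>x\<in>?B \<times> ?A'. (\<lambda>(D1, D2). 1 / real (?N D1) * (1 / real (?N D2))) x)"
      using im finA' finB by (intro sum_mono2) auto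
    also have "\<dots> = (\<Sum>D1\<in>?B. 1 / real (?N D1)) * (\<Sum>D2\<in>?A'. 1 / real (?N D2))"
      by (simp only: sum_product sum.cartesian_product)
    also have "\<dots> \<le> 2 ^ card S * (\<Sum>D2\<in>?A'. 1 / real (?N D2))"
      using sum_inverse_norm_finite_support[OF S(1) _ finB, of w] w2 S(2) nonneg by (intro mult_right_mono) auto
    finally have 1: "c * real n / 2 ^ card S \<le> (\<Sum>D\<in>?A'. 1 / real (?N D))" by (simp add: field_simps)
    \<comment> \<open>Pairs of divisors are lifted along \<open>f\<close> and \<open>g\<close> into
      one divisor over \<open>B\<close>. As the images of \<open>f\<close> and \<open>g\<close> are
      disjoint, the pair can be read off again, and the norm of the lift is the product of the two
      norms.\<close>
    let ?F = "\<lambda>(D1, D2). image_mset f D1 + image_mset g D2"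
    have Mf: "?M (image_mset f D) = ?N D \<and> ?M (image_mset g D) = ?N D" if "set_mset D \<subseteq> A - S" for D
    proof -
      have "u (f v) = w v" "u (g v) = w v" if "v \<in># D" for v using fw \<open>set_mset D \<subseteq> A - S\<close> that by auto
      then have "image_mset (\<lambda>v. u (f v)) D = image_mset w D" "image_mset (\<lambda>v. u (g v)) D = image_mset w D"
        by (auto intro!: image_mset_cong)
      then show ?thesis by (simp add: multiset.map_comp comp_def)
    qed
    have injF: "inj_on ?F (?A' \<times> ?A')"
    proof (rule inj_onI, clarify)
      fix D1 D2 D1' D2'
      assume D: "set_mset D1 \<subseteq> A - S" "set_mset D2 \<subseteq> A - S" "set_mset D1' \<subseteq> A - S" "set_mset D2' \<subseteq> A - S"
        and eq: "image_mset f D1 + image_mset g D2 = image_mset f D1' + image_mset g D2'"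
      have ff: "filter_mset (\<lambda>z. z \<in> f ` (A - S)) (image_mset f D + image_mset g D') = image_mset f D"
        if "set_mset D \<subseteq> A - S" "set_mset D' \<subseteq> A - S" for D D'
      proof -
        have "filter_mset (\<lambda>z. z \<in> f ` (A - S)) (image_mset f D) = image_mset f D"
          using that by (auto simp: filter_mset_eq_conv)
        moreover have "filter_mset (\<lambda>z. z \<in> f ` (A - S)) (image_mset g D') = {#}"
          using that f(3) by (auto simp: filter_mset_eq_mempty_iff)
        ultimately show ?thesis by simp
      qed
      have e1: "image_mset f D1 = image_mset f D1'" using ff[OF D(1,2)] ff[OF D(3,4)] eq by simp
      then have e2: "image_mset g D2 = image_mset g D2'" using eq by simp
      have cancel: "D = D'" if i: "inj_on h (A - S)" and D: "set_mset D \<subseteq> A - S" "set_mset D' \<subseteq> A - S"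
        and e: "image_mset h D = image_mset h D'" for h :: "'v \<Rightarrow> 'z" and D D'
      proof -
        have inv: "image_mset (inv_into (A - S) h) (image_mset h D) = D" if "set_mset D \<subseteq> A - S" for D
        proof -
          have "image_mset (\<lambda>v. inv_into (A - S) h (h v)) D = image_mset (\<lambda>v. v) D"
            using that inv_into_f_f[OF i] by (intro image_mset_cong) auto
          then show ?thesis by (simp add: multiset.map_comp comp_def)
        qed
        show ?thesis using inv[OF D(1)] inv[OF D(2)] unfolding e by (rule subst)
      qed
      show "D1 = D1' \<and> D2 = D2'"
        by (intro conjI cancel[OF f(1) D(1,3) e1] cancel[OF f(2) D(2,4) e2])
    qed
    have imF: "?F ` (?A' \<times> ?A') \<subseteq> {D. set_mset D \<subseteq> B \<and> ?M D < b ^ (2 * (a * n + N))}"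
    proof (rule image_subsetI, clarify)
      fix D1 D2 assume D: "set_mset D1 \<subseteq> A - S" "set_mset D2 \<subseteq> A - S" "?N D1 \<le> a ^ n * N" "?N D2 \<le> a ^ n * N"
      have "?M (image_mset f D1 + image_mset g D2) = ?N D1 * ?N D2" using Mf D by simp
      also have "\<dots> \<le> (a ^ n * N) * (a ^ n * N)" using D(3,4) by (rule mult_le_mono)
      \<comment> \<open>The bases \<open>a\<close> and \<open>b\<close> come from different fields;
        \<open>a < 2 ^ a\<close>, \<open>N < 2 ^ N\<close> and \<open>2 \<le> b\<close> convert one
        bound into the other.\<close>
      also have "\<dots> < b ^ (a * n + N) * b ^ (a * n + N)"
      proof -
        have "a < 2 ^ a" by (rule less_exp)
        then have "a ^ n \<le> (2 ^ a) ^ n" by (intro power_mono) auto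
        moreover have "N < 2 ^ N" by (rule less_exp)
        ultimately have "a ^ n * N < (2 ^ a) ^ n * 2 ^ N" using a by (intro mult_le_less_imp_less) auto
        also have "\<dots> = 2 ^ (a * n + N)" by (simp add: power_add power_mult)
        also have "\<dots> \<le> b ^ (a * n + N)" using b by (rule power_mono) simp
        finally show ?thesis using mult_strict_mono'[of "a ^ n * N" _ "a ^ n * N"] by (metis zero_le)
      qed
      finally have "?M (image_mset f D1 + image_mset g D2) < b ^ (2 * (a * n + N))"
        by (simp only: power_add[symmetric] mult_2)
      moreover have "set_mset (image_mset f D1 + image_mset g D2) \<subseteq> B" using D(1,2) fB by auto
      ultimately show "set_mset (image_mset f D1 + image_mset g D2) \<subseteq> B \<and>
        ?M (image_mset f D1 + image_mset g D2) < b ^ (2 * (a * n + N))" by simp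
    qed
    have "(\<Sum>D\<in>?A'. 1 / real (?N D))\<^sup>2 = (\<Sum>x\<in>?A' \<times> ?A'. (\<lambda>(D1, D2). 1 / real (?N D1) * (1 / real (?N D2))) x)"
      by (simp only: sum_product sum.cartesian_product power2_eq_square)
    also have "\<dots> = (\<Sum>x\<in>?A' \<times> ?A'. 1 / real (?M (?F x)))"
      using Mf by (intro sum.cong refl) (auto simp: case_prod_beta)
    also have "\<dots> = (\<Sum>D\<in>?F ` (?A' \<times> ?A'). 1 / real (?M D))"
      by (rule sum.reindex_cong[OF injF, symmetric]) auto
    also have "\<dots> \<le> K * real (2 * (a * n + N))" using K[OF imF] by blast
    finally have 2: "(\<Sum>D\<in>?A'. 1 / real (?N D))\<^sup>2 \<le> K * real (2 * (a * n + N))" .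
    have "(c * real n / 2 ^ card S)\<^sup>2 \<le> (\<Sum>D\<in>?A'. 1 / real (?N D))\<^sup>2"
      using 1 c(1) by (intro power_mono) auto
    then show ?thesis using 2 by linarith
  qed
  define e where "e = (c / 2 ^ card S)\<^sup>2"
  have e: "e > 0" using c(1) by (simp add: e_def)
  \<comment> \<open>From here on \<open>e * n\<close> exceeds
    \<open>2 * \<bar>K\<bar> * (a + N)\<close>, whereas the estimate \<open>key\<close> gives
    \<open>e * n^2 \<le> 2 * \<bar>K\<bar> * (a + N) * n\<close>.\<close>
  obtain n :: nat where n: "(\<bar>K\<bar> * real (2 * (a + N))) / e < real n" using reals_Archimedean2 by blast
  have n0: "0 < n"
  proof (rule ccontr)
    assume "\<not> 0 < n"
    then have "(\<bar>K\<bar> * real (2 * (a + N))) / e < 0" using n by simp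
    moreover have "0 \<le> (\<bar>K\<bar> * real (2 * (a + N))) / e" using e by simp
    ultimately show False by simp
  qed
  have "e * (real n)\<^sup>2 \<le> K * real (2 * (a * n + N))"
    using key[of n] by (simp add: e_def power_divide power_mult_distrib)
  also have "\<dots> \<le> \<bar>K\<bar> * real (2 * (a * n + N))" by (intro mult_right_mono) auto
  also have "\<dots> \<le> \<bar>K\<bar> * (real (2 * (a + N)) * real n)"
  proof (rule mult_left_mono)
    have "N \<le> N * n" using n0 by simp
    then have "2 * (a * n + N) \<le> 2 * (a + N) * n" by (simp add: algebra_simps)
    then show "real (2 * (a * n + N)) \<le> real (2 * (a + N)) * real n" by (metis of_nat_le_iff of_nat_mult)
  qed simp
  finally have "e * real n * real n \<le> \<bar>K\<bar> * real (2 * (a + N)) * real n" by (simp add: power2_eq_square mult.assoc)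
  then have "e * real n \<le> \<bar>K\<bar> * real (2 * (a + N))" using n0 by simp
  moreover have "\<bar>K\<bar> * real (2 * (a + N)) < e * real n" using n e by (simp add: divide_less_eq mult.commute)
  ultimately show False by simp
qed

section \<open>Surjectivity of the Artin map\<close>

context abelian_function_field_extension
begin

section \<open>Fixed fields of subgroups\<close>

definition fixed_field :: "('a \<Rightarrow> 'a) set \<Rightarrow> 'a set" where
  "fixed_field H = {x \<in> carrier E. \<forall>h\<in>H. h x = x}"

context
  fixes H assumes H: "subgroup H G"
begin

private abbreviation "L \<equiv> fixed_field H"
private abbreviation "LL \<equiv> E\<lparr>carrier := L\<rparr>"
private abbreviation "res Q \<equiv> restrict Q (L - {\<zero>})"

private lemma HG: "h \<in> H \<Longrightarrow> h \<in> carrier G" using subgroup.subset[OF H] by blast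

private lemma Lc: "x \<in> L \<Longrightarrow> x \<in> carrier E" by (simp add: fixed_field_def)

private lemma Lfix: "x \<in> L \<Longrightarrow> h \<in> H \<Longrightarrow> h x = x" by (simp add: fixed_field_def)

lemma fixed_field_subfield: "subfield L E"
proof (rule subfieldI')
  show "subring L E"
  proof (rule subringI)
    show "L \<subseteq> carrier E" using Lc by blast
    show "\<one> \<in> L" using gal_one HG by (simp add: fixed_field_def)
    show "\<ominus> x \<in> L" if x: "x \<in> L" for x
    proof -
      have "h (\<ominus> x) = \<ominus> x" if h: "h \<in> H" for h
      proof -
        have "\<zero> \<ominus> x = \<ominus> x" using Lc[OF x] by (simp add: a_minus_def)
        moreover have "h x = x" using x h by (simp add: fixed_field_def)
        ultimately show ?thesis using gal_minus[OF HG[OF h] zero_closed Lc[OF x]] gal_zero[OF HG[OF h]]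
          by simp
      qed
      then show ?thesis using Lc[OF x] by (simp add: fixed_field_def)
    qed
    show "x \<otimes> y \<in> L" "x \<oplus> y \<in> L" if xy: "x \<in> L" "y \<in> L" for x y
    proof -
      have "h (x \<otimes> y) = x \<otimes> y" "h (x \<oplus> y) = x \<oplus> y" if h: "h \<in> H" for h
        using gal_mult[OF HG[OF h] xy[THEN Lc]] gal_add[OF HG[OF h] xy[THEN Lc]] xy[THEN Lfix, OF h]
        by simp_all
      then show "x \<otimes> y \<in> L" "x \<oplus> y \<in> L" using xy[THEN Lc] by (simp_all add: fixed_field_def)
    qed
  qed
  show "inv x \<in> L" if x: "x \<in> L - {\<zero>}" for x
  proof -
    have xc: "x \<in> carrier E" "x \<noteq> \<zero>" using x Lc by auto
    have "h (inv x) = inv x" if h: "h \<in> H" for h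
    proof -
      have hc: "h (inv x) \<in> carrier E" using gal_closed[OF HG[OF h]] xc by simp
      have "h (x \<otimes> inv x) = x \<otimes> h (inv x)"
        using gal_mult[OF HG[OF h] xc(1), of "inv x"] xc Lfix[OF _ h, of x] x by simp
      then have "x \<otimes> h (inv x) = \<one>" using xc gal_one[OF HG[OF h]] by simp
      then show ?thesis using comm_inv_char[OF xc(1) hc] by simp
    qed
    then show ?thesis using xc by (simp add: fixed_field_def)
  qed
qed

lemma F_subset_fixed_field: "F \<subseteq> L"
  using F_carrier gal_fix HG by (auto simp: fixed_field_def)

text \<open>Sums over H of conjugates lie in L. If some \<open>g\<close> outside H fixed all of L,
  the sum over H would equal the sum over the coset \<open>g H\<close>, a linear relation between
  distinct automorphisms.\<close>

lemma fixed_field_nontrivial: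
  assumes "H \<noteq> carrier G" shows "\<exists>y\<in>L. \<exists>g\<in>carrier G. g y \<noteq> y"
proof (rule ccontr)
  assume no: "\<not> ?thesis"
  obtain g where g: "g \<in> carrier G" "g \<notin> H" using assms subgroup.subset[OF H] by blast
  have Hfin: "finite H" using finite_subset[OF subgroup.subset[OF H] G_finite] .
  have one: "\<one>\<^bsub>G\<^esub> \<in> H" by (rule subgroup.one_closed[OF H])
  define gH where "gH = (\<lambda>h. g \<otimes>\<^bsub>G\<^esub> h) ` H"
  have gHG: "gH \<subseteq> carrier G" "finite gH" using g HG Hfin by (auto simp: gH_def)
  have disj: "H \<inter> gH = {}"
  proof (rule ccontr)
    assume "H \<inter> gH \<noteq> {}"
    then obtain h h' where h: "h \<in> H" "h' \<in> H" "h = g \<otimes>\<^bsub>G\<^esub> h'" by (auto simp: gH_def)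
    then have "g = h \<otimes>\<^bsub>G\<^esub> inv\<^bsub>G\<^esub> h'" using g HG by (simp add: G.m_assoc)
    then show False using g(2) subgroup.m_closed[OF H h(1) subgroup.m_inv_closed[OF H h(2)]] by simp
  qed
  have inj: "inj_on (\<lambda>h. g \<otimes>\<^bsub>G\<^esub> h) H" using g HG by (auto intro!: inj_onI)
  let ?t = "\<lambda>x. \<Oplus>h\<in>H. h x"
  have tL: "?t x \<in> L" if x: "x \<in> carrier E" for x
  proof -
    have tc: "?t x \<in> carrier E" using gal_closed[OF HG x] by (intro finsum_closed) auto
    have "k (?t x) = ?t x" if k: "k \<in> H" for k
    proof -
      have kH: "(\<lambda>h. k \<otimes>\<^bsub>G\<^esub> h) ` H = H" "inj_on (\<lambda>h. k \<otimes>\<^bsub>G\<^esub> h) H"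
      proof -
        show i: "inj_on (\<lambda>h. k \<otimes>\<^bsub>G\<^esub> h) H" using HG[OF k] HG by (auto intro!: inj_onI)
        have "(\<lambda>h. k \<otimes>\<^bsub>G\<^esub> h) ` H \<subseteq> H" using subgroup.m_closed[OF H k] by auto
        then show "(\<lambda>h. k \<otimes>\<^bsub>G\<^esub> h) ` H = H" using endo_inj_surj[OF Hfin _ i] by blast
      qed
      have "k (?t x) = (\<Oplus>h\<in>H. k (h x))" using gal_closed[OF HG x] by (intro gal_finsum[OF HG[OF k]]) auto
      also have "\<dots> = (\<Oplus>h\<in>H. (k \<otimes>\<^bsub>G\<^esub> h) x)"
        using gal_compose[OF HG[OF k] HG x] gal_closed[OF G.m_closed[OF HG[OF k] HG] x] by (intro finsum_cong') auto
      also have "\<dots> = (\<Oplus>h\<in>(\<lambda>h. k \<otimes>\<^bsub>G\<^esub> h) ` H. h x)"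
        using kH gal_closed[OF HG x] by (intro add.finprod_reindex[symmetric]) auto
      finally show ?thesis using kH by simp
    qed
    then show ?thesis using tc by (simp add: fixed_field_def)
  qed
  let ?A = "carrier E - {\<zero>}" and ?S = "H \<union> gH"
  \<comment> \<open>Coefficient 1 on H and -1 on the disjoint coset: the relation is the difference
    of the two sums.\<close>
  define c where "c h = (if h \<in> H then \<one> else \<ominus> \<one>)" for h :: "'a \<Rightarrow> 'a"
  have SG: "h \<in> carrier G" if "h \<in> ?S" for h using that HG gHG by auto
  have "c \<one>\<^bsub>G\<^esub> = \<zero>"
  proof (rule independent_characters[of ?S ?A "\<lambda>h x. h x" "(\<otimes>)" c])
    show "finite ?S" using Hfin gHG by simp
    show "h (b \<otimes> a) = h b \<otimes> h a" if "h \<in> ?S" "a \<in> ?A" "b \<in> ?A" for h a b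
      using gal_mult[OF SG] that by simp
    show "b \<otimes> a \<in> ?A" if "a \<in> ?A" "b \<in> ?A" for a b using that by simp
    show "?A \<noteq> {}" using one_not_zero by auto
    show "h a \<in> carrier E \<and> h a \<noteq> \<zero>" if "h \<in> ?S" "a \<in> ?A" for h a
      using gal_closed[OF SG] gal_eq_zero_iff[OF SG] that by simp
    show "\<exists>a\<in>?A. h a \<noteq> k a" if hk: "h \<in> ?S" "k \<in> ?S" "h \<noteq> k" for h k
    proof (rule ccontr)
      assume "\<not> ?thesis"
      then have "h a = k a" if "a \<in> carrier E" for a
        using that gal_zero[OF SG[OF hk(1)]] gal_zero[OF SG[OF hk(2)]] by (cases "a = \<zero>") auto
      then show False using gal_eqI[OF SG[OF hk(1)] SG[OF hk(2)]] hk(3) by blast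
    qed
    show "c h \<in> carrier E" for h by (simp add: c_def)
    show "\<one>\<^bsub>G\<^esub> \<in> ?S" using one by simp
    fix a assume a: "a \<in> ?A"
    then have ac: "a \<in> carrier E" by simp
    have val: "(\<lambda>h. c h \<otimes> h a) \<in> ?S \<rightarrow> carrier E" using gal_closed[OF SG ac] by (auto simp: c_def)
    have hv: "\<And>h. h \<in> ?S \<Longrightarrow> h a \<in> carrier E" using gal_closed[OF SG ac] .
    have "(\<Oplus>h\<in>?S. c h \<otimes> h a) = (\<Oplus>h\<in>H. c h \<otimes> h a) \<oplus> (\<Oplus>h\<in>gH. c h \<otimes> h a)"
      using Hfin gHG(2) disj val by (intro add.finprod_Un_disjoint) auto
    also have "(\<Oplus>h\<in>H. c h \<otimes> h a) = ?t a"
      using hv by (intro finsum_cong') (auto simp: c_def)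
    also have "(\<Oplus>h\<in>gH. c h \<otimes> h a) = \<ominus> ?t a"
    proof -
      have "(\<Oplus>h\<in>gH. c h \<otimes> h a) = (\<Oplus>h\<in>gH. (\<ominus> \<one>) \<otimes> h a)"
        using hv disj by (intro finsum_cong') (auto simp: c_def)
      also have "\<dots> = (\<ominus> \<one>) \<otimes> (\<Oplus>h\<in>gH. h a)"
        using finsum_rdistr[OF gHG(2), of "\<ominus> \<one>" "\<lambda>h. h a"] hv by (simp add: Pi_def)
      also have "(\<Oplus>h\<in>gH. h a) = (\<Oplus>h\<in>H. (g \<otimes>\<^bsub>G\<^esub> h) a)"
        unfolding gH_def using inj hv by (intro add.finprod_reindex) (auto simp: gH_def)
      also have "\<dots> = (\<Oplus>h\<in>H. g (h a))"
        using gal_compose[OF g(1) HG ac] gal_closed[OF g(1)] hv by (intro finsum_cong') auto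
      also have "\<dots> = g (?t a)" using hv by (intro gal_finsum[OF g(1), symmetric]) auto
      also have "\<dots> = ?t a" using no g(1) tL[OF ac] by blast
      finally show ?thesis using Lc[OF tL[OF ac]] by (simp add: l_minus)
    qed
    finally show "(\<Oplus>h\<in>?S. c h \<otimes> h a) = \<zero>" using Lc[OF tL[OF ac]] by (simp add: r_neg)
  qed
  then show False using one by (simp add: c_def)
qed

section \<open>Restriction of unramified places to the fixed field\<close>

context
  fixes P Q assumes P: "P \<in> places FF" and Q: "Q \<in> places_above E F P" and un: "\<not> ramifies E F P"
begin

private lemma Qp: "Q \<in> places E" using Q by (simp add: places_above_def)

lemma vball_restrict: "x \<in> L \<Longrightarrow> x \<in> vball LL (res Q) n \<longleftrightarrow> x \<in> vball E Q n"
  using Lc by (cases "x = \<zero>") (auto simp: vball_def)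

text \<open>Surjectivity onto the integers is the point: as Q is unramified, it takes all its values
  already on F, so the restriction to L needs no renormalization.\<close>

lemma restrict_place: "res Q \<in> places LL"
proof -
  note Lr = subringE[OF subfieldE(1)[OF fixed_field_subfield]]
  have "n \<in> res Q ` (L - {\<zero>})" for n
  proof -
    obtain x where x: "x \<in> F" "x \<noteq> \<zero>" "P x = n" using FF.place_surj[OF P, of n] by auto
    then have "x \<in> L - {\<zero>}" using F_subset_fixed_field by auto
    then show ?thesis using place_above_unramified[OF P Q un x(1,2)] x(3) by (intro image_eqI[of _ _ x]) auto
  qed
  then have "res Q ` (L - {\<zero>}) = UNIV" by auto
  moreover have "x \<otimes> y \<noteq> \<zero>" "x \<otimes> y \<in> L" "Q (x \<otimes> y) = Q x + Q y"
    if "x \<in> L - {\<zero>}" "y \<in> L - {\<zero>}" for x y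
    using that place_mult[OF Qp, of x y] Lc Lr(6) mult_nonzero[of x y] by auto
  moreover have "min (Q x) (Q y) \<le> Q (x \<oplus> y)" "x \<oplus> y \<in> L"
    if "x \<in> L - {\<zero>}" "y \<in> L - {\<zero>}" "x \<oplus> y \<noteq> \<zero>" for x y
    using that place_add[OF Qp, of x y] Lc Lr(7) by auto
  ultimately show ?thesis by (auto simp: places_def)
qed

context
  assumes frob: "frobenius E F P \<in> H"
begin

lemma residue_class_representatives_in_F:
  "\<exists>Y. finite Y \<and> card Y = place_norm FF P \<and> Y \<subseteq> F \<and> Y \<subseteq> vball E Q 0 \<and>
    (\<forall>y\<in>Y. \<forall>y'\<in>Y. y \<ominus> y' \<in> vball E Q 1 \<longrightarrow> y = y')"
proof -
  obtain Y where Y: "finite Y" "card Y = place_norm FF P" "Y \<subseteq> vball FF P 0"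
    "\<And>y y'. y \<in> Y \<Longrightarrow> y' \<in> Y \<Longrightarrow> y \<ominus>\<^bsub>FF\<^esub> y' \<in> vball FF P 1 \<Longrightarrow> y = y'"
    using FF.residue_representatives[OF P F_residue_finite[OF P]] by metis
  have YF: "Y \<subseteq> F" using Y(3) FF.vball_carrier by fastforce
  have "Y \<subseteq> vball E Q 0" using above_vball[OF P Q un] Y(3) YF by blast
  moreover have "y = y'" if y: "y \<in> Y" "y' \<in> Y" "y \<ominus> y' \<in> vball E Q 1" for y y'
  proof (rule Y(4)[OF y(1,2)])
    have m: "y \<ominus>\<^bsub>FF\<^esub> y' = y \<ominus> y'" using minus_subring[OF subfieldE(1)[OF F_subfield]] y YF by blast
    have "y \<ominus>\<^bsub>FF\<^esub> y' \<in> F" using FF.minus_closed[of y y'] y YF by auto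
    then show "y \<ominus>\<^bsub>FF\<^esub> y' \<in> vball FF P 1" using above_vball[OF P Q un] y(3) unfolding m by blast
  qed
  ultimately show ?thesis using Y(1,2) YF by blast
qed

text \<open>The Frobenius fixes L, so every element of the residue field of L satisfies A^N = A;
  there are at most N such elements, and F already supplies N residue classes. Both conclusions
  follow: the norms agree, and every integral element of L is congruent to an element of F.\<close>

lemma place_norm_restrict: "place_norm LL (res Q) = place_norm FF P"
  and fixed_field_integral_cong: "x \<in> L \<Longrightarrow> x \<in> vball E Q 0 \<Longrightarrow> \<exists>y\<in>F. x \<ominus> y \<in> vball E Q 1"
proof -
  let ?N = "place_norm FF P"
  have Lr: "subring L E" by (rule subfieldE(1)[OF fixed_field_subfield])
  interpret LL: field LL by (rule subfield_iff(2)[OF fixed_field_subfield])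
  obtain V z where "expansion_field LL V z"
    using expansion_field_exists[OF fixed_field_subfield F_subset_fixed_field] by blast
  then interpret XL: expansion_field LL V z .
  let ?\<kappa> = "residue_field LL (res Q)"
  note resp = restrict_place
  interpret \<kappa>: field ?\<kappa> by (rule LL.residue_field_is_field[OF resp])
  let ?rc = "\<lambda>a. valuation_ideal LL (res Q) +>\<^bsub>LL\<^esub> a"
  have car: "carrier ?\<kappa> = ?rc ` vball LL (res Q) 0" by (rule LL.residue_field_carrier[OF resp])
  have fin: "finite (carrier ?\<kappa>)" using XL.finite_residue_classes[OF resp] car by (simp add: valuation_ring_eq_vball)
  have eq: "?rc a = ?rc b \<longleftrightarrow> a \<ominus> b \<in> vball E Q 1" if "a \<in> L" "b \<in> L" for a b
  proof -
    have m: "a \<ominus>\<^bsub>LL\<^esub> b = a \<ominus> b" using minus_subring[OF Lr that(2)] .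
    have "a \<ominus>\<^bsub>LL\<^esub> b \<in> L" using LL.minus_closed[of a b] that by simp
    then have "a \<ominus> b \<in> vball LL (res Q) 1 \<longleftrightarrow> a \<ominus> b \<in> vball E Q 1" unfolding m by (rule vball_restrict)
    then show ?thesis using LL.rc_eq_iff[OF resp, of a b] that unfolding m by simp
  qed
  have N0: "?N \<ge> 2"
  proof -
    obtain V z where "expansion_field FF V z" using expansion_field_F by blast
    then show ?thesis using expansion_field.place_norm_ge_2'[OF _ P P] by blast
  qed
  have power: "A [^]\<^bsub>?\<kappa>\<^esub> ?N = A" if A: "A \<in> carrier ?\<kappa>" for A
  proof -
    obtain a where a: "a \<in> vball LL (res Q) 0" "A = ?rc a" using A car by auto
    have aL: "a \<in> L" using LL.vball_carrier[OF a(1)] by simp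
    have aE: "a \<in> vball E Q 0" using a(1) vball_restrict[OF aL] by simp
    have "frobenius E F P a = a" using frob aL by (simp add: fixed_field_def)
    then have "a \<ominus> a [^] ?N \<in> vball E Q 1"
      using frobenius_properties(2)[OF P un Q] aE by (auto simp: frobenius_at_def)
    moreover have pw: "a [^]\<^bsub>LL\<^esub> ?N = a [^] ?N" by (simp add: nat_pow_def)
    moreover have "a [^]\<^bsub>LL\<^esub> ?N \<in> L" using LL.nat_pow_closed[of a ?N] aL by simp
    ultimately have "?rc a = ?rc (a [^]\<^bsub>LL\<^esub> ?N)" using eq[OF aL] by simp
    then show ?thesis using LL.rc_pow[OF resp a(1)] a(2) by simp
  qed
  \<comment> \<open>Besides zero there are only the roots of X^(N-1) - 1, and a polynomial over a
    field has no more roots than its degree.\<close>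
  have card_le: "card (carrier ?\<kappa>) \<le> ?N"
  proof -
    have root: "A [^]\<^bsub>?\<kappa>\<^esub> (?N - 1) = \<one>\<^bsub>?\<kappa>\<^esub>" if A: "A \<in> carrier ?\<kappa>" "A \<noteq> \<zero>\<^bsub>?\<kappa>\<^esub>" for A
    proof -
      have "?N = Suc (?N - 1)" using N0 by simp
      then have "A [^]\<^bsub>?\<kappa>\<^esub> (?N - 1) \<otimes>\<^bsub>?\<kappa>\<^esub> A = \<one>\<^bsub>?\<kappa>\<^esub> \<otimes>\<^bsub>?\<kappa>\<^esub> A"
        using power[OF A(1)] A(1) by (metis \<kappa>.nat_pow_Suc \<kappa>.l_one)
      then show ?thesis using \<kappa>.m_rcancel[OF A(2) A(1), of "A [^]\<^bsub>?\<kappa>\<^esub> (?N - 1)" "\<one>\<^bsub>?\<kappa>\<^esub>"] A by simp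
    qed
    have "carrier ?\<kappa> \<subseteq> insert \<zero>\<^bsub>?\<kappa>\<^esub> {A \<in> carrier ?\<kappa>. A [^]\<^bsub>?\<kappa>\<^esub> (?N - 1) = \<one>\<^bsub>?\<kappa>\<^esub>}" using root by auto
    then have "card (carrier ?\<kappa>) \<le> card (insert \<zero>\<^bsub>?\<kappa>\<^esub> {A \<in> carrier ?\<kappa>. A [^]\<^bsub>?\<kappa>\<^esub> (?N - 1) = \<one>\<^bsub>?\<kappa>\<^esub>})"
      using fin by (intro card_mono) auto
    also have "\<dots> \<le> Suc (card {A \<in> carrier ?\<kappa>. A [^]\<^bsub>?\<kappa>\<^esub> (?N - 1) = \<one>\<^bsub>?\<kappa>\<^esub>})"
      using fin by (simp add: card_insert_if)
    also have "\<dots> \<le> Suc (?N - 1)" using \<kappa>.num_roots_le_deg[OF fin, of "?N - 1"] N0 by simp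
    finally show ?thesis using N0 by simp
  qed
  obtain Y where Y: "finite Y" "card Y = ?N" "Y \<subseteq> F" "Y \<subseteq> vball E Q 0"
    "\<forall>y\<in>Y. \<forall>y'\<in>Y. y \<ominus> y' \<in> vball E Q 1 \<longrightarrow> y = y'"
    using residue_class_representatives_in_F by (elim exE conjE) (rule that)
  have YL: "Y \<subseteq> L" using Y(3) F_subset_fixed_field by blast
  have "inj_on ?rc Y"
  proof (rule inj_onI)
    fix y y' assume "y \<in> Y" "y' \<in> Y" "?rc y = ?rc y'"
    then show "y = y'" using eq[of y y'] Y(5) YL by blast
  qed
  then have cY: "card (?rc ` Y) = ?N" using Y(2) card_image by fastforce
  have sub: "?rc ` Y \<subseteq> carrier ?\<kappa>"
    unfolding car using vball_restrict Y(4) YL by blast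
  have all: "?rc ` Y = carrier ?\<kappa>" using card_le cY card_seteq[OF fin sub] by simp
  then show "place_norm LL (res Q) = ?N" using cY LL.card_residue_field[OF resp] by simp
  show "\<exists>y\<in>F. x \<ominus> y \<in> vball E Q 1" if x: "x \<in> L" "x \<in> vball E Q 0"
  proof -
    have "x \<in> vball LL (res Q) 0" using vball_restrict[OF x(1)] x(2) by simp
    then have "?rc x \<in> ?rc ` Y" unfolding all car by (rule imageI)
    then obtain y where "y \<in> Y" "?rc x = ?rc y" by blast
    then show ?thesis using eq[OF x(1)] YL Y(3) by blast
  qed
qed

end

end

text \<open>If H were proper, a conjugate pair of places of E above almost every P would restrict to
  two distinct places of L of the same norm as P, which the growth of the divisor sums
  forbids.\<close>

theorem subgroup_containing_frobenius_eq:
  assumes S: "finite S" and frob: "\<And>P. P \<in> places FF \<Longrightarrow> P \<notin> S \<Longrightarrow> \<not> ramifies E F P \<and> frobenius E F P \<in> H"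
  shows "H = carrier G"
proof (rule ccontr)
  assume "H \<noteq> carrier G"
  then obtain y g where y: "y \<in> L" and g: "g \<in> carrier G" "g y \<noteq> y" using fixed_field_nontrivial by blast
  have yc: "y \<in> carrier E" "g y \<in> carrier E" using Lc[OF y] gal_closed[OF g(1)] by auto
  have y0: "y \<noteq> \<zero>" using g gal_zero by auto
  let ?w = "y \<ominus> g y"
  have w: "?w \<in> carrier E" "?w \<noteq> \<zero>" using yc g(2) by (auto simp: minus_eq_zero_iff)
  obtain V z where "expansion_field E V z" using expansion_field_E by blast
  then interpret X: expansion_field E V z .
  obtain VF zF where "expansion_field FF VF zF" using expansion_field_F by blast
  then interpret XF: expansion_field FF VF zF .
  obtain VL zL where "expansion_field LL VL zL"
    using expansion_field_exists[OF fixed_field_subfield F_subset_fixed_field] by blast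
  then interpret XL: expansion_field LL VL zL .
  \<comment> \<open>The zeros of \<open>y - g y\<close>, where the two restrictions may coincide,
    and the poles of \<open>y\<close>, where \<open>y\<close> has no residue.\<close>
  let ?bad = "{Q \<in> places E. 0 < Q ?w} \<union> {Q \<in> places E. 0 < Q (inv y)}"
  have badfin: "finite ?bad" using X.finite_zeros[OF w] X.finite_zeros[of "inv y"] yc y0 by simp
  \<comment> \<open>A place of E lies above at most one place of F, so discarding everything below
    the bad places removes only finitely many P.\<close>
  have below: "finite {P \<in> places FF. Q \<in> places_above E F P}" for Q
  proof (cases "\<exists>P0\<in>places FF. Q \<in> places_above E F P0")
    case True
    then obtain P0 where P0: "P0 \<in> places FF" "Q \<in> places_above E F P0" by blast
    then have "{P \<in> places FF. Q \<in> places_above E F P} \<subseteq> {P0}" using place_below_unique by blast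
    then show ?thesis by (rule finite_subset) simp
  next
    case False
    then have "{P \<in> places FF. Q \<in> places_above E F P} = {}" by blast
    then show ?thesis by (simp only: finite.emptyI)
  qed
  let ?S = "(S \<inter> places FF) \<union> (\<Union>Q\<in>?bad. {P \<in> places FF. Q \<in> places_above E F P})"
  have Sfin: "finite ?S" using S badfin below by (intro finite_UnI finite_UN_I) auto
  have Ssub: "?S \<subseteq> places FF" by blast
  define q where "q P = (SOME Q. Q \<in> places_above E F P)" for P
  have q: "q P \<in> places_above E F P" if "P \<in> places FF" for P
    unfolding q_def using places_above_nonempty[OF that] by (rule someI_ex)
  have qp: "q P \<in> places E" if "P \<in> places FF" for P using q[OF that] by (simp add: places_above_def)
  define q' where "q' P = twist E (q P) g" for P
  have q': "q' P \<in> places_above E F P" if "P \<in> places FF" for P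
    unfolding q'_def by (rule places_above_twist[OF q[OF that] g(1)])
  have good: "P \<in> places FF" "\<not> ramifies E F P" "frobenius E F P \<in> H" "q P \<notin> ?bad"
    if "P \<in> places FF - ?S" for P
    using that frob[of P] q[of P] by blast+
  have agree: "res Q x = P x"
    if "P \<in> places FF - ?S" "Q \<in> places_above E F P" "x \<in> F - {\<zero>}" for P Q x
    using place_above_unramified[OF good(1)[OF that(1)] that(2) good(2)[OF that(1)], of x] that(3)
      F_subset_fixed_field by auto
  \<comment> \<open>At unramified places the restriction to L extends P itself, so P can be
    recovered from it whichever place above P was chosen.\<close>
  have same: "P = P'"
    if PP: "P \<in> places FF - ?S" "P' \<in> places FF - ?S" and QQ: "Q \<in> places_above E F P" "Q' \<in> places_above E F P'"
      and eq: "res Q = res Q'" for P P' Q Q'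
  proof (rule FF.place_eqI[OF good(1)[OF PP(1)] good(1)[OF PP(2)]])
    fix x assume x: "x \<in> carrier FF" "x \<noteq> \<zero>\<^bsub>FF\<^esub>" "0 \<le> P x"
    then have "x \<in> F - {\<zero>}" by simp
    then show "0 \<le> P' x" using agree[OF PP(1) QQ(1)] agree[OF PP(2) QQ(2)] eq x(3) by metis
  qed
  \<comment> \<open>If the restrictions coincided, an element \<open>c\<close> of F congruent to
    \<open>y\<close> at Q would be congruent to \<open>y\<close> also at the twisted place; applying
    \<open>g\<close> gives \<open>g y\<close> congruent to \<open>c\<close> at Q, so
    \<open>y - g y\<close> would vanish at Q.\<close>
  have distinct: "res (q P) \<noteq> res (q' P)" if PP: "P \<in> places FF - ?S" for P
  proof
    assume eq: "res (q P) = res (q' P)"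
    note Pg = good[OF PP]
    have Qp: "q P \<in> places E" by (rule qp[OF Pg(1)])
    have yi: "y \<in> vball E (q P) 0"
      using Pg(4) Qp place_inv[OF Qp yc(1) y0] yc(1) by (intro vballI) auto
    obtain c where c: "c \<in> F" "y \<ominus> c \<in> vball E (q P) 1"
      using fixed_field_integral_cong[OF Pg(1) q[OF Pg(1)] Pg(2,3) y yi] by blast
    have cc: "c \<in> carrier E" "c \<in> L" using c(1) F_carrier F_subset_fixed_field by auto
    have ycL: "y \<ominus> c \<in> L"
      using subringE(5,7)[OF subfieldE(1)[OF fixed_field_subfield]] y cc by (simp add: a_minus_def)
    have "y \<ominus> c \<in> vball LL (res (q P)) 1"
      using c(2) vball_restrict[OF Pg(1) q[OF Pg(1)] Pg(2) ycL] by simp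
    then have "y \<ominus> c \<in> vball E (q' P) 1"
      using eq vball_restrict[OF Pg(1) q'[OF Pg(1)] Pg(2) ycL] by simp
    then have "g (y \<ominus> c) \<in> vball E (q P) 1" using vball_twist[of "y \<ominus> c" g] g(1) yc cc by (simp add: q'_def)
    then have gc: "g y \<ominus> c \<in> vball E (q P) 1"
      using gal_minus[OF g(1) yc(1) cc(1)] gal_fix[OF g(1) c(1)] by simp
    have "?w \<in> vball E (q P) 1"
      using vball_minus_trans[OF Qp c(2) vball_minus_sym[OF Qp gc yc(2) cc(1)]] yc cc by blast
    then have "0 < q P ?w" using w by (auto simp: vball_def)
    then show False using Pg(4) Qp by blast
  qed
  show False
  proof (rule no_two_norm_preserving_lifts[OF Sfin Ssub, of "place_norm FF" "\<lambda>P. res (q P)" "\<lambda>P. res (q' P)"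
        "places LL" "place_norm LL"])
    show "2 \<le> place_norm FF P" if "P \<in> places FF" for P using XF.place_norm_ge_2'[OF that that] .
    show "inj_on (\<lambda>P. res (q P)) (places FF - ?S)"
    proof (rule inj_onI)
      fix P P' assume PP: "P \<in> places FF - ?S" "P' \<in> places FF - ?S" "res (q P) = res (q P')"
      show "P = P'" by (rule same[OF PP(1,2) q q PP(3)]) (use PP in blast)+
    qed
    show "inj_on (\<lambda>P. res (q' P)) (places FF - ?S)"
    proof (rule inj_onI)
      fix P P' assume PP: "P \<in> places FF - ?S" "P' \<in> places FF - ?S" "res (q' P) = res (q' P')"
      show "P = P'" by (rule same[OF PP(1,2) q' q' PP(3)]) (use PP in blast)+
    qed
    show "(\<lambda>P. res (q P)) ` (places FF - ?S) \<inter> (\<lambda>P. res (q' P)) ` (places FF - ?S) = {}"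
    proof (rule equals0I, elim IntE imageE)
      fix z P P' assume zP: "z = res (q P)" "P \<in> places FF - ?S" "z = res (q' P')" "P' \<in> places FF - ?S"
      note PP = zP(2,4) trans[OF zP(1)[symmetric] zP(3)]
      have "P = P'" by (rule same[OF PP(1,2) q q' PP(3)]) (use PP in blast)+
      then show False using distinct[OF PP(1)] PP(3) by simp
    qed
    fix P assume PP: "P \<in> places FF - ?S"
    note Pg = good[OF PP]
    show "res (q P) \<in> places LL \<and> res (q' P) \<in> places LL"
      using restrict_place[OF Pg(1) q[OF Pg(1)] Pg(2)] restrict_place[OF Pg(1) q'[OF Pg(1)] Pg(2)] by blast
    show "place_norm LL (res (q P)) = place_norm FF P \<and> place_norm LL (res (q' P)) = place_norm FF P"
      using place_norm_restrict[OF Pg(1) q[OF Pg(1)] Pg(2,3)] place_norm_restrict[OF Pg(1) q'[OF Pg(1)] Pg(2,3)] by blast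
  next
    show "\<exists>b\<ge>2. \<exists>K::real. \<forall>n \<D>. \<D> \<subseteq> {D. set_mset D \<subseteq> places LL \<and> (\<Prod>v\<in>#D. place_norm LL v) < b ^ n} \<longrightarrow>
      finite \<D> \<and> (\<Sum>D\<in>\<D>. 1 / real (\<Prod>v\<in>#D. place_norm LL v)) \<le> K * real n"
      using XL.sum_inverse_norm_upper unfolding XL.effective_divisors_def divisor_norm_def mem_Collect_eq .
    show "finite {D. set_mset D \<subseteq> places FF \<and> (\<Prod>v\<in>#D. place_norm FF v) \<le> k}" for k
      using XF.finite_bounded_norm[of k] unfolding XF.effective_divisors_def divisor_norm_def mem_Collect_eq .
    show "\<exists>b\<ge>2. \<exists>N::nat. \<exists>c::real. c > 0 \<and> (\<forall>n. c * real n \<le>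
      (\<Sum>D\<in>{D. set_mset D \<subseteq> places FF \<and> (\<Prod>v\<in>#D. place_norm FF v) \<le> b ^ n * N}.
        1 / real (\<Prod>v\<in>#D. place_norm FF v)))"
      using XF.sum_inverse_norm_lower unfolding XF.effective_divisors_def divisor_norm_def mem_Collect_eq .
  qed
qed

end

section \<open>The Artin map on divisors prime to the modulus\<close>

context
  fixes \<mm> :: "('a \<Rightarrow> int) \<Rightarrow>\<^sub>0 int"
  assumes ramified: "{\<pp> \<in> places FF. ramifies E F \<pp>} \<subseteq> Poly_Mapping.keys \<mm>"
begin

private abbreviation "\<D> \<equiv> divisor_group_away FF \<mm>"

private lemma carrier_D: "carrier \<D> = {D. Poly_Mapping.keys D \<subseteq> places FF - Poly_Mapping.keys \<mm>}"
  by (auto simp: divisor_group_away_def divisor_group_def free_Abelian_group_def)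

private lemma mult_D: "D \<otimes>\<^bsub>\<D>\<^esub> D' = D + D'"
  by (simp add: divisor_group_away_def divisor_group_def free_Abelian_group_def)

private lemma frobenius_closed: "P \<in> places FF - Poly_Mapping.keys \<mm> \<Longrightarrow> frobenius E F P \<in> carrier G"
  using frobenius_properties(1) ramified by blast

text \<open>The supports of two divisors and of their sum differ; over a common finite set with
  exponent 0 outside the support, the products can be multiplied factor by factor.\<close>

private lemma artin_map_superset:
  assumes T: "finite T" "Poly_Mapping.keys D \<subseteq> T" "T \<subseteq> places FF - Poly_Mapping.keys \<mm>"
  shows "artin_map E F D = (\<Otimes>\<^bsub>G\<^esub>P\<in>T. frobenius E F P [^]\<^bsub>G\<^esub> Poly_Mapping.lookup D P)"
  unfolding artin_map_def
  by (rule G.finprod_mono_neutral_cong_left[OF T(1,2)])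
    (use T(3) frobenius_closed in \<open>auto simp: in_keys_iff\<close>)

lemma artin_map_closed:
  assumes "D \<in> carrier \<D>" shows "artin_map E F D \<in> carrier G"
  unfolding artin_map_def using assms frobenius_closed by (intro G.finprod_closed) (auto simp: carrier_D)

lemma artin_map_add:
  assumes "D \<in> carrier \<D>" "D' \<in> carrier \<D>"
  shows "artin_map E F (D + D') = artin_map E F D \<otimes>\<^bsub>G\<^esub> artin_map E F D'"
proof -
  let ?T = "Poly_Mapping.keys D \<union> Poly_Mapping.keys D'"
  have T: "finite ?T" "?T \<subseteq> places FF - Poly_Mapping.keys \<mm>" using assms by (auto simp: carrier_D)
  have f: "frobenius E F P \<in> carrier G" if "P \<in> ?T" for P using frobenius_closed T(2) that by blast
  have "artin_map E F (D + D') = (\<Otimes>\<^bsub>G\<^esub>P\<in>?T. frobenius E F P [^]\<^bsub>G\<^esub> Poly_Mapping.lookup (D + D') P)"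
    by (rule artin_map_superset[OF T(1) keys_add T(2)])
  also have "\<dots> = (\<Otimes>\<^bsub>G\<^esub>P\<in>?T. frobenius E F P [^]\<^bsub>G\<^esub> Poly_Mapping.lookup D P
      \<otimes>\<^bsub>G\<^esub> frobenius E F P [^]\<^bsub>G\<^esub> Poly_Mapping.lookup D' P)"
    using f by (intro G.finprod_cong') (auto simp: lookup_add G.int_pow_mult)
  also have "\<dots> = artin_map E F D \<otimes>\<^bsub>G\<^esub> artin_map E F D'"
    using artin_map_superset[OF T(1) Un_upper1 T(2)] artin_map_superset[OF T(1) Un_upper2 T(2)] f
    by (simp add: G.finprod_multf Pi_def)
  finally show ?thesis .
qed

theorem artin_map_hom: "artin_map E F \<in> hom \<D> G"
  using artin_map_closed artin_map_add by (intro homI) (auto simp: mult_D)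

theorem artin_map_surj: "artin_map E F ` carrier \<D> = carrier G"
proof (rule subgroup_containing_frobenius_eq[where S = "Poly_Mapping.keys \<mm>"])
  have zero: "0 \<in> carrier \<D>" by (simp add: carrier_D)
  have a0: "artin_map E F 0 = \<one>\<^bsub>G\<^esub>" by (simp add: artin_map_def)
  show "subgroup (artin_map E F ` carrier \<D>) G"
  proof (rule G.subgroupI)
    show "artin_map E F ` carrier \<D> \<subseteq> carrier G" using artin_map_closed by blast
    show "artin_map E F ` carrier \<D> \<noteq> {}" using zero by blast
    show "inv\<^bsub>G\<^esub> a \<in> artin_map E F ` carrier \<D>" if "a \<in> artin_map E F ` carrier \<D>" for a
    proof -
      obtain D where D: "D \<in> carrier \<D>" "a = artin_map E F D" using \<open>a \<in> artin_map E F ` carrier \<D>\<close> by blast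
      have mD: "- D \<in> carrier \<D>" using D(1) by (simp add: carrier_D)
      have "artin_map E F (- D) \<otimes>\<^bsub>G\<^esub> a = artin_map E F (- D + D)" using artin_map_add[OF mD D(1)] D(2) by simp
      then have "artin_map E F (- D) \<otimes>\<^bsub>G\<^esub> a = \<one>\<^bsub>G\<^esub>" using a0 by simp
      then have "inv\<^bsub>G\<^esub> a = artin_map E F (- D)"
        using G.inv_equality artin_map_closed[OF mD] artin_map_closed[OF D(1)] D(2) by blast
      then show ?thesis using mD by simp
    qed
    show "a \<otimes>\<^bsub>G\<^esub> b \<in> artin_map E F ` carrier \<D>"
      if ab: "a \<in> artin_map E F ` carrier \<D>" "b \<in> artin_map E F ` carrier \<D>" for a b
    proof -
      obtain D D' where D: "D \<in> carrier \<D>" "a = artin_map E F D" "D' \<in> carrier \<D>" "b = artin_map E F D'"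
        using ab by blast
      have "D + D' \<in> carrier \<D>" using keys_add[of D D'] D(1,3) by (auto simp: carrier_D)
      then show ?thesis using artin_map_add[OF D(1,3)] D(2,4) by (metis imageI)
    qed
  qed
  show "finite (Poly_Mapping.keys \<mm>)" by simp
  fix P assume P: "P \<in> places FF" "P \<notin> Poly_Mapping.keys \<mm>"
  have f: "frobenius E F P \<in> carrier G" using frobenius_closed P by blast
  let ?D = "Poly_Mapping.single P (1::int)"
  have "?D \<in> carrier \<D>" using P by (simp add: carrier_D)
  moreover have "artin_map E F ?D = frobenius E F P" using f by (simp add: artin_map_def G.int_pow_1)
  ultimately show "\<not> ramifies E F P \<and> frobenius E F P \<in> artin_map E F ` carrier \<D>"
    using ramified P by (metis (no_types, lifting) imageI mem_Collect_eq subsetD)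
qed

end

end

theorem theorem3p3:
  fixes E :: "('a, 'b) ring_scheme" and F :: "'a set"
    and \<mm> :: "('a \<Rightarrow> int) \<Rightarrow>\<^sub>0 int"
  assumes "global_function_field (E\<lparr>carrier := F\<rparr>)"
    and "finite_abelian_extension E F"
    and "effective_divisor (E\<lparr>carrier := F\<rparr>) \<mm>"
    and "{\<pp> \<in> places (E\<lparr>carrier := F\<rparr>). ramifies E F \<pp>} \<subseteq> Poly_Mapping.keys \<mm>"
  shows "artin_map E F \<in> hom (divisor_group_away (E\<lparr>carrier := F\<rparr>) \<mm>) (galois_group E F)
    \<and> artin_map E F ` carrier (divisor_group_away (E\<lparr>carrier := F\<rparr>) \<mm>)
        = carrier (galois_group E F)"
proof -
  have "field E" using assms(2) by (simp add: finite_abelian_extension_def finite_galois_extension_def)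
  then interpret abelian_function_field_extension E F
    using assms(1,2) by (intro abelian_function_field_extension.intro abelian_function_field_extension_axioms.intro)
  show ?thesis using artin_map_hom[OF assms(4)] artin_map_surj[OF assms(4)] by blast
qed

unused_thms Defs -

end
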